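(* Let $L=L_r(\kappa,\mu,\nu)$ with $r,\kappa\in\mathbb N_{>0}$, $\mu,\nu\in\mathbb R$, $\nu>0$, and let $\varepsilon:L\to\mathbb Z_2$ be a homomorphism, $\varepsilon=(\varepsilon_1,\dots,\varepsilon_4)$, where $(\varepsilon_1,\varepsilon_2)=(0,1)$ is assumed if $\varepsilon_1\neq\varepsilon_2$. Put $\beta:=\pi r/\kappa$. Then the spectrum of $(D^{1/3})^2=-\Omega$ on the spinor bundle of $X=L\backslash\mathrm{Osc}_1$ corresponding to $\varepsilon$ is as follows (with $\varepsilon_4+\kappa$ read modulo 2). If $(\varepsilon_3,\varepsilon_4+\kappa)=(0,0)$, it equals - $\mathcal A_0(\mu,\nu)\cup4\beta\mathbb Z$ for $(\varepsilon_1,\varepsilon_2)=(0,0)$, - $\mathcal A_1(\mu,\nu)\cup4\beta\mathbb Z$ for $(\varepsilon_1,\varepsilon_2)=(0,1)$, - $\mathcal A_2(\mu,\nu)\cup4\beta\mathbb Z$ for $(\varepsilon_1,\varepsilon_2)=(1,1)$. If $(\varepsilon_3,\varepsilon_4+\kappa)=(0,1)$, it equals - $\mathcal A_0(\mu,\nu)\cup2\beta\mathbb Z$ for $(\varepsilon_1,\varepsilon_2)=(0,0)$, - $\mathcal A_1(\mu,\nu)\cup2\beta\mathbb Z_{\neq0}$ for $(\varepsilon_1,\varepsilon_2)=(0,1)$, - $\mathcal A_2(\mu,\nu)\cup2\beta\mathbb Z_{\neq0}$ for $(\varepsilon_1,\varepsilon_2)=(1,1)$. If $(\varepsilon_3,\varepsilon_4+\kappa)=(1,0)$,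 it equals $2\beta\mathbb Z$ in each of the three cases for $(\varepsilon_1,\varepsilon_2)$. If $(\varepsilon_3,\varepsilon_4+\kappa)=(1,1)$, it equals $\beta(2\mathbb Z+1)$ in each of the three cases for $(\varepsilon_1,\varepsilon_2)$.
   Context: Oscillator group. $\mathrm{Osc}_1$ is the set $\mathbb C\times\mathbb R\times\mathbb R$ with multiplication $(\xi_1,z_1,t_1)(\xi_2,z_2,t_2)=(\xi_1+e^{it_1}\xi_2,\ z_1+z_2+\tfrac12\omega(\xi_1,e^{it_1}\xi_2),\ t_1+t_2)$, $\omega(\xi_1,\xi_2)=\mathrm{Im}(\overline{\xi_1}\xi_2)$. Its Lie algebra has basis $X,Y,Z,T$, tangent at the identity to $s\mapsto(s,0,0),(is,0,0),(0,s,0),(0,0,s)$, with non-vanishing brackets $[T,X]=Y$, $[T,Y]=-X$, $[X,Y]=Z$. It carries the bi-invariant Lorentzian metric with $\langle X,X\rangle=\langle Y,Y\rangle=\langle Z,T\rangle=1$, other products of basis vectors zero; its volume measure is Lebesgue measure. Lattice and spin structure. $L_r(\kappa,\mu,\nu)$ is the lattice generated by $l_1=(\frac1{\sqrt\nu},0,0)$, $l_2=(-\frac{\mu}{\sqrt\nu}+i\sqrt\nu,0,0)$, $l_3=(0,\frac1r,0)$, $l_4=(0,0,2\pi\kappa)$. Spin structures on $L\backslash\mathrm{Osc}_1$ correspond to homomorphisms $\varepsilon:L\to\mathbb Z_2=\mathbb Z/2\mathbb Z$; $\varepsilon_i:=\varepsilon(l_i)$ (a tuple defines a homomorphism iff $r\varepsilon_3=0$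 in $\mathbb Z_2$). Spinors. $\Delta=\mathbb C^4$ is the spinor module with Clifford multiplication (convention $v\cdot v=-\langle v,v\rangle$). Sections of the spinor bundle $\Sigma(X)$ are functions $\psi:\mathrm{Osc}_1\to\Delta$ with $\psi(lg)=(-1)^{\varepsilon(l)}\psi(g)$ for $l\in L$, and $L^2(\Sigma(X))$ is the space of those that are square-integrable over $X$ (for a fixed Hermitian product on $\Delta$). Operators. For a Lie algebra element $V$ and smooth $\psi$, $V(\psi)(g)=\frac{d}{ds}|_{s=0}\psi(g\exp(sV))$. The Casimir operator is $\Omega=X^2+Y^2+2ZT$, acting on sections by left-invariant differentiation (i.e. componentwise, trivially on $\Delta$). The cubic Dirac operator is $D^{1/3}\psi=X\cdot X(\psi)+Y\cdot Y(\psi)+Z\cdot T(\psi)+T\cdot Z(\psi)+\tfrac12XYZ\cdot\psi$; on smooth sections $(D^{1/3})^2=-\Omega$. The spectrum in the claim is that of (the closure in $L^2(\Sigma(X))$ of) $-\Omega$. Sets. $\|(k,l)\|_{\mu,\nu}=(\nu k^2+\frac1\nu(-\mu k+l)^2)^{1/2}$. For $a>0$, $\alpha_0(\mu,\nu,a)$, $\alpha_1(\mu,\nu,a)$, $\alpha_2(\mu,\nu,a)$ are the numbers of $(k,l)\in\mathbb Z^2$ with $\|(k,l)\|_{\mu,\nu}=a$ and, respectively: $k$ even and $l$ even; $k$ even and $l$ odd; $k$ odd and $l$ odd. $\mathcal A_j(\mu,\nu)=\{\pi^2a^2\mid a\in\mathbb R_{>0},\ \alpha_j(\mu,\nu,a)\neq0\}$,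 $j=0,1,2$. $\mathbb Z_{\neq0}=\mathbb Z\setminus\{0\}$. *)

theory Defs
  imports
    "HOL-Analysis.Analysis"
    "HOL-Algebra.Generated_Groups"
    "HOL-Algebra.Elementary_Groups"
begin

type_synonym osc = "complex \<times> real \<times> real"

definition osc_omega :: "complex \<Rightarrow> complex \<Rightarrow> real" where
  "osc_omega \<xi> \<eta> = Im (cnj \<xi> * \<eta>)"

fun osc_mult :: "osc \<Rightarrow> osc \<Rightarrow> osc" where
  "osc_mult (\<xi>1, z1, t1) (\<xi>2, z2, t2) =
     (\<xi>1 + cis t1 * \<xi>2, z1 + z2 + osc_omega \<xi>1 (cis t1 * \<xi>2) / 2, t1 + t2)"

definition Osc :: "osc monoid" where
  "Osc = \<lparr>carrier = UNIV, monoid.mult = osc_mult, one = (0, 0, 0)\<rparr>"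

text \<open>A vector \<open>aX + bY + zZ + tT\<close> of the Lie algebra is written \<open>(a + ib, z, t)\<close>, using the
  same coordinates as the group.\<close>

definition vX :: osc where "vX = (1, 0, 0)"
definition vY :: osc where "vY = (\<i>, 0, 0)"
definition vZ :: osc where "vZ = (0, 1, 0)"
definition vT :: osc where "vT = (0, 0, 1)"

fun osc_metric :: "osc \<Rightarrow> osc \<Rightarrow> real" where
  "osc_metric (\<xi>1, z1, t1) (\<xi>2, z2, t2) = Re (cnj \<xi>1 * \<xi>2) + z1 * t2 + t1 * z2"

text \<open>For each basis vector \<open>V\<close> the curve \<open>s \<mapsto> s *\<^sub>R V\<close> is, in these coordinates, the
  one-parameter subgroup \<open>s \<mapsto> exp (s V)\<close> (lemma \<open>exp_basis\<close>; this would fail for a general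
  \<open>V\<close>). The derivative below is therefore only used for basis vectors.\<close>

lemma exp_basis:
  assumes "V \<in> {vX, vY, vZ, vT}"
  shows "osc_mult (s *\<^sub>R V) (s' *\<^sub>R V) = (s + s') *\<^sub>R V"
    and "((\<lambda>s. s *\<^sub>R V) has_vector_derivative V) (at 0)"
proof -
  show "osc_mult (s *\<^sub>R V) (s' *\<^sub>R V) = (s + s') *\<^sub>R V"
    using assms
    by (auto simp: vX_def vY_def vZ_def vT_def osc_omega_def scaleR_conv_of_real algebra_simps)
  show "((\<lambda>s. s *\<^sub>R V) has_vector_derivative V) (at 0)"
    by (auto intro!: derivative_eq_intros)
qed

definition basis_deriv :: "osc \<Rightarrow> (osc \<Rightarrow> complex ^ 4) \<Rightarrow> osc \<Rightarrow> complex ^ 4" where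
  "basis_deriv V \<psi> g = vector_derivative (\<lambda>s. \<psi> (osc_mult g (s *\<^sub>R V))) (at 0)"

definition gen1 :: "real \<Rightarrow> osc" where
  "gen1 \<nu> = (of_real (1 / sqrt \<nu>), 0, 0)"
definition gen2 :: "real \<Rightarrow> real \<Rightarrow> osc" where
  "gen2 \<mu> \<nu> = (Complex (- \<mu> / sqrt \<nu>) (sqrt \<nu>), 0, 0)"
definition gen3 :: "nat \<Rightarrow> osc" where
  "gen3 r = (0, 1 / real r, 0)"
definition gen4 :: "nat \<Rightarrow> osc" where
  "gen4 \<kappa> = (0, 0, 2 * pi * real \<kappa>)"

definition osc_lattice :: "nat \<Rightarrow> nat \<Rightarrow> real \<Rightarrow> real \<Rightarrow> osc set" where
  "osc_lattice r \<kappa> \<mu> \<nu> = generate Osc {gen1 \<nu>, gen2 \<mu> \<nu>, gen3 r, gen4 \<kappa>}"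

text \<open>Spin structures are homomorphisms into \<open>integer_mod_group 2\<close>, so that their values are the
  integers 0 and 1.\<close>

definition spin_structures :: "osc set \<Rightarrow> (osc \<Rightarrow> int) set" where
  "spin_structures L = hom (Osc\<lparr>carrier := L\<rparr>) (integer_mod_group 2)"

text \<open>A fundamental domain for the left action of the lattice (lemma
  \<open>fundamental_domain_osc_lattice\<close>): Lebesgue measure on it realises the volume measure of the
  quotient.\<close>

definition fund_domain :: "nat \<Rightarrow> nat \<Rightarrow> real \<Rightarrow> real \<Rightarrow> osc set" where
  "fund_domain r \<kappa> \<mu> \<nu> =
     {a *\<^sub>R gen1 \<nu> + b *\<^sub>R gen2 \<mu> \<nu> + c *\<^sub>R gen3 r + d *\<^sub>R gen4 \<kappa> | a b c d.
        a \<in> {0..<1} \<and> b \<in> {0..<1} \<and> c \<in> {0..<1} \<and> d \<in> {0..<1}}"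

definition clifford_module :: "(osc \<Rightarrow> complex ^ 4 ^ 4) \<Rightarrow> bool" where
  "clifford_module cl \<longleftrightarrow>
     linear cl \<and> (\<forall>v. cl v ** cl v = mat (- complex_of_real (osc_metric v v)))"

definition spinor_sections :: "osc set \<Rightarrow> (osc \<Rightarrow> int) \<Rightarrow> (osc \<Rightarrow> complex ^ 4) set" where
  "spinor_sections L \<epsilon> =
     {\<psi>. \<forall>l\<in>L. \<forall>g. \<psi> (osc_mult l g) = (- 1) ^ nat (\<epsilon> l) *\<^sub>R \<psi> g}"

text \<open>\<open>C_k k\<close> (total differentiability of all iterated directional derivatives of order below
  \<open>k\<close>, continuity of those of order \<open>k\<close>) implies that the function is \<open>k\<close> times continuously
  differentiable and conversely.\<close>

primrec C_k :: "nat \<Rightarrow> ('a::euclidean_space \<Rightarrow> 'b::real_normed_vector) \<Rightarrow> bool" where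
  "C_k 0 f \<longleftrightarrow> continuous_on UNIV f"
| "C_k (Suc k) f \<longleftrightarrow>
     f differentiable_on UNIV \<and> (\<forall>v. C_k k (\<lambda>x. frechet_derivative f (at x) v))"

definition smooth_sections :: "osc set \<Rightarrow> (osc \<Rightarrow> int) \<Rightarrow> (osc \<Rightarrow> complex ^ 4) set" where
  "smooth_sections L \<epsilon> = {\<psi> \<in> spinor_sections L \<epsilon>. \<forall>k. C_k k \<psi>}"

text \<open>Elements of \<open>L\<^sup>2\<close> are represented by functions; two functions represent the same element iff
  \<open>L2_norm F\<close> of their difference is 0. The Hermitian product on \<open>\<complex>\<^sup>4\<close> is the standard one.\<close>

definition L2_sections ::
    "osc set \<Rightarrow> osc set \<Rightarrow> (osc \<Rightarrow> int) \<Rightarrow> (osc \<Rightarrow> complex ^ 4) set" where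
  "L2_sections F L \<epsilon> =
     {\<psi> \<in> spinor_sections L \<epsilon>. \<psi> \<in> borel_measurable borel \<and>
        set_integrable lborel F (\<lambda>g. (norm (\<psi> g))\<^sup>2)}"

definition L2_norm :: "osc set \<Rightarrow> (osc \<Rightarrow> complex ^ 4) \<Rightarrow> real" where
  "L2_norm F \<psi> = sqrt (LINT g:F|lborel. (norm (\<psi> g))\<^sup>2)"

definition casimir :: "(osc \<Rightarrow> complex ^ 4) \<Rightarrow> osc \<Rightarrow> complex ^ 4" where
  "casimir \<psi> g =
     basis_deriv vX (basis_deriv vX \<psi>) g + basis_deriv vY (basis_deriv vY \<psi>) g
     + 2 *\<^sub>R basis_deriv vZ (basis_deriv vT \<psi>) g"

definition cubic_dirac ::
    "(osc \<Rightarrow> complex ^ 4 ^ 4) \<Rightarrow> (osc \<Rightarrow> complex ^ 4) \<Rightarrow> osc \<Rightarrow> complex ^ 4" where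
  "cubic_dirac cl \<psi> g =
     cl vX *v basis_deriv vX \<psi> g + cl vY *v basis_deriv vY \<psi> g
     + cl vZ *v basis_deriv vT \<psi> g + cl vT *v basis_deriv vZ \<psi> g
     + (1 / 2) *\<^sub>R ((cl vX ** cl vY ** cl vZ) *v \<psi> g)"

text \<open>\<open>H\<close> is a space of functions, seen modulo functions of seminorm \<open>N\<close> zero; \<open>A\<close> is an
  operator with domain \<open>D \<subseteq> H\<close>.\<close>

definition closure_graph ::
    "('a \<Rightarrow> complex ^ 'n) set \<Rightarrow> (('a \<Rightarrow> complex ^ 'n) \<Rightarrow> real) \<Rightarrow> ('a \<Rightarrow> complex ^ 'n) set
     \<Rightarrow> (('a \<Rightarrow> complex ^ 'n) \<Rightarrow> 'a \<Rightarrow> complex ^ 'n)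
     \<Rightarrow> (('a \<Rightarrow> complex ^ 'n) \<times> ('a \<Rightarrow> complex ^ 'n)) set" where
  "closure_graph H N D A =
     {(\<psi>, \<phi>). \<psi> \<in> H \<and> \<phi> \<in> H \<and>
        (\<exists>s. (\<forall>n::nat. s n \<in> D) \<and>
             (\<lambda>n. N (\<lambda>g. s n g - \<psi> g)) \<longlonglongrightarrow> 0 \<and>
             (\<lambda>n. N (\<lambda>g. A (s n) g - \<phi> g)) \<longlonglongrightarrow> 0)}"

text \<open>\<open>z\<close> is in the resolvent set of the operator with graph \<open>G\<close> iff that operator minus
  \<open>z\<close> maps onto \<open>H\<close> and is injective with bounded inverse; the estimate expresses both injectivity
  and boundedness of the inverse.\<close>

definition resolvent_set ::
    "('a \<Rightarrow> complex ^ 'n) set \<Rightarrow> (('a \<Rightarrow> complex ^ 'n) \<Rightarrow> real)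
     \<Rightarrow> (('a \<Rightarrow> complex ^ 'n) \<times> ('a \<Rightarrow> complex ^ 'n)) set \<Rightarrow> complex set" where
  "resolvent_set H N G =
     {z. (\<forall>\<eta>\<in>H. \<exists>(\<psi>, \<phi>)\<in>G. N (\<lambda>g. \<phi> g - z *s \<psi> g - \<eta> g) = 0) \<and>
         (\<exists>C. \<forall>(\<psi>, \<phi>)\<in>G. N \<psi> \<le> C * N (\<lambda>g. \<phi> g - z *s \<psi> g))}"

definition closure_spectrum ::
    "('a \<Rightarrow> complex ^ 'n) set \<Rightarrow> (('a \<Rightarrow> complex ^ 'n) \<Rightarrow> real) \<Rightarrow> ('a \<Rightarrow> complex ^ 'n) set
     \<Rightarrow> (('a \<Rightarrow> complex ^ 'n) \<Rightarrow> 'a \<Rightarrow> complex ^ 'n) \<Rightarrow> complex set" where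
  "closure_spectrum H N D A = - resolvent_set H N (closure_graph H N D A)"

definition spec_casimir ::
    "nat \<Rightarrow> nat \<Rightarrow> real \<Rightarrow> real \<Rightarrow> (osc \<Rightarrow> int) \<Rightarrow> complex set" where
  "spec_casimir r \<kappa> \<mu> \<nu> \<epsilon> =
     (let L = osc_lattice r \<kappa> \<mu> \<nu>; F = fund_domain r \<kappa> \<mu> \<nu>
      in closure_spectrum (L2_sections F L \<epsilon>) (L2_norm F) (smooth_sections L \<epsilon>)
           (\<lambda>\<psi> g. - casimir \<psi> g))"

definition kl_norm :: "real \<Rightarrow> real \<Rightarrow> int \<Rightarrow> int \<Rightarrow> real" where
  "kl_norm \<mu> \<nu> k l = sqrt (\<nu> * (of_int k)\<^sup>2 + (1 / \<nu>) * (- \<mu> * of_int k + of_int l)\<^sup>2)"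

definition alpha0 :: "real \<Rightarrow> real \<Rightarrow> real \<Rightarrow> nat" where
  "alpha0 \<mu> \<nu> a = card {(k, l). kl_norm \<mu> \<nu> k l = a \<and> even k \<and> even l}"
definition alpha1 :: "real \<Rightarrow> real \<Rightarrow> real \<Rightarrow> nat" where
  "alpha1 \<mu> \<nu> a = card {(k, l). kl_norm \<mu> \<nu> k l = a \<and> even k \<and> odd l}"
definition alpha2 :: "real \<Rightarrow> real \<Rightarrow> real \<Rightarrow> nat" where
  "alpha2 \<mu> \<nu> a = card {(k, l). kl_norm \<mu> \<nu> k l = a \<and> odd k \<and> odd l}"

definition calA0 :: "real \<Rightarrow> real \<Rightarrow> real set" where
  "calA0 \<mu> \<nu> = {pi\<^sup>2 * a\<^sup>2 | a. a > 0 \<and> alpha0 \<mu> \<nu> a \<noteq> 0}"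
definition calA1 :: "real \<Rightarrow> real \<Rightarrow> real set" where
  "calA1 \<mu> \<nu> = {pi\<^sup>2 * a\<^sup>2 | a. a > 0 \<and> alpha1 \<mu> \<nu> a \<noteq> 0}"
definition calA2 :: "real \<Rightarrow> real \<Rightarrow> real set" where
  "calA2 \<mu> \<nu> = {pi\<^sup>2 * a\<^sup>2 | a. a > 0 \<and> alpha2 \<mu> \<nu> a \<noteq> 0}"

lemma osc_mult_assoc: "osc_mult (osc_mult g h) k = osc_mult g (osc_mult h k)"
proof -
  obtain x1 z1 t1 x2 z2 t2 x3 z3 t3 where "g = (x1,z1,t1)" "h = (x2,z2,t2)" "k = (x3,z3,t3)"
    by (metis prod_cases3)
  moreover have "osc_omega (cis t1 * u) (cis t1 * v) = osc_omega u v" for u v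
  proof -
    have "cnj (cis t1 * u) * (cis t1 * v) = (cnj (cis t1) * cis t1) * (cnj u * v)" by simp
    also have "cnj (cis t1) * cis t1 = 1" by (simp add: cis_cnj cis_mult)
    finally show ?thesis unfolding osc_omega_def by (metis mult_1)
  qed
  moreover have "osc_omega (u + v) w = osc_omega u w + osc_omega v w"
    "osc_omega u (v + w) = osc_omega u v + osc_omega u w" for u v w
    by (simp_all add: osc_omega_def algebra_simps)
  ultimately show ?thesis
    by (simp add: cis_mult[symmetric] ring_distribs add_divide_distrib mult.assoc)
qed

lemma group_Osc: "group Osc"
proof (rule groupI)
  fix g assume "g \<in> carrier Osc"
  obtain x z t where g: "g = (x, z, t)" by (metis prod_cases3)
  have "Im (cnj (cis (- t) * x) * (cis (- t) * x)) = 0"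
    by (simp add: algebra_simps)
  then have "osc_mult (- cis (- t) * x, - z, - t) g = (0, 0, 0)"
    by (simp add: g osc_omega_def)
  then show "\<exists>h\<in>carrier Osc. h \<otimes>\<^bsub>Osc\<^esub> g = \<one>\<^bsub>Osc\<^esub>"
    by (auto simp: Osc_def)
qed (auto simp: Osc_def osc_mult_assoc, auto simp: osc_omega_def)

text \<open>\<open>lat_elt m n p q\<close> is \<open>gen1^m gen2^n gen3^p gen4^q\<close>.\<close>

definition lat_elt :: "nat \<Rightarrow> nat \<Rightarrow> real \<Rightarrow> real \<Rightarrow> int \<Rightarrow> int \<Rightarrow> int \<Rightarrow> int \<Rightarrow> osc" where
  "lat_elt r \<kappa> \<mu> \<nu> m n p q =
     (Complex ((of_int m - \<mu> * of_int n) / sqrt \<nu>) (of_int n * sqrt \<nu>),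
      of_int (m * n) / 2 + of_int p / real r, 2 * pi * real \<kappa> * of_int q)"

lemma cis_lattice: "cis (2 * pi * real \<kappa> * of_int q) = 1"
  using cis_multiple_2pi[of "of_int (int \<kappa> * q)"] by (simp add: mult.assoc)

lemma osc_mult_lat_elt:
  assumes "\<nu> > 0"
  shows "osc_mult (lat_elt r \<kappa> \<mu> \<nu> m n p q) (x, z, t) =
    (x + Complex ((of_int m - \<mu> * of_int n) / sqrt \<nu>) (of_int n * sqrt \<nu>),
     z + of_int (m * n) / 2 + of_int p / real r
       + ((of_int m - \<mu> * of_int n) / sqrt \<nu> * Im x - of_int n * sqrt \<nu> * Re x) / 2,
     t + 2 * pi * real \<kappa> * of_int q)"
  by (simp add: lat_elt_def cis_lattice osc_omega_def)

lemma lat_elt_mult: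
  assumes "\<nu> > 0" "r > 0"
  shows "osc_mult (lat_elt r \<kappa> \<mu> \<nu> m n p q) (lat_elt r \<kappa> \<mu> \<nu> m' n' p' q') =
    lat_elt r \<kappa> \<mu> \<nu> (m + m') (n + n') (p + p' - int r * n * m') (q + q')"
proof -
  have "osc_mult (lat_elt r \<kappa> \<mu> \<nu> m n p q) (lat_elt r \<kappa> \<mu> \<nu> m' n' p' q') =
    osc_mult (lat_elt r \<kappa> \<mu> \<nu> m n p q)
     (Complex ((of_int m' - \<mu> * of_int n') / sqrt \<nu>) (of_int n' * sqrt \<nu>),
      of_int (m' * n') / 2 + of_int p' / real r, 2 * pi * real \<kappa> * of_int q')"
    by (simp add: lat_elt_def)
  also have "\<dots> = lat_elt r \<kappa> \<mu> \<nu> (m + m') (n + n') (p + p' - int r * n * m') (q + q')"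
    unfolding osc_mult_lat_elt[OF assms(1)] using assms
    by (simp add: lat_elt_def complex_eq_iff field_simps)
  finally show ?thesis .
qed

lemma osc_lattice_eq:
  assumes "\<nu> > 0" "r > 0"
  shows "osc_lattice r \<kappa> \<mu> \<nu> = {lat_elt r \<kappa> \<mu> \<nu> m n p q | m n p q. True}"
proof -
  interpret group Osc by (rule group_Osc)
  note lm = lat_elt_mult[OF assms]
  let ?e = "lat_elt r \<kappa> \<mu> \<nu>"
  let ?S = "{gen1 \<nu>, gen2 \<mu> \<nu>, gen3 r, gen4 \<kappa>}"
  let ?L = "generate Osc ?S"
  have gens: "gen1 \<nu> = ?e 1 0 0 0" "gen2 \<mu> \<nu> = ?e 0 1 0 0" "gen3 r = ?e 0 0 1 0"
    "gen4 \<kappa> = ?e 0 0 0 1"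
    by (simp_all add: gen1_def gen2_def gen3_def gen4_def lat_elt_def complex_eq_iff)
  have one: "\<one>\<^bsub>Osc\<^esub> = ?e 0 0 0 0" by (simp add: Osc_def lat_elt_def complex_eq_iff)
  have inv_e: "inv\<^bsub>Osc\<^esub> (?e m n p q) = ?e (- m) (- n) (- p - int r * n * m) (- q)" for m n p q
  proof (rule inv_equality)
    show "?e (- m) (- n) (- p - int r * n * m) (- q) \<otimes>\<^bsub>Osc\<^esub> ?e m n p q = \<one>\<^bsub>Osc\<^esub>"
      unfolding one using lm by (simp add: Osc_def)
  qed (simp_all add: Osc_def)
  have "g \<in> {?e m n p q | m n p q. True}" if "g \<in> ?L" for g
    using that
  proof (induction rule: generate.induct)
    case one then show ?case using \<open>\<one>\<^bsub>Osc\<^esub> = ?e 0 0 0 0\<close> by blast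
  next
    case (incl h) then show ?case using gens by blast
  next
    case (inv h)
    then have "\<exists>m n p q. h = ?e m n p q" using gens by blast
    then show ?case using inv_e by blast
  next
    case (eng h1 h2)
    then obtain m n p q m' n' p' q' where "h1 = ?e m n p q" "h2 = ?e m' n' p' q'" by blast
    then have "h1 \<otimes>\<^bsub>Osc\<^esub> h2 = ?e (m + m') (n + n') (p + p' - int r * n * m') (q + q')"
      using lm by (simp add: Osc_def)
    then show ?case by blast
  qed
  moreover have "?e m n p q \<in> ?L" for m n p q
  proof -
    have S: "?S \<subseteq> carrier Osc" by (simp add: Osc_def)
    have sub: "subgroup ?L Osc" by (rule generate_is_subgroup[OF S])
    have mult: "osc_mult g h \<in> ?L" if "g \<in> ?L" "h \<in> ?L" for g h
      using generate.eng[OF that] by (simp add: Osc_def)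
    have pow: "f k \<in> ?L"
      if 1: "f 1 \<in> ?L" "f 0 = \<one>\<^bsub>Osc\<^esub>" and a: "\<And>i. osc_mult (f i) (f 1) = f (i + 1)"
        "\<And>i. osc_mult (f i) (f (-1)) = f (i - 1)" "inv\<^bsub>Osc\<^esub> (f 1) = f (-1)"
      for f :: "int \<Rightarrow> osc" and k
    proof (induction k rule: int_induct[where k = 0])
      case base then show ?case using 1 generate.one by metis
    next
      case (step1 i) then show ?case using mult 1 a by metis
    next
      case (step2 i)
      have "f (-1) \<in> ?L" using subgroup.m_inv_closed[OF sub 1(1)] a(3) by simp
      then show ?case using mult a(2) step2 by metis
    qed
    have "?e m 0 0 0 \<in> ?L"
      by (rule pow[of "\<lambda>m. ?e m 0 0 0"]) (use gens one inv_e lm in \<open>auto intro!: generate.incl\<close>)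
    moreover have "?e 0 n 0 0 \<in> ?L"
      by (rule pow[of "\<lambda>n. ?e 0 n 0 0"]) (use gens one inv_e lm in \<open>auto intro!: generate.incl\<close>)
    moreover have "?e 0 0 p 0 \<in> ?L"
      by (rule pow[of "\<lambda>p. ?e 0 0 p 0"]) (use gens one inv_e lm in \<open>auto intro!: generate.incl\<close>)
    moreover have "?e 0 0 0 q \<in> ?L"
      by (rule pow[of "\<lambda>q. ?e 0 0 0 q"]) (use gens one inv_e lm in \<open>auto intro!: generate.incl\<close>)
    ultimately have "osc_mult (?e m 0 0 0) (osc_mult (?e 0 n 0 0) (osc_mult (?e 0 0 p 0) (?e 0 0 0 q)))
        \<in> ?L"
      by (intro mult)
    then show ?thesis by (simp add: lm)
  qed
  ultimately show ?thesis unfolding osc_lattice_def by blast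
qed

lemma fund_domain_iff:
  assumes "\<nu> > 0" "r > 0" "\<kappa> > 0"
  shows "(x, z, t) \<in> fund_domain r \<kappa> \<mu> \<nu> \<longleftrightarrow>
    sqrt \<nu> * Re x + \<mu> * Im x / sqrt \<nu> \<in> {0..<1} \<and> Im x / sqrt \<nu> \<in> {0..<1} \<and>
    real r * z \<in> {0..<1} \<and> t / (2 * pi * real \<kappa>) \<in> {0..<1}"
proof -
  have "(x, z, t) = a *\<^sub>R gen1 \<nu> + b *\<^sub>R gen2 \<mu> \<nu> + c *\<^sub>R gen3 r + d *\<^sub>R gen4 \<kappa> \<longleftrightarrow>
     a = sqrt \<nu> * Re x + \<mu> * Im x / sqrt \<nu> \<and> b = Im x / sqrt \<nu> \<and> c = real r * z \<and>
     d = t / (2 * pi * real \<kappa>)" for a b c d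
  proof -
    have b: "Im x = b * sqrt \<nu> \<longleftrightarrow> b = Im x / sqrt \<nu>" using assms by (auto simp: field_simps)
    have a: "Re x = a / sqrt \<nu> - b * \<mu> / sqrt \<nu> \<longleftrightarrow> a = sqrt \<nu> * Re x + \<mu> * b"
      using assms by (auto simp: field_simps)
    have c: "z = c / real r \<longleftrightarrow> c = real r * z" using assms by (auto simp: field_simps)
    have d: "t = d * (2 * pi * real \<kappa>) \<longleftrightarrow> d = t / (2 * pi * real \<kappa>)"
      using assms by (auto simp: field_simps)
    show ?thesis
      using a b c d by (auto simp: gen1_def gen2_def gen3_def gen4_def complex_eq_iff)
  qed
  then show ?thesis unfolding fund_domain_def by auto
qed

lemma floor_unique_shift: "(y::real) + of_int m \<in> {0..<1} \<longleftrightarrow> m = - \<lfloor>y\<rfloor>"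
  by (simp, linarith)

lemma fundamental_domain_osc_lattice:
  assumes "\<nu> > 0" "r > 0" "\<kappa> > 0"
  shows "fund_domain r \<kappa> \<mu> \<nu> \<in> sets borel"
    and "\<exists>!l. l \<in> osc_lattice r \<kappa> \<mu> \<nu> \<and> osc_mult l g \<in> fund_domain r \<kappa> \<mu> \<nu>"
proof -
  have "fund_domain r \<kappa> \<mu> \<nu> = {g. sqrt \<nu> * Re (fst g) + \<mu> * Im (fst g) / sqrt \<nu> \<in> {0..<1} \<and>
      Im (fst g) / sqrt \<nu> \<in> {0..<1} \<and> real r * fst (snd g) \<in> {0..<1} \<and>
      snd (snd g) / (2 * pi * real \<kappa>) \<in> {0..<1}}"
    using fund_domain_iff[OF assms] by auto
  also have "\<dots> \<in> sets borel"
  proof -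
    have [measurable]:
      "(\<lambda>g::osc. sqrt \<nu> * Re (fst g) + \<mu> * Im (fst g) / sqrt \<nu>) \<in> borel_measurable borel"
      "(\<lambda>g::osc. Im (fst g) / sqrt \<nu>) \<in> borel_measurable borel"
      "(\<lambda>g::osc. real r * fst (snd g)) \<in> borel_measurable borel"
      "(\<lambda>g::osc. snd (snd g) / (2 * pi * real \<kappa>)) \<in> borel_measurable borel"
      by (intro borel_measurable_continuous_onI continuous_intros; use assms in simp)+
    show ?thesis by measurable
  qed
  finally show "fund_domain r \<kappa> \<mu> \<nu> \<in> sets borel" .
next
  obtain x z t where g: "g = (x, z, t)" by (metis prod_cases3)
  define u where "u = sqrt \<nu> * Re x + \<mu> * Im x / sqrt \<nu>"
  define v where "v = Im x / sqrt \<nu>"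
  define w where "w m n = real r * (z + of_int (m * n) / 2
    + ((of_int m - \<mu> * of_int n) / sqrt \<nu> * Im x - of_int n * sqrt \<nu> * Re x) / 2)" for m n
  have iff: "osc_mult (lat_elt r \<kappa> \<mu> \<nu> m n p q) g \<in> fund_domain r \<kappa> \<mu> \<nu> \<longleftrightarrow>
    m = - \<lfloor>u\<rfloor> \<and> n = - \<lfloor>v\<rfloor> \<and> p = - \<lfloor>w m n\<rfloor> \<and> q = - \<lfloor>t / (2 * pi * real \<kappa>)\<rfloor>" for m n p q
  proof -
    have "sqrt \<nu> * (Re x + (of_int m - \<mu> * of_int n) / sqrt \<nu>)
        + \<mu> * (Im x + of_int n * sqrt \<nu>) / sqrt \<nu> = u + of_int m"
      using assms by (simp add: u_def field_simps)
    moreover have "(Im x + of_int n * sqrt \<nu>) / sqrt \<nu> = v + of_int n"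
      using assms by (simp add: v_def field_simps)
    moreover have "real r * (z + of_int (m * n) / 2 + of_int p / real r
       + ((of_int m - \<mu> * of_int n) / sqrt \<nu> * Im x - of_int n * sqrt \<nu> * Re x) / 2)
       = w m n + of_int p"
      using assms by (simp add: w_def field_simps)
    moreover have "(t + 2 * pi * real \<kappa> * of_int q) / (2 * pi * real \<kappa>)
       = t / (2 * pi * real \<kappa>) + of_int q"
      using assms by (simp add: field_simps)
    ultimately show ?thesis
      unfolding g osc_mult_lat_elt[OF assms(1)] fund_domain_iff[OF assms] plus_complex.sel
        complex.sel
      by (simp only: floor_unique_shift)
  qed
  let ?l = "lat_elt r \<kappa> \<mu> \<nu> (- \<lfloor>u\<rfloor>) (- \<lfloor>v\<rfloor>) (- \<lfloor>w (- \<lfloor>u\<rfloor>) (- \<lfloor>v\<rfloor>)\<rfloor>)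
    (- \<lfloor>t / (2 * pi * real \<kappa>)\<rfloor>)"
  show "\<exists>!l. l \<in> osc_lattice r \<kappa> \<mu> \<nu> \<and> osc_mult l g \<in> fund_domain r \<kappa> \<mu> \<nu>"
  proof (rule ex1I[of _ ?l])
    show "?l \<in> osc_lattice r \<kappa> \<mu> \<nu> \<and> osc_mult ?l g \<in> fund_domain r \<kappa> \<mu> \<nu>"
      unfolding osc_lattice_eq[OF assms(1,2)] using iff by blast
    show "l = ?l" if "l \<in> osc_lattice r \<kappa> \<mu> \<nu> \<and> osc_mult l g \<in> fund_domain r \<kappa> \<mu> \<nu>" for l
      using that iff unfolding osc_lattice_eq[OF assms(1,2)] by auto
  qed
qed

end

theory Submission
  imports Defs "HOL-Library.Function_Algebras"
begin

text \<open>The identity for the square of the cubic Dirac operator is a computation in the Clifford algebra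
(\<open>cubic_dirac_square\<close>): the anticommutators of the basis vectors turn the second-order terms
into minus the Casimir operator, and the first-order terms, which come from the Lie brackets and
from the cubic term, cancel.

The Casimir operator acts on every component of a spinor separately, so its spectrum is found by
diagonalising it on complex-valued functions \<open>u\<close> with \<open>u (l g) = (-1) ^ \<epsilon> l * u g\<close> for \<open>l\<close> in the
lattice. The operator is symmetric, since left-invariant derivatives integrate to zero over the
quotient (\<open>integral_lder_zero\<close>). Its spectrum need not be bounded on either side, but for a
symmetric operator whose eigenvectors are total it is just the set of eigenvalues if this
set is closed (\<open>closure_spectrum_eq\<close>), and here it is, because it is locally finite. What
has to be supplied is a total family of smooth eigenfunctions.

In the coordinates \<open>Phi t y x w\<close> the generators \<open>l1\<close>, \<open>l3\<close>, \<open>l4\<close> translate \<open>x\<close>, \<open>w\<close>, \<open>t\<close>, and the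
generator \<open>l2\<close> shifts \<open>y\<close> while shearing \<open>w\<close> by a multiple of \<open>x\<close>. So one separates variables: the
function \<open>h y * exp (\<i> * (\<zeta> w + \<tau> t + s x))\<close> transforms correctly under \<open>l1\<close>, \<open>l3\<close>, \<open>l4\<close> when
\<open>\<zeta> = \<pi> r p\<close>, \<open>\<tau> = q / (2 \<kappa>)\<close>, \<open>s = \<pi> k \<surd>\<nu>\<close> with \<open>p\<close>, \<open>q\<close>, \<open>k\<close> of the parities of \<open>\<epsilon>3\<close>, \<open>\<epsilon>4\<close>, \<open>\<epsilon>1\<close>, and
minus the Casimir operator becomes the oscillator \<open>- h'' + ((s - \<zeta> y)\<^sup>2 + 2 \<zeta> \<tau>) h\<close>
(\<open>wave_eigen\<close>).

For \<open>p = 0\<close>, which requires \<open>\<epsilon>3 = 0\<close>, the oscillator is a free particle; exponentials in \<open>y\<close>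
that fit \<open>l2\<close> give the eigenvalues \<open>\<pi>\<^sup>2 (\<nu> k\<^sup>2 + (l + \<mu> k)\<^sup>2 / \<nu>)\<close> with \<open>l\<close> of the parity of
\<open>\<epsilon>2\<close> (\<open>torus_wave\<close>). These are the sets \<open>calA0\<close>, \<open>calA1\<close>, \<open>calA2\<close>, except that \<open>0\<close> occurs as well
when \<open>\<epsilon>1 = \<epsilon>2 = 0\<close>. This is what turns the nonzero multiples of \<open>2 \<beta>\<close> into all multiples in one of the
cases of the theorem.

For \<open>p \<noteq> 0\<close> one takes a Hermite function in \<open>y\<close> and sums over the powers of \<open>l2\<close>. The resulting theta
function (\<open>theta\<close>) converges with all its derivatives thanks to the Gaussian factor, and has the
eigenvalue \<open>\<beta> (\<bar>p\<bar> \<kappa> (2 j + 1) + p q)\<close>. Since \<open>j\<close> can be absorbed into \<open>q\<close>, these are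
\<open>\<beta> p (q \<plusminus> \<kappa>)\<close>, and running through all \<open>p\<close>, \<open>q\<close> of given parity yields the arithmetic
progressions of the theorem (\<open>theta_integers\<close>). That the theta functions do not vanish is seen
by computing a Fourier coefficient in \<open>x\<close> (\<open>theta_nonzero\<close>).

Totality (\<open>scalar_totality\<close>) comes from unfolding: the inner product of \<open>u\<close> with a theta function
is a sum over the powers of \<open>l2\<close> of integrals over a fundamental box, hence one integral over a
strip in which \<open>y\<close> runs over the whole line (\<open>theta_pairing\<close>). So if \<open>u\<close> is orthogonal to all
eigenfunctions, then its Fourier coefficients with respect to \<open>(t, x, w)\<close>, as functions of \<open>y\<close>, are
orthogonal to all Hermite functions if \<open>p \<noteq> 0\<close>, and to a complete system of exponentials if \<open>p = 0\<close>.
They vanish by the completeness of these systems, and therefore \<open>u\<close> vanishes almost everywhere.\<close>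

section \<open>Symmetric operators with a total family of eigenvectors\<close>

definition smul :: "complex \<Rightarrow> ('a \<Rightarrow> complex ^ 'n) \<Rightarrow> 'a \<Rightarrow> complex ^ 'n" where
  "smul c \<psi> = (\<lambda>g. c *s \<psi> g)"

lemma smul_simps [simp]: "smul 1 \<psi> = \<psi>" "smul 0 \<psi> = 0" "smul c 0 = 0"
  "smul c (smul d \<psi>) = smul (c * d) \<psi>"
  by (auto simp: smul_def fun_eq_iff vec_eq_iff)

lemma smul_add: "smul c (\<psi> + \<phi>) = smul c \<psi> + smul c \<phi>" "smul (c + d) \<psi> = smul c \<psi> + smul d \<psi>"
  and smul_diff: "smul c (\<psi> - \<phi>) = smul c \<psi> - smul c \<phi>" "smul (c - d) \<psi> = smul c \<psi> - smul d \<psi>"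
  by (auto simp: smul_def fun_eq_iff vec_eq_iff algebra_simps)

lemma diff_eq_add_smul: "\<psi> - \<phi> = \<psi> + smul (- 1) \<phi>"
  by (auto simp: smul_def fun_eq_iff vec_eq_iff)

lemma smul_sum: "smul c (sum v T) = (\<Sum>i\<in>T. smul c (v i))"
  by (induction T rule: infinite_finite_induct) (simp_all only: sum.infinite sum.empty sum.insert smul_simps smul_add simp_thms)

text \<open>The algebra behind the Cauchy-Schwarz inequality for a product that may be degenerate.\<close>

lemma nonneg_quadratic_discriminant:
  fixes a b c :: real
  assumes "\<And>r. 0 \<le> a + 2 * r * b + r\<^sup>2 * c" and "a \<ge> 0" and "c \<ge> 0"
  shows "b\<^sup>2 \<le> a * c"
proof (cases "c = 0")
  case True
  have "b = 0"
  proof (rule ccontr)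
    assume "b \<noteq> 0"
    then show False using assms(1)[of "- (a + 1) / (2 * b)"] True by (simp add: field_simps)
  qed
  then show ?thesis by (simp add: True)
next
  case False
  then have c: "c > 0" using assms by simp
  have "0 \<le> a + 2 * (- b / c) * b + (- b / c)\<^sup>2 * c" by (rule assms(1))
  also have "\<dots> = (a * c - b\<^sup>2) / c" using c by (simp add: field_simps power2_eq_square)
  finally show ?thesis using c by (simp add: zero_le_divide_iff)
qed

text \<open>A space of functions with a complete, possibly degenerate inner product. Elements are honest
functions rather than classes, as in the definition of the closure of an operator. The real inner product \<open>ip\<close>
is the real part of the Hermitian one; \<open>ip_smul\<close> is what remains of sesquilinearity, and
the Hermitian product can be recovered from \<open>ip \<psi> \<phi>\<close> and \<open>ip \<psi> (smul \<i> \<phi>)\<close>.\<close>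

locale semi_hilbert =
  fixes H :: "('a \<Rightarrow> complex ^ 'n) set"
    and ip :: "('a \<Rightarrow> complex ^ 'n) \<Rightarrow> ('a \<Rightarrow> complex ^ 'n) \<Rightarrow> real"
  assumes H0: "0 \<in> H"
    and H_add: "\<And>\<psi> \<phi>. \<psi> \<in> H \<Longrightarrow> \<phi> \<in> H \<Longrightarrow> \<psi> + \<phi> \<in> H"
    and H_smul: "\<And>c \<psi>. \<psi> \<in> H \<Longrightarrow> smul c \<psi> \<in> H"
    and ip_sym: "\<And>\<psi> \<phi>. ip \<psi> \<phi> = ip \<phi> \<psi>"
    and ip_add: "\<And>\<psi> \<phi> \<omega>. \<psi> \<in> H \<Longrightarrow> \<phi> \<in> H \<Longrightarrow> \<omega> \<in> H \<Longrightarrow> ip (\<psi> + \<phi>) \<omega> = ip \<psi> \<omega> + ip \<phi> \<omega>"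
    and ip_smul: "\<And>c \<psi> \<phi>. ip (smul c \<psi>) \<phi> = ip \<psi> (smul (cnj c) \<phi>)"
    and ip_real: "\<And>r \<psi> \<phi>. ip (smul (of_real r) \<psi>) \<phi> = r * ip \<psi> \<phi>"
    and ip_nonneg: "\<And>\<psi>. ip \<psi> \<psi> \<ge> 0"
    and complete: "\<And>X. (\<And>n::nat. X n \<in> H) \<Longrightarrow>
      (\<And>e. e > 0 \<Longrightarrow> \<exists>M. \<forall>m\<ge>M. \<forall>n\<ge>M. sqrt (ip (X m - X n) (X m - X n)) < e) \<Longrightarrow>
      \<exists>\<psi>\<in>H. (\<lambda>n. sqrt (ip (X n - \<psi>) (X n - \<psi>))) \<longlonglongrightarrow> 0"
begin

definition N :: "('a \<Rightarrow> complex ^ 'n) \<Rightarrow> real" where "N \<psi> = sqrt (ip \<psi> \<psi>)"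

lemma N_nonneg [simp]: "N \<psi> \<ge> 0" by (simp add: N_def ip_nonneg)
lemma N_sq: "(N \<psi>)\<^sup>2 = ip \<psi> \<psi>" by (simp add: N_def ip_nonneg)

lemma H_diff: "\<psi> \<in> H \<Longrightarrow> \<phi> \<in> H \<Longrightarrow> \<psi> - \<phi> \<in> H"
  by (simp add: diff_eq_add_smul H_add H_smul)

lemma H_sum: "(\<And>i. i \<in> T \<Longrightarrow> v i \<in> H) \<Longrightarrow> sum v T \<in> H"
  by (induction T rule: infinite_finite_induct) (auto simp: H0 H_add)

lemma ip_add_right: "\<psi> \<in> H \<Longrightarrow> \<phi> \<in> H \<Longrightarrow> \<omega> \<in> H \<Longrightarrow> ip \<omega> (\<psi> + \<phi>) = ip \<omega> \<psi> + ip \<omega> \<phi>"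
  using ip_add ip_sym by metis

lemma ip_real_right: "ip \<psi> (smul (of_real r) \<phi>) = r * ip \<psi> \<phi>"
  using ip_real ip_sym by metis

lemma ip_0 [simp]: "ip 0 \<phi> = 0" "ip \<phi> 0 = 0"
  using ip_real[of 0 0 \<phi>] ip_sym by auto

lemma ip_smul_smul: "ip (smul c \<psi>) (smul c \<psi>) = (cmod c)\<^sup>2 * ip \<psi> \<psi>"
proof -
  have "ip (smul c \<psi>) (smul c \<psi>) = ip \<psi> (smul (of_real ((cmod c)\<^sup>2)) \<psi>)"
    unfolding ip_smul smul_simps complex_norm_square by (simp add: mult.commute)
  then show ?thesis by (simp only: ip_real_right)
qed

lemma N_smul: "N (smul c \<psi>) = cmod c * N \<psi>"
  by (simp add: N_def ip_smul_smul real_sqrt_mult)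

lemma N_0 [simp]: "N 0 = 0" by (simp add: N_def)

lemma ip_sum: "\<omega> \<in> H \<Longrightarrow> (\<And>i. i \<in> T \<Longrightarrow> v i \<in> H) \<Longrightarrow> ip (sum v T) \<omega> = (\<Sum>i\<in>T. ip (v i) \<omega>)"
  by (induction T rule: infinite_finite_induct) (auto simp: ip_add H_sum)

lemma ip_expand:
  assumes "\<psi> \<in> H" "\<phi> \<in> H"
  shows "ip (\<psi> + smul (of_real r) \<phi>) (\<psi> + smul (of_real r) \<phi>) = ip \<psi> \<psi> + 2 * r * ip \<psi> \<phi> + r\<^sup>2 * ip \<phi> \<phi>"
proof -
  have s: "smul (of_real r) \<phi> \<in> H" "\<psi> + smul (of_real r) \<phi> \<in> H"
    using assms by (simp_all add: H_add H_smul)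
  show ?thesis
    using assms s ip_sym[of \<phi> \<psi>]
    by (simp add: ip_add ip_add_right ip_real ip_real_right algebra_simps power2_eq_square)
qed

lemma cauchy_schwarz:
  assumes "\<psi> \<in> H" "\<phi> \<in> H" shows "\<bar>ip \<psi> \<phi>\<bar> \<le> N \<psi> * N \<phi>"
proof -
  have "(ip \<psi> \<phi>)\<^sup>2 \<le> ip \<psi> \<psi> * ip \<phi> \<phi>"
    by (rule nonneg_quadratic_discriminant)
      (simp_all add: ip_nonneg ip_expand[OF assms, symmetric])
  then show ?thesis
    by (simp add: N_def real_sqrt_mult[symmetric] real_le_rsqrt)
qed

lemma N_triangle: assumes "\<psi> \<in> H" "\<phi> \<in> H" shows "N (\<psi> + \<phi>) \<le> N \<psi> + N \<phi>"
proof -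
  have "(N (\<psi> + \<phi>))\<^sup>2 = (N \<psi>)\<^sup>2 + 2 * ip \<psi> \<phi> + (N \<phi>)\<^sup>2"
    using ip_expand[OF assms, of 1] by (simp add: N_sq)
  also have "\<dots> \<le> (N \<psi> + N \<phi>)\<^sup>2"
    using cauchy_schwarz[OF assms] by (simp add: power2_sum)
  finally show ?thesis by (rule power2_le_imp_le) simp
qed

lemma N_minus_commute: "N (\<psi> - \<phi>) = N (\<phi> - \<psi>)"
proof -
  have "\<psi> - \<phi> = smul (- 1) (\<phi> - \<psi>)" by (simp add: smul_def fun_eq_iff vec_eq_iff)
  then show ?thesis by (simp add: N_smul)
qed

lemma N_triangle_diff:
  assumes "\<psi> \<in> H" "\<phi> \<in> H" "\<omega> \<in> H" shows "N (\<psi> - \<omega>) \<le> N (\<psi> - \<phi>) + N (\<phi> - \<omega>)"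
  using N_triangle[of "\<psi> - \<phi>" "\<phi> - \<omega>"] assms by (simp add: H_diff)

text \<open>The form in which completeness is used: the bound \<open>a m + a n\<close> is what one gets for approximations
\<open>X n\<close> of a fixed vector that are within distance \<open>a n\<close> of it.\<close>

lemma converges:
  assumes "\<And>n::nat. X n \<in> H" "\<And>m n. N (X m - X n) \<le> a m + a n" "a \<longlonglongrightarrow> 0"
  obtains \<psi> where "\<psi> \<in> H" "(\<lambda>n. N (X n - \<psi>)) \<longlonglongrightarrow> 0"
proof -
  have "\<exists>M. \<forall>m\<ge>M. \<forall>n\<ge>M. sqrt (ip (X m - X n) (X m - X n)) < e" if "e > 0" for e
  proof -
    obtain M where M: "\<And>n. n \<ge> M \<Longrightarrow> \<bar>a n\<bar> < e / 2"
      using assms(3) \<open>e > 0\<close> unfolding LIMSEQ_iff by (metis half_gt_zero diff_zero real_norm_def)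
    have "N (X m - X n) < e" if "m \<ge> M" "n \<ge> M" for m n
      using assms(2)[of m n] M[OF that(1)] M[OF that(2)] by linarith
    then show ?thesis unfolding N_def by blast
  qed
  then have "\<exists>\<psi>\<in>H. (\<lambda>n. sqrt (ip (X n - \<psi>) (X n - \<psi>))) \<longlonglongrightarrow> 0"
    by (rule complete[OF assms(1)])
  then show ?thesis using that by (auto simp: N_def)
qed

text \<open>The projection theorem. A sequence in \<open>S\<close> that minimises the distance to \<open>\<psi>\<close> is Cauchy by the
parallelogram law; its limit differs from \<open>\<psi>\<close> by a vector orthogonal to \<open>S\<close>, which has norm zero
by totality.\<close>

lemma density_of_total_subspace:
  assumes S: "S \<subseteq> H" "0 \<in> S" "\<And>\<psi> \<phi>. \<psi> \<in> S \<Longrightarrow> \<phi> \<in> S \<Longrightarrow> \<psi> + \<phi> \<in> S"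
    "\<And>c \<psi>. \<psi> \<in> S \<Longrightarrow> smul c \<psi> \<in> S"
    and total: "\<And>\<psi>. \<psi> \<in> H \<Longrightarrow> (\<And>s. s \<in> S \<Longrightarrow> ip \<psi> s = 0) \<Longrightarrow> ip \<psi> \<psi> = 0"
    and \<psi>: "\<psi> \<in> H" and e: "e > 0"
  shows "\<exists>s\<in>S. N (\<psi> - s) < e"
proof -
  define d where "d = (INF s\<in>S. ip (\<psi> - s) (\<psi> - s))"
  have bdd: "bdd_below ((\<lambda>s. ip (\<psi> - s) (\<psi> - s)) ` S)"
    by (rule bdd_belowI[of _ 0]) (auto simp: ip_nonneg)
  have d_le: "d \<le> ip (\<psi> - s) (\<psi> - s)" if "s \<in> S" for s
    unfolding d_def by (rule cINF_lower[OF bdd that])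
  have d0: "d \<ge> 0" unfolding d_def by (rule cINF_greatest) (use S in \<open>auto simp: ip_nonneg\<close>)
  have "\<exists>s\<in>S. ip (\<psi> - s) (\<psi> - s) < d + 1 / real (Suc n)" for n
    using cINF_less_iff[OF _ bdd, of "d + 1 / real (Suc n)"] S(2) unfolding d_def by force
  then obtain s where s: "\<And>n. s n \<in> S" "\<And>n. ip (\<psi> - s n) (\<psi> - s n) < d + 1 / real (Suc n)"
    by metis
  have sH: "s n \<in> H" "\<psi> - s n \<in> H" for n using s S \<psi> by (auto intro: H_diff)
  define a where "a n = sqrt (2 / real (Suc n))" for n
  have "N (s m - s n) \<le> a m + a n" for m n
  proof -
    define u v where "u = \<psi> - s m" and "v = \<psi> - s n"
    have uv: "u \<in> H" "v \<in> H" using sH by (auto simp: u_def v_def)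
    let ?mid = "smul (of_real (1/2)) (s m + s n)"
    have "u + v = smul (of_real 2) (\<psi> - ?mid)"
      by (simp add: u_def v_def smul_def fun_eq_iff vec_eq_iff algebra_simps)
    then have "ip (u + v) (u + v) = 4 * ip (\<psi> - ?mid) (\<psi> - ?mid)"
      by (simp only: ip_smul_smul) simp
    also have "\<dots> \<ge> 4 * d" using d_le[of ?mid] S s by simp
    finally have 1: "4 * d \<le> ip (u + v) (u + v)" .
    have "s m - s n = v + smul (of_real (-1)) u"
      by (simp add: u_def v_def smul_def fun_eq_iff vec_eq_iff)
    then have "ip (s m - s n) (s m - s n) = 2 * ip u u + 2 * ip v v - ip (u + v) (u + v)"
      using ip_expand[OF uv(2,1), of "-1"] ip_expand[OF uv, of 1] ip_sym[of u v] by simp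
    also have "\<dots> \<le> 2 / real (Suc m) + 2 / real (Suc n)"
      using 1 s(2)[of m] s(2)[of n] by (simp add: u_def v_def)
    finally have "N (s m - s n) \<le> sqrt (2 / real (Suc m) + 2 / real (Suc n))"
      unfolding N_def by (rule real_sqrt_le_mono)
    also have "\<dots> \<le> a m + a n" unfolding a_def by (rule sqrt_add_le_add_sqrt) auto
    finally show ?thesis .
  qed
  moreover have "a \<longlonglongrightarrow> 0"
  proof -
    have "(\<lambda>n. sqrt (2 * (1 / real (Suc n)))) \<longlonglongrightarrow> sqrt (2 * 0)"
      by (intro tendsto_intros LIMSEQ_Suc[OF lim_1_over_n])
    then show ?thesis by (simp add: a_def[abs_def])
  qed
  ultimately obtain \<phi> where \<phi>: "\<phi> \<in> H" "(\<lambda>n. N (s n - \<phi>)) \<longlonglongrightarrow> 0"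
    using converges[of s a] sH by blast
  define \<omega> where "\<omega> = \<psi> - \<phi>"
  have \<omega>: "\<omega> \<in> H" using \<psi> \<phi> by (simp add: \<omega>_def H_diff)
  have "(\<lambda>n. sqrt (d + 1 / real (Suc n)) + N (s n - \<phi>)) \<longlonglongrightarrow> sqrt (d + 0) + 0"
    by (intro tendsto_intros \<phi> LIMSEQ_Suc[OF lim_1_over_n])
  moreover have "N \<omega> \<le> sqrt (d + 1 / real (Suc n)) + N (s n - \<phi>)" for n
  proof -
    have "N (\<psi> - s n) \<le> sqrt (d + 1 / real (Suc n))"
      unfolding N_def using s(2)[of n] by simp
    then show ?thesis using N_triangle_diff[OF \<psi> sH(1) \<phi>(1), of n] by (simp add: \<omega>_def)
  qed
  ultimately have N\<omega>: "N \<omega> \<le> sqrt d"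
    by (intro LIMSEQ_le_const[of _ "sqrt d"]) auto
  have "ip \<omega> \<sigma> = 0" if \<sigma>: "\<sigma> \<in> S" for \<sigma>
  proof -
    have \<sigma>H: "\<sigma> \<in> H" using S \<sigma> by auto
    have "0 \<le> 0 + 2 * r * ip \<omega> \<sigma> + r\<^sup>2 * ip \<sigma> \<sigma>" for r
    proof -
      have rH: "smul (of_real r) \<sigma> \<in> H" "\<omega> + smul (of_real r) \<sigma> \<in> H" using \<sigma>H \<omega> by (auto intro: H_smul H_add)
      have "sqrt d \<le> N (\<omega> + smul (of_real r) \<sigma>) + N (s n - \<phi>)" for n
      proof -
        have "s n + smul (of_real (- r)) \<sigma> \<in> S" using S s \<sigma> by auto
        then have "sqrt d \<le> N (\<psi> - (s n + smul (of_real (- r)) \<sigma>))"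
          unfolding N_def by (intro real_sqrt_le_mono d_le)
        also have "\<psi> - (s n + smul (of_real (- r)) \<sigma>) = (\<omega> + smul (of_real r) \<sigma>) + (\<phi> - s n)"
          by (simp add: \<omega>_def smul_def fun_eq_iff vec_eq_iff)
        also have "N \<dots> \<le> N (\<omega> + smul (of_real r) \<sigma>) + N (\<phi> - s n)"
          using rH sH \<phi> by (intro N_triangle) (auto intro: H_diff)
        finally show ?thesis by (simp add: N_minus_commute)
      qed
      moreover have "(\<lambda>n. N (\<omega> + smul (of_real r) \<sigma>) + N (s n - \<phi>)) \<longlonglongrightarrow> N (\<omega> + smul (of_real r) \<sigma>) + 0"
        by (intro tendsto_intros \<phi>)
      ultimately have "sqrt d \<le> N (\<omega> + smul (of_real r) \<sigma>)"
        by (intro LIMSEQ_le_const[of _ "N (\<omega> + smul (of_real r) \<sigma>)"]) auto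
      then have "ip \<omega> \<omega> \<le> ip (\<omega> + smul (of_real r) \<sigma>) (\<omega> + smul (of_real r) \<sigma>)"
        using N\<omega> unfolding N_def by (metis order_trans real_sqrt_le_iff)
      then show ?thesis using ip_expand[OF \<omega> \<sigma>H, of r] by simp
    qed
    from nonneg_quadratic_discriminant[OF this] show ?thesis by (simp add: ip_nonneg)
  qed
  then have "N \<omega> = 0" using total[OF \<omega>] by (simp add: N_def)
  have "(\<lambda>n. N (s n - \<phi>)) \<longlonglongrightarrow> 0" by (rule \<phi>)
  then obtain n where n: "N (s n - \<phi>) < e"
    using e unfolding LIMSEQ_iff by (metis abs_of_nonneg N_nonneg diff_zero real_norm_def order_refl)
  have "N (\<psi> - s n) \<le> N (\<psi> - \<phi>) + N (\<phi> - s n)" using \<psi> \<phi> sH by (intro N_triangle_diff) auto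
  also have "\<dots> < e" using n \<open>N \<omega> = 0\<close> by (simp add: \<omega>_def N_minus_commute)
  finally show ?thesis using s by blast
qed

end

text \<open>Totality is asked for with respect to the real product only; for spaces of eigenvectors, which are
closed under multiplication by \<open>\<i>\<close>, this is the same as totality with respect to the Hermitian one.\<close>

locale total_eigenvectors = semi_hilbert H ip
  for H :: "('a \<Rightarrow> complex ^ 'n) set" and ip +
  fixes D :: "('a \<Rightarrow> complex ^ 'n) set" and A and \<Lambda> :: "real set"
  assumes DH: "D \<subseteq> H" and D0: "0 \<in> D"
    and D_add: "\<And>\<psi> \<phi>. \<psi> \<in> D \<Longrightarrow> \<phi> \<in> D \<Longrightarrow> \<psi> + \<phi> \<in> D"
    and D_smul: "\<And>c \<psi>. \<psi> \<in> D \<Longrightarrow> smul c \<psi> \<in> D"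
    and AH: "\<And>\<psi>. \<psi> \<in> D \<Longrightarrow> A \<psi> \<in> H"
    and A_add: "\<And>\<psi> \<phi>. \<psi> \<in> D \<Longrightarrow> \<phi> \<in> D \<Longrightarrow> A (\<psi> + \<phi>) = A \<psi> + A \<phi>"
    and A_smul: "\<And>c \<psi>. \<psi> \<in> D \<Longrightarrow> A (smul c \<psi>) = smul c (A \<psi>)"
    and A_symmetric: "\<And>\<psi> \<phi>. \<psi> \<in> D \<Longrightarrow> \<phi> \<in> D \<Longrightarrow> ip (A \<psi>) \<phi> = ip \<psi> (A \<phi>)"
    and eigenvalues: "\<And>l. l \<in> \<Lambda> \<Longrightarrow> \<exists>\<psi>\<in>D. A \<psi> = smul (of_real l) \<psi> \<and> ip \<psi> \<psi> \<noteq> 0"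
    and total: "\<And>\<psi>. \<psi> \<in> H \<Longrightarrow>
      (\<And>l \<phi>. l \<in> \<Lambda> \<Longrightarrow> \<phi> \<in> D \<Longrightarrow> A \<phi> = smul (of_real l) \<phi> \<Longrightarrow> ip \<psi> \<phi> = 0) \<Longrightarrow> ip \<psi> \<psi> = 0"
    and closed_eigenvalues: "closed \<Lambda>"
begin

definition V :: "real \<Rightarrow> ('a \<Rightarrow> complex ^ 'n) set" where
  "V l = {\<psi> \<in> D. A \<psi> = smul (of_real l) \<psi>}"

definition eigensums :: "('a \<Rightarrow> complex ^ 'n) set" where
  "eigensums = {sum v T | v T. finite T \<and> T \<subseteq> \<Lambda> \<and> (\<forall>l. v l \<in> V l)}"

lemma A0: "A 0 = 0" using A_smul[OF D0, of 0] by simp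

lemma VD: "v \<in> V l \<Longrightarrow> v \<in> D" and VH: "v \<in> V l \<Longrightarrow> v \<in> H"
  using DH by (auto simp: V_def)

lemma V0: "0 \<in> V l" by (simp add: V_def D0 A0)

lemma V_add: "v \<in> V l \<Longrightarrow> w \<in> V l \<Longrightarrow> v + w \<in> V l"
  by (auto simp: V_def D_add A_add smul_add)

lemma V_smul: "v \<in> V l \<Longrightarrow> smul c v \<in> V l"
  by (auto simp: V_def D_smul A_smul mult.commute)

text \<open>Symmetry gives \<open>k * ip v w = l * ip v w\<close>.\<close>

lemma V_orth: assumes "v \<in> V k" "w \<in> V l" "k \<noteq> l" shows "ip v w = 0"
proof -
  have "k * ip v w = ip (A v) w" using assms by (simp add: V_def ip_real)
  also have "\<dots> = ip v (A w)" using assms by (intro A_symmetric) (auto simp: V_def)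
  also have "\<dots> = l * ip v w" using assms by (simp add: V_def ip_real_right)
  finally show ?thesis using assms by simp
qed

lemma D_sum: "(\<And>i. i \<in> T \<Longrightarrow> v i \<in> D) \<Longrightarrow> sum v T \<in> D"
  by (induction T rule: infinite_finite_induct) (auto simp: D0 D_add)

lemma A_sum: "(\<And>i. i \<in> T \<Longrightarrow> v i \<in> D) \<Longrightarrow> A (sum v T) = (\<Sum>i\<in>T. A (v i))"
  by (induction T rule: infinite_finite_induct) (auto simp: A0 D_sum A_add)

lemma ip_sum_orth:
  assumes "finite T" "\<And>l. v l \<in> V l"
  shows "ip (sum v T) (sum v T) = (\<Sum>l\<in>T. ip (v l) (v l))"
proof -
  have vH: "v l \<in> H" for l using assms VH by blast
  have "ip (sum v T) (sum v T) = (\<Sum>k\<in>T. ip (sum v T) (v k))"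
    using ip_sum[of "sum v T" T v] vH by (simp add: H_sum ip_sym)
  also have "\<dots> = (\<Sum>k\<in>T. \<Sum>l\<in>T. ip (v l) (v k))"
    using vH by (intro sum.cong refl ip_sum) auto
  also have "\<dots> = (\<Sum>k\<in>T. \<Sum>l\<in>T. if l = k then ip (v k) (v k) else 0)"
    by (intro sum.cong refl) (use V_orth[OF assms(2) assms(2)] in auto)
  finally show ?thesis using assms(1) by simp
qed

lemma eigensums_D: "s \<in> eigensums \<Longrightarrow> s \<in> D"
  unfolding eigensums_def using VD by (blast intro: D_sum)

lemma eigensums_0: "0 \<in> eigensums"
  unfolding eigensums_def using V0 by (intro CollectI exI[of _ "\<lambda>_. 0"] exI[of _ "{}"]) auto

lemma eigensumsI: "finite T \<Longrightarrow> T \<subseteq> \<Lambda> \<Longrightarrow> (\<And>l. v l \<in> V l) \<Longrightarrow> s = sum v T \<Longrightarrow> s \<in> eigensums"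
  unfolding eigensums_def by blast

lemma eigensums_smul: assumes "s \<in> eigensums" shows "smul c s \<in> eigensums"
proof -
  obtain v T where *: "s = sum v T" "finite T" "T \<subseteq> \<Lambda>" "\<And>l. v l \<in> V l"
    using assms unfolding eigensums_def by blast
  show ?thesis
    by (rule eigensumsI[OF *(2,3), of "\<lambda>l. smul c (v l)"]) (simp_all only: V_smul * smul_sum)
qed

lemma eigensums_add: assumes "s \<in> eigensums" "s' \<in> eigensums" shows "s + s' \<in> eigensums"
proof -
  obtain v T v' T' where *: "s = sum v T" "finite T" "T \<subseteq> \<Lambda>" "\<And>l. v l \<in> V l"
    "s' = sum v' T'" "finite T'" "T' \<subseteq> \<Lambda>" "\<And>l. v' l \<in> V l"
    using assms unfolding eigensums_def by blast
  define w where "w l = (if l \<in> T then v l else 0) + (if l \<in> T' then v' l else 0)" for l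
  have "sum v T = (\<Sum>l\<in>T \<union> T'. if l \<in> T then v l else 0)"
    by (rule sum.mono_neutral_cong_left) (use * in simp_all)
  moreover have "sum v' T' = (\<Sum>l\<in>T \<union> T'. if l \<in> T' then v' l else 0)"
    by (rule sum.mono_neutral_cong_left) (use * in simp_all)
  ultimately have "s + s' = sum w (T \<union> T')"
    unfolding w_def sum.distrib * by (simp only:)
  moreover have "w l \<in> V l" for l
    unfolding w_def by (intro V_add) (simp_all add: * V0)
  ultimately show ?thesis using * by (intro eigensumsI[of "T \<union> T'" w]) simp_all
qed

lemma eigenvector_eigensum: assumes "l \<in> \<Lambda>" "v \<in> V l" shows "v \<in> eigensums"
  by (rule eigensumsI[of "{l}" "\<lambda>k. if k = l then v else 0"]) (use assms V0 in simp_all)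

lemma eigensums_dense: "\<psi> \<in> H \<Longrightarrow> e > 0 \<Longrightarrow> \<exists>s\<in>eigensums. N (\<psi> - s) < e"
proof (rule density_of_total_subspace)
  fix \<psi> assume "\<psi> \<in> H" "\<And>s. s \<in> eigensums \<Longrightarrow> ip \<psi> s = 0"
  then show "ip \<psi> \<psi> = 0"
    using total eigenvector_eigensum unfolding V_def by blast
qed (use DH eigensums_D eigensums_0 eigensums_add eigensums_smul in auto)

text \<open>On a finite sum of eigenvectors the resolvent divides the component of eigenvalue \<open>l\<close> by \<open>l - z\<close>. As
the components are orthogonal, the norm grows at most by the factor \<open>1 / \<delta>\<close>.\<close>

lemma resolvent_on_eigensums:
  assumes \<delta>: "\<delta> > 0" "\<And>l. l \<in> \<Lambda> \<Longrightarrow> \<delta> \<le> cmod (of_real l - z)" and s: "s \<in> eigensums"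
  shows "\<exists>t\<in>eigensums. A t - smul z t = s \<and> \<delta> * N t \<le> N s"
proof -
  obtain v T where *: "s = sum v T" "finite T" "T \<subseteq> \<Lambda>" "\<And>l. v l \<in> V l"
    using s unfolding eigensums_def by blast
  define w where "w l = smul (1 / (of_real l - z)) (v l)" for l
  have w: "w l \<in> V l" for l using * V_smul by (simp add: w_def)
  have nz: "of_real l - z \<noteq> 0" if "l \<in> T" for l using \<delta>(1) \<delta>(2)[of l] * that by auto
  have "A (sum w T) - smul z (sum w T) = (\<Sum>l\<in>T. A (w l) - smul z (w l))"
    by (simp only: A_sum[OF VD[OF w]] smul_sum sum_subtractf)
  also have "\<dots> = (\<Sum>l\<in>T. smul (of_real l - z) (w l))"
    by (rule sum.cong) (use w in \<open>simp_all add: V_def smul_diff\<close>)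
  also have "\<dots> = s" unfolding * by (rule sum.cong) (use nz in \<open>simp_all add: w_def\<close>)
  finally have 1: "A (sum w T) - smul z (sum w T) = s" .
  have "(\<delta> * N (sum w T))\<^sup>2 = (\<Sum>l\<in>T. \<delta>\<^sup>2 * ip (w l) (w l))"
    using * w by (simp add: power_mult_distrib N_sq ip_sum_orth sum_distrib_left)
  also have "\<dots> \<le> (\<Sum>l\<in>T. ip (v l) (v l))"
  proof (rule sum_mono)
    fix l assume l: "l \<in> T"
    have v: "v l = smul (of_real l - z) (w l)" using nz[OF l] by (simp add: w_def)
    have "\<delta>\<^sup>2 \<le> (cmod (of_real l - z))\<^sup>2" using \<delta> l * by (intro power_mono) auto
    then show "\<delta>\<^sup>2 * ip (w l) (w l) \<le> ip (v l) (v l)"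
      unfolding v ip_smul_smul by (intro mult_right_mono ip_nonneg)
  qed
  also have "\<dots> = (N s)\<^sup>2" using * by (simp add: N_sq ip_sum_orth)
  finally have "\<delta> * N (sum w T) \<le> N s" by (rule power2_le_imp_le) simp
  moreover have "sum w T \<in> eigensums" unfolding eigensums_def using * w by blast
  ultimately show ?thesis using 1 by blast
qed

text \<open>For \<open>\<psi>\<close> in the domain this cannot be read off from an expansion, so one argues by duality: \<open>\<psi>\<close> is paired with
a finite sum \<open>s\<close> of eigenvectors written as \<open>A t - cnj z t\<close>, the operator is moved to \<open>\<psi>\<close>, and density of such
sums finishes the estimate.\<close>

lemma lower_bound:
  assumes \<delta>: "\<delta> > 0" "\<And>l. l \<in> \<Lambda> \<Longrightarrow> \<delta> \<le> cmod (of_real l - z)" and \<psi>: "\<psi> \<in> D"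
  shows "\<delta> * N \<psi> \<le> N (A \<psi> - smul z \<psi>)"
proof -
  have \<psi>H: "\<psi> \<in> H" "A \<psi> - smul z \<psi> \<in> H" using \<psi> DH AH by (auto intro: H_diff H_smul)
  have key: "\<delta> * ip \<psi> s \<le> N (A \<psi> - smul z \<psi>) * N s" if s: "s \<in> eigensums" for s
  proof -
    have d: "\<delta> \<le> cmod (of_real l - cnj z)" if "l \<in> \<Lambda>" for l
      using \<delta>(2)[OF that] by (metis complex_cnj_complex_of_real complex_cnj_diff complex_mod_cnj)
    obtain t where t: "t \<in> eigensums" "A t - smul (cnj z) t = s" "\<delta> * N t \<le> N s"
      using resolvent_on_eigensums[OF \<delta>(1) d s] by blast
    have tD: "t \<in> D" "t \<in> H" "A t \<in> H" using t eigensums_D DH AH by auto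
    have "ip \<psi> s = ip \<psi> (A t) + ip \<psi> (smul (- cnj z) t)"
      unfolding t(2)[symmetric] using \<psi>H tD
      by (simp add: diff_eq_add_smul ip_add_right H_smul)
    also have "\<dots> = ip (A \<psi>) t + ip (smul (- z) \<psi>) t"
      using A_symmetric[OF \<psi> tD(1)] ip_smul[of "- z" \<psi> t] by simp
    also have "\<dots> = ip (A \<psi> - smul z \<psi>) t"
      using ip_add[of "A \<psi>" "smul (-z) \<psi>" t] \<psi> \<psi>H tD AH by (simp add: diff_eq_add_smul H_smul)
    also have "\<dots> \<le> N (A \<psi> - smul z \<psi>) * N t"
      using cauchy_schwarz[OF \<psi>H(2) tD(2)] by linarith
    finally have "\<delta> * ip \<psi> s \<le> N (A \<psi> - smul z \<psi>) * (\<delta> * N t)"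
      using \<delta>(1) by (simp add: mult_left_mono mult.left_commute)
    also have "\<dots> \<le> N (A \<psi> - smul z \<psi>) * N s" by (intro mult_left_mono t) simp
    finally show ?thesis .
  qed
  let ?c = "N (A \<psi> - smul z \<psi>)"
  have "\<exists>s\<in>eigensums. N (\<psi> - s) < 1 / real (Suc n)" for n by (intro eigensums_dense \<psi>H) simp
  then obtain s where s: "\<And>n. s n \<in> eigensums" "\<And>n. N (\<psi> - s n) < 1 / real (Suc n)" by metis
  have "\<delta> * (N \<psi>)\<^sup>2 \<le> ?c * N \<psi> + (?c + \<delta> * N \<psi>) * (1 / real (Suc n))" for n
  proof -
    have sH: "s n \<in> H" using eigensums_D[OF s(1)] DH by blast
    have sH: "s n \<in> H" "\<psi> - s n \<in> H" by (fact sH) (rule H_diff[OF \<psi>H(1) sH])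
    have "(N \<psi>)\<^sup>2 = ip \<psi> (s n) + ip \<psi> (\<psi> - s n)"
      using ip_add_right[of "s n" "\<psi> - s n" \<psi>] sH \<psi>H by (simp add: N_sq)
    moreover have "\<delta> * ip \<psi> (\<psi> - s n) \<le> \<delta> * (N \<psi> * (1 / real (Suc n)))"
    proof (rule mult_left_mono)
      have "ip \<psi> (\<psi> - s n) \<le> N \<psi> * N (\<psi> - s n)" using cauchy_schwarz[OF \<psi>H(1) sH(2)] by linarith
      also have "\<dots> \<le> N \<psi> * (1 / real (Suc n))" using s(2)[of n] by (intro mult_left_mono) auto
      finally show "ip \<psi> (\<psi> - s n) \<le> N \<psi> * (1 / real (Suc n))" .
    qed (use \<delta>(1) in simp)
    moreover have "N (s n) \<le> N \<psi> + 1 / real (Suc n)"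
    proof -
      have "N (s n - 0) \<le> N (s n - \<psi>) + N (\<psi> - 0)" using sH \<psi>H H0 by (intro N_triangle_diff) auto
      then show ?thesis using s(2)[of n] by (simp add: N_minus_commute)
    qed
    then have "?c * N (s n) \<le> ?c * (N \<psi> + 1 / real (Suc n))" by (intro mult_left_mono) auto
    then have "\<delta> * ip \<psi> (s n) \<le> ?c * (N \<psi> + 1 / real (Suc n))" using key[OF s(1), of n] by linarith
    ultimately have "\<delta> * (N \<psi>)\<^sup>2 \<le> ?c * (N \<psi> + 1 / real (Suc n)) + \<delta> * (N \<psi> * (1 / real (Suc n)))"
      by (simp only: distrib_left add_mono)
    then show ?thesis by (simp add: algebra_simps)
  qed
  moreover have "(\<lambda>n. ?c * N \<psi> + (?c + \<delta> * N \<psi>) * (1 / real (Suc n))) \<longlonglongrightarrow> ?c * N \<psi> + (?c + \<delta> * N \<psi>) * 0"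
    by (intro tendsto_intros LIMSEQ_Suc[OF lim_1_over_n])
  ultimately have "\<delta> * (N \<psi>)\<^sup>2 \<le> ?c * N \<psi>"
    by (intro LIMSEQ_le_const[of _ "?c * N \<psi>"]) auto
  then have "N \<psi> * (\<delta> * N \<psi>) \<le> N \<psi> * ?c" by (simp add: power2_eq_square mult_ac)
  then show ?thesis using N_nonneg[of \<psi>] by (cases "N \<psi> = 0") (auto simp: mult_le_cancel_left)
qed

text \<open>An eigenvalue is not in the resolvent set, as its eigenvector violates the lower estimate. If \<open>z\<close> is not
an eigenvalue, it has a positive distance to the closed set \<open>\<Lambda>\<close>. The lower bound then passes to the closure,
and surjectivity follows by completeness: the resolvent is defined and bounded on the dense set of finite
sums of eigenvectors.\<close>

theorem closure_spectrum_eq: "closure_spectrum H N D A = of_real ` \<Lambda>"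
proof -
  let ?G = "closure_graph H N D A"
  have fd: "(\<lambda>g. \<psi> g - \<phi> g) = \<psi> - \<phi>" for \<psi> \<phi> :: "'a \<Rightarrow> complex ^ 'n" by auto
  have G: "(\<psi>, \<phi>) \<in> ?G \<longleftrightarrow> \<psi> \<in> H \<and> \<phi> \<in> H \<and> (\<exists>s. (\<forall>n. s n \<in> D) \<and>
     (\<lambda>n. N (s n - \<psi>)) \<longlonglongrightarrow> 0 \<and> (\<lambda>n. N (A (s n) - \<phi>)) \<longlonglongrightarrow> 0)" for \<psi> \<phi>
    unfolding closure_graph_def by (simp add: fd)
  have not_res: "of_real l \<notin> resolvent_set H N ?G" if l: "l \<in> \<Lambda>" for l
  proof
    assume "of_real l \<in> resolvent_set H N ?G"
    then obtain C where C: "\<And>\<psi> \<phi>. (\<psi>, \<phi>) \<in> ?G \<Longrightarrow> N \<psi> \<le> C * N (\<phi> - smul (of_real l) \<psi>)"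
      unfolding resolvent_set_def smul_def by (fastforce simp: fun_diff_def)
    obtain \<psi> where \<psi>: "\<psi> \<in> D" "A \<psi> = smul (of_real l) \<psi>" "ip \<psi> \<psi> \<noteq> 0"
      using eigenvalues[OF l] by blast
    have "(\<psi>, A \<psi>) \<in> ?G" unfolding G using \<psi>(1) DH AH by (auto intro!: exI[of _ "\<lambda>_. \<psi>"])
    then have "N \<psi> \<le> C * N 0" using C \<psi>(2) by fastforce
    then have "N \<psi> = 0" by (simp add: order_antisym)
    then show False using \<psi>(3) by (simp add: N_def)
  qed
  have res: "z \<in> resolvent_set H N ?G" if z: "z \<notin> of_real ` \<Lambda>" for z
  proof -
    have "closed (of_real ` \<Lambda> :: complex set)"
      by (rule closed_injective_linear_image[OF closed_eigenvalues])
        (auto intro!: linearI simp: inj_def scaleR_conv_of_real)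
    then obtain \<delta> where \<delta>: "\<delta> > 0" "\<And>l. l \<in> \<Lambda> \<Longrightarrow> \<delta> \<le> cmod (of_real l - z)"
      using separate_point_closed[OF _ z] by (metis dist_commute dist_norm imageI)
    have bound: "N \<psi> \<le> 1 / \<delta> * N (\<phi> - smul z \<psi>)" if G': "(\<psi>, \<phi>) \<in> ?G" for \<psi> \<phi>
    proof -
      obtain s where H: "\<psi> \<in> H" "\<phi> \<in> H" and s: "\<And>n. s n \<in> D" "(\<lambda>n. N (s n - \<psi>)) \<longlonglongrightarrow> 0"
        "(\<lambda>n. N (A (s n) - \<phi>)) \<longlonglongrightarrow> 0" using G' unfolding G by blast
      have "\<delta> * N \<psi> \<le> N (A (s n) - \<phi>) + N (\<phi> - smul z \<psi>) + cmod z * N (s n - \<psi>) + \<delta> * N (s n - \<psi>)" for n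
      proof -
        have sH: "s n \<in> H" "A (s n) \<in> H" using s(1) DH AH by auto
        have "N (\<psi> - 0) \<le> N (\<psi> - s n) + N (s n - 0)" using H sH H0 by (intro N_triangle_diff) auto
        then have 1: "\<delta> * N \<psi> \<le> \<delta> * N (s n - \<psi>) + \<delta> * N (s n)"
          using \<delta>(1) by (simp add: N_minus_commute distrib_left[symmetric])
        have "\<delta> * N (s n) \<le> N (A (s n) - smul z (s n))" using lower_bound[OF \<delta> s(1)] by blast
        also have "\<dots> \<le> N (A (s n) - smul z \<psi>) + N (smul z \<psi> - smul z (s n))"
          using H sH by (intro N_triangle_diff) (auto intro: H_smul)
        also have "N (A (s n) - smul z \<psi>) \<le> N (A (s n) - \<phi>) + N (\<phi> - smul z \<psi>)"
          using H sH by (intro N_triangle_diff) (auto intro: H_smul)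
        also have "N (smul z \<psi> - smul z (s n)) = cmod z * N (s n - \<psi>)"
          by (simp add: smul_diff(1)[symmetric] N_smul N_minus_commute)
        finally show ?thesis using 1 by linarith
      qed
      moreover have "(\<lambda>n. N (A (s n) - \<phi>) + N (\<phi> - smul z \<psi>) + cmod z * N (s n - \<psi>) + \<delta> * N (s n - \<psi>))
        \<longlonglongrightarrow> 0 + N (\<phi> - smul z \<psi>) + cmod z * 0 + \<delta> * 0" by (intro tendsto_intros s)
      ultimately have "\<delta> * N \<psi> \<le> N (\<phi> - smul z \<psi>)"
        by (intro LIMSEQ_le_const[of _ "N (\<phi> - smul z \<psi>)"]) auto
      then show ?thesis using \<delta>(1) by (simp add: field_simps)
    qed
    have surj: "\<exists>\<psi> \<phi>. (\<psi>, \<phi>) \<in> ?G \<and> \<phi> - smul z \<psi> - \<eta> = 0" if \<eta>: "\<eta> \<in> H" for \<eta>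
    proof -
      have "\<exists>s\<in>eigensums. N (\<eta> - s) < 1 / real (Suc n)" for n by (intro eigensums_dense \<eta>) simp
      then obtain s where s: "\<And>n. s n \<in> eigensums" "\<And>n. N (\<eta> - s n) < 1 / real (Suc n)" by metis
      have "\<exists>t\<in>eigensums. A t - smul z t = s n" for n
        using resolvent_on_eigensums[OF \<delta> s(1)] by blast
      then obtain t where t: "\<And>n. t n \<in> eigensums" "\<And>n. A (t n) - smul z (t n) = s n" by metis
      have tD: "t n \<in> D" "t n \<in> H" "s n \<in> H" for n using t s eigensums_D DH by auto
      have "N (t m - t n) \<le> 1 / \<delta> * (1 / real (Suc m)) + 1 / \<delta> * (1 / real (Suc n))" for m n
      proof -
        have e: "t m - t n = t m + smul (- 1) (t n)" by (rule diff_eq_add_smul)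
        have "t m - t n \<in> D" unfolding e by (intro D_add D_smul tD)
        then have "\<delta> * N (t m - t n) \<le> N (A (t m - t n) - smul z (t m - t n))"
          using lower_bound[OF \<delta>] by blast
        also have "A (t m - t n) - smul z (t m - t n) = s m - s n"
          unfolding t(2)[symmetric] smul_diff e
          by (simp add: A_add A_smul D_smul tD smul_add) (simp add: smul_def fun_eq_iff vec_eq_iff)
        also have "N (s m - s n) \<le> N (s m - \<eta>) + N (\<eta> - s n)" using tD \<eta> by (intro N_triangle_diff) auto
        also have "\<dots> \<le> 1 / real (Suc m) + 1 / real (Suc n)"
          using s(2)[of m] s(2)[of n] by (simp add: N_minus_commute)
        finally have f: "\<delta> * N (t m - t n) \<le> 1 / real (Suc m) + 1 / real (Suc n)" .
        have "N (t m - t n) = 1 / \<delta> * (\<delta> * N (t m - t n))" using \<delta>(1) by simp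
        also have "\<dots> \<le> 1 / \<delta> * (1 / real (Suc m) + 1 / real (Suc n))"
          by (rule mult_left_mono[OF f]) (use \<delta>(1) in simp)
        finally show ?thesis by (simp only: distrib_left)
      qed
      moreover have "(\<lambda>n. 1 / \<delta> * (1 / real (Suc n))) \<longlonglongrightarrow> 1 / \<delta> * 0"
        by (intro tendsto_intros LIMSEQ_Suc[OF lim_1_over_n])
      ultimately obtain \<psi> where \<psi>: "\<psi> \<in> H" "(\<lambda>n. N (t n - \<psi>)) \<longlonglongrightarrow> 0"
        using converges[of t "\<lambda>n. 1 / \<delta> * (1 / real (Suc n))"] tD by (metis mult_zero_right)
      let ?\<phi> = "\<eta> + smul z \<psi>"
      have \<phi>: "?\<phi> \<in> H" using \<eta> \<psi> by (intro H_add H_smul)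
      have "N (A (t n) - ?\<phi>) \<le> 1 / real (Suc n) + cmod z * N (t n - \<psi>)" for n
      proof -
        have e: "A (t n) - ?\<phi> = (s n - \<eta>) + smul z (t n - \<psi>)"
          unfolding t(2)[symmetric] by (simp add: smul_def fun_eq_iff vec_eq_iff algebra_simps)
        have "N (A (t n) - ?\<phi>) \<le> N (s n - \<eta>) + N (smul z (t n - \<psi>))"
          unfolding e using tD \<eta> \<psi> by (intro N_triangle H_diff H_smul)
        then show ?thesis using s(2)[of n] by (simp add: N_smul N_minus_commute)
      qed
      then have le: "N (A (t n) - ?\<phi>) \<le> 1 / real (Suc n) + cmod z * N (t n - \<psi>)" for n .
      have "(\<lambda>n. 1 / real (Suc n) + cmod z * N (t n - \<psi>)) \<longlonglongrightarrow> 0 + cmod z * 0"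
        by (intro tendsto_intros LIMSEQ_Suc[OF lim_1_over_n] \<psi>)
      then have lim: "(\<lambda>n. 1 / real (Suc n) + cmod z * N (t n - \<psi>)) \<longlonglongrightarrow> 0"
        by (simp only: mult_zero_right add_0_right)
      have "(\<lambda>n. N (A (t n) - ?\<phi>)) \<longlonglongrightarrow> 0"
        by (rule tendsto_sandwich[OF _ _ tendsto_const lim]) (intro always_eventually allI N_nonneg le)+
      then have "(\<psi>, ?\<phi>) \<in> ?G" unfolding G by (intro conjI exI[of _ t] allI \<psi> \<phi> tD)
      then show ?thesis by (intro exI[of _ \<psi>] exI[of _ ?\<phi>]) simp
    qed
    have "\<exists>(\<psi>, \<phi>)\<in>?G. N (\<lambda>g. \<phi> g - z *s \<psi> g - \<eta> g) = 0" if "\<eta> \<in> H" for \<eta>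
    proof -
      obtain \<psi> \<phi> where *: "(\<psi>, \<phi>) \<in> ?G" "\<phi> - smul z \<psi> - \<eta> = 0" using surj[OF \<open>\<eta> \<in> H\<close>] by blast
      have "(\<lambda>g. \<phi> g - z *s \<psi> g - \<eta> g) = \<phi> - smul z \<psi> - \<eta>" by (simp add: smul_def fun_diff_def)
      then show ?thesis using * by (intro bexI[of _ "(\<psi>, \<phi>)"]) auto
    qed
    moreover have "\<exists>C. \<forall>(\<psi>, \<phi>)\<in>?G. N \<psi> \<le> C * N (\<lambda>g. \<phi> g - z *s \<psi> g)"
      using bound unfolding smul_def fun_diff_def by blast
    ultimately show ?thesis unfolding resolvent_set_def by simp
  qed
  show ?thesis unfolding closure_spectrum_def using not_res res by blast
qed

end

section \<open>Uniqueness for Fourier series and Hermite expansions\<close>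

lemma integrable_bounded_mult:
  fixes f h :: "'a \<Rightarrow> complex"
  assumes "integrable M f" "h \<in> borel_measurable M" "\<And>x. cmod (h x) \<le> B"
  shows "integrable M (\<lambda>x. h x * f x)"
proof (rule Bochner_Integration.integrable_bound)
  show "integrable M (\<lambda>x. B * cmod (f x))" using assms(1) by auto
  show "(\<lambda>x. h x * f x) \<in> borel_measurable M" using assms by auto
  have "0 \<le> B" using order_trans[OF norm_ge_zero assms(3)] by blast
  then show "AE x in M. norm (h x * f x) \<le> norm (B * cmod (f x))"
    using assms(3) by (auto simp: norm_mult mult_right_mono)
qed

lemma measurable_cis [measurable]: "cis \<in> borel_measurable borel"
  by (intro borel_measurable_continuous_onI continuous_intros)

text \<open>Polynomials in the real and imaginary part of \<open>cis (\<omega> * x)\<close> are trigonometric polynomials. The statement also carries the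
other Fourier coefficients, which makes it stable under products.\<close>

lemma trigonometric_polynomial_orthogonal:
  fixes f :: "real \<Rightarrow> complex" and \<omega> :: real
  assumes "real_polynomial_function g"
    and "integrable lborel f" "\<And>n::int. (LINT x|lborel. f x * cis (\<omega> * n * x)) = 0"
  shows "integrable lborel (\<lambda>x. of_real (g (cis (\<omega> * x))) * f x) \<and>
    (\<forall>n::int. (LINT x|lborel. of_real (g (cis (\<omega> * x))) * f x * cis (\<omega> * n * x)) = 0)"
  using assms
proof (induction arbitrary: f rule: real_polynomial_function.induct)
  case (linear g)
  define c1 c2 where "c1 = Complex (g 1 / 2) (- g \<i> / 2)" and "c2 = Complex (g 1 / 2) (g \<i> / 2)"
  have g: "complex_of_real (g (cis t)) = c1 * cis t + c2 * cis (- t)" for t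
  proof -
    have "cis t = cos t *\<^sub>R 1 + sin t *\<^sub>R \<i>" by (simp add: complex_eq_iff)
    then have "g (cis t) = cos t * g 1 + sin t * g \<i>"
      using linear(1) by (simp only: linear_simps(1,5)[OF linear(1)] real_scaleR_def)
    then show ?thesis by (simp add: complex_eq_iff c1_def c2_def)
  qed
  have I: "integrable lborel (\<lambda>x. f x * cis (\<omega> * n * x))" for n :: real
  proof -
    have "integrable lborel (\<lambda>x. cis (\<omega> * n * x) * f x)"
      by (rule integrable_bounded_mult[OF linear(2), of _ 1]) auto
    then show ?thesis by (simp add: mult.commute)
  qed
  have e: "complex_of_real (g (cis (\<omega> * x))) * f x * cis (\<omega> * n * x) =
     c1 * (f x * cis (\<omega> * (n + 1) * x)) + c2 * (f x * cis (\<omega> * (n - 1) * x))" for x n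
  proof -
    have 1: "cis (\<omega> * (n + 1) * x) = cis (\<omega> * x) * cis (\<omega> * n * x)"
      "cis (\<omega> * (n - 1) * x) = cis (- (\<omega> * x)) * cis (\<omega> * n * x)"
      by (simp_all add: cis_mult algebra_simps)
    show ?thesis unfolding g 1 by (simp add: algebra_simps)
  qed
  have "integrable lborel (\<lambda>x. complex_of_real (g (cis (\<omega> * x))) * f x)"
    using e[of _ 0] I[of 1] I[of "-1"] by simp
  moreover have "(LINT x|lborel. complex_of_real (g (cis (\<omega> * x))) * f x * cis (\<omega> * n * x)) = 0" for n :: int
    unfolding e using I linear(3)[of "n + 1"] linear(3)[of "n - 1"] by simp
  ultimately show ?case by blast
next
  case (const c)
  then show ?case by (simp add: mult.assoc)
next
  case (add g1 g2)
  have 1: "integrable lborel (\<lambda>x. complex_of_real (g (cis (\<omega> * x))) * f x * cis (\<omega> * n * x))"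
    if "integrable lborel (\<lambda>x. complex_of_real (g (cis (\<omega> * x))) * f x)" for n :: real and g
  proof -
    have "integrable lborel (\<lambda>x. cis (\<omega> * n * x) * (complex_of_real (g (cis (\<omega> * x))) * f x))"
      by (rule integrable_bounded_mult[OF that, of _ 1]) auto
    then show ?thesis by (simp add: mult.commute)
  qed
  show ?case using add.IH[OF add.prems] 1 by (simp add: distrib_right)
next
  case (mult g1 g2)
  note 2 = mult.IH(2)[OF mult.prems]
  show ?case
    using mult.IH(1)[of "\<lambda>x. complex_of_real (g2 (cis (\<omega> * x))) * f x"] 2 by (simp add: mult.assoc)
qed

text \<open>By the Stone-Weierstrass theorem on the unit circle.\<close>

lemma continuous_periodic_orthogonal:
  fixes f :: "real \<Rightarrow> complex" and \<omega> :: real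
  assumes f: "integrable lborel f" "\<And>n::int. (LINT x|lborel. f x * cis (\<omega> * n * x)) = 0"
    and h: "continuous_on UNIV (h :: complex \<Rightarrow> real)"
  shows "(LINT x|lborel. of_real (h (cis (\<omega> * x))) * f x) = 0"
proof -
  let ?I = "LINT x|lborel. of_real (h (cis (\<omega> * x))) * f x"
  let ?J = "LINT x|lborel. cmod (f x)"
  have [measurable]: "h \<in> borel_measurable borel" using h by (rule borel_measurable_continuous_onI)
  have "compact (h ` sphere 0 1)" by (intro compact_continuous_image continuous_on_subset[OF h]) auto
  then obtain B where "\<forall>z\<in>sphere 0 1. \<bar>h z\<bar> \<le> B"
    using compact_imp_bounded[of "h ` sphere 0 1"] unfolding bounded_iff by auto
  then have B: "\<bar>h z\<bar> \<le> B" if "cmod z = 1" for z using that by simp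
  have hI: "integrable lborel (\<lambda>x. of_real (h (cis (\<omega> * x))) * f x)"
    by (rule integrable_bounded_mult[OF f(1), of _ B]) (auto intro: B)
  have "cmod ?I \<le> e * ?J" if e: "e > 0" for e
  proof -
    obtain g where g: "real_polynomial_function g" "\<And>x. x \<in> sphere 0 1 \<Longrightarrow> \<bar>h x - g x\<bar> < e"
      using Stone_Weierstrass_real_polynomial_function[of "sphere (0::complex) 1" h e]
        continuous_on_subset[OF h] e by auto
    note tp = trigonometric_polynomial_orthogonal[OF g(1) f]
    have "(LINT x|lborel. of_real (g (cis (\<omega> * x))) * f x) = 0"
      using tp[THEN conjunct2, rule_format, of 0] by simp
    then have "?I = (LINT x|lborel. of_real (h (cis (\<omega> * x))) * f x - of_real (g (cis (\<omega> * x))) * f x)"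
      using hI tp by (simp add: Bochner_Integration.integral_diff)
    also have "cmod \<dots> \<le> (LINT x|lborel. cmod (of_real (h (cis (\<omega> * x))) * f x - of_real (g (cis (\<omega> * x))) * f x))"
      by simp
    also have "\<dots> \<le> (LINT x|lborel. e * cmod (f x))"
    proof (rule integral_mono)
      show "integrable lborel (\<lambda>x. cmod (of_real (h (cis (\<omega> * x))) * f x - of_real (g (cis (\<omega> * x))) * f x))"
        using hI tp by auto
      show "integrable lborel (\<lambda>x. e * cmod (f x))" using f(1) by auto
      show "cmod (of_real (h (cis (\<omega> * x))) * f x - of_real (g (cis (\<omega> * x))) * f x) \<le> e * cmod (f x)" for x
      proof -
        have "of_real (h (cis (\<omega> * x))) * f x - of_real (g (cis (\<omega> * x))) * f x =
           of_real (h (cis (\<omega> * x)) - g (cis (\<omega> * x))) * f x" by (simp add: algebra_simps)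
        then have "cmod (of_real (h (cis (\<omega> * x))) * f x - of_real (g (cis (\<omega> * x))) * f x)
            = \<bar>h (cis (\<omega> * x)) - g (cis (\<omega> * x))\<bar> * cmod (f x)"
          by (simp only: norm_mult norm_of_real)
        also have "\<dots> \<le> e * cmod (f x)"
          using g(2)[of "cis (\<omega> * x)"] by (intro mult_right_mono) auto
        finally show ?thesis .
      qed
    qed
    finally show ?thesis by simp
  qed
  have J: "?J \<ge> 0" by simp
  have "cmod ?I \<le> 0"
  proof (rule field_le_epsilon)
    fix d :: real assume d: "d > 0"
    have J1: "?J + 1 > 0" using J by linarith
    have "cmod ?I \<le> d / (?J + 1) * ?J"
      by (intro \<open>\<And>e. e > 0 \<Longrightarrow> cmod ?I \<le> e * ?J\<close> divide_pos_pos J1 d)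
    also have "\<dots> \<le> d" using J1 d by (simp add: field_simps)
    finally show "cmod ?I \<le> 0 + d" by simp
  qed
  then show ?thesis by simp
qed

text \<open>The indicator of a closed set is a bounded pointwise limit of continuous functions, so that
dominated convergence applies.\<close>

lemma closed_periodic_orthogonal:
  fixes f :: "real \<Rightarrow> complex" and \<omega> :: real
  assumes f: "integrable lborel f" "\<And>n::int. (LINT x|lborel. f x * cis (\<omega> * n * x)) = 0"
    and K: "closed K"
  shows "(LINT x|lborel. indicator K (cis (\<omega> * x)) * f x) = 0"
proof (cases "K = {}")
  case False
  define h where "h n z = max 0 (1 - real n * infdist z K)" for n z
  have "(\<lambda>n. LINT x|lborel. of_real (h n (cis (\<omega> * x))) * f x) \<longlonglongrightarrow>
    (LINT x|lborel. indicator K (cis (\<omega> * x)) * f x)"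
  proof (rule integral_dominated_convergence)
    show "integrable lborel (\<lambda>x. cmod (f x))" using f(1) by auto
    have [measurable]: "f \<in> borel_measurable borel" "K \<in> sets borel" using f(1) K by auto
    have [measurable]: "h n \<in> borel_measurable borel" for n unfolding h_def
      by (intro borel_measurable_continuous_onI continuous_intros)
    show "(\<lambda>x. indicator K (cis (\<omega> * x)) * f x) \<in> borel_measurable lborel" by measurable
    show "(\<lambda>x. of_real (h n (cis (\<omega> * x))) * f x) \<in> borel_measurable lborel" for n by measurable
    show "AE x in lborel. norm (of_real (h n (cis (\<omega> * x))) * f x) \<le> cmod (f x)" for n
      by (rule AE_I2) (auto simp: norm_mult h_def infdist_nonneg intro!: mult_left_le_one_le)
    have "(\<lambda>n. complex_of_real (h n z)) \<longlonglongrightarrow> indicator K z" for z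
    proof (cases "z \<in> K")
      case True
      then show ?thesis by (simp add: h_def)
    next
      case z: False
      then have "infdist z K > 0" using K False by (metis in_closed_iff_infdist_zero infdist_nonneg order_le_less)
      then obtain N where N: "1 < real N * infdist z K" using reals_Archimedean3 by blast
      have "h n z = 0" if "n \<ge> N" for n
      proof -
        have "real N * infdist z K \<le> real n * infdist z K" using that by (intro mult_right_mono infdist_nonneg) auto
        then show ?thesis using N by (simp add: h_def)
      qed
      then have "\<forall>\<^sub>F n in sequentially. complex_of_real (h n z) = 0"
        unfolding eventually_sequentially by (intro exI[of _ N]) simp
      then show ?thesis using z by (simp add: tendsto_eventually)
    qed
    then show "AE x in lborel. (\<lambda>n. of_real (h n (cis (\<omega> * x))) * f x) \<longlonglongrightarrow> indicator K (cis (\<omega> * x)) * f x"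
      by (intro AE_I2 tendsto_intros)
  qed
  moreover have "(LINT x|lborel. of_real (h n (cis (\<omega> * x))) * f x) = 0" for n
    by (rule continuous_periodic_orthogonal[OF f]) (auto simp: h_def intro!: continuous_intros)
  ultimately show ?thesis by (simp add: LIMSEQ_const_iff)
qed simp

text \<open>By inner regularity of the finite measure with density the positive part of \<open>f\<close>, it is enough to
control compact sets.\<close>

lemma compact_integrals_zero_real:
  fixes f :: "real \<Rightarrow> real"
  assumes f: "integrable lborel f" and S: "\<And>x. x \<notin> S \<Longrightarrow> f x = 0"
    and 0: "\<And>K. compact K \<Longrightarrow> K \<subseteq> S \<Longrightarrow> (LINT x|lborel. indicator K x * f x) = 0"
  shows "AE x in lborel. f x \<le> 0"
proof -
  have [measurable]: "f \<in> borel_measurable borel" using f by auto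
  define M where "M = density lborel (\<lambda>x. ennreal (f x))"
  define A where "A = {x. f x > 0}"
  have A[measurable]: "A \<in> sets borel" by (auto simp: A_def)
  have AS: "A \<subseteq> S" using S by (fastforce simp: A_def)
  have sets: "sets M = sets borel" by (simp add: M_def)
  have "(\<integral>\<^sup>+x. ennreal (f x) \<partial>lborel) \<le> (\<integral>\<^sup>+x. ennreal (norm (f x)) \<partial>lborel)"
    by (intro nn_integral_mono ennreal_leI) auto
  also have "\<dots> < \<infinity>" using f by (simp add: integrable_iff_bounded)
  finally have "emeasure M (space M) \<noteq> \<infinity>"
    by (simp add: M_def emeasure_density)
  then have "emeasure M A = (SUP K\<in>{K. K \<subseteq> A \<and> compact K}. emeasure M K)"
    by (intro inner_regular sets) (simp_all add: sets)
  also have "\<dots> = 0"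
  proof -
    have "emeasure M K = 0" if K: "K \<subseteq> A" "compact K" for K
    proof -
      have [measurable]: "K \<in> sets borel" using K by (simp add: borel_compact)
      have I: "integrable lborel (\<lambda>x. indicator K x * f x)"
        using integrable_mult_indicator[of K lborel f] f by simp
      have "emeasure M K = (\<integral>\<^sup>+x. ennreal (indicator K x * f x) \<partial>lborel)"
        unfolding M_def by (subst emeasure_density) (auto intro!: nn_integral_cong simp: indicator_def)
      also have "\<dots> = ennreal (LINT x|lborel. indicator K x * f x)"
        by (rule nn_integral_eq_integral[OF I]) (rule AE_I2, use K in \<open>auto simp: A_def indicator_def\<close>)
      also have "\<dots> = 0" using 0[OF K(2)] K AS by simp
      finally show ?thesis .
    qed
    then show ?thesis by (auto intro!: antisym SUP_least)
  qed
  finally have "(\<integral>\<^sup>+x. ennreal (f x) * indicator A x \<partial>lborel) = 0"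
    unfolding M_def by (subst (asm) emeasure_density) auto
  then have "AE x in lborel. ennreal (f x) * indicator A x = 0"
    by (subst (asm) nn_integral_0_iff_AE) auto
  then show ?thesis by eventually_elim (auto simp: A_def indicator_def ennreal_eq_0_iff split: if_splits)
qed

lemma compact_integrals_zero:
  fixes f :: "real \<Rightarrow> complex"
  assumes f: "integrable lborel f" and S: "\<And>x. x \<notin> S \<Longrightarrow> f x = 0"
    and 0: "\<And>K. compact K \<Longrightarrow> K \<subseteq> S \<Longrightarrow> (LINT x|lborel. indicator K x * f x) = 0"
  shows "AE x in lborel. f x = 0"
proof -
  have *: "AE x in lborel. g (f x) \<le> 0" if g: "bounded_linear (g :: complex \<Rightarrow> real)" for g
  proof (rule compact_integrals_zero_real[of _ S])
    interpret bounded_linear g by (rule g)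
    show "integrable lborel (\<lambda>x. g (f x))" by (rule integrable_bounded_linear[OF g f])
    show "g (f x) = 0" if "x \<notin> S" for x using S[OF that] by (simp add: zero)
    fix K :: "real set" assume K: "compact K" "K \<subseteq> S"
    then have [measurable]: "K \<in> sets borel" by (simp add: borel_compact)
    have "integrable lborel (\<lambda>x. indicator K x * f x)"
      by (rule integrable_bounded_mult[OF f, of _ 1]) (auto simp: indicator_def)
    then have "g (LINT x|lborel. indicator K x * f x) = (LINT x|lborel. g (indicator K x * f x))"
      by (rule integral_bounded_linear[OF g, symmetric])
    also have "(\<lambda>x. g (indicator K x * f x)) = (\<lambda>x. indicator K x * g (f x))"
      by (auto simp: indicator_def zero)
    finally show "(LINT x|lborel. indicator K x * g (f x)) = 0" using 0[OF K] by (simp add: zero)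
  qed
  show ?thesis
    using *[OF bounded_linear_Re] *[OF bounded_linear_minus[OF bounded_linear_Re]]
      *[OF bounded_linear_Im] *[OF bounded_linear_minus[OF bounded_linear_Im]]
    by eventually_elim (simp add: complex_eq_iff)
qed

lemma cis_eq_imp_eq: assumes "cis a = cis b" "\<bar>a - b\<bar> < 2 * pi" shows "a = b"
proof -
  have "cis (a - b) = 1" using assms(1) by (simp add: cis_divide[symmetric])
  then have "cos (a - b) = 1" by (metis cis.sel(1) one_complex.sel(1))
  then obtain n :: int where n: "a - b = real_of_int n * 2 * pi" using cos_one_2pi_int by blast
  have "\<bar>real_of_int n\<bar> * (2 * pi) < 1 * (2 * pi)" using assms(2) n by (simp add: abs_mult)
  then have "\<bar>real_of_int n\<bar> < 1" by (simp only: mult_less_cancel_right_pos[OF pi_gt_zero] mult_less_cancel_right) simp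
  then have "n = 0" by linarith
  then show ?thesis using n by simp
qed

text \<open>Since \<open>x \<mapsto> cis (2 * pi / P * x)\<close> is injective on \<open>{0..<P}\<close>, every compact subset of this interval is the part
in it of the preimage of a closed subset of the circle.\<close>

proposition fourier_coefficients_unique:
  fixes f :: "real \<Rightarrow> complex"
  assumes P: "P > 0" and f: "integrable lborel f" and S: "\<And>x. x \<notin> {0..<P} \<Longrightarrow> f x = 0"
    and 0: "\<And>n::int. (LINT x|lborel. f x * cis (2 * pi / P * n * x)) = 0"
  shows "AE x in lborel. f x = 0"
proof (rule compact_integrals_zero[OF f S])
  fix K assume K: "compact K" "K \<subseteq> {0..<P}"
  let ?\<omega> = "2 * pi / P"
  have "compact ((\<lambda>x. cis (?\<omega> * x)) ` K)" by (intro compact_continuous_image K continuous_intros)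
  then have "closed ((\<lambda>x. cis (?\<omega> * x)) ` K)" by (rule compact_imp_closed)
  from closed_periodic_orthogonal[OF f 0 this]
  have "(LINT x|lborel. indicator ((\<lambda>x. cis (?\<omega> * x)) ` K) (cis (?\<omega> * x)) * f x) = 0" .
  also have "(\<lambda>x. indicator ((\<lambda>x. cis (?\<omega> * x)) ` K) (cis (?\<omega> * x)) * f x) = (\<lambda>x. indicator K x * f x)"
  proof
    fix x
    have iff: "cis (?\<omega> * x) \<in> (\<lambda>x. cis (?\<omega> * x)) ` K \<longleftrightarrow> x \<in> K" if "x \<in> {0..<P}"
    proof
      assume "cis (?\<omega> * x) \<in> (\<lambda>x. cis (?\<omega> * x)) ` K"
      then obtain k where k: "k \<in> K" "cis (?\<omega> * x) = cis (?\<omega> * k)" by blast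
      have lt: "\<bar>x - k\<bar> < P" using k(1) K(2) that by (auto simp: abs_real_def)
      have "\<bar>?\<omega> * x - ?\<omega> * k\<bar> = ?\<omega> * \<bar>x - k\<bar>"
        unfolding right_diff_distrib[symmetric] abs_mult using P by simp
      also have "\<dots> < ?\<omega> * P" using P by (intro mult_strict_left_mono lt) simp
      also have "\<dots> = 2 * pi" using P by simp
      finally have "\<bar>?\<omega> * x - ?\<omega> * k\<bar> < 2 * pi" .
      from cis_eq_imp_eq[OF k(2) this] show "x \<in> K" using k P by simp
    qed auto
    show "indicator ((\<lambda>x. cis (?\<omega> * x)) ` K) (cis (?\<omega> * x)) * f x = indicator K x * f x"
    proof (cases "x \<in> {0..<P}")
      case True
      show ?thesis unfolding indicator_def iff[OF True] ..
    next
      case False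
      then have "f x = 0" by (rule S)
      then show ?thesis by simp
    qed
  qed
  finally show "(LINT x|lborel. indicator K x * f x) = 0" .
qed

text \<open>Vanishing of the whole transform gives vanishing Fourier coefficients for the period \<open>2 * pi / \<omega>\<close>, for
every \<open>\<omega>\<close>. As \<open>\<omega>\<close> tends to zero the period becomes so long that a given compact set is eventually
separated from any given point outside it.\<close>

proposition fourier_transform_unique:
  fixes f :: "real \<Rightarrow> complex"
  assumes f: "integrable lborel f" and 0: "\<And>s. (LINT x|lborel. f x * cis (s * x)) = 0"
  shows "AE x in lborel. f x = 0"
proof (rule compact_integrals_zero[OF f, of UNIV])
  fix K :: "real set" assume K: "compact K"
  then obtain a where a: "\<And>x. x \<in> K \<Longrightarrow> \<bar>x\<bar> \<le> a"
    using compact_imp_bounded[OF K] unfolding bounded_iff by auto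
  define \<omega> where "\<omega> n = 1 / real (Suc n)" for n
  define C where "C n = (\<lambda>x. cis (\<omega> n * x)) ` K" for n
  have "closed (C n)" for n
    unfolding C_def by (intro compact_imp_closed compact_continuous_image K continuous_intros)
  then have zero: "(LINT x|lborel. indicator (C n) (cis (\<omega> n * x)) * f x) = 0" for n
    by (intro closed_periodic_orthogonal f 0)
  have "(\<lambda>n. LINT x|lborel. indicator (C n) (cis (\<omega> n * x)) * f x) \<longlonglongrightarrow> (LINT x|lborel. indicator K x * f x)"
  proof (rule integral_dominated_convergence)
    have [measurable]: "K \<in> sets borel" "C n \<in> sets borel" "f \<in> borel_measurable borel" for n
      using K \<open>closed (C n)\<close> f by (auto simp: borel_compact)
    show "integrable lborel (\<lambda>x. cmod (f x))" using f by auto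
    show "(\<lambda>x. indicator K x * f x) \<in> borel_measurable lborel" by measurable
    show "(\<lambda>x. indicator (C n) (cis (\<omega> n * x)) * f x) \<in> borel_measurable lborel" for n by measurable
    show "AE x in lborel. norm (indicator (C n) (cis (\<omega> n * x)) * f x) \<le> cmod (f x)" for n
      by (rule AE_I2) (auto simp: norm_mult indicator_def)
    have "(\<lambda>n. indicator (C n) (cis (\<omega> n * x)) :: complex) \<longlonglongrightarrow> indicator K x" for x
    proof (rule tendsto_eventually)
      obtain N where N: "\<bar>x\<bar> + a < real N" using reals_Archimedean2 by blast
      have "indicator (C n) (cis (\<omega> n * x)) = (indicator K x :: complex)" if n: "n \<ge> N" for n
      proof -
        have "x \<in> K" if "cis (\<omega> n * x) \<in> C n"
        proof -
          obtain k where k: "k \<in> K" "cis (\<omega> n * x) = cis (\<omega> n * k)" using \<open>cis (\<omega> n * x) \<in> C n\<close> by (auto simp: C_def)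
          have "\<bar>\<omega> n * x - \<omega> n * k\<bar> = \<bar>x - k\<bar> / real (Suc n)"
            by (simp add: \<omega>_def diff_divide_distrib[symmetric])
          also have "\<dots> < 1" using a[OF k(1)] N n by (simp add: field_simps)
          also have "1 < 2 * pi" using pi_gt3 by simp
          finally have "\<omega> n * x = \<omega> n * k" by (rule cis_eq_imp_eq[OF k(2)])
          then show ?thesis using k by (simp add: \<omega>_def)
        qed
        then show ?thesis by (auto simp: indicator_def C_def)
      qed
      then show "\<forall>\<^sub>F n in sequentially. indicator (C n) (cis (\<omega> n * x)) = (indicator K x :: complex)"
        unfolding eventually_sequentially by blast
    qed
    then show "AE x in lborel. (\<lambda>n. indicator (C n) (cis (\<omega> n * x)) * f x) \<longlonglongrightarrow> indicator K x * f x"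
      by (intro AE_I2 tendsto_intros)
  qed
  then show "(LINT x|lborel. indicator K x * f x) = 0" by (simp add: zero LIMSEQ_const_iff)
qed auto

text \<open>The physicists' Hermite polynomials, for which \<open>herm j u * exp (- u\<^sup>2 / 2)\<close> is an eigenfunction of the harmonic oscillator.\<close>

fun herm :: "nat \<Rightarrow> real \<Rightarrow> real" where
  "herm 0 u = 1"
| "herm (Suc 0) u = 2 * u"
| "herm (Suc (Suc n)) u = 2 * u * herm (Suc n) u - 2 * real (Suc n) * herm n u"

lemma herm_mult: "u * herm j u = herm (Suc j) u / 2 + real j * herm (j - 1) u"
  by (cases j) (auto simp: field_simps)

lemma herm_deriv: "(herm n has_real_derivative 2 * real n * herm (n - 1) u) (at u)"
proof (induction n rule: less_induct)
  case (less n)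
  consider "n = 0" | "n = 1" | m where "n = Suc (Suc m)" by (metis One_nat_def not0_implies_Suc)
  then show ?case
  proof cases
    case 1
    have "herm 0 = (\<lambda>u. 1)" by auto
    then show ?thesis using 1 by simp
  next
    case 2
    have "herm 1 = (\<lambda>u. 2 * u)" by auto
    then show ?thesis using 2 by (auto intro!: derivative_eq_intros)
  next
    case (3 m)
    have e: "herm n = (\<lambda>u. 2 * u * herm (Suc m) u - 2 * real (Suc m) * herm m u)" using 3 by auto
    have [derivative_intros]: "(herm (Suc m) has_real_derivative 2 * real (Suc m) * herm m u) (at u)"
      "(herm m has_real_derivative 2 * real m * herm (m - 1) u) (at u)"
      using less(1)[of "Suc m"] less(1)[of m] 3 by auto
    have "((\<lambda>u. 2 * u * herm (Suc m) u - 2 * real (Suc m) * herm m u) has_real_derivative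
      2 * herm (Suc m) u + 2 * u * (2 * real (Suc m) * herm m u) - 2 * real (Suc m) * (2 * real m * herm (m - 1) u)) (at u)"
      by (auto intro!: derivative_eq_intros)
    also have "2 * herm (Suc m) u + 2 * u * (2 * real (Suc m) * herm m u) - 2 * real (Suc m) * (2 * real m * herm (m - 1) u)
       = 2 * herm (Suc m) u + 4 * real (Suc m) * (u * herm m u) - 4 * real (Suc m) * real m * herm (m - 1) u"
      by (simp add: algebra_simps)
    also have "\<dots> = 2 * real n * herm (n - 1) u"
      unfolding herm_mult using 3 by (simp add: algebra_simps)
    finally show ?thesis using e by simp
  qed
qed

lemma continuous_herm [continuous_intros]: "continuous_on S (herm n)"
  by (meson DERIV_isCont continuous_at_imp_continuous_on herm_deriv)

lemma measurable_herm [measurable]: "herm n \<in> borel_measurable borel"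
  by (intro borel_measurable_continuous_onI continuous_intros)

text \<open>A crude bound of any polynomial by an exponential; the power of \<open>u\<close> is there only to let the induction along
the recursion of \<open>herm\<close> go through.\<close>

lemma herm_exp_bound: "\<exists>C. \<forall>u. \<bar>u ^ n * herm j u\<bar> \<le> C * exp \<bar>u\<bar>"
proof (induction j arbitrary: n rule: less_induct)
  case (less j)
  consider "j = 0" | "j = 1" | m where "j = Suc (Suc m)" by (metis One_nat_def not0_implies_Suc)
  then show ?case
  proof cases
    case 1
    have "\<bar>u\<bar> ^ n \<le> fact n * exp \<bar>u\<bar>" for u :: real
    proof -
      have "(\<Sum>k\<in>{n}. \<bar>u\<bar> ^ k / fact k) \<le> (\<Sum>k. \<bar>u\<bar> ^ k / fact k)"
        using exp_converges[of "\<bar>u\<bar>"] by (intro sum_le_suminf) (auto simp: sums_iff divide_inverse mult.commute)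
      also have "\<dots> = exp \<bar>u\<bar>" by (simp add: exp_def divide_inverse mult.commute)
      finally show ?thesis by (simp add: field_simps)
    qed
    then show ?thesis using 1 by (intro exI[of _ "fact n"]) (auto simp: power_abs)
  next
    case 2
    obtain C where C: "\<bar>u ^ Suc n * herm 0 u\<bar> \<le> C * exp \<bar>u\<bar>" for u
      using less(1)[of 0 "Suc n"] 2 by auto
    show ?thesis using 2 C by (intro exI[of _ "2 * C"]) (auto simp: abs_mult mult_ac)
  next
    case (3 m)
    obtain C D where C: "\<bar>u ^ Suc n * herm (Suc m) u\<bar> \<le> C * exp \<bar>u\<bar>" and D: "\<bar>u ^ n * herm m u\<bar> \<le> D * exp \<bar>u\<bar>" for u
      using less(1)[of "Suc m" "Suc n"] less(1)[of m n] 3 by auto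
    have "\<bar>u ^ n * herm j u\<bar> \<le> (2 * C + 2 * real (Suc m) * D) * exp \<bar>u\<bar>" for u
    proof -
      have "u ^ n * herm j u = 2 * (u ^ Suc n * herm (Suc m) u) - 2 * real (Suc m) * (u ^ n * herm m u)"
        using 3 by (simp add: algebra_simps)
      also have "\<bar>\<dots>\<bar> \<le> 2 * \<bar>u ^ Suc n * herm (Suc m) u\<bar> + 2 * real (Suc m) * \<bar>u ^ n * herm m u\<bar>"
        by (rule order_trans[OF abs_triangle_ineq4]) (simp add: abs_mult)
      also have "\<dots> \<le> 2 * (C * exp \<bar>u\<bar>) + 2 * real (Suc m) * (D * exp \<bar>u\<bar>)"
        by (intro add_mono mult_left_mono C D) auto
      finally show ?thesis by (simp add: algebra_simps)
    qed
    then show ?thesis by blast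
  qed
qed

lemma gaussian_exp_bound:
  fixes \<sigma> c a :: real assumes "\<sigma> > 0"
  shows "\<exists>C>0. \<forall>y. exp (a * \<bar>y\<bar>) * exp (- (\<sigma> * (y - c))\<^sup>2 / 2) \<le> C * exp (- \<bar>y\<bar>)"
proof (intro exI conjI allI)
  define b where "b = \<bar>a\<bar> + 1"
  fix y
  have "a * \<bar>y\<bar> \<le> \<bar>a\<bar> * \<bar>y\<bar>" by (intro mult_right_mono) auto
  then have "a * \<bar>y\<bar> + \<bar>y\<bar> \<le> b * \<bar>y\<bar>" by (simp add: b_def algebra_simps)
  also have "\<dots> \<le> b * (\<bar>y - c\<bar> + \<bar>c\<bar>)" by (intro mult_left_mono) (auto simp: b_def)
  finally have 1: "a * \<bar>y\<bar> + \<bar>y\<bar> \<le> b * \<bar>y - c\<bar> + b * \<bar>c\<bar>" by (simp add: distrib_left)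
  have "0 \<le> (b / \<sigma> - \<sigma> * \<bar>y - c\<bar>)\<^sup>2" by simp
  also have "\<dots> = b\<^sup>2 / \<sigma>\<^sup>2 - 2 * b * \<bar>y - c\<bar> + (\<sigma> * (y - c))\<^sup>2"
    using assms by (simp add: power2_diff power_divide power_mult_distrib)
  finally have "a * \<bar>y\<bar> - (\<sigma> * (y - c))\<^sup>2 / 2 \<le> (b * \<bar>c\<bar> + b\<^sup>2 / (2 * \<sigma>\<^sup>2)) - \<bar>y\<bar>" using 1 by (simp add: field_simps)
  then have "exp (a * \<bar>y\<bar> + (- (\<sigma> * (y - c))\<^sup>2 / 2)) \<le> exp ((b * \<bar>c\<bar> + b\<^sup>2 / (2 * \<sigma>\<^sup>2)) + - \<bar>y\<bar>)" by simp
  then show "exp (a * \<bar>y\<bar>) * exp (- (\<sigma> * (y - c))\<^sup>2 / 2) \<le> exp ((\<bar>a\<bar> + 1) * \<bar>c\<bar> + (\<bar>a\<bar> + 1)\<^sup>2 / (2 * \<sigma>\<^sup>2)) * exp (- \<bar>y\<bar>)"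
    by (simp only: exp_add b_def)
qed simp

text \<open>Orthogonality to all Hermite functions means that all moments of \<open>G = g * w\<close> vanish, where \<open>w\<close> is the Gaussian. Because \<open>G\<close>
is integrable against every exponential, its Fourier transform is the sum of the power series with these
moments as coefficients, so it is zero.

The weight \<open>exp (- \<bar>y\<bar>)\<close> allows functions \<open>g\<close> that are not integrable themselves, such as functions whose
absolute value has bounded integrals over intervals of a given length.\<close>

proposition hermite_functions_total:
  fixes g :: "real \<Rightarrow> complex" and \<sigma> c :: real
  assumes \<sigma>: "\<sigma> > 0" and g: "integrable lborel (\<lambda>y. of_real (exp (- \<bar>y\<bar>)) * g y)"
    and hz: "\<And>j. (LINT y|lborel. g y * of_real (herm j (\<sigma> * (y - c)) * exp (- (\<sigma> * (y - c))\<^sup>2 / 2))) = 0"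
  shows "AE y in lborel. g y = 0"
proof -
  define w where "w y = exp (- (\<sigma> * (y - c))\<^sup>2 / 2)" for y
  define G where "G y = g y * of_real (w y)" for y
  have [measurable]: "(\<lambda>y. of_real (exp (- \<bar>y\<bar>)) * g y) \<in> borel_measurable borel" using g by auto
  have "(\<lambda>y. of_real (exp \<bar>y\<bar>) * (of_real (exp (- \<bar>y\<bar>)) * g y)) \<in> borel_measurable borel" by measurable
  then have [measurable]: "g \<in> borel_measurable borel"
    by (simp add: mult.assoc[symmetric] of_real_mult[symmetric] exp_minus_inverse del: of_real_mult)
  have [measurable]: "w \<in> borel_measurable borel" "G \<in> borel_measurable borel" unfolding w_def G_def by measurable
  have int: "integrable lborel (\<lambda>y. G y * p y)"
    if p: "p \<in> borel_measurable borel" "\<And>y. cmod (p y) \<le> B * exp (a * \<bar>y\<bar>)" for p :: "real \<Rightarrow> complex" and a B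
  proof -
    obtain C where C: "C > 0" "\<And>y. exp (a * \<bar>y\<bar>) * w y \<le> C * exp (- \<bar>y\<bar>)"
      using gaussian_exp_bound[OF \<sigma>, of a c] unfolding w_def by blast
    have B: "B \<ge> 0" using order_trans[OF norm_ge_zero p(2)[of 0]] by simp
    show ?thesis
    proof (rule Bochner_Integration.integrable_bound)
      show "integrable lborel (\<lambda>y. of_real (B * C) * (of_real (exp (- \<bar>y\<bar>)) * g y))" using g by auto
      show "(\<lambda>y. G y * p y) \<in> borel_measurable lborel" using p(1) by measurable
      show "AE y in lborel. norm (G y * p y) \<le> norm (of_real (B * C) * (of_real (exp (- \<bar>y\<bar>)) * g y))"
      proof (rule AE_I2)
        fix y
        have "norm (G y * p y) = cmod (g y) * (w y * cmod (p y))"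
          by (simp add: G_def norm_mult w_def)
        also have "w y * cmod (p y) \<le> w y * (B * exp (a * \<bar>y\<bar>))" by (intro mult_left_mono p(2)) (simp add: w_def)
        also have "\<dots> = B * (exp (a * \<bar>y\<bar>) * w y)" by simp
        also have "\<dots> \<le> B * (C * exp (- \<bar>y\<bar>))" by (intro mult_left_mono C B)
        finally have "norm (G y * p y) \<le> cmod (g y) * (B * (C * exp (- \<bar>y\<bar>)))" by (simp add: mult_left_mono)
        then show "norm (G y * p y) \<le> norm (of_real (B * C) * (of_real (exp (- \<bar>y\<bar>)) * g y))"
          using B C(1) by (simp add: norm_mult mult_ac)
      qed
    qed
  qed
  define u where "u y = \<sigma> * (y - c)" for y
  have u: "\<bar>u y\<bar> \<le> \<sigma> * \<bar>y\<bar> + \<sigma> * \<bar>c\<bar>" for y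
  proof -
    have "\<bar>u y\<bar> = \<sigma> * \<bar>y - c\<bar>" using \<sigma> by (simp add: u_def abs_mult)
    also have "\<dots> \<le> \<sigma> * (\<bar>y\<bar> + \<bar>c\<bar>)" using \<sigma> by (intro mult_left_mono) auto
    finally show ?thesis by (simp add: distrib_left)
  qed
  have [measurable]: "u \<in> borel_measurable borel" unfolding u_def by measurable
  have intp: "integrable lborel (\<lambda>y. G y * of_real (u y ^ n * herm j (u y)))" for n j
  proof -
    obtain C where C: "\<And>u. \<bar>u ^ n * herm j u\<bar> \<le> C * exp \<bar>u\<bar>" using herm_exp_bound by blast
    have C0: "C \<ge> 0" using order_trans[OF abs_ge_zero C[of 0]] by simp
    show ?thesis
    proof (rule int[of _ "C * exp (\<sigma> * \<bar>c\<bar>)" \<sigma>])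
      fix y
      have "cmod (of_real (u y ^ n * herm j (u y))) \<le> C * exp \<bar>u y\<bar>" unfolding norm_of_real by (rule C)
      also have "\<dots> \<le> C * exp (\<sigma> * \<bar>y\<bar> + \<sigma> * \<bar>c\<bar>)" using u C0 by (intro mult_left_mono) auto
      finally show "cmod (of_real (u y ^ n * herm j (u y))) \<le> C * exp (\<sigma> * \<bar>c\<bar>) * exp (\<sigma> * \<bar>y\<bar>)"
        by (simp add: exp_add mult_ac)
    qed measurable
  qed
  have mom: "(LINT y|lborel. G y * of_real (u y ^ n * herm j (u y))) = 0" for n j
  proof (induction n arbitrary: j)
    case 0
    then show ?case using hz by (simp add: G_def u_def w_def mult_ac)
  next
    case (Suc n)
    have "G y * of_real (u y ^ Suc n * herm j (u y)) =
       of_real (1 / 2) * (G y * of_real (u y ^ n * herm (Suc j) (u y)))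
       + of_real (real j) * (G y * of_real (u y ^ n * herm (j - 1) (u y)))" for y
    proof -
      have "u y ^ Suc n * herm j (u y) = u y ^ n * (u y * herm j (u y))" by simp
      also have "\<dots> = 1 / 2 * (u y ^ n * herm (Suc j) (u y)) + real j * (u y ^ n * herm (j - 1) (u y))"
        unfolding herm_mult by (simp add: algebra_simps)
      finally have "complex_of_real (u y ^ Suc n * herm j (u y)) =
        of_real (1 / 2) * of_real (u y ^ n * herm (Suc j) (u y)) + of_real (real j) * of_real (u y ^ n * herm (j - 1) (u y))"
        by (simp only: of_real_add of_real_mult)
      then show ?thesis by (simp only: distrib_left mult_ac)
    qed
    then have "(LINT y|lborel. G y * of_real (u y ^ Suc n * herm j (u y))) =
      of_real (1 / 2) * (LINT y|lborel. G y * of_real (u y ^ n * herm (Suc j) (u y)))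
       + of_real (real j) * (LINT y|lborel. G y * of_real (u y ^ n * herm (j - 1) (u y)))"
      using intp by (simp only: Bochner_Integration.integral_add integrable_mult_right integral_mult_right_zero)
    then show ?case using Suc by simp
  qed
  have ft: "(LINT y|lborel. G y * cis (s * u y)) = 0" for s
  proof -
    have "(\<lambda>N. LINT y|lborel. G y * (\<Sum>n<N. (\<i> * of_real (s * u y)) ^ n / fact n)) \<longlonglongrightarrow> (LINT y|lborel. G y * cis (s * u y))"
    proof (rule integral_dominated_convergence)
      have "integrable lborel (\<lambda>y. G y * of_real (exp (\<bar>s\<bar> * \<bar>u y\<bar>)))"
      proof (rule int[of _ "exp (\<bar>s\<bar> * (\<sigma> * \<bar>c\<bar>))" "\<bar>s\<bar> * \<sigma>"])
        fix y
        have "\<bar>s\<bar> * \<bar>u y\<bar> \<le> \<bar>s\<bar> * (\<sigma> * \<bar>y\<bar> + \<sigma> * \<bar>c\<bar>)" by (intro mult_left_mono u) auto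
        then have "exp (\<bar>s\<bar> * \<bar>u y\<bar>) \<le> exp (\<bar>s\<bar> * (\<sigma> * \<bar>c\<bar>) + \<bar>s\<bar> * \<sigma> * \<bar>y\<bar>)" by (simp add: algebra_simps)
        then show "cmod (of_real (exp (\<bar>s\<bar> * \<bar>u y\<bar>))) \<le> exp (\<bar>s\<bar> * (\<sigma> * \<bar>c\<bar>)) * exp (\<bar>s\<bar> * \<sigma> * \<bar>y\<bar>)"
          by (simp add: exp_add[symmetric])
      qed measurable
      then show "integrable lborel (\<lambda>y. cmod (G y * of_real (exp (\<bar>s\<bar> * \<bar>u y\<bar>))))" by auto
      show "(\<lambda>y. G y * cis (s * u y)) \<in> borel_measurable lborel" by measurable
      show "(\<lambda>y. G y * (\<Sum>n<N. (\<i> * of_real (s * u y)) ^ n / fact n)) \<in> borel_measurable lborel" for N by measurable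
      show "AE y in lborel. (\<lambda>N. G y * (\<Sum>n<N. (\<i> * of_real (s * u y)) ^ n / fact n)) \<longlonglongrightarrow> G y * cis (s * u y)"
      proof (intro AE_I2 tendsto_intros)
        fix y
        have "(\<lambda>n. (\<i> * of_real (s * u y)) ^ n /\<^sub>R fact n) sums exp (\<i> * of_real (s * u y))"
          by (rule exp_converges)
        then show "(\<lambda>N. \<Sum>n<N. (\<i> * of_real (s * u y)) ^ n / fact n) \<longlonglongrightarrow> cis (s * u y)"
          unfolding sums_def cis_conv_exp by (simp add: scaleR_conv_of_real divide_inverse mult.commute)
      qed
      show "AE y in lborel. norm (G y * (\<Sum>n<N. (\<i> * of_real (s * u y)) ^ n / fact n)) \<le> cmod (G y * of_real (exp (\<bar>s\<bar> * \<bar>u y\<bar>)))" for N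
      proof (rule AE_I2)
        fix y
        have "norm (\<Sum>n<N. (\<i> * of_real (s * u y)) ^ n / fact n) \<le> (\<Sum>n<N. (\<bar>s\<bar> * \<bar>u y\<bar>) ^ n / fact n)"
          by (rule order_trans[OF norm_sum]) (simp add: norm_divide norm_power norm_mult abs_mult)
        also have "\<dots> \<le> exp (\<bar>s\<bar> * \<bar>u y\<bar>)"
        proof -
          have "(\<lambda>n. (\<bar>s\<bar> * \<bar>u y\<bar>) ^ n / fact n) sums exp (\<bar>s\<bar> * \<bar>u y\<bar>)"
            using exp_converges[of "\<bar>s\<bar> * \<bar>u y\<bar>"] by (simp add: divide_inverse mult.commute)
          then show ?thesis using sum_le_suminf[of "\<lambda>n. (\<bar>s\<bar> * \<bar>u y\<bar>) ^ n / fact n" "{..<N}"]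
            by (auto simp: sums_iff)
        qed
        finally show "norm (G y * (\<Sum>n<N. (\<i> * of_real (s * u y)) ^ n / fact n)) \<le> cmod (G y * of_real (exp (\<bar>s\<bar> * \<bar>u y\<bar>)))"
          by (simp add: norm_mult mult_left_mono)
      qed
    qed
    moreover have "(LINT y|lborel. G y * (\<Sum>n<N. (\<i> * of_real (s * u y)) ^ n / fact n)) = 0" for N
    proof -
      have e: "G y * (\<Sum>n<N. (\<i> * of_real (s * u y)) ^ n / fact n) =
        (\<Sum>n<N. ((\<i> * of_real s) ^ n / fact n) * (G y * of_real (u y ^ n * herm 0 (u y))))" for y
        by (simp add: sum_distrib_left power_mult_distrib mult_ac)
      show ?thesis unfolding e using intp[of _ 0] mom[of _ 0]
        by (subst Bochner_Integration.integral_sum) (auto simp del: of_real_mult herm.simps)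
    qed
    ultimately show ?thesis by (simp add: LIMSEQ_const_iff)
  qed
  have "AE y in lborel. G y = 0"
  proof (rule fourier_transform_unique)
    show "integrable lborel G" using intp[of 0 0] by simp
    fix t
    have "G y * cis (t * y) = cis (t * c) * (G y * cis (t / \<sigma> * u y))" for y
    proof -
      have "t * y = t * c + t / \<sigma> * u y" using \<sigma> by (simp add: u_def field_simps)
      then show ?thesis by (simp add: cis_mult[symmetric] mult_ac)
    qed
    then show "(LINT y|lborel. G y * cis (t * y)) = 0" using ft[of "t / \<sigma>"] by (simp only: integral_mult_right_zero mult_zero_right)
  qed
  then show ?thesis by eventually_elim (simp add: G_def w_def)
qed

section \<open>Smooth functions and left-invariant derivatives\<close>

definition dird :: "'a::euclidean_space \<Rightarrow> ('a \<Rightarrow> 'b::real_normed_vector) \<Rightarrow> 'a \<Rightarrow> 'b" where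
  "dird v f = (\<lambda>x. frechet_derivative f (at x) v)"

definition smooth :: "('a::euclidean_space \<Rightarrow> 'b::real_normed_vector) \<Rightarrow> bool" where
  "smooth f \<longleftrightarrow> (\<forall>k. C_k k f)"

lemma C_k_Suc_iff: "C_k (Suc k) f \<longleftrightarrow> (\<forall>x. f differentiable (at x)) \<and> (\<forall>v. C_k k (dird v f))"
  by (simp add: dird_def differentiable_on_def)

declare C_k.simps(2) [simp del]

lemma C_k_mono: "C_k (Suc k) f \<Longrightarrow> C_k k f"
proof (induction k arbitrary: f)
  case 0
  then show ?case
    by (auto simp: C_k_Suc_iff intro!: continuous_at_imp_continuous_on differentiable_imp_continuous_within)
next
  case (Suc k)
  then show ?case using C_k_Suc_iff by blast
qed

lemma smooth_differentiable: "smooth f \<Longrightarrow> f differentiable (at x)"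
  unfolding smooth_def using C_k_Suc_iff by blast

lemma smooth_dird: "smooth f \<Longrightarrow> smooth (dird v f)"
  unfolding smooth_def using C_k_Suc_iff by blast

lemma smooth_continuous: "smooth f \<Longrightarrow> continuous_on S f"
  unfolding smooth_def using C_k.simps(1) continuous_on_subset by blast

lemma smooth_has_derivative: "smooth f \<Longrightarrow> (f has_derivative (\<lambda>v. dird v f x)) (at x)"
  using smooth_differentiable[of f x] by (simp add: frechet_derivative_works dird_def)

lemma dird_eq: "(f has_derivative f') (at x) \<Longrightarrow> dird v f x = f' v"
  unfolding dird_def using frechet_derivative_at by metis

lemma dird_add: "f differentiable (at x) \<Longrightarrow> g differentiable (at x) \<Longrightarrow>
    dird v (\<lambda>x. f x + g x) x = dird v f x + dird v g x"
  unfolding frechet_derivative_works by (rule dird_eq[THEN trans], erule (1) has_derivative_add) (simp add: dird_def)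

lemma dird_bounded_linear: "bounded_linear T \<Longrightarrow> f differentiable (at x) \<Longrightarrow>
    dird v (\<lambda>x. T (f x)) x = T (dird v f x)"
  unfolding frechet_derivative_works by (rule dird_eq[THEN trans], erule (1) bounded_linear.has_derivative) (simp add: dird_def)

lemma dird_bilinear: "bounded_bilinear P \<Longrightarrow> f differentiable (at x) \<Longrightarrow> g differentiable (at x) \<Longrightarrow>
    dird v (\<lambda>x. P (f x) (g x)) x = P (f x) (dird v g x) + P (dird v f x) (g x)"
  unfolding frechet_derivative_works by (rule dird_eq[THEN trans], erule (2) bounded_bilinear.FDERIV) (simp add: dird_def)

lemma dird_scaleR: fixes f :: "'a::euclidean_space \<Rightarrow> real" shows
  "f differentiable (at x) \<Longrightarrow> g differentiable (at x) \<Longrightarrow>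
    dird v (\<lambda>x. f x *\<^sub>R g x) x = f x *\<^sub>R dird v g x + dird v f x *\<^sub>R g x"
  by (rule dird_bilinear[OF bounded_bilinear_scaleR])

lemma dird_linear: "bounded_linear T \<Longrightarrow> dird v T x = T v"
  by (rule dird_eq) (rule bounded_linear_imp_has_derivative)

lemma dird_const: "dird v (\<lambda>_. c) x = 0"
  by (rule dird_eq[THEN trans], rule has_derivative_const) simp

lemma C_k_const: "C_k k (\<lambda>_::'a::euclidean_space. c :: 'b::real_normed_vector)"
proof (induction k arbitrary: c)
  case (Suc k)
  have "dird v (\<lambda>_::'a. c) = (\<lambda>_. 0)" for v by (rule ext) (rule dird_const)
  then show ?case using Suc by (simp add: C_k_Suc_iff)
qed simp

lemma C_k_add: "C_k k f \<Longrightarrow> C_k k g \<Longrightarrow> C_k k (\<lambda>x. f x + g x)"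
proof (induction k arbitrary: f g)
  case (Suc k)
  then have "dird v (\<lambda>x. f x + g x) = (\<lambda>x. dird v f x + dird v g x)" for v
    by (intro ext dird_add) (auto simp: C_k_Suc_iff)
  then show ?case using Suc by (auto simp: C_k_Suc_iff)
qed (auto intro: continuous_intros)

lemma C_k_bounded_linear: "bounded_linear T \<Longrightarrow> C_k k f \<Longrightarrow> C_k k (\<lambda>x. T (f x))"
proof (induction k arbitrary: f)
  case 0
  then show ?case by (auto intro: bounded_linear.continuous_on)
next
  case (Suc k)
  then have "dird v (\<lambda>x. T (f x)) = (\<lambda>x. T (dird v f x))" for v
    by (intro ext dird_bounded_linear) (auto simp: C_k_Suc_iff)
  moreover have "(\<lambda>x. T (f x)) differentiable at x" for x
    using Suc.prems unfolding C_k_Suc_iff differentiable_def by (blast intro: bounded_linear.has_derivative)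
  ultimately show ?case using Suc by (auto simp: C_k_Suc_iff)
qed

lemma C_k_bilinear: "bounded_bilinear P \<Longrightarrow> C_k k f \<Longrightarrow> C_k k g \<Longrightarrow> C_k k (\<lambda>x. P (f x) (g x))"
proof (induction k arbitrary: f g)
  case 0
  then show ?case by (auto intro: bounded_bilinear.continuous_on)
next
  case (Suc k)
  have d: "f differentiable at x" "g differentiable at x" for x using Suc by (auto simp: C_k_Suc_iff)
  then have "dird v (\<lambda>x. P (f x) (g x)) = (\<lambda>x. P (f x) (dird v g x) + P (dird v f x) (g x))" for v
    using Suc(2) by (intro ext dird_bilinear)
  moreover have "(\<lambda>x. P (f x) (g x)) differentiable at x" for x
    using d[of x] bounded_bilinear.FDERIV[OF Suc(2)] unfolding differentiable_def by blast
  moreover have "C_k k (\<lambda>x. P (f x) (dird v g x) + P (dird v f x) (g x))" for v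
    using Suc.prems(2,3) C_k_mono[OF Suc.prems(2)] C_k_mono[OF Suc.prems(3)]
    by (intro C_k_add Suc.IH[OF Suc.prems(1)]) (auto simp: C_k_Suc_iff)
  ultimately show ?case by (auto simp: C_k_Suc_iff)
qed

lemma smooth_const: "smooth (\<lambda>_. c)"
  by (simp add: smooth_def C_k_const)

lemma smooth_add: "smooth f \<Longrightarrow> smooth g \<Longrightarrow> smooth (\<lambda>x. f x + g x)"
  by (simp add: smooth_def C_k_add)

lemma smooth_bounded_linear: "bounded_linear T \<Longrightarrow> smooth f \<Longrightarrow> smooth (\<lambda>x. T (f x))"
  by (simp add: smooth_def C_k_bounded_linear)

lemma smooth_bilinear:
  "bounded_bilinear P \<Longrightarrow> smooth f \<Longrightarrow> smooth g \<Longrightarrow> smooth (\<lambda>x. P (f x) (g x))"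
  by (simp add: smooth_def C_k_bilinear)

lemmas smooth_scaleR = smooth_bilinear[OF bounded_bilinear_scaleR]
lemmas smooth_inner = smooth_bilinear[OF bounded_bilinear_inner]

lemma smooth_linear: assumes "bounded_linear T" shows "smooth T"
proof -
  have "C_k k T" for k
  proof (cases k)
    case 0
    then show ?thesis using assms by (auto intro: linear_continuous_on)
  next
    case (Suc m)
    have "dird v T = (\<lambda>_. T v)" for v by (rule ext) (rule dird_linear[OF assms])
    then show ?thesis using assms Suc by (auto simp: C_k_Suc_iff C_k_const bounded_linear_imp_differentiable)
  qed
  then show ?thesis by (simp add: smooth_def)
qed

text \<open>Smoothness by coinduction: a class of differentiable functions that is closed under directional derivatives
consists of smooth functions.\<close>

lemma smooth_coinduct:
  assumes "\<And>f. f \<in> X \<Longrightarrow> (\<forall>x. f differentiable (at x)) \<and> (\<forall>v. dird v f \<in> X)" and "f \<in> X"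
  shows "smooth f"
proof -
  have "C_k k f" if "f \<in> X" for k f
    using that
  proof (induction k arbitrary: f)
    case 0
    then show ?case using assms(1)
      by (auto intro!: continuous_at_imp_continuous_on differentiable_imp_continuous_within)
  next
    case (Suc k)
    then show ?case using assms(1) by (auto simp: C_k_Suc_iff)
  qed
  then show ?thesis using assms(2) by (auto simp: smooth_def)
qed

lemma smooth_minus: "smooth f \<Longrightarrow> smooth (\<lambda>x. - f x)"
  by (rule smooth_bounded_linear[OF bounded_linear_minus[OF bounded_linear_ident]])

lemma smooth_sin_cos_linear:
  assumes L: "bounded_linear (L :: 'a::euclidean_space \<Rightarrow> real)"
  shows "smooth (\<lambda>x. sin (L x))" "smooth (\<lambda>x. cos (L x))"
proof -
  define X where "X = {\<lambda>x. a * sin (L x) + b * cos (L x) | a b. True}"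
  have 1: "((\<lambda>x. a * sin (L x) + b * cos (L x)) has_derivative (\<lambda>v. (- b * L v) * sin (L x) + (a * L v) * cos (L x))) (at x)" for a b x
    by (auto intro!: derivative_eq_intros bounded_linear_imp_has_derivative[OF L] simp: algebra_simps)
  have "(\<forall>x. f differentiable (at x)) \<and> (\<forall>v. dird v f \<in> X)" if "f \<in> X" for f
  proof -
    have "\<exists>a b. f = (\<lambda>x. a * sin (L x) + b * cos (L x))" using that unfolding X_def by simp
    then obtain a b where f: "f = (\<lambda>x. a * sin (L x) + b * cos (L x))" by blast
    have "dird v f = (\<lambda>x. (- b * L v) * sin (L x) + (a * L v) * cos (L x))" for v
      unfolding f by (rule ext) (rule dird_eq[OF 1])
    then show ?thesis unfolding f X_def using 1 unfolding differentiable_def by blast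
  qed
  moreover have "(\<lambda>x. sin (L x)) \<in> X" unfolding X_def by (rule CollectI, rule exI[of _ 1], rule exI[of _ 0]) auto
  moreover have "(\<lambda>x. cos (L x)) \<in> X" unfolding X_def by (rule CollectI, rule exI[of _ 0], rule exI[of _ 1]) auto
  ultimately show "smooth (\<lambda>x. sin (L x))" "smooth (\<lambda>x. cos (L x))" using smooth_coinduct[of X] by blast+
qed

lemma smooth_line_derivative:
  assumes "smooth f"
  shows "((\<lambda>s. f (a + s *\<^sub>R u)) has_vector_derivative dird u f (a + s *\<^sub>R u)) (at s)"
proof -
  have 1: "((\<lambda>s. a + s *\<^sub>R u) has_derivative (\<lambda>h. h *\<^sub>R u)) (at s)" by (auto intro!: derivative_eq_intros)
  have "linear (\<lambda>v. dird v f (a + s *\<^sub>R u))" using smooth_has_derivative[OF assms] has_derivative_linear by blast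
  then show ?thesis
    using diff_chain_at[OF 1 smooth_has_derivative[OF assms]] linear_cmul[of "\<lambda>v. dird v f (a + s *\<^sub>R u)"]
    by (simp add: has_vector_derivative_def o_def)
qed

text \<open>Both mixed derivatives are the limit of the same second difference, by applying the mean value theorem
once in each direction.\<close>

lemma symmetric_derivatives_real:
  fixes f :: "'a::euclidean_space \<Rightarrow> real"
  assumes f: "smooth f" shows "dird u (dird v f) x = dird v (dird u f) x"
proof -
  have D: "\<exists>p q. 0 < p \<and> p < h \<and> 0 < q \<and> q < h \<and>
      f (x + h *\<^sub>R u + h *\<^sub>R v) - f (x + h *\<^sub>R u) - f (x + h *\<^sub>R v) + f x = h * h * dird v (dird u f) (x + p *\<^sub>R u + q *\<^sub>R v)"
    if h: "h > 0" for h u v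
  proof -
    define g where "g s = f ((x + h *\<^sub>R v) + s *\<^sub>R u) - f (x + s *\<^sub>R u)" for s
    have "(g has_real_derivative dird u f ((x + h *\<^sub>R v) + s *\<^sub>R u) - dird u f (x + s *\<^sub>R u)) (at s)" for s
      unfolding g_def using f
      by (intro DERIV_diff; intro has_real_derivative_iff_has_vector_derivative[THEN iffD2] smooth_line_derivative smooth_dird)
    then obtain p where p: "0 < p" "p < h" "g h - g 0 = (h - 0) * (dird u f ((x + h *\<^sub>R v) + p *\<^sub>R u) - dird u f (x + p *\<^sub>R u))"
      using MVT2[OF h, of g "\<lambda>s. dird u f ((x + h *\<^sub>R v) + s *\<^sub>R u) - dird u f (x + s *\<^sub>R u)"] by blast
    have "((\<lambda>s. dird u f ((x + p *\<^sub>R u) + s *\<^sub>R v)) has_real_derivative dird v (dird u f) ((x + p *\<^sub>R u) + s *\<^sub>R v)) (at s)" for s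
      by (intro has_real_derivative_iff_has_vector_derivative[THEN iffD2] smooth_line_derivative smooth_dird f)
    then obtain q where q: "0 < q" "q < h" "dird u f ((x + p *\<^sub>R u) + h *\<^sub>R v) - dird u f ((x + p *\<^sub>R u) + 0 *\<^sub>R v) = (h - 0) * dird v (dird u f) ((x + p *\<^sub>R u) + q *\<^sub>R v)"
      using MVT2[OF h, of "\<lambda>s. dird u f ((x + p *\<^sub>R u) + s *\<^sub>R v)" "\<lambda>s. dird v (dird u f) ((x + p *\<^sub>R u) + s *\<^sub>R v)"] by blast
    have "f (x + h *\<^sub>R u + h *\<^sub>R v) - f (x + h *\<^sub>R u) - f (x + h *\<^sub>R v) + f x = g h - g 0"
      by (simp add: g_def algebra_simps)
    also have "\<dots> = h * (dird u f ((x + p *\<^sub>R u) + h *\<^sub>R v) - dird u f ((x + p *\<^sub>R u) + 0 *\<^sub>R v))"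
      unfolding p(3) by (simp add: algebra_simps)
    also have "\<dots> = h * h * dird v (dird u f) (x + p *\<^sub>R u + q *\<^sub>R v)" unfolding q(3) by simp
    finally show ?thesis using p q by blast
  qed
  define h where "h n = 1 / real (Suc n)" for n
  have h: "h n > 0" for n by (simp add: h_def)
  have hl: "h \<longlonglongrightarrow> 0" unfolding h_def by (intro LIMSEQ_Suc[OF lim_1_over_n])
  have lim: "\<exists>X. X \<longlonglongrightarrow> dird v (dird u f) x \<and> (\<forall>n. f (x + h n *\<^sub>R u + h n *\<^sub>R v) - f (x + h n *\<^sub>R u) - f (x + h n *\<^sub>R v) + f x = h n * h n * X n)" for u v
  proof -
    obtain p q where pq: "\<And>n. 0 < p n \<and> p n < h n \<and> 0 < q n \<and> q n < h n \<and>
      f (x + h n *\<^sub>R u + h n *\<^sub>R v) - f (x + h n *\<^sub>R u) - f (x + h n *\<^sub>R v) + f x = h n * h n * dird v (dird u f) (x + p n *\<^sub>R u + q n *\<^sub>R v)"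
      using D[OF h, of _ u v] by metis
    have "p \<longlonglongrightarrow> 0" "q \<longlonglongrightarrow> 0"
      using pq by (auto intro!: tendsto_sandwich[OF _ _ tendsto_const hl] always_eventually less_imp_le)
    then have "(\<lambda>n. x + p n *\<^sub>R u + q n *\<^sub>R v) \<longlonglongrightarrow> x + 0 *\<^sub>R u + 0 *\<^sub>R v" by (intro tendsto_intros)
    then have l: "(\<lambda>n. x + p n *\<^sub>R u + q n *\<^sub>R v) \<longlonglongrightarrow> x" by simp
    have "isCont (dird v (dird u f)) x"
      using smooth_continuous[OF smooth_dird[OF smooth_dird[OF f]], of UNIV] by (simp add: continuous_on_eq_continuous_at)
    then have "(\<lambda>n. dird v (dird u f) (x + p n *\<^sub>R u + q n *\<^sub>R v)) \<longlonglongrightarrow> dird v (dird u f) x"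
      by (rule isCont_tendsto_compose[OF _ l])
    then show ?thesis using pq by blast
  qed
  obtain X where X: "X \<longlonglongrightarrow> dird v (dird u f) x" "\<And>n. f (x + h n *\<^sub>R u + h n *\<^sub>R v) - f (x + h n *\<^sub>R u) - f (x + h n *\<^sub>R v) + f x = h n * h n * X n"
    using lim[of v u] by blast
  obtain Y where Y: "Y \<longlonglongrightarrow> dird u (dird v f) x" "\<And>n. f (x + h n *\<^sub>R v + h n *\<^sub>R u) - f (x + h n *\<^sub>R v) - f (x + h n *\<^sub>R u) + f x = h n * h n * Y n"
    using lim[of u v] by blast
  have "X n = Y n" for n
  proof -
    have e: "x + h n *\<^sub>R v + h n *\<^sub>R u = x + h n *\<^sub>R u + h n *\<^sub>R v" by (simp add: algebra_simps)
    have "h n * h n * X n = h n * h n * Y n" unfolding X(2)[symmetric] Y(2)[symmetric] e by simp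
    then show ?thesis using h[of n] by simp
  qed
  then have "X = Y" by blast
  then show ?thesis using X(1) Y(1) LIMSEQ_unique by blast
qed

text \<open>Reduced to real-valued functions by taking coordinates.\<close>

lemma symmetric_derivatives:
  fixes f :: "'a::euclidean_space \<Rightarrow> 'b::euclidean_space"
  assumes f: "smooth f" shows "dird u (dird v f) x = dird v (dird u f) x"
proof (rule euclidean_eqI)
  fix b :: 'b assume "b \<in> Basis"
  let ?T = "\<lambda>w. w \<bullet> b"
  have T: "bounded_linear ?T" by (rule bounded_linear_inner_left)
  have e: "dird v (\<lambda>x. ?T (g x)) = (\<lambda>x. ?T (dird v g x))" if "smooth g" for g :: "'a \<Rightarrow> 'b" and v
    by (intro ext dird_bounded_linear T smooth_differentiable that)
  have "dird u (dird v (\<lambda>x. ?T (f x))) x = dird v (dird u (\<lambda>x. ?T (f x))) x"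
    by (rule symmetric_derivatives_real[OF smooth_bounded_linear[OF T f]])
  then show "dird u (dird v f) x \<bullet> b = dird v (dird u f) x \<bullet> b"
    unfolding e[OF f] e[OF smooth_dird[OF f]] .
qed

text \<open>The derivative in the definition of the operators, for functions with values in any normed space, because it is
needed for complex and real functions as well.\<close>

definition lder :: "osc \<Rightarrow> (osc \<Rightarrow> 'b::real_normed_vector) \<Rightarrow> osc \<Rightarrow> 'b" where
  "lder V f g = vector_derivative (\<lambda>s. f (osc_mult g (s *\<^sub>R V))) (at 0)"

lemma basis_deriv_lder: "basis_deriv = lder"
  by (intro ext) (simp add: basis_deriv_def lder_def)

lemma lder_left_translate: "lder V (\<lambda>g. f (osc_mult l g)) g = lder V f (osc_mult l g)"
  unfolding lder_def osc_mult_assoc ..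

text \<open>The left-invariant vector field generated by \<open>V\<close>: right multiplication by \<open>s *\<^sub>R V\<close> is a straight line in
these coordinates.\<close>

definition lvec :: "osc \<Rightarrow> osc \<Rightarrow> osc" where
  "lvec V g = (cis (snd (snd g)) * fst V, fst (snd V) + osc_omega (fst g) (cis (snd (snd g)) * fst V) / 2, snd (snd V))"

lemma osc_mult_line: "osc_mult g (s *\<^sub>R V) = g + s *\<^sub>R lvec V g"
proof -
  obtain x z t v c d where gV: "g = (x, z, t)" "V = (v, c, d)" by (metis prod_cases3)
  have "osc_omega x (cis t * (s *\<^sub>R v)) = s * osc_omega x (cis t * v)"
    by (simp add: osc_omega_def mult_scaleR_right)
  then show ?thesis by (simp add: gV lvec_def distrib_left)
qed

lemma lder_eq: assumes "smooth f" shows "lder V f g = dird (lvec V g) f g"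
  using smooth_line_derivative[OF assms, of g "lvec V g" 0]
  by (simp add: lder_def osc_mult_line vector_derivative_at)

text \<open>The curve is a one-parameter subgroup, so its derivative at \<open>s\<close> is a derivative at \<open>0\<close> from another base point.\<close>

lemma lder_flow:
  assumes "smooth f" "V \<in> {vX, vY, vZ, vT}"
  shows "((\<lambda>s. f (osc_mult g (s *\<^sub>R V))) has_vector_derivative lder V f (osc_mult g (s *\<^sub>R V))) (at s)"
proof -
  let ?h = "osc_mult g (s *\<^sub>R V)"
  have "((\<lambda>r. f (osc_mult ?h (r *\<^sub>R V))) has_vector_derivative lder V f ?h) (at 0)"
    using smooth_line_derivative[OF assms(1), of ?h "lvec V ?h" 0]
    by (simp add: osc_mult_line lder_eq[OF assms(1)])
  moreover have "osc_mult ?h (r *\<^sub>R V) = osc_mult g ((s + r) *\<^sub>R V)" for r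
    by (simp add: osc_mult_assoc exp_basis(1)[OF assms(2)])
  ultimately have 1: "((\<lambda>r. f (osc_mult g ((s + r) *\<^sub>R V))) has_vector_derivative lder V f ?h) (at (s - s))" by simp
  have d: "((\<lambda>q. q - s) has_vector_derivative 1) (at s)"
    by (auto intro!: derivative_eq_intros)
  show ?thesis
    using vector_diff_chain_at[where g="\<lambda>r. f (osc_mult g ((s + r) *\<^sub>R V))" and f="\<lambda>q. q - s" and x=s, OF d 1]
    by (simp add: o_def)
qed

abbreviation "dX \<equiv> dird ((1, 0, 0) :: osc)"
abbreviation "dY \<equiv> dird ((\<i>, 0, 0) :: osc)"
abbreviation "dZ \<equiv> dird ((0, 1, 0) :: osc)"
abbreviation "dT \<equiv> dird ((0, 0, 1) :: osc)"

text \<open>The frame of the Heisenberg group. The left-invariant fields \<open>X\<close> and \<open>Y\<close> of the oscillator group arise from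
\<open>hA\<close> and \<open>hB\<close> by rotation through the angle \<open>t\<close>.\<close>

definition hA :: "(osc \<Rightarrow> 'b::real_normed_vector) \<Rightarrow> osc \<Rightarrow> 'b" where
  "hA f = (\<lambda>g. dX f g + (- Im (fst g) / 2) *\<^sub>R dZ f g)"
definition hB :: "(osc \<Rightarrow> 'b::real_normed_vector) \<Rightarrow> osc \<Rightarrow> 'b" where
  "hB f = (\<lambda>g. dY f g + (Re (fst g) / 2) *\<^sub>R dZ f g)"

lemma bl_coords: "bounded_linear (\<lambda>g::osc. - Im (fst g) / 2)" "bounded_linear (\<lambda>g::osc. Re (fst g) / 2)"
  "bounded_linear (\<lambda>g::osc. snd (snd g))"
  using bounded_linear_const_mult[OF bounded_linear_compose[OF bounded_linear_Im bounded_linear_fst[where 'a=complex and 'b="real \<times> real"]], of "- 1 / 2"]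
    bounded_linear_const_mult[OF bounded_linear_compose[OF bounded_linear_Re bounded_linear_fst[where 'a=complex and 'b="real \<times> real"]], of "1 / 2"]
    bounded_linear_compose[OF bounded_linear_snd[where 'a=real and 'b=real] bounded_linear_snd[where 'a=complex and 'b="real \<times> real"]]
  by simp_all

lemmas smooth_coords = smooth_linear[OF bl_coords(1)] smooth_linear[OF bl_coords(2)]
  smooth_sin_cos_linear[OF bl_coords(3)]

lemma smooth_hA: "smooth f \<Longrightarrow> smooth (hA f)"
  unfolding hA_def by (intro smooth_add smooth_scaleR smooth_dird smooth_coords)

lemma smooth_hB: "smooth f \<Longrightarrow> smooth (hB f)"
  unfolding hB_def by (intro smooth_add smooth_scaleR smooth_dird smooth_coords)

lemma dird_linear_comb:
  assumes "smooth f" shows "dird (a *\<^sub>R u + b *\<^sub>R v) f x = a *\<^sub>R dird u f x + b *\<^sub>R dird v f x"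
proof -
  have "linear (\<lambda>v. dird v f x)" using smooth_has_derivative[OF assms] has_derivative_linear by blast
  from linear_add[OF this] linear_cmul[OF this] show ?thesis by simp
qed

lemma lder_basis:
  assumes f: "smooth f"
  shows "lder vX f = (\<lambda>g. cos (snd (snd g)) *\<^sub>R hA f g + sin (snd (snd g)) *\<^sub>R hB f g)"
    and "lder vY f = (\<lambda>g. - sin (snd (snd g)) *\<^sub>R hA f g + cos (snd (snd g)) *\<^sub>R hB f g)"
    and "lder vZ f = dZ f" and "lder vT f = dT f"
proof -
  have AB: "dird (p *\<^sub>R (1, - Im (fst g) / 2, 0) + q *\<^sub>R (\<i>, Re (fst g) / 2, 0)) f g = p *\<^sub>R hA f g + q *\<^sub>R hB f g" for p q and g :: osc
  proof -
    have e: "(1, - Im (fst g) / 2, 0) = 1 *\<^sub>R ((1, 0, 0) :: osc) + (- Im (fst g) / 2) *\<^sub>R (0, 1, 0)"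
      "(\<i>, Re (fst g) / 2, 0) = 1 *\<^sub>R ((\<i>, 0, 0) :: osc) + (Re (fst g) / 2) *\<^sub>R (0, 1, 0)" by simp_all
    show ?thesis unfolding e dird_linear_comb[OF f] hA_def hB_def by simp
  qed
  have "lvec vX g = cos (snd (snd g)) *\<^sub>R (1, - Im (fst g) / 2, 0) + sin (snd (snd g)) *\<^sub>R (\<i>, Re (fst g) / 2, 0)" for g
    by (simp add: lvec_def vX_def osc_omega_def complex_eq_iff algebra_simps diff_divide_distrib)
  then show "lder vX f = (\<lambda>g. cos (snd (snd g)) *\<^sub>R hA f g + sin (snd (snd g)) *\<^sub>R hB f g)"
    by (intro ext) (simp only: lder_eq[OF f] AB)
  have "lvec vY g = (- sin (snd (snd g))) *\<^sub>R (1, - Im (fst g) / 2, 0) + cos (snd (snd g)) *\<^sub>R (\<i>, Re (fst g) / 2, 0)" for g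
    by (simp add: lvec_def vY_def osc_omega_def complex_eq_iff algebra_simps add_divide_distrib)
  then show "lder vY f = (\<lambda>g. - sin (snd (snd g)) *\<^sub>R hA f g + cos (snd (snd g)) *\<^sub>R hB f g)"
    by (intro ext) (simp only: lder_eq[OF f] AB)
  have "lvec vZ g = (0, 1, 0)" "lvec vT g = (0, 0, 1)" for g
    by (simp_all add: lvec_def vZ_def vT_def osc_omega_def)
  then show "lder vZ f = dZ f" "lder vT f = dT f"
    by (intro ext, simp only: lder_eq[OF f])+
qed

lemma smooth_lder:
  assumes f: "smooth f" and "V \<in> {vX, vY, vZ, vT}" shows "smooth (lder V f)"
proof -
  have "smooth (lder vX f)" "smooth (lder vY f)" "smooth (lder vZ f)" "smooth (lder vT f)"
    unfolding lder_basis[OF f]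
    by (intro smooth_add smooth_scaleR smooth_minus smooth_coords smooth_hA smooth_hB smooth_dird f)+
  then show ?thesis using assms(2) by auto
qed

text \<open>The coefficients of the rotation depend on \<open>t\<close> only, so \<open>hA\<close> and \<open>hB\<close> treat them as constants.\<close>

lemma frame_trig:
  fixes f :: "osc \<Rightarrow> 'b::real_normed_vector"
  assumes f: "smooth f"
  shows "hA (\<lambda>g. sin (snd (snd g)) *\<^sub>R f g) = (\<lambda>g. sin (snd (snd g)) *\<^sub>R hA f g)"
    and "hA (\<lambda>g. cos (snd (snd g)) *\<^sub>R f g) = (\<lambda>g. cos (snd (snd g)) *\<^sub>R hA f g)"
    and "hB (\<lambda>g. sin (snd (snd g)) *\<^sub>R f g) = (\<lambda>g. sin (snd (snd g)) *\<^sub>R hB f g)"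
    and "hB (\<lambda>g. cos (snd (snd g)) *\<^sub>R f g) = (\<lambda>g. cos (snd (snd g)) *\<^sub>R hB f g)"
    and "dT (\<lambda>g. sin (snd (snd g)) *\<^sub>R f g) = (\<lambda>g. sin (snd (snd g)) *\<^sub>R dT f g + cos (snd (snd g)) *\<^sub>R f g)"
    and "dT (\<lambda>g. cos (snd (snd g)) *\<^sub>R f g) = (\<lambda>g. cos (snd (snd g)) *\<^sub>R dT f g - sin (snd (snd g)) *\<^sub>R f g)"
    and "dZ (\<lambda>g. sin (snd (snd g)) *\<^sub>R f g) = (\<lambda>g. sin (snd (snd g)) *\<^sub>R dZ f g)"
    and "dZ (\<lambda>g. cos (snd (snd g)) *\<^sub>R f g) = (\<lambda>g. cos (snd (snd g)) *\<^sub>R dZ f g)"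
proof -
  have s: "dird v (\<lambda>g::osc. sin (snd (snd g))) x = snd (snd v) * cos (snd (snd x))"
    and c: "dird v (\<lambda>g::osc. cos (snd (snd g))) x = - snd (snd v) * sin (snd (snd x))" for v x
    by (rule dird_eq[THEN trans]; auto intro!: derivative_eq_intros bounded_linear_imp_has_derivative[OF bl_coords(3)])+
  note d = dird_scaleR[OF smooth_differentiable smooth_differentiable, OF smooth_coords(3) f]
    dird_scaleR[OF smooth_differentiable smooth_differentiable, OF smooth_coords(4) f]
  show "hA (\<lambda>g. sin (snd (snd g)) *\<^sub>R f g) = (\<lambda>g. sin (snd (snd g)) *\<^sub>R hA f g)"
    "hA (\<lambda>g. cos (snd (snd g)) *\<^sub>R f g) = (\<lambda>g. cos (snd (snd g)) *\<^sub>R hA f g)"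
    "hB (\<lambda>g. sin (snd (snd g)) *\<^sub>R f g) = (\<lambda>g. sin (snd (snd g)) *\<^sub>R hB f g)"
    "hB (\<lambda>g. cos (snd (snd g)) *\<^sub>R f g) = (\<lambda>g. cos (snd (snd g)) *\<^sub>R hB f g)"
    "dT (\<lambda>g. sin (snd (snd g)) *\<^sub>R f g) = (\<lambda>g. sin (snd (snd g)) *\<^sub>R dT f g + cos (snd (snd g)) *\<^sub>R f g)"
    "dT (\<lambda>g. cos (snd (snd g)) *\<^sub>R f g) = (\<lambda>g. cos (snd (snd g)) *\<^sub>R dT f g - sin (snd (snd g)) *\<^sub>R f g)"
    "dZ (\<lambda>g. sin (snd (snd g)) *\<^sub>R f g) = (\<lambda>g. sin (snd (snd g)) *\<^sub>R dZ f g)"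
    "dZ (\<lambda>g. cos (snd (snd g)) *\<^sub>R f g) = (\<lambda>g. cos (snd (snd g)) *\<^sub>R dZ f g)"
    by (rule ext; simp add: hA_def hB_def d s c algebra_simps)+
qed

lemma frame_add:
  fixes f g :: "osc \<Rightarrow> 'b::real_normed_vector"
  assumes f: "smooth f" and g: "smooth g"
  shows "hA (\<lambda>x. f x + g x) = (\<lambda>x. hA f x + hA g x)" "hB (\<lambda>x. f x + g x) = (\<lambda>x. hB f x + hB g x)"
    "dird v (\<lambda>x. f x + g x) = (\<lambda>x. dird v f x + dird v g x)"
    "lder V (\<lambda>x. f x + g x) = (\<lambda>x. lder V f x + lder V g x)"
proof -
  show 1: "dird v (\<lambda>x. f x + g x) = (\<lambda>x. dird v f x + dird v g x)" for v
    by (intro ext dird_add smooth_differentiable f g)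
  show "hA (\<lambda>x. f x + g x) = (\<lambda>x. hA f x + hA g x)" "hB (\<lambda>x. f x + g x) = (\<lambda>x. hB f x + hB g x)"
    unfolding hA_def hB_def 1 by (simp_all add: scaleR_add_right algebra_simps)
  show "lder V (\<lambda>x. f x + g x) = (\<lambda>x. lder V f x + lder V g x)"
    by (intro ext) (simp add: lder_eq smooth_add f g 1)
qed

lemma frame_bounded_linear:
  assumes T: "bounded_linear T" and f: "smooth (f :: osc \<Rightarrow> 'b::real_normed_vector)"
  shows "hA (\<lambda>x. T (f x)) = (\<lambda>x. T (hA f x))" "hB (\<lambda>x. T (f x)) = (\<lambda>x. T (hB f x))"
    "dird v (\<lambda>x. T (f x)) = (\<lambda>x. T (dird v f x))" "lder V (\<lambda>x. T (f x)) = (\<lambda>x. T (lder V f x))"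
proof -
  interpret bounded_linear T by (rule T)
  show 1: "dird v (\<lambda>x. T (f x)) = (\<lambda>x. T (dird v f x))" for v
    by (intro ext dird_bounded_linear T smooth_differentiable f)
  show "hA (\<lambda>x. T (f x)) = (\<lambda>x. T (hA f x))" "hB (\<lambda>x. T (f x)) = (\<lambda>x. T (hB f x))"
    unfolding hA_def hB_def 1 by (simp_all add: add scaleR diff)
  show "lder V (\<lambda>x. T (f x)) = (\<lambda>x. T (lder V f x))"
    by (intro ext) (simp add: lder_eq smooth_bounded_linear[OF T] f 1)
qed

text \<open>The only bracket in the Heisenberg frame is \<open>[hA, hB] = dZ\<close>. It comes from the coefficients \<open>- y / 2\<close> and \<open>x / 2\<close>;
everything else is symmetry of second derivatives.\<close>

lemma frame_commute:
  fixes f :: "osc \<Rightarrow> 'b::euclidean_space"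
  assumes f: "smooth f"
  shows "hA (hB f) = (\<lambda>g. hB (hA f) g + dZ f g)"
    and "dZ (hA f) = hA (dZ f)" and "dZ (hB f) = hB (dZ f)"
    and "dT (hA f) = hA (dT f)" and "dT (hB f) = hB (dT f)" and "dT (dZ f) = dZ (dT f)"
proof -
  note sd = smooth_dird[OF f]
  have a: "dird v (hA f) g = dird v (dX f) g + ((- Im (fst g) / 2) *\<^sub>R dird v (dZ f) g + (- Im (fst v) / 2) *\<^sub>R dZ f g)" for v g
  proof -
    have "dird v (hA f) g = dird v (dX f) g + dird v (\<lambda>g. (- Im (fst g) / 2) *\<^sub>R dZ f g) g"
      unfolding hA_def by (intro dird_add smooth_differentiable sd smooth_scaleR smooth_coords)
    also have "dird v (\<lambda>g. (- Im (fst g) / 2) *\<^sub>R dZ f g) g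
        = (- Im (fst g) / 2) *\<^sub>R dird v (dZ f) g + dird v (\<lambda>g. - Im (fst g) / 2) g *\<^sub>R dZ f g"
      by (intro dird_scaleR smooth_differentiable smooth_coords sd)
    also have "dird v (\<lambda>g. - Im (fst g) / 2) g = - Im (fst v) / 2" by (rule dird_linear[OF bl_coords(1)])
    finally show ?thesis .
  qed
  have b: "dird v (hB f) g = dird v (dY f) g + ((Re (fst g) / 2) *\<^sub>R dird v (dZ f) g + (Re (fst v) / 2) *\<^sub>R dZ f g)" for v g
  proof -
    have "dird v (hB f) g = dird v (dY f) g + dird v (\<lambda>g. (Re (fst g) / 2) *\<^sub>R dZ f g) g"
      unfolding hB_def by (intro dird_add smooth_differentiable sd smooth_scaleR smooth_coords)
    also have "dird v (\<lambda>g. (Re (fst g) / 2) *\<^sub>R dZ f g) g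
        = (Re (fst g) / 2) *\<^sub>R dird v (dZ f) g + dird v (\<lambda>g. Re (fst g) / 2) g *\<^sub>R dZ f g"
      by (intro dird_scaleR smooth_differentiable smooth_coords sd)
    also have "dird v (\<lambda>g. Re (fst g) / 2) g = Re (fst v) / 2" by (rule dird_linear[OF bl_coords(2)])
    finally show ?thesis .
  qed
  note s = symmetric_derivatives[OF f]
  show "hA (hB f) = (\<lambda>g. hB (hA f) g + dZ f g)"
    by (rule ext) (simp add: hA_def[of "hB f"] hB_def[of "hA f"] a b s[of "(1,0,0)" "(\<i>,0,0)"] s[of "(0,1,0)" "(\<i>,0,0)"] s[of "(0,1,0)" "(1,0,0)"]
      scaleR_add_right scaleR_diff_right scaleR_left_distrib[symmetric] algebra_simps)
  show "dZ (hA f) = hA (dZ f)" "dZ (hB f) = hB (dZ f)" "dT (hA f) = hA (dT f)" "dT (hB f) = hB (dT f)" "dT (dZ f) = dZ (dT f)"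
    by (rule ext; simp add: a b hA_def[of "dird _ f"] hB_def[of "dird _ f"] s[of "(0,0,1)"] s[of "(0,1,0)" "(\<i>,0,0)"] s[of "(0,1,0)" "(1,0,0)"])+
qed

text \<open>Invariance of trace and antisymmetric part of a bilinear expression under a rotation of the frame.\<close>

lemma rotation_combine:
  fixes c s :: real and a b d e :: "'b::real_vector"
  assumes "c * c + s * s = 1"
  shows "(c *\<^sub>R (c *\<^sub>R a + s *\<^sub>R b) + s *\<^sub>R (c *\<^sub>R d + s *\<^sub>R e))
      + (- s *\<^sub>R (- s *\<^sub>R a + c *\<^sub>R b) + c *\<^sub>R (- s *\<^sub>R d + c *\<^sub>R e)) = a + e"
    and "(c *\<^sub>R (- s *\<^sub>R a + c *\<^sub>R b) + s *\<^sub>R (- s *\<^sub>R d + c *\<^sub>R e))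
      - (- s *\<^sub>R (c *\<^sub>R a + s *\<^sub>R b) + c *\<^sub>R (c *\<^sub>R d + s *\<^sub>R e)) = b - d"
proof -
  have "(c *\<^sub>R (c *\<^sub>R a + s *\<^sub>R b) + s *\<^sub>R (c *\<^sub>R d + s *\<^sub>R e))
      + (- s *\<^sub>R (- s *\<^sub>R a + c *\<^sub>R b) + c *\<^sub>R (- s *\<^sub>R d + c *\<^sub>R e))
      = (c * c + s * s) *\<^sub>R a + (c * c + s * s) *\<^sub>R e" by (simp add: algebra_simps)
  then show "(c *\<^sub>R (c *\<^sub>R a + s *\<^sub>R b) + s *\<^sub>R (c *\<^sub>R d + s *\<^sub>R e))
      + (- s *\<^sub>R (- s *\<^sub>R a + c *\<^sub>R b) + c *\<^sub>R (- s *\<^sub>R d + c *\<^sub>R e)) = a + e"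
    by (simp only: assms scaleR_one)
  have "(c *\<^sub>R (- s *\<^sub>R a + c *\<^sub>R b) + s *\<^sub>R (- s *\<^sub>R d + c *\<^sub>R e))
      - (- s *\<^sub>R (c *\<^sub>R a + s *\<^sub>R b) + c *\<^sub>R (c *\<^sub>R d + s *\<^sub>R e))
      = (c * c + s * s) *\<^sub>R b - (c * c + s * s) *\<^sub>R d" by (simp add: algebra_simps)
  then show "(c *\<^sub>R (- s *\<^sub>R a + c *\<^sub>R b) + s *\<^sub>R (- s *\<^sub>R d + c *\<^sub>R e))
      - (- s *\<^sub>R (c *\<^sub>R a + s *\<^sub>R b) + c *\<^sub>R (c *\<^sub>R d + s *\<^sub>R e)) = b - d"
    by (simp only: assms scaleR_one)
qed

text \<open>Rotating the frame does not change \<open>X\<^sup>2 + Y\<^sup>2\<close>, so the dependence on the angle \<open>t\<close> disappears.\<close>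

lemma casimir_eq:
  assumes f: "smooth \<psi>"
  shows "casimir \<psi> g = hA (hA \<psi>) g + hB (hB \<psi>) g + 2 *\<^sub>R dZ (dT \<psi>) g"
proof -
  note sm = smooth_add smooth_scaleR smooth_minus smooth_coords smooth_hA smooth_hB smooth_dird f
  let ?c = "cos (snd (snd g))" and ?s = "sin (snd (snd g))"
  have neg: "hA (\<lambda>g. - sin (snd (snd g)) *\<^sub>R h g) = (\<lambda>g. - sin (snd (snd g)) *\<^sub>R hA h g)"
    "hB (\<lambda>g. - sin (snd (snd g)) *\<^sub>R h g) = (\<lambda>g. - sin (snd (snd g)) *\<^sub>R hB h g)" if "smooth h" for h :: "osc \<Rightarrow> complex^4"
    using frame_bounded_linear[OF bounded_linear_minus[OF bounded_linear_ident] smooth_scaleR[OF smooth_coords(3) that]]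
    by (simp_all add: frame_trig[OF that])
  have X: "lder vX (lder vX \<psi>) g = ?c *\<^sub>R (?c *\<^sub>R hA (hA \<psi>) g + ?s *\<^sub>R hA (hB \<psi>) g) + ?s *\<^sub>R (?c *\<^sub>R hB (hA \<psi>) g + ?s *\<^sub>R hB (hB \<psi>) g)"
    unfolding lder_basis(1)[OF f]
    by (subst lder_basis(1)) (intro sm, simp add: frame_add frame_trig sm)
  have Y: "lder vY (lder vY \<psi>) g = - ?s *\<^sub>R (- ?s *\<^sub>R hA (hA \<psi>) g + ?c *\<^sub>R hA (hB \<psi>) g) + ?c *\<^sub>R (- ?s *\<^sub>R hB (hA \<psi>) g + ?c *\<^sub>R hB (hB \<psi>) g)"
    unfolding lder_basis(2)[OF f]
    by (subst lder_basis(2)) (intro sm, simp add: frame_add frame_trig neg sm del: scaleR_minus_left)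
  have "?c * ?c + ?s * ?s = 1" by (metis power2_eq_square sin_cos_squared_add2)
  then have "lder vX (lder vX \<psi>) g + lder vY (lder vY \<psi>) g = hA (hA \<psi>) g + hB (hB \<psi>) g"
    unfolding X Y by (rule rotation_combine)
  then show ?thesis
    by (simp add: casimir_def basis_deriv_lder lder_basis(4)[OF f] lder_basis(3)[OF smooth_dird[OF f]])
qed

lemma lie_brackets:
  fixes f :: "osc \<Rightarrow> 'b::euclidean_space"
  assumes f: "smooth f"
  shows "lder vX (lder vY f) g = lder vY (lder vX f) g + lder vZ f g"
    and "lder vT (lder vX f) g = lder vX (lder vT f) g + lder vY f g"
    and "lder vT (lder vY f) g = lder vY (lder vT f) g - lder vX f g"
    and "lder vX (lder vZ f) g = lder vZ (lder vX f) g"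
    and "lder vY (lder vZ f) g = lder vZ (lder vY f) g"
    and "lder vT (lder vZ f) g = lder vZ (lder vT f) g"
proof -
  note sm = smooth_add smooth_scaleR smooth_minus smooth_coords smooth_hA smooth_hB smooth_dird f
  let ?c = "cos (snd (snd g))" and ?s = "sin (snd (snd g))"
  have neg: "hA (\<lambda>g. - sin (snd (snd g)) *\<^sub>R h g) = (\<lambda>g. - sin (snd (snd g)) *\<^sub>R hA h g)"
    "hB (\<lambda>g. - sin (snd (snd g)) *\<^sub>R h g) = (\<lambda>g. - sin (snd (snd g)) *\<^sub>R hB h g)"
    "dZ (\<lambda>g. - sin (snd (snd g)) *\<^sub>R h g) = (\<lambda>g. - sin (snd (snd g)) *\<^sub>R dZ h g)"
    "dT (\<lambda>g. - sin (snd (snd g)) *\<^sub>R h g) = (\<lambda>g. - sin (snd (snd g)) *\<^sub>R dT h g - cos (snd (snd g)) *\<^sub>R h g)"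
    if "smooth h" for h :: "osc \<Rightarrow> 'b"
    using frame_bounded_linear[OF bounded_linear_minus[OF bounded_linear_ident] smooth_scaleR[OF smooth_coords(3) that]]
    by (simp_all add: frame_trig[OF that])
  have XY: "lder vX (lder vY f) g = ?c *\<^sub>R (- ?s *\<^sub>R hA (hA f) g + ?c *\<^sub>R hA (hB f) g) + ?s *\<^sub>R (- ?s *\<^sub>R hB (hA f) g + ?c *\<^sub>R hB (hB f) g)"
    unfolding lder_basis(2)[OF f]
    by (subst lder_basis(1)) (intro sm, simp add: frame_add frame_trig neg sm del: scaleR_minus_left)
  have YX: "lder vY (lder vX f) g = - ?s *\<^sub>R (?c *\<^sub>R hA (hA f) g + ?s *\<^sub>R hA (hB f) g) + ?c *\<^sub>R (?c *\<^sub>R hB (hA f) g + ?s *\<^sub>R hB (hB f) g)"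
    unfolding lder_basis(1)[OF f]
    by (subst lder_basis(2)) (intro sm, simp add: frame_add frame_trig sm)
  have "?c * ?c + ?s * ?s = 1" by (metis power2_eq_square sin_cos_squared_add2)
  then have "lder vX (lder vY f) g - lder vY (lder vX f) g = hA (hB f) g - hB (hA f) g"
    unfolding XY YX by (rule rotation_combine)
  then show "lder vX (lder vY f) g = lder vY (lder vX f) g + lder vZ f g"
    by (simp add: frame_commute(1)[OF f] lder_basis(3)[OF f] algebra_simps)
  note V = smooth_lder[OF f, of vX, simplified] smooth_lder[OF f, of vY, simplified]
    smooth_dird[OF f, of "(0, 1, 0)"] smooth_dird[OF f, of "(0, 0, 1)"]
  note L = lder_basis
  show "lder vT (lder vX f) g = lder vX (lder vT f) g + lder vY f g"
    unfolding L(4)[OF V(1)] unfolding L(1,2,4)[OF f] L(1)[OF V(4)]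
    by (simp add: frame_add frame_trig frame_commute[OF f] sm)
  show "lder vT (lder vY f) g = lder vY (lder vT f) g - lder vX f g"
    unfolding L(4)[OF V(2)] unfolding L(1,2,4)[OF f] L(2)[OF V(4)]
    by (simp add: frame_add frame_trig neg frame_commute[OF f] sm del: scaleR_minus_left)
  show "lder vX (lder vZ f) g = lder vZ (lder vX f) g"
    unfolding L(3)[OF V(1)] unfolding L(1,3)[OF f] L(1)[OF V(3)]
    by (simp add: frame_add frame_trig frame_commute[OF f] sm)
  show "lder vY (lder vZ f) g = lder vZ (lder vY f) g"
    unfolding L(3)[OF V(2)] unfolding L(2,3)[OF f] L(2)[OF V(3)]
    by (simp add: frame_add frame_trig neg frame_commute[OF f] sm del: scaleR_minus_left)
  show "lder vT (lder vZ f) g = lder vZ (lder vT f) g"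
    unfolding L(3,4)[OF f] L(3)[OF V(4)] L(4)[OF V(3)] by (simp add: frame_commute[OF f])
qed

text \<open>Polarising the Clifford relation gives the anticommutators of Clifford multiplication by \<open>X, Y, Z, T\<close>: only \<open>X\<close>, \<open>X\<close> and \<open>Y\<close>, \<open>Y\<close>
and \<open>Z\<close>, \<open>T\<close> have nonzero product. Expanding the square, the mixed second-order terms combine to Lie
brackets, and the resulting first-order terms are cancelled by the anticommutators with the cubic
term, whose own square vanishes because \<open>Z\<close> is a null vector.\<close>

lemma cubic_dirac_square:
  fixes cl :: "osc \<Rightarrow> complex ^ 4 ^ 4"
  assumes cl: "clifford_module cl" and \<psi>: "smooth \<psi>"
  shows "cubic_dirac cl (cubic_dirac cl \<psi>) g = - casimir \<psi> g"
proof -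
  define M where "M v w = cl v *v w" for v w
  have lin: "linear cl" and sq: "cl v ** cl v = mat (- complex_of_real (osc_metric v v))" for v
    using cl unfolding clifford_module_def by blast+
  have M_lin: "linear (M v)" for v
    by (rule linearI) (auto simp: M_def matrix_vector_mult_def vec_eq_iff sum.distrib scaleR_sum_right algebra_simps)
  note M_simps = linear_add[OF M_lin] linear_cmul[OF M_lin] linear_neg[OF M_lin] linear_0[OF M_lin] linear_diff[OF M_lin]
  have M_bl: "bounded_linear (M v)" for v using M_lin by (simp add: linear_conv_bounded_linear)
  have M_add: "M (u + v) w = M u w + M v w" for u v w
    by (simp add: M_def linear_add[OF lin] matrix_vector_mult_add_rdistrib)
  have M_sq: "M v (M v w) = - (osc_metric v v *\<^sub>R w)" for v w
    by (simp add: M_def matrix_vector_mul_assoc sq)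
      (simp add: matrix_vector_mult_def mat_def vec_eq_iff if_distrib[of "\<lambda>a. a * _"] scaleR_conv_of_real[where 'a=complex] cong: if_cong)
  have anti: "M u (M v w) = - M v (M u w) - (osc_metric (u + v) (u + v) - osc_metric u u - osc_metric v v) *\<^sub>R w" for u v w
  proof -
    have "M (u + v) (M (u + v) w) = M u (M u w) + M v (M v w) + M u (M v w) + M v (M u w)"
      by (simp add: M_add M_simps)
    then show ?thesis unfolding M_sq by (simp add: algebra_simps)
  qed
  have rel: "M vX (M vX w) = - w" "M vY (M vY w) = - w" "M vZ (M vZ w) = 0" "M vT (M vT w) = 0"
    "M vY (M vX w) = - M vX (M vY w)" "M vZ (M vX w) = - M vX (M vZ w)" "M vT (M vX w) = - M vX (M vT w)"
    "M vZ (M vY w) = - M vY (M vZ w)" "M vT (M vY w) = - M vY (M vT w)" "M vT (M vZ w) = - M vZ (M vT w) - 2 *\<^sub>R w" for w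
    using M_sq[of vX] M_sq[of vY] M_sq[of vZ] M_sq[of vT] anti[of vY vX] anti[of vZ vX] anti[of vT vX]
      anti[of vZ vY] anti[of vT vY] anti[of vT vZ]
    by (simp_all add: vX_def vY_def vZ_def vT_def)
  have D: "cubic_dirac cl \<phi> = (\<lambda>g. M vX (lder vX \<phi> g) + M vY (lder vY \<phi> g) + M vZ (lder vT \<phi> g) + M vT (lder vZ \<phi> g)
      + (1 / 2) *\<^sub>R M vX (M vY (M vZ (\<phi> g))))" for \<phi>
    by (simp add: fun_eq_iff cubic_dirac_def basis_deriv_lder M_def matrix_vector_mul_assoc matrix_mul_assoc)
  have sl: "smooth (lder vX \<psi>)" "smooth (lder vY \<psi>)" "smooth (lder vZ \<psi>)" "smooth (lder vT \<psi>)"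
    by (intro smooth_lder \<psi>; simp)+
  have XYZ: "bounded_linear (\<lambda>w. (1 / 2) *\<^sub>R M vX (M vY (M vZ w)))"
    by (intro bounded_linear_const_scaleR bounded_linear_compose[OF M_bl] M_bl)
  have sm: "smooth (\<lambda>g. M v (f g))" if "smooth f" for v and f :: "osc \<Rightarrow> complex ^ 4"
    by (rule smooth_bounded_linear[OF M_bl that])
  have ld: "lder V (cubic_dirac cl \<psi>) g = M vX (lder V (lder vX \<psi>) g) + M vY (lder V (lder vY \<psi>) g) + M vZ (lder V (lder vT \<psi>) g)
      + M vT (lder V (lder vZ \<psi>) g) + (1 / 2) *\<^sub>R M vX (M vY (M vZ (lder V \<psi> g)))" for V
    unfolding D
    using sl \<psi> smooth_bounded_linear[OF XYZ \<psi>] frame_bounded_linear(4)[OF XYZ \<psi>]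
    by (simp add: frame_add(4) frame_bounded_linear(4)[OF M_bl] sm smooth_add)
  have "cubic_dirac cl (cubic_dirac cl \<psi>) g =
      M vX (lder vX (cubic_dirac cl \<psi>) g) + M vY (lder vY (cubic_dirac cl \<psi>) g)
      + M vZ (lder vT (cubic_dirac cl \<psi>) g) + M vT (lder vZ (cubic_dirac cl \<psi>) g)
      + (1 / 2) *\<^sub>R M vX (M vY (M vZ (cubic_dirac cl \<psi> g)))"
    by (subst D) simp
  also have "\<dots> = - (lder vX (lder vX \<psi>) g + lder vY (lder vY \<psi>) g + 2 *\<^sub>R lder vZ (lder vT \<psi>) g)"
    unfolding ld unfolding D by (simp add: M_simps rel lie_brackets[OF \<psi>] scaleR_add_right scaleR_diff_right)
  finally show ?thesis by (simp add: casimir_def basis_deriv_lder)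
qed

section \<open>Coordinates adapted to the lattice\<close>

text \<open>Bochner integrals are controlled by nonnegative integrals: if all nonnegative functions of \<open>f\<close> and \<open>g\<close> have the
same integral, then \<open>f\<close> and \<open>g\<close> have the same distribution. This allows all changes of variables below to be done for
nonnegative functions, where no integrability has to be checked.\<close>

lemma integral_transfer:
  fixes f :: "'a \<Rightarrow> 'c::{banach, second_countable_topology}" and g :: "'b \<Rightarrow> 'c"
  assumes [measurable]: "f \<in> borel_measurable M" "g \<in> borel_measurable N"
    and eq: "\<And>\<theta> :: 'c \<Rightarrow> ennreal. \<theta> \<in> borel_measurable borel \<Longrightarrow> (\<integral>\<^sup>+x. \<theta> (f x) \<partial>M) = (\<integral>\<^sup>+x. \<theta> (g x) \<partial>N)"
  shows "integrable M f \<longleftrightarrow> integrable N g" and "integral\<^sup>L M f = integral\<^sup>L N g"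
proof -
  have "distr M borel f = distr N borel g"
  proof (rule measure_eqI)
    fix A assume "A \<in> sets (distr M borel f)"
    then have [measurable]: "A \<in> sets borel" by simp
    have "emeasure (distr M borel f) A = (\<integral>\<^sup>+x. indicator A x \<partial>distr M borel f)" by simp
    also have "\<dots> = (\<integral>\<^sup>+x. indicator A (f x) \<partial>M)" by (rule nn_integral_distr) auto
    also have "\<dots> = (\<integral>\<^sup>+x. indicator A (g x) \<partial>N)" by (rule eq) simp
    also have "\<dots> = (\<integral>\<^sup>+x. indicator A x \<partial>distr N borel g)" by (rule nn_integral_distr[symmetric]) auto
    also have "\<dots> = emeasure (distr N borel g) A" by simp
    finally show "emeasure (distr M borel f) A = emeasure (distr N borel g) A" .
  qed simp
  note eq = this
  have "integrable M f \<longleftrightarrow> integrable (distr M borel f) (\<lambda>x. x)"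
    by (rule integrable_distr_eq[symmetric]) auto
  also have "\<dots> \<longleftrightarrow> integrable N g"
    unfolding eq by (rule integrable_distr_eq) auto
  finally show "integrable M f \<longleftrightarrow> integrable N g" .
  have "integral\<^sup>L M f = integral\<^sup>L (distr M borel f) (\<lambda>x. x)"
    by (rule integral_distr[symmetric]) auto
  also have "\<dots> = integral\<^sup>L N g"
    unfolding eq by (rule integral_distr) auto
  finally show "integral\<^sup>L M f = integral\<^sup>L N g" .
qed

lemma nn_integral_shift:
  fixes f :: "real \<Rightarrow> ennreal" assumes "f \<in> borel_measurable borel"
  shows "(\<integral>\<^sup>+x. f (x + c) \<partial>lborel) = (\<integral>\<^sup>+x. f x \<partial>lborel)"
  using nn_integral_real_affine[OF assms, of 1 c] by (simp add: add.commute)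

lemma nn_integral_periodic:
  fixes f :: "real \<Rightarrow> ennreal"
  assumes [measurable]: "f \<in> borel_measurable borel" and P: "P > 0" and per: "\<And>x. f (x + P) = f x"
  shows "(\<integral>\<^sup>+x\<in>{a..<a + P}. f x \<partial>lborel) = (\<integral>\<^sup>+x\<in>{0..<P}. f x \<partial>lborel)"
proof -
  have pern: "f (x + real n * P) = f x" for x n
  proof (induction n)
    case (Suc n)
    have "f (x + real (Suc n) * P) = f ((x + real n * P) + P)" by (simp add: algebra_simps)
    then show ?case using Suc per by simp
  qed simp
  have peri: "f (x + of_int n * P) = f x" for x and n :: int
  proof (cases "n \<ge> 0")
    case True
    then show ?thesis using pern[of x "nat n"] by simp
  next
    case False
    then show ?thesis using pern[of "x + of_int n * P" "nat (- n)"] by simp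
  qed
  define n where "n = \<lfloor>a / P\<rfloor>"
  define s where "s = a - of_int n * P"
  have "of_int n \<le> a / P" "a / P < of_int n + 1" unfolding n_def by linarith+
  then have s: "0 \<le> s" "s < P" using P by (auto simp: s_def field_simps)
  have "(\<integral>\<^sup>+x\<in>{a..<a + P}. f x \<partial>lborel) = (\<integral>\<^sup>+x. f (x + of_int n * P) * indicator {a..<a + P} (x + of_int n * P) \<partial>lborel)"
    by (rule nn_integral_shift[symmetric]) simp
  also have "\<dots> = (\<integral>\<^sup>+x. f x * indicator {s..<P} x + f x * indicator {P..<P + s} x \<partial>lborel)"
    by (intro nn_integral_cong) (use s in \<open>auto simp: peri s_def indicator_def\<close>)
  also have "\<dots> = (\<integral>\<^sup>+x\<in>{s..<P}. f x \<partial>lborel) + (\<integral>\<^sup>+x\<in>{P..<P + s}. f x \<partial>lborel)"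
    by (rule nn_integral_add) auto
  also have "(\<integral>\<^sup>+x\<in>{P..<P + s}. f x \<partial>lborel) = (\<integral>\<^sup>+x. f (x + P) * indicator {P..<P + s} (x + P) \<partial>lborel)"
    by (rule nn_integral_shift[symmetric]) simp
  also have "\<dots> = (\<integral>\<^sup>+x\<in>{0..<s}. f x \<partial>lborel)"
    by (intro nn_integral_cong) (auto simp: per indicator_def)
  also have "(\<integral>\<^sup>+x\<in>{s..<P}. f x \<partial>lborel) + (\<integral>\<^sup>+x\<in>{0..<s}. f x \<partial>lborel) =
      (\<integral>\<^sup>+x. f x * indicator {s..<P} x + f x * indicator {0..<s} x \<partial>lborel)"
    by (rule nn_integral_add[symmetric]) auto
  also have "\<dots> = (\<integral>\<^sup>+x\<in>{0..<P}. f x \<partial>lborel)"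
    by (intro nn_integral_cong) (use s in \<open>auto simp: indicator_def\<close>)
  finally show ?thesis .
qed

lemma nn_integral_periodic_shift:
  fixes f :: "real \<Rightarrow> ennreal"
  assumes [measurable]: "f \<in> borel_measurable borel" and P: "P > 0" and per: "\<And>x. f (x + P) = f x"
  shows "(\<integral>\<^sup>+x\<in>{0..<P}. f (x + c) \<partial>lborel) = (\<integral>\<^sup>+x\<in>{0..<P}. f x \<partial>lborel)"
proof -
  have "(\<integral>\<^sup>+x\<in>{0..<P}. f (x + c) \<partial>lborel) = (\<integral>\<^sup>+x. f (x + c) * indicator {c..<c + P} (x + c) \<partial>lborel)"
    by (intro nn_integral_cong) (auto simp: indicator_def)
  also have "\<dots> = (\<integral>\<^sup>+x\<in>{c..<c + P}. f x \<partial>lborel)" by (rule nn_integral_shift) simp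
  also have "\<dots> = (\<integral>\<^sup>+x\<in>{0..<P}. f x \<partial>lborel)" by (rule nn_integral_periodic) (use assms in auto)
  finally show ?thesis .
qed

text \<open>Coordinates in which the lattice acts almost by translations. The term \<open>x * y / 2\<close> makes the action of \<open>l1\<close> a pure
translation of \<open>x\<close>; the twist of the group law is left in the action of \<open>l2\<close> only.\<close>

definition Phi :: "real \<Rightarrow> real \<Rightarrow> real \<Rightarrow> real \<Rightarrow> osc" where
  "Phi t y x w = (Complex x y, w + x * y / 2, t)"

lemma measurable_Phi [measurable (raw)]:
  assumes [measurable]: "t \<in> borel_measurable M" "y \<in> borel_measurable M" "x \<in> borel_measurable M" "w \<in> borel_measurable M"
  shows "(\<lambda>p. Phi (t p) (y p) (x p) (w p)) \<in> M \<rightarrow>\<^sub>M borel"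
proof -
  have "(\<lambda>p. (of_real (x p) + \<i> * of_real (y p), w p + x p * y p / 2, t p)) \<in> M \<rightarrow>\<^sub>M borel \<Otimes>\<^sub>M (borel \<Otimes>\<^sub>M borel)"
    by measurable
  then show ?thesis by (simp add: Phi_def Complex_eq borel_prod)
qed

lemma lborel_complex: "distr (lborel \<Otimes>\<^sub>M lborel) borel (\<lambda>(x, y). Complex x y) = lborel"
proof (rule lborel_eqI[symmetric])
  have m[measurable]: "(\<lambda>(x, y). Complex x y) \<in> (lborel \<Otimes>\<^sub>M lborel) \<rightarrow>\<^sub>M borel"
    unfolding Complex_eq by measurable
  fix l u :: complex assume le: "\<And>b. b \<in> Basis \<Longrightarrow> l \<bullet> b \<le> u \<bullet> b"
  have le: "Re l \<le> Re u" "Im l \<le> Im u" using le[of 1] le[of \<i>] by (auto simp: Basis_complex_def)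
  have "(\<lambda>(x, y). Complex x y) -` box l u = {Re l<..<Re u} \<times> {Im l<..<Im u}"
    by (auto simp: box_def Basis_complex_def)
  then have "emeasure (distr (lborel \<Otimes>\<^sub>M lborel) borel (\<lambda>(x, y). Complex x y)) (box l u)
    = emeasure (lborel \<Otimes>\<^sub>M lborel) ({Re l<..<Re u} \<times> {Im l<..<Im u})"
    by (subst emeasure_distr[OF m]) (auto simp: space_pair_measure)
  also have "\<dots> = ennreal (Re u - Re l) * ennreal (Im u - Im l)"
    using le by (subst lborel.emeasure_pair_measure_Times) auto
  also have "\<dots> = (\<Prod>b\<in>Basis. (u - l) \<bullet> b)"
    using le by (simp add: Basis_complex_def ennreal_mult[symmetric])
  finally show "emeasure (distr (lborel \<Otimes>\<^sub>M lborel) borel (\<lambda>(x, y). Complex x y)) (box l u) = (\<Prod>b\<in>Basis. (u - l) \<bullet> b)" .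
qed simp

lemma nn_integral_prod_lborel:
  fixes f :: "'a::euclidean_space \<times> 'b::euclidean_space \<Rightarrow> ennreal"
  assumes "f \<in> borel_measurable borel"
  shows "(\<integral>\<^sup>+v. f v \<partial>lborel) = (\<integral>\<^sup>+x. \<integral>\<^sup>+y. f (x, y) \<partial>lborel \<partial>lborel)"
  using lborel.nn_integral_fst[of f "lborel :: 'a measure"] assms by (simp add: lborel_prod)

lemma nn_integral_complex:
  assumes [measurable]: "f \<in> borel_measurable borel"
  shows "(\<integral>\<^sup>+z. f z \<partial>lborel) = (\<integral>\<^sup>+x. \<integral>\<^sup>+y. f (Complex x y) \<partial>lborel \<partial>lborel)"
proof -
  have m[measurable]: "(\<lambda>(x, y). Complex x y) \<in> (lborel \<Otimes>\<^sub>M lborel) \<rightarrow>\<^sub>M borel"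
    unfolding Complex_eq by measurable
  have "(\<integral>\<^sup>+z. f z \<partial>lborel) = (\<integral>\<^sup>+p. f (case p of (x, y) \<Rightarrow> Complex x y) \<partial>(lborel \<Otimes>\<^sub>M lborel))"
    by (subst lborel_complex[symmetric]) (rule nn_integral_distr, auto)
  also have "\<dots> = (\<integral>\<^sup>+x. \<integral>\<^sup>+y. f (case (x, y) of (x, y) \<Rightarrow> Complex x y) \<partial>lborel \<partial>lborel)"
    by (rule lborel.nn_integral_fst[symmetric]) measurable
  finally show ?thesis by simp
qed

text \<open>\<open>Phi\<close> is a shear followed by a permutation of coordinates, so it preserves Lebesgue measure.\<close>

lemma nn_integral_Phi:
  assumes [measurable]: "f \<in> borel_measurable borel"
  shows "(\<integral>\<^sup>+g. f g \<partial>lborel) = (\<integral>\<^sup>+t. \<integral>\<^sup>+y. \<integral>\<^sup>+x. \<integral>\<^sup>+w. f (Phi t y x w) \<partial>lborel \<partial>lborel \<partial>lborel \<partial>lborel)"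
proof -
  have [measurable]: "(\<lambda>p. (Complex (x p) (y p), z p, t p)) \<in> M \<rightarrow>\<^sub>M borel"
    if [measurable]: "x \<in> borel_measurable M" "y \<in> borel_measurable M" "z \<in> borel_measurable M" "t \<in> borel_measurable M" for M :: "'z measure" and x y z t :: "'z \<Rightarrow> real"
  proof -
    have "(\<lambda>p. Phi (t p) (y p) (x p) (z p - x p * y p / 2)) \<in> M \<rightarrow>\<^sub>M borel" by measurable
    then show ?thesis by (simp add: Phi_def)
  qed
  have c: "(\<lambda>\<xi>. \<integral>\<^sup>+q. f (\<xi>, q) \<partial>lborel) \<in> borel_measurable borel"
    using lborel.borel_measurable_nn_integral_fst[of f "lborel :: complex measure"] by (simp add: lborel_prod)
  have d: "(\<integral>\<^sup>+q. f (\<xi>, q) \<partial>lborel) = (\<integral>\<^sup>+z. \<integral>\<^sup>+t. f (\<xi>, z, t) \<partial>lborel \<partial>lborel)" for \<xi>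
  proof (rule nn_integral_prod_lborel)
    have "(\<lambda>q. f (\<xi>, q)) \<in> borel_measurable (borel \<Otimes>\<^sub>M borel)" unfolding borel_prod
      by (rule measurable_compose[OF _ assms]) (intro borel_measurable_continuous_onI continuous_intros)
    then show "(\<lambda>q. f (\<xi>, q)) \<in> borel_measurable borel" by (simp add: borel_prod)
  qed
  have "(\<integral>\<^sup>+g. f g \<partial>lborel) = (\<integral>\<^sup>+\<xi>. \<integral>\<^sup>+q. f (\<xi>, q) \<partial>lborel \<partial>lborel)"
    by (rule nn_integral_prod_lborel) simp
  also have "\<dots> = (\<integral>\<^sup>+x. \<integral>\<^sup>+y. \<integral>\<^sup>+z. \<integral>\<^sup>+t. f (Complex x y, z, t) \<partial>lborel \<partial>lborel \<partial>lborel \<partial>lborel)"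
    using nn_integral_complex[OF c] by (simp only: d)
  also have "\<dots> = (\<integral>\<^sup>+x. \<integral>\<^sup>+y. \<integral>\<^sup>+t. \<integral>\<^sup>+z. f (Complex x y, z, t) \<partial>lborel \<partial>lborel \<partial>lborel \<partial>lborel)"
    by (intro nn_integral_cong lborel_pair.Fubini') measurable
  also have "\<dots> = (\<integral>\<^sup>+x. \<integral>\<^sup>+t. \<integral>\<^sup>+y. \<integral>\<^sup>+z. f (Complex x y, z, t) \<partial>lborel \<partial>lborel \<partial>lborel \<partial>lborel)"
    by (intro nn_integral_cong lborel_pair.Fubini') measurable
  also have "\<dots> = (\<integral>\<^sup>+t. \<integral>\<^sup>+x. \<integral>\<^sup>+y. \<integral>\<^sup>+z. f (Complex x y, z, t) \<partial>lborel \<partial>lborel \<partial>lborel \<partial>lborel)"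
    by (intro lborel_pair.Fubini') measurable
  also have "\<dots> = (\<integral>\<^sup>+t. \<integral>\<^sup>+y. \<integral>\<^sup>+x. \<integral>\<^sup>+z. f (Complex x y, z, t) \<partial>lborel \<partial>lborel \<partial>lborel \<partial>lborel)"
    by (intro nn_integral_cong lborel_pair.Fubini') measurable
  also have "\<dots> = (\<integral>\<^sup>+t. \<integral>\<^sup>+y. \<integral>\<^sup>+x. \<integral>\<^sup>+w. f (Complex x y, w + x * y / 2, t) \<partial>lborel \<partial>lborel \<partial>lborel \<partial>lborel)"
    by (intro nn_integral_cong nn_integral_shift[symmetric]) measurable
  finally show ?thesis by (simp add: Phi_def)
qed

lemma nn_integral_4:
  fixes f :: "real \<times> real \<times> real \<times> real \<Rightarrow> ennreal"
  assumes [measurable]: "f \<in> borel_measurable borel"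
  shows "(\<integral>\<^sup>+v. f v \<partial>lborel) = (\<integral>\<^sup>+t. \<integral>\<^sup>+y. \<integral>\<^sup>+x. \<integral>\<^sup>+w. f (t, y, x, w) \<partial>lborel \<partial>lborel \<partial>lborel \<partial>lborel)"
proof -
  have m: "(\<lambda>q. f (t, q)) \<in> borel_measurable borel" "(\<lambda>q. f (t, y, q)) \<in> borel_measurable borel" for t y
    by (rule measurable_compose[OF _ assms], intro borel_measurable_continuous_onI continuous_intros)+
  show ?thesis
    by (simp add: nn_integral_prod_lborel[OF assms] nn_integral_prod_lborel[OF m(1)] nn_integral_prod_lborel[OF m(2)])
qed

locale osc_quotient =
  fixes r \<kappa> :: nat and \<mu> \<nu> :: real
  assumes r: "r > 0" and \<kappa>: "\<kappa> > 0" and \<nu>: "\<nu> > 0"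
begin

abbreviation "L \<equiv> osc_lattice r \<kappa> \<mu> \<nu>"
abbreviation "F \<equiv> fund_domain r \<kappa> \<mu> \<nu>"
abbreviation "lat \<equiv> lat_elt r \<kappa> \<mu> \<nu>"
abbreviation "pt \<equiv> 2 * pi * real \<kappa>"
abbreviation "py \<equiv> sqrt \<nu>"
abbreviation "px \<equiv> 1 / sqrt \<nu>"
abbreviation "pw \<equiv> 1 / real r"

lemma periods_pos: "pt > 0" "py > 0" "px > 0" "pw > 0"
  using r \<kappa> \<nu> by auto

text \<open>The element \<open>lat m n p q\<close> is \<open>l1^m l2^n l3^p l4^q\<close>. All but the exponent \<open>n\<close> act by translations with periods
\<open>px\<close>, \<open>pw\<close>, \<open>pt\<close>.\<close>

lemma lat_Phi: "osc_mult (lat m n p q) (Phi t y x w) =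
    Phi (t + pt * of_int q) (y + of_int n * py) (x + (of_int m - \<mu> * of_int n) * px)
      (w + of_int p * pw - of_int n * py * x + \<mu> * (of_int n)\<^sup>2 / 2)"
proof -
  define A B where "A = (of_int m - \<mu> * of_int n) / py" and "B = of_int n * py"
  have AB: "A * B = of_int m * of_int n - \<mu> * (of_int n)\<^sup>2"
  proof -
    have "A * B = (of_int m - \<mu> * of_int n) * of_int n" using \<nu> by (simp add: A_def B_def)
    then show ?thesis by (simp add: power2_eq_square left_diff_distrib)
  qed
  have "(x + A) * (y + B) = x * y + B * x + A * y + A * B" by (simp add: algebra_simps)
  then have z: "w + x * y / 2 + of_int (m * n) / 2 + of_int p / real r + (A * y - B * x) / 2
      = (w + of_int p * pw - B * x + \<mu> * (of_int n)\<^sup>2 / 2) + (x + A) * (y + B) / 2"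
    unfolding AB by (simp add: field_simps)
  have A: "(of_int m - \<mu> * of_int n) * px = A" by (simp add: A_def)
  have t: "t + 2 * pi * real \<kappa> * of_int q = t + pt * of_int q" ..
  show ?thesis
    unfolding Phi_def osc_mult_lat_elt[OF \<nu>] complex.sel A A_def[symmetric] B_def[symmetric] z
    by (simp add: complex_eq_iff)
qed

lemma lat_in_L: "lat m n p q \<in> L"
  unfolding osc_lattice_eq[OF \<nu> r] by blast

text \<open>Right multiplication translates \<open>t\<close>, translates \<open>(x, y)\<close> by an amount that depends on \<open>t\<close>, and translates \<open>w\<close> by
an amount that depends on \<open>t\<close> and \<open>y\<close>. Integrating in the order \<open>w, x, y, t\<close> these are all translations.\<close>

lemma Phi_right_mult: "osc_mult (Phi t y x w) (\<eta>, z, t') =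
    Phi (t + t') (y + Im (cis t * \<eta>)) (x + Re (cis t * \<eta>))
      (w + (z - Re (cis t * \<eta>) * y - Re (cis t * \<eta>) * Im (cis t * \<eta>) / 2))"
proof -
  obtain p q where pq: "cis t * \<eta> = Complex p q" by (metis complex_surj)
  show ?thesis unfolding Phi_def osc_mult.simps pq osc_omega_def
    by (simp add: complex_eq_iff) (simp add: field_simps)
qed

text \<open>A fundamental box for the subgroup generated by \<open>l1\<close>, \<open>l3\<close>, \<open>l4\<close>, with \<open>y\<close> in the \<open>n\<close>-th translate of a period of \<open>l2\<close>.\<close>

definition box :: "int \<Rightarrow> (real \<times> real \<times> real \<times> real) set" where
  "box n = {0..<pt} \<times> {of_int n * py..<(of_int n + 1) * py} \<times> {0..<px} \<times> {0..<pw}"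

abbreviation "MF \<equiv> restrict_space lborel F"
abbreviation "MB n \<equiv> restrict_space lborel (box n)"

lemma sets_F [measurable]: "F \<in> sets borel"
  by (rule fundamental_domain_osc_lattice(1)[OF \<nu> r \<kappa>])

lemma sets_box [measurable]: "box n \<in> sets borel"
  unfolding box_def borel_prod[symmetric] by (intro pair_measureI) simp_all

lemma nn_MF: "f \<in> borel_measurable borel \<Longrightarrow> (\<integral>\<^sup>+g. f g \<partial>MF) = (\<integral>\<^sup>+g. f g * indicator F g \<partial>lborel)"
  by (rule nn_integral_restrict_space) simp

text \<open>With \<open>w\<close> innermost, the amount by which a lattice element shifts a variable depends on outer variables only.\<close>

lemma nn_MB: 
  assumes [measurable]: "f \<in> borel_measurable borel"
  shows "(\<integral>\<^sup>+v. f v \<partial>MB n) = (\<integral>\<^sup>+t\<in>{0..<pt}. (\<integral>\<^sup>+y\<in>{of_int n * py..<(of_int n + 1) * py}. (\<integral>\<^sup>+x\<in>{0..<px}. (\<integral>\<^sup>+w\<in>{0..<pw}.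
      f (t, y, x, w) \<partial>lborel) \<partial>lborel) \<partial>lborel) \<partial>lborel)"
proof -
  have [measurable]: "(\<lambda>p. f (t p, y p, x p, w p)) \<in> borel_measurable M"
    if [measurable]: "t \<in> borel_measurable M" "y \<in> borel_measurable M" "x \<in> borel_measurable M" "w \<in> borel_measurable M" for M :: "'z measure" and t y x w :: "'z \<Rightarrow> real"
  proof -
    have "(\<lambda>p. (t p, y p, x p, w p)) \<in> M \<rightarrow>\<^sub>M (borel \<Otimes>\<^sub>M (borel \<Otimes>\<^sub>M (borel \<Otimes>\<^sub>M borel)))" by measurable
    then show ?thesis by (intro measurable_compose[OF _ assms]) (simp add: borel_prod)
  qed
  have "(\<integral>\<^sup>+v. f v \<partial>MB n) = (\<integral>\<^sup>+v. f v * indicator (box n) v \<partial>lborel)"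
    by (rule nn_integral_restrict_space) simp
  also have "\<dots> = (\<integral>\<^sup>+t. \<integral>\<^sup>+y. \<integral>\<^sup>+x. \<integral>\<^sup>+w. f (t, y, x, w) * indicator (box n) (t, y, x, w) \<partial>lborel \<partial>lborel \<partial>lborel \<partial>lborel)"
    by (rule nn_integral_4) simp
  also have "\<dots> = (\<integral>\<^sup>+t. \<integral>\<^sup>+y. \<integral>\<^sup>+x. \<integral>\<^sup>+w. f (t, y, x, w) * indicator {0..<pw} w * indicator {0..<px} x
      * indicator {of_int n * py..<(of_int n + 1) * py} y * indicator {0..<pt} t \<partial>lborel \<partial>lborel \<partial>lborel \<partial>lborel)"
    by (intro nn_integral_cong) (simp add: box_def indicator_times mult_ac)
  finally show ?thesis by (simp add: nn_integral_multc)
qed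

end

section \<open>Integrals of lattice-invariant functions\<close>

lemma continuous_osc_mult [continuous_intros]:
  assumes "continuous_on S f" "continuous_on S g" shows "continuous_on S (\<lambda>x. osc_mult (f x) (g x))"
proof -
  have "osc_mult p q = (fst p + cis (snd (snd p)) * fst q,
      fst (snd p) + fst (snd q) + Im (cnj (fst p) * (cis (snd (snd p)) * fst q)) / 2, snd (snd p) + snd (snd q))" for p q
    by (cases p; cases q) (simp only: osc_mult.simps osc_omega_def fst_conv snd_conv)
  then show ?thesis by (simp only:) (intro continuous_intros assms, simp)
qed

lemma measurable_osc_mult [measurable]: "osc_mult h \<in> borel_measurable borel" "(\<lambda>g. osc_mult g h) \<in> borel_measurable borel"
  by (intro borel_measurable_continuous_onI continuous_intros)+

definition Phi4 :: "real \<times> real \<times> real \<times> real \<Rightarrow> osc" where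
  "Phi4 v = Phi (fst v) (fst (snd v)) (fst (snd (snd v))) (snd (snd (snd v)))"

lemma measurable_Phi4 [measurable]: "Phi4 \<in> borel_measurable borel"
proof -
  have "(\<lambda>v. Phi (fst v) (fst (snd v)) (fst (snd (snd v))) (snd (snd (snd v)))) \<in> borel \<Otimes>\<^sub>M (borel \<Otimes>\<^sub>M (borel \<Otimes>\<^sub>M borel)) \<rightarrow>\<^sub>M borel"
    by measurable
  then show ?thesis unfolding borel_prod Phi4_def[abs_def] .
qed

lemma interval_integral_deriv_01:
  fixes f f' :: "real \<Rightarrow> real"
  assumes "\<And>s. (f has_vector_derivative f' s) (at s)" "continuous_on UNIV f'"
  shows "(LINT s|restrict_space lborel {0..1}. f' s) = f 1 - f 0"
proof -
  have "(LINT s|restrict_space lborel {0..1}. f' s) = (LINT s|lborel. indicator {0..1} s *\<^sub>R f' s)"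
    by (rule integral_restrict_space) simp
  also have "\<dots> = f 1 - f 0"
    by (rule integral_FTC_atLeastAtMost)
      (auto intro: has_vector_derivative_at_within assms continuous_on_subset[OF assms(2)])
  finally show ?thesis .
qed

context osc_quotient begin

definition L_inv :: "(osc \<Rightarrow> 'c) \<Rightarrow> bool" where
  "L_inv f \<longleftrightarrow> (\<forall>l\<in>L. \<forall>g. f (osc_mult l g) = f g)"

lemma L_inv_lat: "L_inv f \<Longrightarrow> f (osc_mult (lat m n p q) g) = f g"
  using lat_in_L unfolding L_inv_def by blast

lemma L_inv_comp: "L_inv f \<Longrightarrow> L_inv (\<lambda>g. \<theta> (f g))" by (simp add: L_inv_def)

lemma L_inv_right: "L_inv f \<Longrightarrow> L_inv (\<lambda>g. f (osc_mult g h))"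
  unfolding L_inv_def osc_mult_assoc by blast

lemma nn_MB_Phi:
  fixes f :: "osc \<Rightarrow> ennreal"
  assumes [measurable]: "f \<in> borel_measurable borel"
  shows "(\<integral>\<^sup>+v. f (Phi4 v) \<partial>MB n) = (\<integral>\<^sup>+t\<in>{0..<pt}. (\<integral>\<^sup>+y\<in>{of_int n * py..<(of_int n + 1) * py}. (\<integral>\<^sup>+x\<in>{0..<px}. (\<integral>\<^sup>+w\<in>{0..<pw}.
      f (Phi t y x w) \<partial>lborel) \<partial>lborel) \<partial>lborel) \<partial>lborel)"
  by (subst nn_MB) (measurable, simp add: Phi4_def)

text \<open>A shift of \<open>w\<close> by an amount depending on \<open>x\<close> is harmless when integrating over \<open>w\<close> first.\<close>

lemma xw_shift:
  fixes f :: "osc \<Rightarrow> ennreal"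
  assumes [measurable]: "f \<in> borel_measurable borel"
    and w: "\<And>t y x w. f (Phi t y x (w + pw)) = f (Phi t y x w)"
    and x: "\<And>t y x w. f (Phi t y (x + px) w) = f (Phi t y x w)"
  shows "(\<integral>\<^sup>+x\<in>{0..<px}. (\<integral>\<^sup>+w\<in>{0..<pw}. f (Phi t y (x + a) (w + c x)) \<partial>lborel) \<partial>lborel)
    = (\<integral>\<^sup>+x\<in>{0..<px}. (\<integral>\<^sup>+w\<in>{0..<pw}. f (Phi t y x w) \<partial>lborel) \<partial>lborel)"
proof -
  define J where "J x = (\<integral>\<^sup>+w\<in>{0..<pw}. f (Phi t y x w) \<partial>lborel)" for x
  have [measurable]: "J \<in> borel_measurable borel" unfolding J_def by measurable
  have "(\<integral>\<^sup>+w\<in>{0..<pw}. f (Phi t y (x + a) (w + c x)) \<partial>lborel) = J (x + a)" for x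
    unfolding J_def by (rule nn_integral_periodic_shift) (measurable, use periods_pos w in auto)
  moreover have "(\<integral>\<^sup>+x\<in>{0..<px}. J (x + a) \<partial>lborel) = (\<integral>\<^sup>+x\<in>{0..<px}. J x \<partial>lborel)"
    by (rule nn_integral_periodic_shift) (measurable, use periods_pos x in \<open>auto simp: J_def\<close>)
  ultimately show ?thesis by (simp add: J_def)
qed

lemma L_inv_periods:
  assumes "L_inv f"
  shows "f (Phi t y x (w + pw)) = f (Phi t y x w)" "f (Phi t y (x + px) w) = f (Phi t y x w)"
    "f (Phi (t + pt) y x w) = f (Phi t y x w)"
    "f (Phi t (y + py) (x + (- \<mu> * px)) (w + (\<mu> / 2 - py * x))) = f (Phi t y x w)"
  using L_inv_lat[OF assms, of 0 0 1 0 "Phi t y x w"] L_inv_lat[OF assms, of 1 0 0 0 "Phi t y x w"]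
    L_inv_lat[OF assms, of 0 0 0 1 "Phi t y x w"] L_inv_lat[OF assms, of 0 1 0 0 "Phi t y x w"]
  unfolding lat_Phi by (simp_all add: algebra_simps)

text \<open>In the coordinates \<open>Phi\<close> the fundamental domain \<open>F\<close> is itself a box whose sides in \<open>w\<close> and \<open>x\<close> are displaced by
functions of the outer variables. Periodicity in \<open>w\<close> and \<open>x\<close> removes the displacements.\<close>

lemma nn_F_box:
  fixes f :: "osc \<Rightarrow> ennreal"
  assumes [measurable]: "f \<in> borel_measurable borel" and inv: "L_inv f"
  shows "(\<integral>\<^sup>+g. f g \<partial>MF) = (\<integral>\<^sup>+v. f (Phi4 v) \<partial>MB 0)"
proof -
  have ind: "indicator F (Phi t y x w) = (indicator {- (x * y / 2)..<- (x * y / 2) + pw} w * indicator {- (\<mu> * y / \<nu>)..<- (\<mu> * y / \<nu>) + px} x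
      * indicator {0..<py} y * indicator {0..<pt} t :: ennreal)" for t y x w
  proof -
    have s: "py * py = \<nu>" using \<nu> by simp
    have "py * x + \<mu> * y / py \<in> {0..<1} \<longleftrightarrow> x \<in> {- (\<mu> * y / \<nu>)..<- (\<mu> * y / \<nu>) + px}"
    proof -
      have e: "py * x + \<mu> * y / py = py * (x + \<mu> * y / \<nu>)" using \<nu> s by (simp add: field_simps)
      have "0 \<le> py * z \<longleftrightarrow> 0 \<le> z" "py * z < 1 \<longleftrightarrow> z < px" for z
        using periods_pos(2) by (simp_all add: zero_le_mult_iff less_divide_eq mult.commute)
      then show ?thesis unfolding e by auto
    qed
    moreover have "y / py \<in> {0..<1} \<longleftrightarrow> y \<in> {0..<py}" using periods_pos by (auto simp: field_simps)
    moreover have "real r * (w + x * y / 2) \<in> {0..<1} \<longleftrightarrow> w \<in> {- (x * y / 2)..<- (x * y / 2) + pw}"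
    proof -
      have "0 \<le> real r * z \<longleftrightarrow> 0 \<le> z" "real r * z < 1 \<longleftrightarrow> z < pw" for z
        using r by (simp_all add: zero_le_mult_iff less_divide_eq mult.commute)
      then show ?thesis by auto
    qed
    moreover have "t / pt \<in> {0..<1} \<longleftrightarrow> t \<in> {0..<pt}" using periods_pos by (auto simp: field_simps)
    ultimately show ?thesis unfolding indicator_def Phi_def fund_domain_iff[OF \<nu> r \<kappa>] complex.sel by simp
  qed
  note per = L_inv_periods[OF inv]
  define J where "J t y x = (\<integral>\<^sup>+w\<in>{0..<pw}. f (Phi t y x w) \<partial>lborel)" for t y x
  define I where "I t y = (\<integral>\<^sup>+x\<in>{0..<px}. J t y x \<partial>lborel)" for t y
  have [measurable (raw)]: "(\<lambda>p. J (a p) (b p) (c p)) \<in> borel_measurable M"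
    if [measurable]: "a \<in> borel_measurable M" "b \<in> borel_measurable M" "c \<in> borel_measurable M" for a b c and M :: "'z measure"
    unfolding J_def by measurable
  have [measurable (raw)]: "(\<lambda>p. I (a p) (b p)) \<in> borel_measurable M"
    if [measurable]: "a \<in> borel_measurable M" "b \<in> borel_measurable M" for a b and M :: "'z measure"
    unfolding I_def by measurable
  have w: "(\<integral>\<^sup>+w. f (Phi t y x w) * indicator F (Phi t y x w) \<partial>lborel) =
      J t y x * indicator {- (\<mu> * y / \<nu>)..<- (\<mu> * y / \<nu>) + px} x * indicator {0..<py} y * indicator {0..<pt} t" for t y x
  proof -
    have "(\<integral>\<^sup>+w\<in>{- (x * y / 2)..<- (x * y / 2) + pw}. f (Phi t y x w) \<partial>lborel) = J t y x"
      unfolding J_def by (rule nn_integral_periodic) (measurable, use periods_pos per in auto)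
    then show ?thesis unfolding ind mult.assoc[symmetric] by (simp add: nn_integral_multc)
  qed
  have x: "(\<integral>\<^sup>+x\<in>{- (\<mu> * y / \<nu>)..<- (\<mu> * y / \<nu>) + px}. J t y x \<partial>lborel) = I t y" for t y
    unfolding I_def by (rule nn_integral_periodic) (measurable, use periods_pos per in \<open>auto simp: J_def\<close>)
  have x': "(\<integral>\<^sup>+x. J t y x * indicator {- (\<mu> * y / \<nu>)..<- (\<mu> * y / \<nu>) + px} x * indicator {0..<py} y * indicator {0..<pt} t \<partial>lborel)
      = I t y * indicator {0..<py} y * indicator {0..<pt} t" for t y
    unfolding x[symmetric] by (simp add: nn_integral_multc)
  have "(\<integral>\<^sup>+g. f g \<partial>MF) = (\<integral>\<^sup>+t. \<integral>\<^sup>+y. \<integral>\<^sup>+x. \<integral>\<^sup>+w. f (Phi t y x w) * indicator F (Phi t y x w) \<partial>lborel \<partial>lborel \<partial>lborel \<partial>lborel)"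
    unfolding nn_MF[OF assms(1)] by (rule nn_integral_Phi) simp
  also have "\<dots> = (\<integral>\<^sup>+t\<in>{0..<pt}. (\<integral>\<^sup>+y\<in>{0..<py}. I t y \<partial>lborel) \<partial>lborel)"
    unfolding w x' by (simp add: nn_integral_multc)
  also have "\<dots> = (\<integral>\<^sup>+v. f (Phi4 v) \<partial>MB 0)"
    unfolding nn_MB_Phi[OF assms(1)] by (simp add: I_def J_def)
  finally show ?thesis .
qed

text \<open>The quotient has a right-invariant measure: right translation is a sequence of translations in the coordinates, each
absorbed by a period. The shift in \<open>y\<close> uses \<open>l2\<close> and is compensated by shifts in \<open>x\<close> and \<open>w\<close>.\<close>

lemma nn_box_right:
  fixes f :: "osc \<Rightarrow> ennreal"
  assumes [measurable]: "f \<in> borel_measurable borel" and inv: "L_inv f"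
  shows "(\<integral>\<^sup>+g. f (osc_mult g h) \<partial>MF) = (\<integral>\<^sup>+g. f g \<partial>MF)"
proof -
  obtain \<eta> z t' where h: "h = (\<eta>, z, t')" by (metis prod_cases3)
  note per = L_inv_periods[OF inv]
  define I where "I t y = (\<integral>\<^sup>+x\<in>{0..<px}. (\<integral>\<^sup>+w\<in>{0..<pw}. f (Phi t y x w) \<partial>lborel) \<partial>lborel)" for t y
  have mI[measurable (raw)]: "(\<lambda>p. I (a p) (b p)) \<in> borel_measurable M"
    if [measurable]: "a \<in> borel_measurable M" "b \<in> borel_measurable M" for a b and M :: "'z measure"
    unfolding I_def by measurable
  have I: "(\<integral>\<^sup>+x\<in>{0..<px}. (\<integral>\<^sup>+w\<in>{0..<pw}. f (Phi t y (x + a) (w + c x)) \<partial>lborel) \<partial>lborel) = I t y" for t y a c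
    unfolding I_def by (rule xw_shift) (use per in auto)
  have Iy: "I t (y + py) = I t y" for t y
    using I[of t "y + py" "- \<mu> * px" "\<lambda>x. \<mu> / 2 - py * x"] unfolding per(4) by (simp add: I_def)
  define K where "K t = (\<integral>\<^sup>+y\<in>{0..<py}. I t y \<partial>lborel)" for t
  have [measurable]: "K \<in> borel_measurable borel" unfolding K_def by measurable
  have K: "(\<integral>\<^sup>+y\<in>{0..<py}. I t (y + c) \<partial>lborel) = K t" for t c
    unfolding K_def by (rule nn_integral_periodic_shift) (measurable, use periods_pos Iy in auto)
  have Kt: "K (t + pt) = K t" for t unfolding K_def I_def using per(3) by simp
  have m: "(\<lambda>g. f (osc_mult g h)) \<in> borel_measurable borel" by measurable
  have "(\<integral>\<^sup>+g. f (osc_mult g h) \<partial>MF) = (\<integral>\<^sup>+v. f (osc_mult (Phi4 v) h) \<partial>MB 0)"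
    by (rule nn_F_box) (use L_inv_right[OF inv] in simp_all)
  also have "\<dots> = (\<integral>\<^sup>+t\<in>{0..<pt}. K (t + t') \<partial>lborel)"
    unfolding nn_MB_Phi[OF m] unfolding h Phi_right_mult I by (simp add: K)
  also have "\<dots> = (\<integral>\<^sup>+t\<in>{0..<pt}. K t \<partial>lborel)"
    by (rule nn_integral_periodic_shift) (measurable, use periods_pos Kt in auto)
  also have "\<dots> = (\<integral>\<^sup>+v. f (Phi4 v) \<partial>MB 0)"
    unfolding nn_MB_Phi[OF assms(1)] by (simp add: K_def I_def)
  also have "\<dots> = (\<integral>\<^sup>+g. f g \<partial>MF)" by (rule nn_F_box[symmetric]) (use inv in simp_all)
  finally show ?thesis .
qed

text \<open>The element \<open>l2^n\<close> maps the box number \<open>0\<close> onto the box number \<open>n\<close> up to shifts in \<open>x\<close> and \<open>w\<close>, which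
periodicity absorbs.\<close>

lemma nn_box_strip:
  fixes f :: "osc \<Rightarrow> ennreal"
  assumes [measurable]: "f \<in> borel_measurable borel" and inv: "\<And>m p q g. f (osc_mult (lat m 0 p q) g) = f g"
  shows "(\<integral>\<^sup>+v. f (osc_mult (lat 0 n 0 0) (Phi4 v)) \<partial>MB 0) = (\<integral>\<^sup>+v. f (Phi4 v) \<partial>MB n)"
proof -
  have per: "f (Phi t y x (w + pw)) = f (Phi t y x w)" "f (Phi t y (x + px) w) = f (Phi t y x w)" for t y x w
    using inv[of 0 1 0 "Phi t y x w"] inv[of 1 0 0 "Phi t y x w"] unfolding lat_Phi by simp_all
  define I where "I t y = (\<integral>\<^sup>+x\<in>{0..<px}. (\<integral>\<^sup>+w\<in>{0..<pw}. f (Phi t y x w) \<partial>lborel) \<partial>lborel)" for t y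
  have mI[measurable (raw)]: "(\<lambda>p. I (a p) (b p)) \<in> borel_measurable M"
    if [measurable]: "a \<in> borel_measurable M" "b \<in> borel_measurable M" for a b and M :: "'z measure"
    unfolding I_def by measurable
  have I: "(\<integral>\<^sup>+x\<in>{0..<px}. (\<integral>\<^sup>+w\<in>{0..<pw}. f (Phi t y (x + a) (w + c x)) \<partial>lborel) \<partial>lborel) = I t y" for t y a c
    unfolding I_def by (rule xw_shift) (use per in auto)
  have e: "osc_mult (lat 0 n 0 0) (Phi t y x w) = Phi t (y + of_int n * py) (x + - (\<mu> * of_int n * px)) (w + (\<mu> * (of_int n)\<^sup>2 / 2 - of_int n * py * x))" for t y x w
    unfolding lat_Phi by (simp add: algebra_simps)
  have y: "(\<integral>\<^sup>+y\<in>{0..<py}. I t (y + of_int n * py) \<partial>lborel) = (\<integral>\<^sup>+y\<in>{of_int n * py..<(of_int n + 1) * py}. I t y \<partial>lborel)" for t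
  proof -
    have "(\<integral>\<^sup>+y\<in>{0..<py}. I t (y + of_int n * py) \<partial>lborel) = (\<integral>\<^sup>+y. I t (y + of_int n * py) * indicator {of_int n * py..<(of_int n + 1) * py} (y + of_int n * py) \<partial>lborel)"
      by (intro nn_integral_cong) (auto simp: indicator_def algebra_simps)
    also have "\<dots> = (\<integral>\<^sup>+y\<in>{of_int n * py..<(of_int n + 1) * py}. I t y \<partial>lborel)"
      by (rule nn_integral_shift) measurable
    finally show ?thesis .
  qed
  have m: "(\<lambda>g. f (osc_mult (lat 0 n 0 0) g)) \<in> borel_measurable borel" by measurable
  have "(\<integral>\<^sup>+v. f (osc_mult (lat 0 n 0 0) (Phi4 v)) \<partial>MB 0) = (\<integral>\<^sup>+t\<in>{0..<pt}. (\<integral>\<^sup>+y\<in>{0..<py}. I t (y + of_int n * py) \<partial>lborel) \<partial>lborel)"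
    unfolding nn_MB_Phi[OF m] e I by simp
  also have "\<dots> = (\<integral>\<^sup>+v. f (Phi4 v) \<partial>MB n)"
    unfolding y unfolding nn_MB_Phi[OF assms(1)] I_def ..
  finally show ?thesis .
qed

lemma measurable_MF: "f \<in> borel_measurable borel \<Longrightarrow> f \<in> borel_measurable MF"
  and measurable_MB: "g \<in> borel_measurable borel \<Longrightarrow> g \<in> borel_measurable (MB n)"
  by (auto intro!: measurable_restrict_space1)

lemma F_box:
  fixes f :: "osc \<Rightarrow> 'c::{banach, second_countable_topology}"
  assumes [measurable]: "f \<in> borel_measurable borel" and inv: "L_inv f"
  shows "integrable MF f \<longleftrightarrow> integrable (MB 0) (\<lambda>v. f (Phi4 v))" (is ?thesis1)
    and "integral\<^sup>L MF f = integral\<^sup>L (MB 0) (\<lambda>v. f (Phi4 v))" (is ?thesis2)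
proof -
  have eq: "(\<integral>\<^sup>+x. \<theta> (f x) \<partial>MF) = (\<integral>\<^sup>+v. \<theta> (f (Phi4 v)) \<partial>MB 0)" if [measurable]: "\<theta> \<in> borel_measurable borel" for \<theta> :: "'c \<Rightarrow> ennreal"
    by (rule nn_F_box[where f="\<lambda>g. \<theta> (f g)"]) (measurable, rule L_inv_comp[OF inv])
  have a: "f \<in> borel_measurable MF" by (rule measurable_MF) measurable
  have b: "(\<lambda>v. f (Phi4 v)) \<in> borel_measurable (MB 0)" by (rule measurable_MB) measurable
  show ?thesis1 by (rule integral_transfer(1)[OF a b eq])
  show ?thesis2 by (rule integral_transfer(2)[OF a b eq])
qed

lemma F_right:
  fixes f :: "osc \<Rightarrow> 'c::{banach, second_countable_topology}"
  assumes [measurable]: "f \<in> borel_measurable borel" and inv: "L_inv f"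
  shows "integrable MF (\<lambda>g. f (osc_mult g h)) \<longleftrightarrow> integrable MF f" (is ?thesis1)
    and "integral\<^sup>L MF (\<lambda>g. f (osc_mult g h)) = integral\<^sup>L MF f" (is ?thesis2)
proof -
  have eq: "(\<integral>\<^sup>+g. \<theta> (f (osc_mult g h)) \<partial>MF) = (\<integral>\<^sup>+g. \<theta> (f g) \<partial>MF)" if [measurable]: "\<theta> \<in> borel_measurable borel" for \<theta> :: "'c \<Rightarrow> ennreal"
    by (rule nn_box_right[where f="\<lambda>g. \<theta> (f g)"]) (measurable, rule L_inv_comp[OF inv])
  have a: "(\<lambda>g. f (osc_mult g h)) \<in> borel_measurable MF" by (rule measurable_MF) measurable
  have b: "f \<in> borel_measurable MF" by (rule measurable_MF) measurable
  show ?thesis1 by (rule integral_transfer(1)[OF a b eq])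
  show ?thesis2 by (rule integral_transfer(2)[OF a b eq])
qed

lemma box_strip:
  fixes f :: "osc \<Rightarrow> 'c::{banach, second_countable_topology}"
  assumes [measurable]: "f \<in> borel_measurable borel" and inv: "\<And>m p q g. f (osc_mult (lat m 0 p q) g) = f g"
  shows "integrable (MB 0) (\<lambda>v. f (osc_mult (lat 0 n 0 0) (Phi4 v))) \<longleftrightarrow> integrable (MB n) (\<lambda>v. f (Phi4 v))" (is ?thesis1)
    and "integral\<^sup>L (MB 0) (\<lambda>v. f (osc_mult (lat 0 n 0 0) (Phi4 v))) = integral\<^sup>L (MB n) (\<lambda>v. f (Phi4 v))" (is ?thesis2)
proof -
  have eq: "(\<integral>\<^sup>+v. \<theta> (f (osc_mult (lat 0 n 0 0) (Phi4 v))) \<partial>MB 0) = (\<integral>\<^sup>+v. \<theta> (f (Phi4 v)) \<partial>MB n)" if [measurable]: "\<theta> \<in> borel_measurable borel" for \<theta> :: "'c \<Rightarrow> ennreal"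
    by (rule nn_box_strip[where f="\<lambda>g. \<theta> (f g)"]) (measurable, rule arg_cong[OF inv])
  have a: "(\<lambda>v. f (osc_mult (lat 0 n 0 0) (Phi4 v))) \<in> borel_measurable (MB 0)" by (rule measurable_MB) measurable
  have b: "(\<lambda>v. f (Phi4 v)) \<in> borel_measurable (MB n)" by (rule measurable_MB) measurable
  show ?thesis1 by (rule integral_transfer(1)[OF a b eq])
  show ?thesis2 by (rule integral_transfer(2)[OF a b eq])
qed

lemma F_bounded: obtains K where "compact K" "F \<subseteq> K"
proof
  define f where "f p = fst p *\<^sub>R gen1 \<nu> + fst (snd p) *\<^sub>R gen2 \<mu> \<nu> + fst (snd (snd p)) *\<^sub>R gen3 r + snd (snd (snd p)) *\<^sub>R gen4 \<kappa>"
    for p :: "real \<times> real \<times> real \<times> real"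
  have "continuous_on ({0..1} \<times> {0..1} \<times> {0..1} \<times> {0..1}) f" unfolding f_def by (intro continuous_intros)
  then show "compact (f ` ({0..1} \<times> {0..1} \<times> {0..1} \<times> {0..1}))"
    by (rule compact_continuous_image) (intro compact_Times compact_Icc)
  show "F \<subseteq> f ` ({0..1} \<times> {0..1} \<times> {0..1} \<times> {0..1})"
  proof
    fix g assume "g \<in> F"
    then obtain a b c d where "g = f (a, b, c, d)" "a \<in> {0..<1}" "b \<in> {0..<1}" "c \<in> {0..<1}" "d \<in> {0..<1}"
      unfolding fund_domain_def f_def by auto
    then show "g \<in> f ` ({0..1} \<times> {0..1} \<times> {0..1} \<times> {0..1})" by (intro image_eqI[of _ f "(a, b, c, d)"]) auto
  qed
qed

lemma finite_measure_MF: "finite_measure MF"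
proof
  obtain K where K: "compact K" "F \<subseteq> K" by (rule F_bounded)
  have "emeasure MF (space MF) = emeasure lborel F" by (simp add: emeasure_restrict_space)
  also have "\<dots> \<le> emeasure lborel K" using K by (intro emeasure_mono) (auto simp: borel_compact)
  also have "\<dots> < \<infinity>" using K by (intro emeasure_bounded_finite compact_imp_bounded)
  finally show "emeasure MF (space MF) \<noteq> \<infinity>" by simp
qed

lemma to_F: obtains l where "l \<in> L" "osc_mult l g \<in> F"
  using fundamental_domain_osc_lattice(2)[OF \<nu> r \<kappa>] by blast

text \<open>The quotient is compact: every orbit meets the bounded set \<open>F\<close>.\<close>

lemma L_inv_continuous_bounded:
  fixes f :: "osc \<Rightarrow> 'c::real_normed_vector"
  assumes "continuous_on UNIV f" "L_inv (\<lambda>g. norm (f g))"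
  obtains C where "\<And>g. norm (f g) \<le> C"
proof -
  obtain K where K: "compact K" "F \<subseteq> K" by (rule F_bounded)
  have "compact (f ` K)" using assms(1) K by (intro compact_continuous_image) (auto intro: continuous_on_subset)
  then have "bounded (f ` K)" by (rule compact_imp_bounded)
  then obtain C where C: "\<forall>z\<in>f ` K. norm z \<le> C" unfolding bounded_iff by blast
  have "norm (f g) \<le> C" for g
  proof -
    obtain l where l: "l \<in> L" "osc_mult l g \<in> F" by (rule to_F)
    then have e: "norm (f (osc_mult l g)) = norm (f g)" using assms(2) unfolding L_inv_def by blast
    have "osc_mult l g \<in> K" using K(2) l(2) by (rule subsetD)
    then have "norm (f (osc_mult l g)) \<le> C" using C by blast
    then show ?thesis by (simp only: e)
  qed
  then show ?thesis using that by blast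
qed

lemma integrable_MF_bounded:
  fixes f :: "osc \<Rightarrow> 'c::{banach, second_countable_topology}"
  assumes "f \<in> borel_measurable borel" "\<And>g. norm (f g) \<le> C" shows "integrable MF f"
proof -
  interpret finite_measure MF by (rule finite_measure_MF)
  show ?thesis using assms by (intro integrable_const_bound[of _ C] measurable_MF) auto
qed

text \<open>Integrating the derivative along the flow \<open>g \<mapsto> g * exp (s V)\<close> for \<open>s\<close> between \<open>0\<close> and \<open>1\<close>, one gets
\<open>f (g * exp V) - f g\<close>, whose integral vanishes by right invariance. By Fubini and right invariance
again the same integral is the one of \<open>lder V f\<close>. This is what makes the Casimir operator symmetric.\<close>

theorem integral_lder_zero:
  fixes f :: "osc \<Rightarrow> real"
  assumes f: "smooth f" and inv: "L_inv f" and V: "V \<in> {vX, vY, vZ, vT}"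
  shows "(LINT g|MF. lder V f g) = 0"
proof -
  interpret F: finite_measure MF by (rule finite_measure_MF)
  have fc: "continuous_on S f" and dc: "continuous_on S (lder V f)" for S
    by (intro smooth_continuous smooth_lder f V)+
  have [measurable]: "f \<in> borel_measurable borel" "lder V f \<in> borel_measurable borel"
    by (intro borel_measurable_continuous_onI fc dc)+
  have "(\<lambda>g. f (osc_mult l g)) = f" if "l \<in> L" for l using inv that unfolding L_inv_def by blast
  then have dinv: "L_inv (lder V f)" unfolding L_inv_def using lder_left_translate by metis
  obtain C where C: "\<And>g. norm (f g) \<le> C" using L_inv_continuous_bounded[OF fc L_inv_comp[OF inv]] by blast
  obtain C' where C': "\<And>g. norm (lder V f g) \<le> C'" using L_inv_continuous_bounded[OF dc L_inv_comp[OF dinv]] by blast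
  let ?U = "restrict_space lborel {0..1::real}"
  interpret U: finite_measure ?U by standard (simp add: emeasure_restrict_space)
  interpret P: pair_sigma_finite MF ?U ..
  have m: "(\<lambda>(g, s). lder V f (osc_mult g (s *\<^sub>R V))) \<in> borel_measurable (MF \<Otimes>\<^sub>M ?U)"
  proof -
    have "(\<lambda>p. lder V f (osc_mult (fst p) (snd p *\<^sub>R V))) \<in> borel_measurable borel"
      by (intro borel_measurable_continuous_onI continuous_on_compose2[OF dc[of UNIV]] continuous_intros) auto
    then have "(\<lambda>(g, s). lder V f (osc_mult g (s *\<^sub>R V))) \<in> borel_measurable (borel \<Otimes>\<^sub>M borel)"
      by (simp add: borel_prod split_beta)
    moreover have "(\<lambda>p. p) \<in> MF \<Otimes>\<^sub>M ?U \<rightarrow>\<^sub>M borel \<Otimes>\<^sub>M borel"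
      by (rule measurable_pair) (auto simp: comp_def intro!: measurable_compose[OF measurable_fst] measurable_compose[OF measurable_snd] measurable_restrict_space1)
    ultimately show ?thesis by (rule measurable_compose[rotated])
  qed
  have int: "integrable (MF \<Otimes>\<^sub>M ?U) (\<lambda>(g, s). lder V f (osc_mult g (s *\<^sub>R V)))"
  proof (rule finite_measure.integrable_const_bound)
    show "finite_measure (MF \<Otimes>\<^sub>M ?U)" by (rule finite_measure_pair_measure[OF U.finite_measure_axioms F.finite_measure_axioms])
    show "AE p in MF \<Otimes>\<^sub>M ?U. norm (case p of (g, s) \<Rightarrow> lder V f (osc_mult g (s *\<^sub>R V))) \<le> C'" using C' by (auto split: prod.split)
  qed (rule m)
  have "(LINT g|MF. lder V f g) = (LINT s|?U. (LINT g|MF. lder V f g))"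
    by (simp add: measure_restrict_space)
  also have "\<dots> = (LINT s|?U. (LINT g|MF. lder V f (osc_mult g (s *\<^sub>R V))))"
    by (simp only: F_right(2)[OF \<open>lder V f \<in> _\<close> dinv])
  also have "\<dots> = (LINT g|MF. (LINT s|?U. lder V f (osc_mult g (s *\<^sub>R V))))"
    by (rule P.Fubini_integral[OF int])
  also have "\<dots> = (LINT g|MF. f (osc_mult g V) - f g)"
  proof (rule Bochner_Integration.integral_cong[OF refl])
    fix g
    have "(LINT s|?U. lder V f (osc_mult g (s *\<^sub>R V))) = f (osc_mult g (1 *\<^sub>R V)) - f (osc_mult g (0 *\<^sub>R V))"
      by (rule interval_integral_deriv_01, rule lder_flow[OF f V])
        (intro continuous_on_compose2[OF dc[of UNIV]] continuous_intros; simp)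
    moreover have "osc_mult g (0 *\<^sub>R V) = g" unfolding osc_mult_line by simp
    ultimately show "(LINT s|?U. lder V f (osc_mult g (s *\<^sub>R V))) = f (osc_mult g V) - f g"
      by (simp only: scaleR_one)
  qed
  also have "\<dots> = (LINT g|MF. f (osc_mult g V)) - (LINT g|MF. f g)"
    by (intro Bochner_Integration.integral_diff integrable_MF_bounded[of _ C]; (rule C | measurable))
  also have "\<dots> = 0" by (simp add: F_right(2)[OF _ inv])
  finally show ?thesis .
qed

end

section \<open>Series of smooth functions and plane waves\<close>

text \<open>Termwise differentiation for a class of series that is closed under differentiation. Stating it for a class
gives smoothness of the sum by coinduction.\<close>

theorem smooth_series:
  fixes \<F> :: "(nat \<Rightarrow> 'a::euclidean_space \<Rightarrow> 'b::euclidean_space) set"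
  assumes diff: "\<And>F n x. F \<in> \<F> \<Longrightarrow> F n differentiable (at x)"
    and closed: "\<And>F v. F \<in> \<F> \<Longrightarrow> (\<lambda>n. dird v (F n)) \<in> \<F>"
    and dom: "\<And>F R. F \<in> \<F> \<Longrightarrow> \<exists>M. summable M \<and> (\<forall>n x. norm x \<le> R \<longrightarrow> norm (F n x) \<le> M n)"
    and F: "F \<in> \<F>"
  shows "smooth (\<lambda>x. \<Sum>n. F n x)" and "dird v (\<lambda>x. \<Sum>n. F n x) = (\<lambda>x. \<Sum>n. dird v (F n) x)"
    and "summable (\<lambda>n. F n x)"
proof -
  have sm: "summable (\<lambda>n. F n x)" if F: "F \<in> \<F>" for F x
  proof -
    obtain M where M: "summable M" "\<And>n y. norm y \<le> norm x \<Longrightarrow> norm (F n y) \<le> M n"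
      using dom[OF F, of "norm x"] by blast
    show ?thesis by (rule summable_comparison_test'[OF M(1), of 0]) (use M(2) in auto)
  qed
  show "summable (\<lambda>n. F n x)" by (rule sm[OF F])
  have der: "((\<lambda>x. \<Sum>n. F n x) has_derivative (\<lambda>v. \<Sum>n. dird v (F n) x0)) (at x0)" if F: "F \<in> \<F>" for F x0
  proof -
    define R where "R = norm x0 + 1"
    define S where "S = ball (0::'a) R"
    have S: "convex S" "open S" "x0 \<in> S" by (auto simp: S_def R_def)
    have "\<exists>M. summable M \<and> (\<forall>n x. norm x \<le> R \<longrightarrow> norm (dird b (F n) x) \<le> M n)" for b
      using dom[OF closed[OF F]] by blast
    then obtain M where M: "\<And>b. summable (M b)" "\<And>b n x. norm x \<le> R \<Longrightarrow> norm (dird b (F n) x) \<le> M b n" by metis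
    define T where "T n = (\<Sum>b\<in>Basis. M b n)" for n
    have T: "summable T" unfolding T_def by (intro summable_sum M)
    have lin: "linear (\<lambda>v. dird v (F n) x)" for n x
      using diff[OF F] unfolding dird_def by (simp add: linear_frechet_derivative)
    have bound: "norm (dird h (F n) x) \<le> norm h * T n" if "norm x \<le> R" for h n x
    proof -
      have "dird h (F n) x = dird (\<Sum>b\<in>Basis. (h \<bullet> b) *\<^sub>R b) (F n) x" by (simp add: euclidean_representation)
      also have "\<dots> = (\<Sum>b\<in>Basis. (h \<bullet> b) *\<^sub>R dird b (F n) x)"
        by (simp only: linear_sum[OF lin] linear_cmul[OF lin])
      also have "norm \<dots> \<le> (\<Sum>b\<in>Basis. norm h * M b n)"
      proof (rule sum_norm_le)
        fix b :: 'a assume "b \<in> Basis"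
        then show "norm ((h \<bullet> b) *\<^sub>R dird b (F n) x) \<le> norm h * M b n"
          unfolding norm_scaleR by (intro mult_mono M(2)[OF that]) (auto simp: Basis_le_norm)
      qed
      finally show ?thesis by (simp add: T_def sum_distrib_left)
    qed
    have "\<exists>g. \<forall>x\<in>S. (\<lambda>n. F n x) sums g x \<and> (g has_derivative (\<lambda>v. \<Sum>n. dird v (F n) x)) (at x within S)"
    proof (rule has_derivative_series[OF S(1)])
      show "(F n has_derivative (\<lambda>v. dird v (F n) x)) (at x within S)" for n x
        using diff[OF F, of n x] unfolding dird_def frechet_derivative_works by (rule has_derivative_at_withinI)
      show "(\<lambda>n. F n x0) sums (\<Sum>n. F n x0)" using sm[OF F] by (simp add: sums_iff)
      fix e :: real assume "e > 0"
      then obtain N where N: "\<And>n. n \<ge> N \<Longrightarrow> norm (\<Sum>i. T (i + n)) < e"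
        using suminf_exist_split[OF _ T] by blast
      have "norm ((\<Sum>i<n. dird h (F i) x) - (\<Sum>n. dird h (F n) x)) \<le> e * norm h" if n: "n \<ge> N" and x: "x \<in> S" for n x h
      proof -
        have xR: "norm x \<le> R" using x by (simp add: S_def)
        have s: "summable (\<lambda>n. dird h (F n) x)" by (rule sm[OF closed[OF F]])
        have "(\<Sum>i. dird h (F i) x) = (\<Sum>i. dird h (F (i + n)) x) + (\<Sum>i<n. dird h (F i) x)"
          by (rule suminf_split_initial_segment[OF s])
        then have "norm ((\<Sum>i<n. dird h (F i) x) - (\<Sum>n. dird h (F n) x)) = norm (\<Sum>i. dird h (F (i + n)) x)" by simp
        also have "\<dots> \<le> (\<Sum>i. norm h * T (i + n))"
          by (rule norm_suminf_le)
            (use bound[OF xR] T in \<open>auto intro!: summable_mult summable_ignore_initial_segment\<close>)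
        also have "\<dots> = norm h * (\<Sum>i. T (i + n))"
          by (rule suminf_mult) (intro summable_ignore_initial_segment T)
        also have "\<dots> \<le> norm h * e" using N[OF n] by (intro mult_left_mono) auto
        finally show ?thesis by (simp add: mult.commute)
      qed
      then show "\<forall>\<^sub>F n in sequentially. \<forall>x\<in>S. \<forall>h. norm ((\<Sum>i<n. dird h (F i) x) - (\<Sum>n. dird h (F n) x)) \<le> e * norm h"
        unfolding eventually_sequentially by blast
    qed (rule S(3))
    then obtain g where g: "\<forall>x\<in>S. (\<lambda>n. F n x) sums g x \<and> (g has_derivative (\<lambda>v. \<Sum>n. dird v (F n) x)) (at x within S)" ..
    have gd: "(g has_derivative (\<lambda>v. \<Sum>n. dird v (F n) x0)) (at x0)"
      using bspec[OF g S(3)] unfolding at_within_open[OF S(3,2)] by (rule conjunct2)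
    have "g x = (\<Sum>n. F n x)" if "x \<in> S" for x
      using bspec[OF g that] by (rule sums_unique[OF conjunct1])
    then show ?thesis by (rule has_derivative_transform_within_open[OF gd S(2,3)])
  qed
  have dd: "dird v (\<lambda>x. \<Sum>n. F n x) = (\<lambda>x. \<Sum>n. dird v (F n) x)" if "F \<in> \<F>" for F v
    by (rule ext) (rule dird_eq[OF der[OF that]])
  show "dird v (\<lambda>x. \<Sum>n. F n x) = (\<lambda>x. \<Sum>n. dird v (F n) x)" by (rule dd[OF F])
  show "smooth (\<lambda>x. \<Sum>n. F n x)"
  proof (rule smooth_coinduct[of "(\<lambda>F x. \<Sum>n. F n x) ` \<F>"])
    fix f assume "f \<in> (\<lambda>F x. \<Sum>n. F n x) ` \<F>"
    then obtain F where f: "f = (\<lambda>x. \<Sum>n. F n x)" "F \<in> \<F>" by (rule imageE)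
    have "dird v f \<in> (\<lambda>F x. \<Sum>n. F n x) ` \<F>" for v
      unfolding f(1) dd[OF f(2)] by (rule image_eqI[OF refl closed[OF f(2)]])
    moreover have "f differentiable (at x)" for x
      unfolding f(1) differentiable_def using der[OF f(2)] by blast
    ultimately show "(\<forall>x. f differentiable (at x)) \<and> (\<forall>v. dird v f \<in> (\<lambda>F x. \<Sum>n. F n x) ` \<F>)" by blast
  qed (rule imageI[OF F])
qed

text \<open>Families of functions on the group, indexed by the integers, that are polynomial in the coordinates and in the index. They provide the
class of series \<open>\<Sum> q m g * exp (Q m g)\<close> that is closed under differentiation.\<close>

inductive_set polyfam :: "(int \<Rightarrow> osc \<Rightarrow> complex) set" where
  const: "(\<lambda>m g. c) \<in> polyfam"
| index: "(\<lambda>m g. of_int m) \<in> polyfam"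
| coord: "bounded_linear T \<Longrightarrow> (\<lambda>m g. of_real (T g)) \<in> polyfam"
| add: "p \<in> polyfam \<Longrightarrow> q \<in> polyfam \<Longrightarrow> (\<lambda>m g. p m g + q m g) \<in> polyfam"
| mult: "p \<in> polyfam \<Longrightarrow> q \<in> polyfam \<Longrightarrow> (\<lambda>m g. p m g * q m g) \<in> polyfam"

lemma polyfam_diff: "p \<in> polyfam \<Longrightarrow> q \<in> polyfam \<Longrightarrow> (\<lambda>m g. p m g - q m g) \<in> polyfam"
  using polyfam.add[OF _ polyfam.mult[OF polyfam.const[of "-1"]], of p q] by simp

lemma polyfam_scale: "q \<in> polyfam \<Longrightarrow> (\<lambda>m g. c * q m g) \<in> polyfam"
  by (rule polyfam.mult[OF polyfam.const])

lemma polyfam_power: "q \<in> polyfam \<Longrightarrow> (\<lambda>m g. (q m g) ^ n) \<in> polyfam"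
  by (induction n) (auto intro: polyfam.const polyfam.mult)

lemma polyfam_coords: "(\<lambda>m g. of_real (Re (fst g))) \<in> polyfam" "(\<lambda>m g. of_real (Im (fst g))) \<in> polyfam"
  "(\<lambda>m g. of_real (fst (snd g))) \<in> polyfam" "(\<lambda>m g. of_real (snd (snd g))) \<in> polyfam"
  by (intro polyfam.coord bounded_linear_compose[OF bounded_linear_Re] bounded_linear_compose[OF bounded_linear_Im]
     bounded_linear_compose[OF bounded_linear_fst] bounded_linear_compose[OF bounded_linear_snd] bounded_linear_fst bounded_linear_snd)+

lemma polyfam_smooth: "p \<in> polyfam \<Longrightarrow> smooth (p m)"
  by (induction rule: polyfam.induct)
    (auto intro: smooth_const smooth_add smooth_bilinear[OF bounded_bilinear_mult]
      smooth_linear[OF bounded_linear_compose[OF bounded_linear_of_real]])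

lemma polyfam_dird: "p \<in> polyfam \<Longrightarrow> (\<lambda>m. dird v (p m)) \<in> polyfam"
proof (induction rule: polyfam.induct)
  case (coord T)
  have "dird v (\<lambda>g. complex_of_real (T g)) = (\<lambda>g. of_real (T v))"
    by (rule ext) (rule dird_linear[OF bounded_linear_compose[OF bounded_linear_of_real coord]])
  then show ?case by (simp add: polyfam.const)
next
  case (add p q)
  have "dird v (\<lambda>g. p m g + q m g) = (\<lambda>g. dird v (p m) g + dird v (q m) g)" for m
    by (intro ext dird_add smooth_differentiable polyfam_smooth add)
  then show ?case using polyfam.add[OF add.IH] by simp
next
  case (mult p q)
  have "dird v (\<lambda>g. p m g * q m g) = (\<lambda>g. p m g * dird v (q m) g + dird v (p m) g * q m g)" for m
    by (intro ext dird_bilinear[OF bounded_bilinear_mult] smooth_differentiable polyfam_smooth mult)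
  then show ?case using polyfam.add[OF polyfam.mult[OF mult.hyps(1) mult.IH(2)] polyfam.mult[OF mult.IH(1) mult.hyps(2)]] by simp
qed (simp_all add: dird_const[abs_def] polyfam.const)

text \<open>On bounded sets a member of the class grows polynomially in the index.\<close>

lemma polyfam_bound: "p \<in> polyfam \<Longrightarrow> \<exists>C d. C \<ge> 0 \<and> (\<forall>m g. norm g \<le> R \<longrightarrow> cmod (p m g) \<le> C * (1 + \<bar>real_of_int m\<bar>) ^ d)"
proof (induction rule: polyfam.induct)
  case (const c)
  show ?case by (rule exI[of _ "cmod c"], rule exI[of _ 0]) auto
next
  case index
  show ?case by (rule exI[of _ 1], rule exI[of _ 1]) auto
next
  case (coord T)
  then obtain K where K: "K \<ge> 0" "\<And>g. norm (T g) \<le> norm g * K" using bounded_linear.nonneg_bounded by blast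
  have "\<bar>T g\<bar> \<le> \<bar>R\<bar> * K" if "norm g \<le> R" for g
    using order_trans[OF K(2)[of g] mult_right_mono[OF _ K(1)]] that by auto
  then show ?case using K(1) by (intro exI[of _ "\<bar>R\<bar> * K"] exI[of _ 0]) auto
next
  case (add p q)
  then obtain C d C' d' where *: "C \<ge> 0" "\<And>m g. norm g \<le> R \<Longrightarrow> cmod (p m g) \<le> C * (1 + \<bar>real_of_int m\<bar>) ^ d"
    "C' \<ge> 0" "\<And>m g. norm g \<le> R \<Longrightarrow> cmod (q m g) \<le> C' * (1 + \<bar>real_of_int m\<bar>) ^ d'" by blast
  have "cmod (p m g + q m g) \<le> (C + C') * (1 + \<bar>real_of_int m\<bar>) ^ (d + d')" if g: "norm g \<le> R" for m g
  proof -
    have "cmod (p m g) \<le> C * (1 + \<bar>real_of_int m\<bar>) ^ (d + d')"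
      using *(2)[OF g, of m] mult_left_mono[OF power_increasing[of d "d + d'" "1 + \<bar>real_of_int m\<bar>"] *(1)] by simp
    moreover have "cmod (q m g) \<le> C' * (1 + \<bar>real_of_int m\<bar>) ^ (d + d')"
      using *(4)[OF g, of m] mult_left_mono[OF power_increasing[of d' "d + d'" "1 + \<bar>real_of_int m\<bar>"] *(3)] by simp
    ultimately show ?thesis using norm_triangle_ineq[of "p m g" "q m g"] by (simp add: distrib_right)
  qed
  then show ?case using *(1,3) by (intro exI[of _ "C + C'"] exI[of _ "d + d'"]) auto
next
  case (mult p q)
  then obtain C d C' d' where *: "C \<ge> 0" "\<And>m g. norm g \<le> R \<Longrightarrow> cmod (p m g) \<le> C * (1 + \<bar>real_of_int m\<bar>) ^ d"
    "C' \<ge> 0" "\<And>m g. norm g \<le> R \<Longrightarrow> cmod (q m g) \<le> C' * (1 + \<bar>real_of_int m\<bar>) ^ d'" by blast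
  have "cmod (p m g * q m g) \<le> (C * C') * (1 + \<bar>real_of_int m\<bar>) ^ (d + d')" if g: "norm g \<le> R" for m g
  proof -
    have "cmod (p m g * q m g) \<le> (C * (1 + \<bar>real_of_int m\<bar>) ^ d) * (C' * (1 + \<bar>real_of_int m\<bar>) ^ d')"
      unfolding norm_mult by (intro mult_mono *(2,4) g) (use *(1) in auto)
    then show ?thesis by (simp add: power_add mult_ac)
  qed
  then show ?case using *(1,3) by (intro exI[of _ "C * C'"] exI[of _ "d + d'"]) auto
qed

lemma smooth_exp: 
  assumes f: "smooth (f :: osc \<Rightarrow> complex)"
  shows "(\<lambda>x. exp (f x)) differentiable (at x)" "dird v (\<lambda>x. exp (f x)) x = dird v f x * exp (f x)"
proof -
  have "((\<lambda>x. exp (f x)) has_derivative (\<lambda>v. exp (f x) * dird v f x)) (at x)"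
    using has_derivative_compose[OF smooth_has_derivative[OF f] has_field_derivative_imp_has_derivative[OF DERIV_exp]] .
  then show "(\<lambda>x. exp (f x)) differentiable (at x)" "dird v (\<lambda>x. exp (f x)) x = dird v f x * exp (f x)"
    by (auto simp: differentiable_def dird_eq mult.commute)
qed

lemma polyexp_dird:
  assumes q: "q \<in> polyfam" and Q: "Q \<in> polyfam"
  shows "(\<lambda>g. q m g * exp (Q m g)) differentiable (at x)"
    and "\<exists>p\<in>polyfam. \<forall>m. dird v (\<lambda>g. q m g * exp (Q m g)) = (\<lambda>g. p m g * exp (Q m g))"
proof -
  note ce = smooth_exp(1)[OF polyfam_smooth[OF Q]] and dce = smooth_exp(2)[OF polyfam_smooth[OF Q]]
  show "(\<lambda>g. q m g * exp (Q m g)) differentiable (at x)"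
    using bounded_bilinear.FDERIV[OF bounded_bilinear_mult smooth_has_derivative[OF polyfam_smooth[OF q]]] ce[of m x]
    unfolding differentiable_def by blast
  show "\<exists>p\<in>polyfam. \<forall>m. dird v (\<lambda>g. q m g * exp (Q m g)) = (\<lambda>g. p m g * exp (Q m g))"
  proof (intro bexI[of _ "\<lambda>m g. q m g * dird v (Q m) g + dird v (q m) g"] allI ext)
    show "(\<lambda>m g. q m g * dird v (Q m) g + dird v (q m) g) \<in> polyfam"
      by (intro polyfam.add polyfam.mult polyfam_dird q Q)
    fix m x
    show "dird v (\<lambda>g. q m g * exp (Q m g)) x = (q m x * dird v (Q m) x + dird v (q m) x) * exp (Q m x)"
      unfolding dird_bilinear[OF bounded_bilinear_mult smooth_differentiable[OF polyfam_smooth[OF q]] ce] dce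
      by (simp add: algebra_simps)
  qed
qed

lemma smooth_polyexp:
  assumes "q \<in> polyfam" "Q \<in> polyfam" shows "smooth (\<lambda>g. q m g * exp (Q m g))"
proof (rule smooth_coinduct[of "(\<lambda>q g. q m g * exp (Q m g)) ` polyfam"])
  fix f assume "f \<in> (\<lambda>q g. q m g * exp (Q m g)) ` polyfam"
  then obtain q where q: "f = (\<lambda>g. q m g * exp (Q m g))" "q \<in> polyfam" by (rule imageE)
  have "dird v f \<in> (\<lambda>q g. q m g * exp (Q m g)) ` polyfam" for v
  proof -
    obtain p where p: "p \<in> polyfam" "\<And>m. dird v (\<lambda>g. q m g * exp (Q m g)) = (\<lambda>g. p m g * exp (Q m g))"
      using polyexp_dird(2)[OF q(2) assms(2), where v=v] by auto
    show ?thesis unfolding q(1) p(2) by (rule imageI[OF p(1)])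
  qed
  moreover have "f differentiable (at x)" for x
    unfolding q(1) by (rule polyexp_dird(1)[OF q(2) assms(2)])
  ultimately show "(\<forall>x. f differentiable (at x)) \<and> (\<forall>v. dird v f \<in> (\<lambda>q g. q m g * exp (Q m g)) ` polyfam)" by simp
qed (rule imageI[OF assms(1)])

text \<open>Sums over the integers are written as series over \<open>int_decode\<close>.\<close>

lemma summable_exp_int_decode_rate:
  assumes c: "c > 0" shows "summable (\<lambda>n. exp (- (c * \<bar>real_of_int (int_decode n)\<bar>)))"
proof (rule summable_comparison_test'[of "\<lambda>n. exp (c / 2) * exp (- c / 2) ^ n" 0])
  show "summable (\<lambda>n. exp (c / 2) * exp (- c / 2 :: real) ^ n)"
    using c by (intro summable_mult summable_geometric) auto
  fix n :: nat
  have "real n \<le> 2 * \<bar>real_of_int (int_decode n)\<bar> + 1"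
    unfolding int_decode_def sum_decode_def by (auto elim!: evenE oddE)
  then have "c / 2 * real n \<le> c / 2 * (2 * \<bar>real_of_int (int_decode n)\<bar> + 1)" using c by (intro mult_left_mono) auto
  then have "- (c * \<bar>real_of_int (int_decode n)\<bar>) \<le> c / 2 + real n * (- c / 2)" by (simp add: algebra_simps)
  then have "exp (- (c * \<bar>real_of_int (int_decode n)\<bar>)) \<le> exp (c / 2 + real n * (- c / 2))" by (rule exp_le_cancel_iff[THEN iffD2])
  then show "norm (exp (- (c * \<bar>real_of_int (int_decode n)\<bar>))) \<le> exp (c / 2) * exp (- c / 2) ^ n"
    by (simp only: exp_add exp_of_nat_mult real_norm_def abs_exp_cancel)
qed

lemma summable_exp_int_decode: "summable (\<lambda>n. exp (- \<bar>real_of_int (int_decode n)\<bar>))"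
  using summable_exp_int_decode_rate[of 1] by simp

lemma poly_times_exp_bound:
  fixes u :: real assumes "u \<ge> 0" shows "(1 + u) ^ d * exp (- 2 * u) \<le> fact d * exp 1 * exp (- u)"
proof -
  have "(\<Sum>k\<in>{d}. (1 + u) ^ k / fact k) \<le> (\<Sum>k. (1 + u) ^ k / fact k)"
    using exp_converges[of "1 + u"] assms by (intro sum_le_suminf) (auto simp: sums_iff divide_inverse mult.commute)
  also have "\<dots> = exp (1 + u)" by (simp add: exp_def divide_inverse mult.commute)
  finally have "(1 + u) ^ d \<le> fact d * exp (1 + u)" by (simp add: field_simps)
  then have "(1 + u) ^ d * exp (- 2 * u) \<le> fact d * exp (1 + u) * exp (- 2 * u)" by (intro mult_right_mono) auto
  also have "\<dots> = fact d * exp 1 * exp (- u)" by (simp add: exp_add[symmetric] mult.assoc)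
  finally show ?thesis .
qed

text \<open>The exponent of a theta series. The rate \<open>2\<close> in the decay leaves room for a polynomial in \<open>m\<close>, at the cost of the weaker rate
\<open>1\<close> in \<open>dominated\<close>.\<close>

locale theta_family =
  fixes Q :: "int \<Rightarrow> osc \<Rightarrow> complex"
  assumes Q: "Q \<in> polyfam"
    and gauss: "\<And>R. \<exists>C. \<forall>m g. norm g \<le> R \<longrightarrow> cmod (exp (Q m g)) \<le> C * exp (- 2 * \<bar>real_of_int m\<bar>)"
begin

definition \<T> :: "(nat \<Rightarrow> osc \<Rightarrow> complex) set" where
  "\<T> = (\<lambda>q n g. q (int_decode n) g * exp (Q (int_decode n) g)) ` polyfam"

lemma \<T>I: "q \<in> polyfam \<Longrightarrow> (\<lambda>n g. q (int_decode n) g * exp (Q (int_decode n) g)) \<in> \<T>"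
  unfolding \<T>_def by (rule imageI)

lemma dominated:
  assumes q: "q \<in> polyfam"
  shows "\<exists>C. \<forall>m g. norm g \<le> R \<longrightarrow> cmod (q m g * exp (Q m g)) \<le> C * exp (- \<bar>real_of_int m\<bar>)"
proof -
  obtain C d where C: "C \<ge> 0" "\<And>m g. norm g \<le> R \<Longrightarrow> cmod (q m g) \<le> C * (1 + \<bar>real_of_int m\<bar>) ^ d"
    using polyfam_bound[OF q] by blast
  obtain D where D: "\<And>m g. norm g \<le> R \<Longrightarrow> cmod (exp (Q m g)) \<le> D * exp (- 2 * \<bar>real_of_int m\<bar>)"
    using gauss by blast
  have "cmod (q m g * exp (Q m g)) \<le> (C * \<bar>D\<bar> * (fact d * exp 1)) * exp (- \<bar>real_of_int m\<bar>)" if g: "norm g \<le> R" for m g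
  proof -
    let ?u = "\<bar>real_of_int m\<bar>"
    have "cmod (q m g * exp (Q m g)) \<le> (C * (1 + ?u) ^ d) * (\<bar>D\<bar> * exp (- 2 * ?u))"
      unfolding norm_mult
      by (intro mult_mono C(2)[OF g] order_trans[OF D[OF g]] mult_right_mono) (use C(1) in auto)
    also have "\<dots> = C * \<bar>D\<bar> * ((1 + ?u) ^ d * exp (- 2 * ?u))" by simp
    also have "\<dots> \<le> C * \<bar>D\<bar> * (fact d * exp 1 * exp (- ?u))"
      by (intro mult_left_mono poly_times_exp_bound) (use C(1) in auto)
    finally show ?thesis by (simp add: mult.assoc)
  qed
  then show ?thesis by blast
qed

lemma \<T>_props:
  shows "F \<in> \<T> \<Longrightarrow> F n differentiable (at x)"
    and "F \<in> \<T> \<Longrightarrow> (\<lambda>n. dird v (F n)) \<in> \<T>"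
    and "F \<in> \<T> \<Longrightarrow> \<exists>M. summable M \<and> (\<forall>n x. norm x \<le> R \<longrightarrow> norm (F n x) \<le> M n)"
proof -
  assume "F \<in> \<T>"
  then obtain q where F: "F = (\<lambda>n g. q (int_decode n) g * exp (Q (int_decode n) g))" and q: "q \<in> polyfam"
    unfolding \<T>_def by (rule imageE)
  show "F n differentiable (at x)" unfolding F by (rule polyexp_dird(1)[OF q Q])
  obtain p where p: "p \<in> polyfam" "\<And>m. dird v (\<lambda>g. q m g * exp (Q m g)) = (\<lambda>g. p m g * exp (Q m g))"
    using polyexp_dird(2)[OF q Q, where v=v] by auto
  show "(\<lambda>n. dird v (F n)) \<in> \<T>" unfolding F p(2) by (rule \<T>I[OF p(1)])
  obtain C where C: "\<And>m g. norm g \<le> R \<Longrightarrow> cmod (q m g * exp (Q m g)) \<le> C * exp (- \<bar>real_of_int m\<bar>)"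
    using dominated[OF q] by blast
  have "summable (\<lambda>n. C * exp (- \<bar>real_of_int (int_decode n)\<bar>))"
    by (intro summable_mult summable_exp_int_decode)
  then show "\<exists>M. summable M \<and> (\<forall>n x. norm x \<le> R \<longrightarrow> norm (F n x) \<le> M n)"
    unfolding F using C by blast
qed

lemma series:
  assumes F: "F \<in> \<T>"
  shows "smooth (\<lambda>x. \<Sum>n. F n x)" and "dird v (\<lambda>x. \<Sum>n. F n x) = (\<lambda>x. \<Sum>n. dird v (F n) x)"
    and "summable (\<lambda>n. F n x)"
proof -
  show "smooth (\<lambda>x. \<Sum>n. F n x)"
    by (rule smooth_series(1)[where \<F>=\<T>]) (fact \<T>_props(1) \<T>_props(2) \<T>_props(3) F)+
  show "dird v (\<lambda>x. \<Sum>n. F n x) = (\<lambda>x. \<Sum>n. dird v (F n) x)"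
    by (rule smooth_series(2)[where \<F>=\<T>]) (fact \<T>_props(1) \<T>_props(2) \<T>_props(3) F)+
  show "summable (\<lambda>n. F n x)"
    by (rule smooth_series(3)[where \<F>=\<T>]) (fact \<T>_props(1) \<T>_props(2) \<T>_props(3) F)+
qed

lemma \<T>_smooth: "F \<in> \<T> \<Longrightarrow> smooth (F n)"
  unfolding \<T>_def by (elim imageE) (simp only: smooth_polyexp[OF _ Q])

lemma \<T>_mult_add: "F \<in> \<T> \<Longrightarrow> G \<in> \<T> \<Longrightarrow> (\<lambda>n g. F n g + G n g) \<in> \<T>"
  "bounded_linear T \<Longrightarrow> F \<in> \<T> \<Longrightarrow> (\<lambda>n g. T g *\<^sub>R F n g) \<in> \<T>"
proof -
  assume F: "F \<in> \<T>"
  obtain p where p: "F = (\<lambda>n g. p (int_decode n) g * exp (Q (int_decode n) g))" "p \<in> polyfam"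
    using F unfolding \<T>_def by (rule imageE)
  show "(\<lambda>n g. F n g + G n g) \<in> \<T>" if G: "G \<in> \<T>"
  proof -
    obtain q where q: "G = (\<lambda>n g. q (int_decode n) g * exp (Q (int_decode n) g))" "q \<in> polyfam"
      using G unfolding \<T>_def by (rule imageE)
    show ?thesis using \<T>I[OF polyfam.add[OF p(2) q(2)]] by (simp add: p(1) q(1) distrib_right)
  qed
  show "(\<lambda>n g. T g *\<^sub>R F n g) \<in> \<T>" if T: "bounded_linear T"
    using \<T>I[OF polyfam.mult[OF polyfam.coord[OF T] p(2)]] by (simp add: p(1) scaleR_conv_of_real mult.assoc)
qed

lemma \<T>_frame:
  assumes F: "F \<in> \<T>"
  shows "(\<lambda>n. hA (F n)) \<in> \<T>" "(\<lambda>n. hB (F n)) \<in> \<T>"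
    and "hA (\<lambda>x. \<Sum>n. F n x) = (\<lambda>x. \<Sum>n. hA (F n) x)" "hB (\<lambda>x. \<Sum>n. F n x) = (\<lambda>x. \<Sum>n. hB (F n) x)"
proof -
  note d = \<T>_props(2)[OF F] and s = series(3)[OF \<T>_props(2)[OF F]]
  show "(\<lambda>n. hA (F n)) \<in> \<T>" "(\<lambda>n. hB (F n)) \<in> \<T>"
    unfolding hA_def hB_def by (intro \<T>_mult_add d bl_coords)+
  show "hA (\<lambda>x. \<Sum>n. F n x) = (\<lambda>x. \<Sum>n. hA (F n) x)" "hB (\<lambda>x. \<Sum>n. F n x) = (\<lambda>x. \<Sum>n. hB (F n) x)"
    unfolding hA_def hB_def series(2)[OF F]
    by (rule ext, subst suminf_scaleR_right[OF s], rule suminf_add[OF s summable_scaleR_right[OF s]])+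
qed

end

text \<open>The coordinate \<open>w\<close> of \<open>Phi\<close>.\<close>

definition ww :: "osc \<Rightarrow> real" where "ww g = fst (snd g) - Re (fst g) * Im (fst g) / 2"

text \<open>Separated functions: by \<open>wave_Phi\<close> these are \<open>h y\<close> times an exponential in \<open>w\<close>, \<open>t\<close>, \<open>x\<close>.\<close>

definition wave :: "real \<Rightarrow> real \<Rightarrow> real \<Rightarrow> (real \<Rightarrow> complex) \<Rightarrow> osc \<Rightarrow> complex" where
  "wave \<zeta> \<tau> s h g = h (Im (fst g)) * exp (\<i> * of_real (\<zeta> * ww g + \<tau> * snd (snd g) + s * Re (fst g)))"

lemma wave_Phi: "wave \<zeta> \<tau> s h (Phi t y x w) = h y * exp (\<i> * of_real (\<zeta> * w + \<tau> * t + s * x))"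
  by (simp add: wave_def Phi_def ww_def)

lemma wave_has_derivative:
  assumes h: "\<And>y. (h has_vector_derivative h' y) (at y)"
  shows "(wave \<zeta> \<tau> s h has_derivative (\<lambda>v. wave \<zeta> \<tau> s (\<lambda>y. of_real (Im (fst v)) * h' y) g
    + \<i> * of_real (\<zeta> * (fst (snd v) - (Re (fst v) * Im (fst g) + Re (fst g) * Im (fst v)) / 2) + \<tau> * snd (snd v) + s * Re (fst v)) * wave \<zeta> \<tau> s h g)) (at g)"
proof -
  have 1: "((\<lambda>g. h (Im (fst g))) has_derivative (\<lambda>v. of_real (Im (fst v)) * h' (Im (fst g)))) (at g)"
  proof -
    have "(h has_derivative (\<lambda>d. d *\<^sub>R h' (Im (fst g)))) (at (Im (fst g)))" using h by (simp add: has_vector_derivative_def)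
    moreover have "((\<lambda>g::osc. Im (fst g)) has_derivative (\<lambda>v. Im (fst v))) (at g)"
      by (rule bounded_linear_imp_has_derivative[OF bounded_linear_compose[OF bounded_linear_Im bounded_linear_fst]])
    ultimately show ?thesis using has_derivative_compose[of "\<lambda>g::osc. Im (fst g)" "\<lambda>v. Im (fst v)" g UNIV h] by (simp add: scaleR_conv_of_real)
  qed
  let ?\<theta> = "\<lambda>g. \<zeta> * ww g + \<tau> * snd (snd g) + s * Re (fst g)"
  let ?d = "\<lambda>v. \<zeta> * (fst (snd v) - (Re (fst v) * Im (fst g) + Re (fst g) * Im (fst v)) / 2) + \<tau> * snd (snd v) + s * Re (fst v)"
  have 2: "(?\<theta> has_derivative ?d) (at g)"
    unfolding ww_def by (auto intro!: derivative_eq_intros simp: algebra_simps)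
  have 3: "((\<lambda>g. \<i> * complex_of_real (?\<theta> g)) has_derivative (\<lambda>v. \<i> * of_real (?d v))) (at g)"
    by (rule bounded_linear.has_derivative[OF bounded_linear_compose[OF bounded_linear_mult_right bounded_linear_of_real] 2])
  have 4: "((\<lambda>g. exp (\<i> * complex_of_real (?\<theta> g))) has_derivative (\<lambda>v. exp (\<i> * complex_of_real (?\<theta> g)) * (\<i> * of_real (?d v)))) (at g)"
    using has_derivative_compose[OF 3 has_field_derivative_imp_has_derivative[OF DERIV_exp]] .
  show ?thesis
    unfolding wave_def
    by (rule has_derivative_eq_rhs[OF has_derivative_mult[OF 1 4]]) (simp add: fun_eq_iff algebra_simps)
qed

lemma wave_frame:
  assumes h: "\<And>y. (h has_vector_derivative h' y) (at y)"
  shows "hA (wave \<zeta> \<tau> s h) = wave \<zeta> \<tau> s (\<lambda>y. \<i> * of_real (s - \<zeta> * y) * h y)"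
    and "hB (wave \<zeta> \<tau> s h) = wave \<zeta> \<tau> s h'"
    and "dZ (wave \<zeta> \<tau> s h) = wave \<zeta> \<tau> s (\<lambda>y. \<i> * of_real \<zeta> * h y)"
    and "dT (wave \<zeta> \<tau> s h) = wave \<zeta> \<tau> s (\<lambda>y. \<i> * of_real \<tau> * h y)"
  by (rule ext; simp add: hA_def hB_def dird_eq[OF wave_has_derivative[OF h]] scaleR_conv_of_real wave_def; simp add: algebra_simps)+

text \<open>On separated functions the Casimir operator acts as a harmonic oscillator on \<open>h\<close>, centred at \<open>s / \<zeta>\<close> if \<open>\<zeta>\<close> is not zero.\<close>

lemma wave_eigen:
  assumes h: "\<And>y. (h has_vector_derivative h' y) (at y)" and h': "\<And>y. (h' has_vector_derivative h'' y) (at y)"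
    and ode: "\<And>y. h'' y = of_real ((s - \<zeta> * y)\<^sup>2 + 2 * \<zeta> * \<tau> - l) * h y"
  shows "hA (hA (wave \<zeta> \<tau> s h)) g + hB (hB (wave \<zeta> \<tau> s h)) g + 2 *\<^sub>R dZ (dT (wave \<zeta> \<tau> s h)) g = - of_real l * wave \<zeta> \<tau> s h g"
proof -
  have 1: "((\<lambda>y. \<i> * of_real (s - \<zeta> * y) * h y) has_vector_derivative (\<i> * of_real (s - \<zeta> * y) * h' y + \<i> * of_real (- \<zeta>) * h y)) (at y)" for y
    by (auto intro!: derivative_eq_intros h simp: has_vector_derivative_def[of "\<lambda>x. of_real _"])
  have 2: "((\<lambda>y. \<i> * of_real \<tau> * h y) has_vector_derivative (\<i> * of_real \<tau> * h' y)) (at y)" for y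
    by (auto intro!: derivative_eq_intros h)
  show ?thesis
    unfolding wave_frame[OF h] wave_frame(1)[OF 1] wave_frame(2)[OF h'] wave_frame(3)[OF 2]
    by (simp add: wave_def ode scaleR_conv_of_real power2_eq_square algebra_simps)
qed

text \<open>Hermite functions scaled to the oscillator of frequency \<open>\<bar>\<zeta>\<bar>\<close> and centred at \<open>s / \<zeta>\<close>.\<close>

definition hf :: "nat \<Rightarrow> real \<Rightarrow> real \<Rightarrow> real \<Rightarrow> real" where
  "hf j \<zeta> s y = herm j (sqrt \<bar>\<zeta>\<bar> * (y - s / \<zeta>)) * exp (- (sqrt \<bar>\<zeta>\<bar> * (y - s / \<zeta>))\<^sup>2 / 2)"

lemma hf_ode:
  assumes "\<zeta> \<noteq> 0"
  obtains h' where "\<And>y. ((\<lambda>y. complex_of_real (hf j \<zeta> s y)) has_vector_derivative h' y) (at y)"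
    "\<And>y. (h' has_vector_derivative of_real ((s - \<zeta> * y)\<^sup>2 - \<bar>\<zeta>\<bar> * (2 * real j + 1)) * complex_of_real (hf j \<zeta> s y)) (at y)"
proof -
  define a where "a = sqrt \<bar>\<zeta>\<bar>"
  have a2: "a * a = \<bar>\<zeta>\<bar>" by (simp add: a_def)
  define u where "u y = a * (y - s / \<zeta>)" for y
  define k where "k y = a * ((2 * real j * herm (j - 1) (u y) - u y * herm j (u y)) * exp (- (u y)\<^sup>2 / 2))" for y
  have hf: "hf j \<zeta> s = (\<lambda>y. herm j (u y) * exp (- (u y)\<^sup>2 / 2))" by (simp add: fun_eq_iff hf_def u_def a_def)
  have du[derivative_intros]: "(u has_real_derivative a) (at y)" for y
    unfolding u_def by (auto intro!: derivative_eq_intros)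
  have dh[derivative_intros]: "((\<lambda>y. herm n (u y)) has_real_derivative (2 * real n * herm (n - 1) (u y)) * a) (at y)" for n y
    by (rule DERIV_chain2[OF herm_deriv du])
  have 1: "(hf j \<zeta> s has_real_derivative k y) (at y)" for y
    unfolding hf k_def by (auto intro!: derivative_eq_intros simp: algebra_simps)
  have uh: "u y * herm j (u y) = herm (Suc j) (u y) / 2 + real j * herm (j - 1) (u y)" for y by (rule herm_mult)
  have 2: "(k has_real_derivative ((s - \<zeta> * y)\<^sup>2 - \<bar>\<zeta>\<bar> * (2 * real j + 1)) * hf j \<zeta> s y) (at y)" for y
  proof -
    let ?U = "u y" and ?E = "exp (- (u y)\<^sup>2 / 2)"
    have "(k has_real_derivative a * ((2 * real j * ((2 * real (j - 1) * herm (j - 1 - 1) ?U) * a) - (a * herm j ?U + ?U * ((2 * real j * herm (j - 1) ?U) * a))) * ?E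
        + (2 * real j * herm (j - 1) ?U - ?U * herm j ?U) * (?E * (- (?U * a))))) (at y)"
      unfolding k_def by (auto intro!: derivative_eq_intros simp: algebra_simps power2_eq_square)
    also have "a * ((2 * real j * ((2 * real (j - 1) * herm (j - 1 - 1) ?U) * a) - (a * herm j ?U + ?U * ((2 * real j * herm (j - 1) ?U) * a))) * ?E
        + (2 * real j * herm (j - 1) ?U - ?U * herm j ?U) * (?E * (- (?U * a))))
      = (a * a) * ((real j * (4 * real (j - 1) * herm (j - 1 - 1) ?U - 4 * (?U * herm (j - 1) ?U)) - herm j ?U + ?U * ?U * herm j ?U) * ?E)"
      by (simp add: algebra_simps)
    also have "real j * (4 * real (j - 1) * herm (j - 1 - 1) ?U - 4 * (?U * herm (j - 1) ?U)) = - 2 * real j * herm j ?U"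
      unfolding herm_mult by (cases j) (auto simp: algebra_simps)
    also have "(a * a) * ((- 2 * real j * herm j ?U - herm j ?U + ?U * ?U * herm j ?U) * ?E)
       = ((a * a) * (?U * ?U) - (a * a) * (2 * real j + 1)) * (herm j ?U * ?E)" by (simp add: algebra_simps)
    also have "(a * a) * (?U * ?U) = (s - \<zeta> * y)\<^sup>2"
    proof -
      have "(a * a) * (?U * ?U) = (a * a) * (a * a) * (y - s / \<zeta>)\<^sup>2" by (simp add: u_def power2_eq_square)
      also have "\<dots> = (\<zeta> * (y - s / \<zeta>))\<^sup>2" unfolding a2 by (simp add: power_mult_distrib power2_eq_square)
      also have "\<zeta> * (y - s / \<zeta>) = \<zeta> * y - s" using assms by (simp add: field_simps)
      finally show ?thesis by (simp add: power2_commute)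
    qed
    finally show ?thesis unfolding a2 hf .
  qed
  show ?thesis
  proof (rule that[of "\<lambda>y. complex_of_real (k y)"])
    show "((\<lambda>y. complex_of_real (hf j \<zeta> s y)) has_vector_derivative complex_of_real (k y)) (at y)" for y
      by (intro has_vector_derivative_of_real has_real_derivative_iff_has_vector_derivative[THEN iffD1] 1)
    show "((\<lambda>y. complex_of_real (k y)) has_vector_derivative of_real ((s - \<zeta> * y)\<^sup>2 - \<bar>\<zeta>\<bar> * (2 * real j + 1)) * complex_of_real (hf j \<zeta> s y)) (at y)" for y
      unfolding of_real_mult[symmetric]
      by (intro has_vector_derivative_of_real has_real_derivative_iff_has_vector_derivative[THEN iffD1] 2)
  qed
qed

section \<open>Theta functions as eigenfunctions\<close>

lemma cis_pi_int: "cis (pi * of_int k) = of_int ((- 1) ^ nat \<bar>k\<bar>)"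
proof -
  have n: "cis (pi * real n) = of_int ((- 1) ^ n)" for n
  proof -
    have "cis (pi * real n) = cis (real n * pi)" by (simp only: mult.commute)
    also have "\<dots> = cis pi ^ n" by (rule Complex.DeMoivre[symmetric])
    finally show ?thesis by simp
  qed
  show ?thesis
  proof (cases "k \<ge> 0")
    case True
    then show ?thesis using n[of "nat k"] by simp
  next
    case False
    have "cis (pi * of_int k) = cnj (cis (pi * real (nat (- k))))" using False by (simp add: cis_cnj)
    also have "\<dots> = of_int ((- 1) ^ nat (- k))" unfolding n by simp
    finally show ?thesis using False by simp
  qed
qed

lemma cis_pi_even: "even k \<Longrightarrow> cis (pi * of_int k) = 1"
  unfolding cis_pi_int by (simp add: even_nat_iff)

lemma cis_pi_cong: assumes "even (k - l)" shows "cis (pi * of_int k) = cis (pi * of_int l)"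
proof -
  have "cis (pi * of_int k) = cis (pi * of_int (k - l)) * cis (pi * of_int l)"
    by (simp add: cis_mult algebra_simps)
  then show ?thesis using cis_pi_even[OF assms] by simp
qed

text \<open>The Casimir operator in the Heisenberg frame, for functions with values in any normed space, so that it can be
applied to the scalar components of a spinor.\<close>

definition cas :: "(osc \<Rightarrow> 'b::real_normed_vector) \<Rightarrow> osc \<Rightarrow> 'b" where
  "cas u = (\<lambda>g. hA (hA u) g + hB (hB u) g + 2 *\<^sub>R dZ (dT u) g)"

lemma casimir_linear_image:
  assumes T: "bounded_linear (T :: complex \<Rightarrow> complex ^ 4)" and u: "smooth u"
  shows "casimir (\<lambda>g. T (u g)) g = T (cas u g)"
proof -
  interpret bounded_linear T by (rule T)
  note fl = frame_bounded_linear[OF T]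
  show ?thesis
    unfolding casimir_eq[OF smooth_bounded_linear[OF T u]] fl[OF u] fl[OF smooth_hA[OF u]] fl[OF smooth_hB[OF u]] fl[OF smooth_dird[OF u]]
    by (simp add: cas_def add scaleR)
qed

context theta_family begin

lemma cas_series:
  assumes F: "F \<in> \<T>" shows "cas (\<lambda>x. \<Sum>n. F n x) = (\<lambda>x. \<Sum>n. cas (F n) x)"
proof
  fix x
  note A = \<T>_frame(1)[OF \<T>_frame(1)[OF F]] and B = \<T>_frame(2)[OF \<T>_frame(2)[OF F]]
  note D = \<T>_props(2)[OF \<T>_props(2)[OF F]]
  have "cas (\<lambda>x. \<Sum>n. F n x) x = (\<Sum>n. hA (hA (F n)) x) + (\<Sum>n. hB (hB (F n)) x) + 2 *\<^sub>R (\<Sum>n. dZ (dT (F n)) x)"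
    unfolding cas_def \<T>_frame(3)[OF F] \<T>_frame(3)[OF \<T>_frame(1)[OF F]] \<T>_frame(4)[OF F] \<T>_frame(4)[OF \<T>_frame(2)[OF F]]
      series(2)[OF F] series(2)[OF \<T>_props(2)[OF F]] ..
  also have "\<dots> = (\<Sum>n. cas (F n) x)"
    unfolding cas_def
    by (simp only: suminf_add[OF series(3)[OF A] series(3)[OF B]] suminf_scaleR_right[OF series(3)[OF D]]
      suminf_add[OF summable_add[OF series(3)[OF A] series(3)[OF B]] summable_scaleR_right[OF series(3)[OF D]]])
  finally show "cas (\<lambda>x. \<Sum>n. F n x) x = (\<Sum>n. cas (F n) x)" .
qed

end

lemma has_sum_int_decode: "((\<lambda>n. f (int_decode n)) has_sum S) UNIV \<longleftrightarrow> (f has_sum S) (UNIV :: int set)"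
  using has_sum_reindex_bij_betw[OF bij_int_decode, of f S] by simp

lemma Phi_surj: "g = Phi (snd (snd g)) (Im (fst g)) (Re (fst g)) (ww g)"
  by (cases g) (simp add: Phi_def ww_def)

context osc_quotient begin

abbreviation zt :: "int \<Rightarrow> real" where "zt p \<equiv> pi * real r * of_int p"
abbreviation tf :: "int \<Rightarrow> real" where "tf q \<equiv> of_int q / (2 * real \<kappa>)"
abbreviation sx :: "int \<Rightarrow> real" where "sx k \<equiv> py * pi * of_int k"

text \<open>The parameters \<open>zt p\<close>, \<open>tf q\<close>, \<open>sx k\<close> are chosen such that \<open>l3\<close>, \<open>l4\<close>, \<open>l1\<close> act by the signs \<open>(-1)^p\<close>, \<open>(-1)^q\<close>,
\<open>(-1)^k\<close>.\<close>

lemma wave_lat: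
  "wave (zt p) (tf q) (sx k) h (osc_mult (lat a 0 b c) g) = cis (pi * of_int (k * a + p * b + q * c)) * wave (zt p) (tf q) (sx k) h g"
proof -
  obtain t y x w where g: "g = Phi t y x w" using Phi_surj by blast
  have 1: "sx k * (of_int a * px) = pi * of_int (k * a)" using \<nu> by simp
  have 2: "zt p * (of_int b * pw) = pi * of_int (p * b)" using r by simp
  have 3: "tf q * (pt * of_int c) = pi * of_int (q * c)" using \<kappa> by simp
  have e: "zt p * (w + of_int b * pw) + tf q * (t + pt * of_int c) + sx k * (x + of_int a * px)
     = pi * of_int (k * a + p * b + q * c) + (zt p * w + tf q * t + sx k * x)"
    using 1 2 3 by (simp only: distrib_left of_int_add)
  have l: "osc_mult (lat a 0 b c) g = Phi (t + pt * of_int c) y (x + of_int a * px) (w + of_int b * pw)"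
    unfolding g lat_Phi by simp
  have "u * exp (\<i> * of_real (a + b)) = cis a * (u * exp (\<i> * of_real b))" for u a b
    by (simp add: cis_conv_exp exp_add distrib_left)
  then show ?thesis unfolding l wave_Phi e unfolding g wave_Phi .
qed

text \<open>The translate by \<open>l2^m\<close> of a wave whose profile is a Hermite function, multiplied with the sign of \<open>l2^m\<close>.\<close>

definition theta_term :: "nat \<Rightarrow> int \<Rightarrow> int \<Rightarrow> int \<Rightarrow> int \<Rightarrow> int \<Rightarrow> osc \<Rightarrow> complex" where
  "theta_term j p q k e m g = cis (pi * of_int (e * m)) * wave (zt p) (tf q) (sx k) (\<lambda>y. of_real (hf j (zt p) (sx k) y)) (osc_mult (lat 0 m 0 0) g)"

definition theta :: "nat \<Rightarrow> int \<Rightarrow> int \<Rightarrow> int \<Rightarrow> int \<Rightarrow> osc \<Rightarrow> complex" where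
  "theta j p q k e g = (\<Sum>n. theta_term j p q k e (int_decode n) g)"

text \<open>The logarithm of a term of the theta series, up to a Hermite polynomial; the last summand is the
Gaussian.\<close>

definition theta_exponent :: "int \<Rightarrow> int \<Rightarrow> int \<Rightarrow> int \<Rightarrow> int \<Rightarrow> osc \<Rightarrow> complex" where
  "theta_exponent p q k e m g = \<i> * of_real (zt p * ww g + tf q * snd (snd g) + (sx k - zt p * of_int m * py) * Re (fst g)
      + zt p * \<mu> * (of_int m)\<^sup>2 / 2 - sx k * of_int m * \<mu> * px + pi * of_int (e * m))
    - of_real ((sqrt \<bar>zt p\<bar> * (Im (fst g) - sx k / zt p + of_int m * py))\<^sup>2 / 2)"

lemma theta_term_polyexp:
  "theta_term j p q k e m g = of_real (herm j (sqrt \<bar>zt p\<bar> * (Im (fst g) - sx k / zt p + of_int m * py))) * exp (theta_exponent p q k e m g)"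
proof -
  obtain t y x w where g: "g = Phi t y x w" using Phi_surj by blast
  have l: "osc_mult (lat 0 m 0 0) g = Phi t (y + of_int m * py) (x - \<mu> * of_int m * px) (w - of_int m * py * x + \<mu> * (of_int m)\<^sup>2 / 2)"
    unfolding g lat_Phi by (simp add: algebra_simps)
  let ?u = "sqrt \<bar>zt p\<bar> * (y - sx k / zt p + of_int m * py)"
  have u: "sqrt \<bar>zt p\<bar> * (y + of_int m * py - sx k / zt p) = ?u" by (simp add: algebra_simps)
  have ge: "Im (fst g) = y" "Re (fst g) = x" "snd (snd g) = t" "ww g = w" by (simp_all add: g Phi_def ww_def)
  have ph: "pi * of_int (e * m) + (zt p * (w - of_int m * py * x + \<mu> * (of_int m)\<^sup>2 / 2) + tf q * t + sx k * (x - \<mu> * of_int m * px))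
    = zt p * w + tf q * t + (sx k - zt p * of_int m * py) * x + zt p * \<mu> * (of_int m)\<^sup>2 / 2 - sx k * of_int m * \<mu> * px + pi * of_int (e * m)"
    by (simp add: algebra_simps)
  have "theta_term j p q k e m g = of_real (herm j ?u) * (exp (\<i> * of_real (pi * of_int (e * m) + (zt p * (w - of_int m * py * x + \<mu> * (of_int m)\<^sup>2 / 2) + tf q * t + sx k * (x - \<mu> * of_int m * px)))) * of_real (exp (- (?u)\<^sup>2 / 2)))"
  proof -
    have "cis a * (complex_of_real (b * c) * exp (\<i> * of_real d)) = of_real b * (exp (\<i> * of_real (a + d)) * of_real c)" for a b c d
      by (simp add: cis_conv_exp exp_add distrib_left)
    then show ?thesis unfolding theta_term_def l wave_Phi hf_def u by (simp only:)
  qed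
  also have "exp (\<i> * of_real (pi * of_int (e * m) + (zt p * (w - of_int m * py * x + \<mu> * (of_int m)\<^sup>2 / 2) + tf q * t + sx k * (x - \<mu> * of_int m * px)))) * of_real (exp (- (?u)\<^sup>2 / 2)) = exp (theta_exponent p q k e m g)"
    unfolding theta_exponent_def ge ph exp_of_real[symmetric] exp_add[symmetric] by simp
  finally show ?thesis by (simp only: ge)
qed

lemma theta_exponent_polyfam: "theta_exponent p q k e \<in> polyfam"
proof -
  note P = polyfam_coords polyfam.const polyfam.index polyfam.add polyfam_diff polyfam.mult polyfam_power
  have "(\<lambda>m g. \<i> * (of_real (zt p) * (of_real (fst (snd g)) - of_real (1 / 2) * (of_real (Re (fst g)) * of_real (Im (fst g)))) + of_real (tf q) * of_real (snd (snd g))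
      + (of_real (sx k) - of_real (zt p * py) * of_int m) * of_real (Re (fst g))
      + of_real (zt p * \<mu> / 2) * (of_int m)\<^sup>2 - of_real (sx k * \<mu> * px) * of_int m + of_real (pi * of_int e) * of_int m)
    - of_real (1 / 2) * (of_real (sqrt \<bar>zt p\<bar>) * (of_real (Im (fst g)) - of_real (sx k / zt p) + of_int m * of_real py))\<^sup>2) \<in> polyfam"
    by (intro P)
  also have "(\<lambda>m g. \<i> * (of_real (zt p) * (of_real (fst (snd g)) - of_real (1 / 2) * (of_real (Re (fst g)) * of_real (Im (fst g)))) + of_real (tf q) * of_real (snd (snd g))
      + (of_real (sx k) - of_real (zt p * py) * of_int m) * of_real (Re (fst g))
      + of_real (zt p * \<mu> / 2) * (of_int m)\<^sup>2 - of_real (sx k * \<mu> * px) * of_int m + of_real (pi * of_int e) * of_int m)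
    - of_real (1 / 2) * (of_real (sqrt \<bar>zt p\<bar>) * (of_real (Im (fst g)) - of_real (sx k / zt p) + of_int m * of_real py))\<^sup>2) = theta_exponent p q k e"
    by (intro ext) (simp add: theta_exponent_def ww_def algebra_simps)
  finally show ?thesis .
qed

lemma herm_polyfam: "(\<lambda>m g. of_real (f m g)) \<in> polyfam \<Longrightarrow> (\<lambda>m g. complex_of_real (herm j (f m g))) \<in> polyfam"
proof (induction j rule: less_induct)
  case (less j)
  consider "j = 0" | "j = 1" | i where "j = Suc (Suc i)" by (metis One_nat_def not0_implies_Suc)
  then show ?case
  proof cases
    case 1
    then show ?thesis by (simp add: polyfam.const)
  next
    case 2
    then show ?thesis using polyfam_scale[OF less.prems, of 2] by simp
  next
    case (3 i)
    have "(\<lambda>m g. 2 * (of_real (f m g) * complex_of_real (herm (Suc i) (f m g))) - of_real (2 * real (Suc i)) * complex_of_real (herm i (f m g))) \<in> polyfam"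
      by (intro polyfam_diff polyfam_scale polyfam.mult less.prems less.IH) (simp_all add: 3)
    then show ?thesis by (simp add: 3 mult.assoc)
  qed
qed

text \<open>The Gaussian in \<open>y + m * py\<close> beats \<open>exp (- 2 * \<bar>m\<bar>)\<close>, uniformly on bounded sets.\<close>

lemma theta_family:
  assumes p: "p \<noteq> 0" shows "theta_family (theta_exponent p q k e)"
proof
  show "theta_exponent p q k e \<in> polyfam" by (rule theta_exponent_polyfam)
  fix R
  define a where "a = sqrt \<bar>zt p\<bar>"
  define b where "b = 2 / py"
  define D where "D = \<bar>R\<bar> + \<bar>sx k / zt p\<bar>"
  have a: "a > 0" using p r by (simp add: a_def)
  obtain C where C: "C > 0" "\<And>v. exp (b * \<bar>v\<bar>) * exp (- (a * (v - 0))\<^sup>2 / 2) \<le> C * exp (- \<bar>v\<bar>)"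
    using gaussian_exp_bound[OF a, of b 0] by blast
  have b: "b > 0" "b * py = 2" using periods_pos by (auto simp: b_def)
  show "\<exists>C. \<forall>m g. norm g \<le> R \<longrightarrow> cmod (exp (theta_exponent p q k e m g)) \<le> C * exp (- 2 * \<bar>real_of_int m\<bar>)"
  proof (intro exI[of _ "C * exp (b * D)"] allI impI)
    fix m :: int and g :: osc assume g: "norm g \<le> R"
    define v where "v = Im (fst g) - sx k / zt p + of_int m * py"
    have "\<bar>Im (fst g)\<bar> \<le> \<bar>R\<bar>"
      using abs_Im_le_cmod[of "fst g"] norm_fst_le[of "fst g" "snd g"] g by simp
    moreover have "\<bar>of_int m * py\<bar> = \<bar>real_of_int m\<bar> * py" using periods_pos by (simp add: abs_mult)
    moreover have "\<bar>c\<bar> \<le> \<bar>a - b + c\<bar> + \<bar>a\<bar> + \<bar>b\<bar>" for a b c :: real by linarith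
    from this[of "of_int m * py" "Im (fst g)" "sx k / zt p"]
    have "\<bar>of_int m * py\<bar> \<le> \<bar>v\<bar> + \<bar>Im (fst g)\<bar> + \<bar>sx k / zt p\<bar>" unfolding v_def .
    ultimately have v: "\<bar>real_of_int m\<bar> * py \<le> \<bar>v\<bar> + D" unfolding D_def by linarith
    have "cmod (exp (theta_exponent p q k e m g)) = exp (- (a * v)\<^sup>2 / 2)"
      by (simp add: norm_exp_eq_Re theta_exponent_def v_def a_def)
    also have "\<dots> = exp (- b * \<bar>v\<bar>) * (exp (b * \<bar>v\<bar>) * exp (- (a * (v - 0))\<^sup>2 / 2))"
      by (simp add: exp_add[symmetric])
    also have "\<dots> \<le> exp (- b * \<bar>v\<bar>) * (C * exp (- \<bar>v\<bar>))" by (intro mult_left_mono C) auto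
    also have "\<dots> \<le> exp (- b * \<bar>v\<bar>) * (C * 1)" using C(1) by (intro mult_left_mono) auto
    also have "\<dots> \<le> exp (b * D - 2 * \<bar>real_of_int m\<bar>) * C"
    proof -
      have "b * (\<bar>real_of_int m\<bar> * py) \<le> b * (\<bar>v\<bar> + D)" using v b(1) by (intro mult_left_mono) auto
      moreover have "b * (\<bar>real_of_int m\<bar> * py) = 2 * \<bar>real_of_int m\<bar>" using b(2) by (simp add: mult.left_commute)
      ultimately have "- b * \<bar>v\<bar> \<le> b * D - 2 * \<bar>real_of_int m\<bar>" by (simp add: distrib_left)
      then show ?thesis using C(1) by simp
    qed
    finally show "cmod (exp (theta_exponent p q k e m g)) \<le> C * exp (b * D) * exp (- 2 * \<bar>real_of_int m\<bar>)"
      by (simp add: exp_diff exp_minus field_simps)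
  qed
qed

context
  fixes j :: nat and p q k e :: int
  assumes p: "p \<noteq> 0" and rp: "even (int r * p)"
begin

interpretation theta_family "theta_exponent p q k e" by (rule theta_family[OF p])

abbreviation "\<theta> \<equiv> theta j p q k e"
abbreviation "tt \<equiv> theta_term j p q k e"

lemma tt_poly: "(\<lambda>m g. complex_of_real (herm j (sqrt \<bar>zt p\<bar> * (Im (fst g) - sx k / zt p + of_int m * py)))) \<in> polyfam"
proof (rule herm_polyfam)
  have "(\<lambda>m g::osc. complex_of_real (sqrt \<bar>zt p\<bar>) * (of_real (Im (fst g)) - of_real (sx k / zt p) + of_int m * of_real py)) \<in> polyfam"
    by (intro polyfam_coords polyfam.const polyfam.index polyfam.add polyfam_diff polyfam.mult)
  then show "(\<lambda>m g::osc. complex_of_real (sqrt \<bar>zt p\<bar> * (Im (fst g) - sx k / zt p + of_int m * py))) \<in> polyfam" by simp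
qed

lemma tt_T: "(\<lambda>n. tt (int_decode n)) \<in> \<T>"
  using \<T>I[OF tt_poly] by (simp add: theta_term_polyexp[abs_def])

lemma theta_eq: "\<theta> = (\<lambda>g. \<Sum>n. tt (int_decode n) g)"
  by (simp add: fun_eq_iff theta_def)

lemma theta_smooth: "smooth \<theta>"
  unfolding theta_eq by (rule series(1)[OF tt_T])

lemma tt_dominated: "\<exists>C. \<forall>m g. norm g \<le> R \<longrightarrow> cmod (tt m g) \<le> C * exp (- \<bar>real_of_int m\<bar>)"
  using dominated[OF tt_poly] by (simp add: theta_term_polyexp)

lemma tt_has_sum: "((\<lambda>m. tt m g) has_sum \<theta> g) UNIV"
proof -
  obtain C where C: "\<And>m h. norm h \<le> norm g \<Longrightarrow> cmod (tt m h) \<le> C * exp (- \<bar>real_of_int m\<bar>)"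
    using tt_dominated by blast
  have "summable (\<lambda>n. norm (tt (int_decode n) g))"
    by (rule summable_comparison_test'[OF summable_mult[OF summable_exp_int_decode, of C], of 0]) (use C in simp)
  then have "((\<lambda>n. tt (int_decode n) g) has_sum \<theta> g) UNIV"
    unfolding theta_def by (metis norm_summable_imp_has_sum summable_norm_cancel summable_sums)
  then show ?thesis by (rule has_sum_int_decode[of "\<lambda>m. tt m g", THEN iffD1])
qed

text \<open>The translate of a wave by \<open>l2^m\<close> is again a wave, up to a constant: the shear of \<open>w\<close> changes the frequency in \<open>x\<close>, and this moves the
centre of the Hermite function in agreement with the shift of \<open>y\<close>.\<close>

lemma tt_wave: "tt m = (\<lambda>g. exp (\<i> * of_real (zt p * \<mu> * (of_int m)\<^sup>2 / 2 - sx k * of_int m * \<mu> * px + pi * of_int (e * m))) *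
    wave (zt p) (tf q) (sx k - zt p * of_int m * py) (\<lambda>y. of_real (hf j (zt p) (sx k - zt p * of_int m * py) y)) g)"
proof
  fix g
  have z: "zt p \<noteq> 0" using p r by simp
  have "(sx k - zt p * of_int m * py) / zt p = sx k / zt p - of_int m * py"
    using z by (simp add: diff_divide_distrib)
  then have u: "sqrt \<bar>zt p\<bar> * (y - (sx k - zt p * of_int m * py) / zt p) = sqrt \<bar>zt p\<bar> * (y - sx k / zt p + of_int m * py)" for y
    by simp
  show "tt m g = exp (\<i> * of_real (zt p * \<mu> * (of_int m)\<^sup>2 / 2 - sx k * of_int m * \<mu> * px + pi * of_int (e * m))) *
    wave (zt p) (tf q) (sx k - zt p * of_int m * py) (\<lambda>y. of_real (hf j (zt p) (sx k - zt p * of_int m * py) y)) g"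
    unfolding theta_term_polyexp theta_exponent_def wave_def hf_def u of_real_mult[of "herm j _"] exp_of_real[symmetric]
    by (simp add: exp_add[symmetric] mult.left_commute[of "exp _"] mult.left_commute[of "cor _"] algebra_simps)
qed

text \<open>Each term is an eigenfunction for the same eigenvalue, because the eigenvalue of the oscillator does not depend on its centre.\<close>

lemma theta_cas: "cas \<theta> g = - of_real (\<bar>zt p\<bar> * (2 * real j + 1) + 2 * zt p * tf q) * \<theta> g"
proof -
  let ?l = "\<bar>zt p\<bar> * (2 * real j + 1) + 2 * zt p * tf q"
  have z: "zt p \<noteq> 0" using p r by simp
  have tm: "cas (tt m) g = - of_real ?l * tt m g" for m
  proof -
    define s where "s = sx k - zt p * of_int m * py"
    define C where "C = exp (\<i> * of_real (zt p * \<mu> * (of_int m)\<^sup>2 / 2 - sx k * of_int m * \<mu> * px + pi * of_int (e * m)))"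
    define W where "W = wave (zt p) (tf q) s (\<lambda>y. of_real (hf j (zt p) s y))"
    have tW: "tt m = (\<lambda>g. C * W g)" unfolding tt_wave C_def W_def s_def ..
    obtain h' where h': "\<And>y. ((\<lambda>y. complex_of_real (hf j (zt p) s y)) has_vector_derivative h' y) (at y)"
      "\<And>y. (h' has_vector_derivative of_real ((s - zt p * y)\<^sup>2 - \<bar>zt p\<bar> * (2 * real j + 1)) * complex_of_real (hf j (zt p) s y)) (at y)"
      using hf_ode[OF z, of j s] by blast
    have W: "cas W g = - of_real ?l * W g"
      unfolding cas_def W_def by (rule wave_eigen[OF h']) simp
    have "C \<noteq> 0" by (simp add: C_def)
    then have W': "W = (\<lambda>g. inverse C * tt m g)" unfolding tW by (simp add: fun_eq_iff)
    have "smooth (tt m)" using \<T>_smooth[OF tt_T, of "int_encode m"] by simp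
    then have sW: "smooth W"
      unfolding W' by (rule smooth_bounded_linear[OF bounded_linear_mult_right])
    have bl: "bounded_linear (\<lambda>z. C * z)" by (rule bounded_linear_mult_right)
    note fl = frame_bounded_linear[OF bl]
    have "cas (tt m) g = C * cas W g"
      unfolding tW cas_def fl[OF sW] fl[OF smooth_hA[OF sW]] fl[OF smooth_hB[OF sW]] fl[OF smooth_dird[OF sW]]
      by (simp add: distrib_left)
    also have "\<dots> = - of_real ?l * tt m g" unfolding W tW by simp
    finally show ?thesis .
  qed
  have "cas \<theta> g = (\<Sum>n. - of_real ?l * tt (int_decode n) g)"
    unfolding theta_eq cas_series[OF tt_T] tm ..
  also have "\<dots> = - of_real ?l * \<theta> g"
    unfolding theta_eq by (rule suminf_mult[OF series(3)[OF tt_T]])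
  finally show ?thesis .
qed

text \<open>Commuting \<open>l1^a\<close> past \<open>l2^m\<close> produces the power \<open>- r * m * a\<close> of \<open>l3\<close>. It acts trivially since \<open>r * p\<close> is even.\<close>

lemma tt_lat: "tt m (osc_mult (lat a 0 b c) g) = cis (pi * of_int (k * a + p * b + q * c)) * tt m g"
proof -
  note lm = lat_elt_mult[OF \<nu> r]
  have "osc_mult (lat 0 m 0 0) (osc_mult (lat a 0 b c) g) = osc_mult (lat a 0 (b - int r * m * a) c) (osc_mult (lat 0 m 0 0) g)"
    unfolding osc_mult_assoc[symmetric] lm by (simp add: mult.assoc)
  then have "tt m (osc_mult (lat a 0 b c) g) = cis (pi * of_int (k * a + p * (b - int r * m * a) + q * c)) * tt m g"
    unfolding theta_term_def by (simp add: wave_lat)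
  also have "cis (pi * of_int (k * a + p * (b - int r * m * a) + q * c)) = cis (pi * of_int (k * a + p * b + q * c))"
  proof (rule cis_pi_cong)
    have "k * a + p * (b - int r * m * a) + q * c - (k * a + p * b + q * c) = - (int r * p) * (m * a)" by (simp add: algebra_simps)
    then show "even (k * a + p * (b - int r * m * a) + q * c - (k * a + p * b + q * c))" using rp by simp
  qed
  finally show ?thesis .
qed

lemma theta_lat: "\<theta> (osc_mult (lat a 0 b c) g) = cis (pi * of_int (k * a + p * b + q * c)) * \<theta> g"
  unfolding theta_eq tt_lat by (rule suminf_mult[OF series(3)[OF tt_T]])

text \<open>The action of \<open>l2\<close> shifts the summation index.\<close>

lemma theta_gen2: "\<theta> (osc_mult (lat 0 1 0 0) g) = cis (pi * of_int e) * \<theta> g"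
proof -
  have "tt m (osc_mult (lat 0 1 0 0) g) = cis (- (pi * of_int e)) * tt (m + 1) g" for m
  proof -
    have l: "osc_mult (lat 0 m 0 0) (osc_mult (lat 0 1 0 0) g) = osc_mult (lat 0 (m + 1) 0 0) g"
      unfolding osc_mult_assoc[symmetric] lat_elt_mult[OF \<nu> r] by simp
    have c: "cis (pi * of_int (e * m)) = cis (- (pi * of_int e)) * cis (pi * of_int (e * (m + 1)))"
      by (simp add: cis_mult algebra_simps)
    show ?thesis unfolding theta_term_def l c by (simp only: mult.assoc)
  qed
  moreover have "((\<lambda>m. tt (m + 1) g) has_sum \<theta> g) UNIV"
  proof -
    have "bij_betw (\<lambda>m::int. m + 1) UNIV UNIV" by (rule bij_betwI[of _ _ _ "\<lambda>m. m - 1"]) auto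
    from has_sum_reindex_bij_betw[OF this, of "\<lambda>m. tt m g" "\<theta> g"] show ?thesis using tt_has_sum by simp
  qed
  ultimately have "((\<lambda>m. tt m (osc_mult (lat 0 1 0 0) g)) has_sum cis (- (pi * of_int e)) * \<theta> g) UNIV"
    by (simp add: has_sum_cmult_right)
  then have "\<theta> (osc_mult (lat 0 1 0 0) g) = cis (- (pi * of_int e)) * \<theta> g"
    using tt_has_sum has_sum_unique by blast
  also have "cis (- (pi * of_int e)) = cis (pi * of_int e)" using cis_pi_cong[of "- e" e] by simp
  finally show ?thesis .
qed

end

end

section \<open>The Hilbert space of spinor sections\<close>

lemma inner_cscale: fixes x y :: "complex ^ 'n" shows "(c *s x) \<bullet> y = x \<bullet> (cnj c *s y)"
  by (simp add: inner_vec_def inner_complex_def algebra_simps)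

lemma norm_cscale: fixes x :: "complex ^ 'n" shows "(norm (c *s x))\<^sup>2 = (cmod c)\<^sup>2 * (norm x)\<^sup>2"
  by (simp add: norm_vec_def L2_set_def norm_mult power_mult_distrib sum_distrib_left sum_nonneg)

lemma continuous_cscale: "continuous_on UNIV (\<lambda>x::complex ^ 'n. c *s x)"
proof -
  have "linear (\<lambda>x::complex ^ 'n. c *s x)" by (rule linearI) (auto simp: vec_eq_iff algebra_simps)
  then show ?thesis by (simp add: linear_continuous_on linear_conv_bounded_linear)
qed

lemma bounded_linear_cscale: "bounded_linear (\<lambda>x::complex ^ 'n. c *s x)"
proof -
  have "linear (\<lambda>x::complex ^ 'n. c *s x)" by (rule linearI) (auto simp: vec_eq_iff algebra_simps)
  then show ?thesis by (simp add: linear_conv_bounded_linear)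
qed

lemma norm_add_sq_le: fixes x y :: "'a::real_inner" shows "(norm (x + y))\<^sup>2 \<le> 2 * (norm x)\<^sup>2 + 2 * (norm y)\<^sup>2"
proof -
  have "(norm (x + y))\<^sup>2 + (norm (x - y))\<^sup>2 = 2 * (norm x)\<^sup>2 + 2 * (norm y)\<^sup>2"
    by (simp add: power2_norm_eq_inner algebra_simps inner_commute)
  then show ?thesis by (metis add.commute le_add_same_cancel2 zero_le_power2)
qed

lemma inner_le_sq: fixes x y :: "'a::real_inner" shows "\<bar>x \<bullet> y\<bar> \<le> (norm x)\<^sup>2 + (norm y)\<^sup>2"
proof -
  have "\<bar>x \<bullet> y\<bar> \<le> norm x * norm y" by (rule Cauchy_Schwarz_ineq2)
  also have "\<dots> \<le> (norm x)\<^sup>2 + (norm y)\<^sup>2"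
    using sum_squares_bound[of "norm x" "norm y"] mult_nonneg_nonneg[OF norm_ge_zero[of x] norm_ge_zero[of y]] by linarith
  finally show ?thesis .
qed

locale osc_spin = osc_quotient +
  fixes \<epsilon> :: "osc \<Rightarrow> int"
  assumes \<epsilon>: "\<epsilon> \<in> spin_structures (osc_lattice r \<kappa> \<mu> \<nu>)"
begin

lemma \<epsilon>_hom: "a \<in> L \<Longrightarrow> b \<in> L \<Longrightarrow> \<epsilon> (osc_mult a b) = (\<epsilon> a + \<epsilon> b) mod 2"
  and \<epsilon>_range: "a \<in> L \<Longrightarrow> \<epsilon> a = 0 \<or> \<epsilon> a = 1"
proof -
  show "\<epsilon> (osc_mult a b) = (\<epsilon> a + \<epsilon> b) mod 2" if "a \<in> L" "b \<in> L"
    using \<epsilon> that unfolding spin_structures_def hom_def by (simp add: Osc_def mult_integer_mod_group)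
  show "\<epsilon> a = 0 \<or> \<epsilon> a = 1" if "a \<in> L"
  proof -
    have "\<epsilon> a \<in> {0..<2}" using \<epsilon> that unfolding spin_structures_def hom_def by (auto simp: carrier_integer_mod_group)
    then show ?thesis by auto
  qed
qed

definition sg :: "osc \<Rightarrow> real" where "sg l = (- 1) ^ nat (\<epsilon> l)"

lemma sg_sq: "sg l * sg l = 1" and abs_sg: "\<bar>sg l\<bar> = 1"
  by (simp_all add: sg_def power_mult_distrib[symmetric] power_abs)

lemma sg_mult: "a \<in> L \<Longrightarrow> b \<in> L \<Longrightarrow> sg (osc_mult a b) = sg a * sg b"
  using \<epsilon>_range[of a] \<epsilon>_range[of b] by (auto simp: sg_def \<epsilon>_hom)

lemma one_lat: "lat 0 0 0 0 = (0, 0, 0)" by (simp add: lat_elt_def complex_eq_iff)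

lemma sg_one: "sg (0, 0, 0) = 1"
proof -
  have e: "osc_mult (lat 0 0 0 0) (lat 0 0 0 0) = lat 0 0 0 0" by (simp add: lat_elt_mult[OF \<nu> r])
  have "sg (lat 0 0 0 0) = sg (lat 0 0 0 0) * sg (lat 0 0 0 0)"
    using sg_mult[OF lat_in_L lat_in_L, of 0 0 0 0 0 0 0 0] unfolding e .
  then show ?thesis unfolding sg_sq one_lat .
qed

lemma gens_lat: "gen1 \<nu> = lat 1 0 0 0" "gen2 \<mu> \<nu> = lat 0 1 0 0" "gen3 r = lat 0 0 1 0" "gen4 \<kappa> = lat 0 0 0 1"
  by (simp_all add: gen1_def gen2_def gen3_def gen4_def lat_elt_def complex_eq_iff)

lemma sectionD: "\<psi> \<in> spinor_sections L \<epsilon> \<Longrightarrow> l \<in> L \<Longrightarrow> \<psi> (osc_mult l g) = sg l *\<^sub>R \<psi> g"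
  unfolding spinor_sections_def sg_def by (drule CollectD, drule (1) bspec, erule spec)

lemma sectionI: "(\<And>l g. l \<in> L \<Longrightarrow> \<psi> (osc_mult l g) = sg l *\<^sub>R \<psi> g) \<Longrightarrow> \<psi> \<in> spinor_sections L \<epsilon>"
  unfolding spinor_sections_def sg_def by (rule CollectI, rule ballI, rule allI)

lemma one_mult: "osc_mult (0, 0, 0) g = g"
  by (cases g) (simp add: osc_omega_def)

text \<open>Equivariance is preserved by products and inverses in the lattice.\<close>

lemma section_gensI:
  fixes \<psi> :: "osc \<Rightarrow> complex ^ 4"
  assumes gen: "\<And>g. \<psi> (osc_mult (lat 1 0 0 0) g) = sg (lat 1 0 0 0) *\<^sub>R \<psi> g"
    "\<And>g. \<psi> (osc_mult (lat 0 1 0 0) g) = sg (lat 0 1 0 0) *\<^sub>R \<psi> g"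
    "\<And>g. \<psi> (osc_mult (lat 0 0 1 0) g) = sg (lat 0 0 1 0) *\<^sub>R \<psi> g"
    "\<And>g. \<psi> (osc_mult (lat 0 0 0 1) g) = sg (lat 0 0 0 1) *\<^sub>R \<psi> g"
  shows "\<psi> \<in> spinor_sections L \<epsilon>"
proof -
  interpret group Osc by (rule group_Osc)
  define S where "S = {gen1 \<nu>, gen2 \<mu> \<nu>, gen3 r, gen4 \<kappa>}"
  have L: "L = generate Osc S" by (simp add: osc_lattice_def S_def)
  have genS: "\<psi> (osc_mult l g) = sg l *\<^sub>R \<psi> g" if "l \<in> S" for l g
    using that gen unfolding S_def gens_lat by (elim insertE emptyE) simp_all
  have "\<psi> (osc_mult l g) = sg l *\<^sub>R \<psi> g" if "l \<in> generate Osc S" for l g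
    using that
  proof (induction arbitrary: g rule: generate.induct)
    case one
    have "\<one>\<^bsub>Osc\<^esub> = (0, 0, 0)" by (simp add: Osc_def)
    then show ?case by (simp only: one_mult sg_one scaleR_one)
  next
    case (incl h)
    then show ?case by (rule genS)
  next
    case (inv h)
    define i where "i = inv\<^bsub>Osc\<^esub> h"
    have hi: "osc_mult h i = (0, 0, 0)" using r_inv[of h] by (simp add: Osc_def i_def)
    have hL: "h \<in> L" "i \<in> L" unfolding L i_def by (rule generate.incl[OF inv], rule generate.inv[OF inv])
    have s: "sg h * sg i = 1" using sg_mult[OF hL] unfolding hi sg_one by simp
    have "\<psi> g = \<psi> (osc_mult h (osc_mult i g))"
      unfolding osc_mult_assoc[symmetric] hi one_mult ..
    also have "\<dots> = sg h *\<^sub>R \<psi> (osc_mult i g)" by (rule genS[OF inv])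
    finally have "sg i *\<^sub>R \<psi> g = (sg h * sg i) *\<^sub>R \<psi> (osc_mult i g)" by (simp add: mult.commute)
    then show ?case unfolding s i_def[symmetric] by simp
  next
    case (eng a b)
    then have "a \<in> L" "b \<in> L" unfolding L by auto
    then have "sg (osc_mult a b) = sg a * sg b" by (rule sg_mult)
    moreover have "a \<otimes>\<^bsub>Osc\<^esub> b = osc_mult a b" by (simp add: Osc_def)
    ultimately show ?case by (simp only: osc_mult_assoc eng.IH scaleR_scaleR)
  qed
  then show ?thesis unfolding L[symmetric] by (rule sectionI)
qed

text \<open>The element \<open>l3^r\<close> is a commutator of \<open>l1\<close> and \<open>l2\<close>, so every homomorphism into a commutative group kills it.\<close>

lemma even_r_\<epsilon>3: "even (int r * \<epsilon> (lat 0 0 1 0))"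
proof -
  note lm = lat_elt_mult[OF \<nu> r] and lL = lat_in_L
  have n: "even (\<epsilon> (lat 0 0 (int n) 0) - int n * \<epsilon> (lat 0 0 1 0))" for n
  proof (induction n)
    case 0
    have "\<epsilon> (lat 0 0 0 0) = (\<epsilon> (lat 0 0 0 0) + \<epsilon> (lat 0 0 0 0)) mod 2"
      using \<epsilon>_hom[OF lL lL, of 0 0 0 0 0 0 0 0] by (simp add: lm)
    then show ?case using \<epsilon>_range[OF lL, of 0 0 0 0] by auto
  next
    case (Suc n)
    have "\<epsilon> (lat 0 0 (int (Suc n)) 0) = (\<epsilon> (lat 0 0 (int n) 0) + \<epsilon> (lat 0 0 1 0)) mod 2"
      using \<epsilon>_hom[OF lL lL, of 0 0 "int n" 0 0 0 1 0] by (simp add: lm add.commute)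
    then have "\<epsilon> (lat 0 0 (int (Suc n)) 0) - int (Suc n) * \<epsilon> (lat 0 0 1 0) =
      (\<epsilon> (lat 0 0 (int n) 0) + \<epsilon> (lat 0 0 1 0)) mod 2 - (\<epsilon> (lat 0 0 (int n) 0) + \<epsilon> (lat 0 0 1 0)) + (\<epsilon> (lat 0 0 (int n) 0) - int n * \<epsilon> (lat 0 0 1 0))"
      by (simp add: algebra_simps)
    moreover have "even (a mod 2 - a)" for a :: int by presburger
    ultimately show ?case using Suc by simp
  qed
  have "osc_mult (lat 1 0 0 0) (lat 0 1 0 0) = lat 1 1 0 0" "osc_mult (lat 0 1 0 0) (lat 1 0 0 0) = lat 1 1 (- int r) 0"
    "osc_mult (lat 0 0 (int r) 0) (lat 1 1 (- int r) 0) = lat 1 1 0 0" by (simp_all add: lm)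
  then have "\<epsilon> (lat 1 1 0 0) = (\<epsilon> (lat 1 0 0 0) + \<epsilon> (lat 0 1 0 0)) mod 2" "\<epsilon> (lat 1 1 (- int r) 0) = (\<epsilon> (lat 0 1 0 0) + \<epsilon> (lat 1 0 0 0)) mod 2"
    "\<epsilon> (lat 1 1 0 0) = (\<epsilon> (lat 0 0 (int r) 0) + \<epsilon> (lat 1 1 (- int r) 0)) mod 2"
    using \<epsilon>_hom[OF lL lL] by metis+
  then have "even (\<epsilon> (lat 0 0 (int r) 0))" by presburger
  then show ?thesis using n[of r] by simp
qed

abbreviation "H \<equiv> L2_sections F L \<epsilon>"
abbreviation "D \<equiv> smooth_sections L \<epsilon>"

definition ip :: "(osc \<Rightarrow> complex ^ 4) \<Rightarrow> (osc \<Rightarrow> complex ^ 4) \<Rightarrow> real" where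
  "ip \<psi> \<phi> = (LINT g|MF. \<psi> g \<bullet> \<phi> g)"

lemma H_iff: "\<psi> \<in> H \<longleftrightarrow> \<psi> \<in> spinor_sections L \<epsilon> \<and> \<psi> \<in> borel_measurable borel \<and> integrable MF (\<lambda>g. (norm (\<psi> g))\<^sup>2)"
  unfolding L2_sections_def set_integrable_def by (simp add: integrable_restrict_space)

lemma L2_norm_ip: "L2_norm F \<psi> = sqrt (ip \<psi> \<psi>)"
  unfolding L2_norm_def ip_def set_lebesgue_integral_def by (simp add: integral_restrict_space dot_square_norm)

lemma H_inner_integrable:
  assumes "\<psi> \<in> H" "\<phi> \<in> H" shows "integrable MF (\<lambda>g. \<psi> g \<bullet> \<phi> g)"
proof (rule Bochner_Integration.integrable_bound)
  show "integrable MF (\<lambda>g. (norm (\<psi> g))\<^sup>2 + (norm (\<phi> g))\<^sup>2)" using assms by (auto simp: H_iff)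
  have [measurable]: "\<psi> \<in> borel_measurable borel" "\<phi> \<in> borel_measurable borel" using assms by (auto simp: H_iff)
  show "(\<lambda>g. \<psi> g \<bullet> \<phi> g) \<in> borel_measurable MF" by (rule measurable_MF) measurable
  show "AE g in MF. norm (\<psi> g \<bullet> \<phi> g) \<le> norm ((norm (\<psi> g))\<^sup>2 + (norm (\<phi> g))\<^sup>2)"
    by (rule AE_I2) (use inner_le_sq in \<open>auto simp: real_norm_def\<close>)
qed

text \<open>The norm of a continuous section is a continuous function on the compact quotient.\<close>

lemma bounded_section_H:
  assumes "\<psi> \<in> spinor_sections L \<epsilon>" "continuous_on UNIV \<psi>" shows "\<psi> \<in> H"
proof -
  have m[measurable]: "\<psi> \<in> borel_measurable borel" by (rule borel_measurable_continuous_onI[OF assms(2)])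
  have "L_inv (\<lambda>g. norm (\<psi> g))"
    unfolding L_inv_def using sectionD[OF assms(1)] by (simp add: abs_sg del: split_paired_All)
  then obtain C where C: "\<And>g. norm (\<psi> g) \<le> C" using L_inv_continuous_bounded[OF assms(2)] by blast
  have "integrable MF (\<lambda>g. (norm (\<psi> g))\<^sup>2)"
  proof (rule integrable_MF_bounded[of _ "C\<^sup>2"])
    show "norm ((norm (\<psi> g))\<^sup>2) \<le> C\<^sup>2" for g using power_mono[OF C norm_ge_zero, of g 2] by simp
  qed measurable
  then show ?thesis using assms(1) m by (simp add: H_iff)
qed

lemma D_iff: "\<psi> \<in> D \<longleftrightarrow> \<psi> \<in> spinor_sections L \<epsilon> \<and> smooth \<psi>"
  by (auto simp: smooth_sections_def smooth_def)

lemma D_H: "D \<subseteq> H"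
proof
  fix \<psi> assume "\<psi> \<in> D"
  then show "\<psi> \<in> H" unfolding D_iff by (elim conjE) (intro bounded_section_H smooth_continuous)
qed

lemma section_add: "\<psi> \<in> spinor_sections L \<epsilon> \<Longrightarrow> \<phi> \<in> spinor_sections L \<epsilon> \<Longrightarrow> (\<lambda>g. \<psi> g + \<phi> g) \<in> spinor_sections L \<epsilon>"
  by (rule sectionI) (simp add: sectionD scaleR_add_right)

lemma section_smul: "\<psi> \<in> spinor_sections L \<epsilon> \<Longrightarrow> (\<lambda>g. c *s \<psi> g) \<in> spinor_sections L \<epsilon>"
  by (rule sectionI) (simp add: sectionD vec_eq_iff)

lemma L2_add: assumes "\<psi> \<in> H" "\<phi> \<in> H" shows "(\<lambda>g. \<psi> g + \<phi> g) \<in> H"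
proof -
  have m[measurable]: "\<psi> \<in> borel_measurable borel" "\<phi> \<in> borel_measurable borel" using assms by (auto simp: H_iff)
  have "integrable MF (\<lambda>g. (norm (\<psi> g + \<phi> g))\<^sup>2)"
  proof (rule Bochner_Integration.integrable_bound)
    show "integrable MF (\<lambda>g. 2 * (norm (\<psi> g))\<^sup>2 + 2 * (norm (\<phi> g))\<^sup>2)" using assms by (auto simp: H_iff)
    show "(\<lambda>g. (norm (\<psi> g + \<phi> g))\<^sup>2) \<in> borel_measurable MF" by (rule measurable_MF) measurable
    show "AE g in MF. norm ((norm (\<psi> g + \<phi> g))\<^sup>2) \<le> norm (2 * (norm (\<psi> g))\<^sup>2 + 2 * (norm (\<phi> g))\<^sup>2)"
      by (rule AE_I2) (use norm_add_sq_le in auto)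
  qed
  then show ?thesis using assms section_add by (simp add: H_iff)
qed

lemma L2_smul: assumes "\<psi> \<in> H" shows "(\<lambda>g. c *s \<psi> g) \<in> H"
proof -
  have "(\<lambda>g. c *s \<psi> g) \<in> borel_measurable borel"
    using assms by (intro borel_measurable_continuous_on[OF continuous_cscale]) (simp add: H_iff)
  then show ?thesis using assms section_smul by (simp add: H_iff norm_cscale)
qed

lemma zero_D: "(\<lambda>g. 0) \<in> D"
  by (simp add: D_iff smooth_const sectionI)

lemma nn_sq_ip:
  assumes "\<psi> \<in> H" shows "(\<integral>\<^sup>+g. ennreal ((norm (\<psi> g))\<^sup>2) \<partial>MF) = ennreal (ip \<psi> \<psi>)"
  unfolding ip_def using assms
  by (subst nn_integral_eq_integral) (auto simp: H_iff dot_square_norm)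

lemma ip_self_nonneg: "ip \<psi> \<psi> \<ge> 0"
  unfolding ip_def by simp

text \<open>The Riesz-Fischer theorem for sections. A subsequence \<open>Y\<close> with rapidly decreasing steps converges almost everywhere, since the sum of
its steps is integrable, and Fatou's lemma identifies its limit as the limit of the whole sequence. The limit
has to be a section everywhere, not only almost everywhere, which dictates the choice of \<open>\<psi>\<close>.\<close>

lemma L2_complete:
  assumes X: "\<And>n::nat. X n \<in> H" and
    C: "\<And>e. e > 0 \<Longrightarrow> \<exists>M. \<forall>m\<ge>M. \<forall>n\<ge>M. sqrt (ip (\<lambda>g. X m g - X n g) (\<lambda>g. X m g - X n g)) < e"
  shows "\<exists>\<psi>\<in>H. (\<lambda>n. sqrt (ip (\<lambda>g. X n g - \<psi> g) (\<lambda>g. X n g - \<psi> g))) \<longlonglongrightarrow> 0"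
proof -
  interpret F: finite_measure MF by (rule finite_measure_MF)
  have diff: "(\<lambda>g. \<phi> g - \<psi> g) \<in> H" if "\<phi> \<in> H" "\<psi> \<in> H" for \<phi> \<psi>
    using L2_add[OF that(1) L2_smul[OF that(2), of "-1"]] by (simp add: vec_eq_iff[symmetric])
  have Xm[measurable]: "X n \<in> borel_measurable borel" for n using X by (simp add: H_iff)
  have ex: "\<exists>M. \<forall>m\<ge>M. \<forall>n\<ge>M. ip (\<lambda>g. X m g - X n g) (\<lambda>g. X m g - X n g) < (1/4) ^ k" for k :: nat
  proof -
    obtain M where M: "\<forall>m\<ge>M. \<forall>n\<ge>M. sqrt (ip (\<lambda>g. X m g - X n g) (\<lambda>g. X m g - X n g)) < (1/2) ^ k"
      using C[of "(1/2) ^ k"] by auto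
    have "ip (\<lambda>g. X m g - X n g) (\<lambda>g. X m g - X n g) < (1/4) ^ k" if "m \<ge> M" "n \<ge> M" for m n
    proof -
      have "(sqrt (ip (\<lambda>g. X m g - X n g) (\<lambda>g. X m g - X n g)))\<^sup>2 < ((1/2) ^ k)\<^sup>2"
        using M that by (intro power_strict_mono) (auto simp: ip_self_nonneg)
      then show ?thesis by (simp add: ip_self_nonneg power_mult[symmetric] power2_eq_square power_mult_distrib[symmetric])
    qed
    then show ?thesis by blast
  qed
  obtain M where "\<forall>k. \<forall>m\<ge>M k. \<forall>n\<ge>M k. ip (\<lambda>g. X m g - X n g) (\<lambda>g. X m g - X n g) < (1/4) ^ k"
    by (rule exE[OF choice[OF allI[OF ex]]])
  then have M: "ip (\<lambda>g. X m g - X n g) (\<lambda>g. X m g - X n g) < (1/4) ^ k" if "m \<ge> M k" "n \<ge> M k" for k m n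
    using that by simp
  (* Partial sums make the chosen indices increasing. *)
  define s where "s k = (\<Sum>i\<le>k. M i)" for k
  have sM: "s k \<ge> M k" "s (Suc k) \<ge> M k" for k
    unfolding s_def by (auto intro!: member_le_sum trans_le_add1)
  have sge: "s k \<ge> M i" if "i \<le> k" for i k
    unfolding s_def using that by (intro member_le_sum) auto
  define Y where "Y k = X (s k)" for k
  have YH: "Y k \<in> H" and [measurable]: "Y k \<in> borel_measurable borel" for k using X by (auto simp: Y_def)
  define f where "f k g = Y (Suc k) g - Y k g" for k g
  have fH: "f k \<in> H" for k unfolding f_def using diff YH by blast
  have [measurable]: "f k \<in> borel_measurable borel" for k using fH by (simp add: H_iff)
  have fk: "ip (f k) (f k) < (1/4) ^ k" for k
    unfolding f_def Y_def by (rule M) (use sM in auto)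
  define V where "V = measure MF (space MF)"
  have bound: "(\<integral>\<^sup>+g. ennreal (norm (f k g)) \<partial>MF) \<le> ennreal ((V + 1) * (1/2) ^ k)" for k
  proof -
    have "(\<integral>\<^sup>+g. ennreal (norm (f k g)) \<partial>MF) \<le> (\<integral>\<^sup>+g. ennreal ((1/2) ^ k) + ennreal (2 ^ k) * ennreal ((norm (f k g))\<^sup>2) \<partial>MF)"
    proof (intro nn_integral_mono)
      fix g
      let ?a = "(1/2::real) ^ k" and ?x = "norm (f k g)"
      (* The weighted inequality of arithmetic and geometric means, with weight 2 ^ k, turns the
         square-integral 4 ^ (- k) into an integral of size 2 ^ (- k). *)
      have p: "?a * 2 ^ k = 1" by (simp add: power_mult_distrib[symmetric])
      have "0 \<le> 2 ^ k * (?x - ?a)\<^sup>2" by simp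
      also have "\<dots> = 2 ^ k * ?x\<^sup>2 - 2 * (?a * 2 ^ k) * ?x + (?a * 2 ^ k) * ?a"
        by (simp add: power2_eq_square algebra_simps)
      finally have "0 \<le> 2 ^ k * ?x\<^sup>2 - 2 * 1 * ?x + 1 * ?a" unfolding p .
      moreover have "0 \<le> ?x" by simp
      ultimately have "?x \<le> ?a + 2 ^ k * ?x\<^sup>2" by linarith
      then have "ennreal ?x \<le> ennreal (?a + 2 ^ k * ?x\<^sup>2)" by (rule ennreal_leI)
      then show "ennreal ?x \<le> ennreal ?a + ennreal (2 ^ k) * ennreal (?x\<^sup>2)" by (simp add: ennreal_mult ennreal_plus)
    qed
    also have "\<dots> = ennreal ((1/2) ^ k) * emeasure MF (space MF) + ennreal (2 ^ k) * ennreal (ip (f k) (f k))"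
    proof -
      have [measurable]: "(\<lambda>g. ennreal ((norm (f k g))\<^sup>2)) \<in> borel_measurable MF" by (rule measurable_MF) measurable
      have "(\<integral>\<^sup>+g. ennreal ((1/2) ^ k) + ennreal (2 ^ k) * ennreal ((norm (f k g))\<^sup>2) \<partial>MF)
          = (\<integral>\<^sup>+g. ennreal ((1/2) ^ k) \<partial>MF) + (\<integral>\<^sup>+g. ennreal (2 ^ k) * ennreal ((norm (f k g))\<^sup>2) \<partial>MF)"
        by (rule nn_integral_add) measurable
      also have "\<dots> = ennreal ((1/2) ^ k) * emeasure MF (space MF) + ennreal (2 ^ k) * (\<integral>\<^sup>+g. ennreal ((norm (f k g))\<^sup>2) \<partial>MF)"
        by (rule arg_cong2[of _ _ _ _ "(+)", OF nn_integral_const nn_integral_cmult]) measurable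
      finally show ?thesis unfolding nn_sq_ip[OF fH] .
    qed
    also have "\<dots> \<le> ennreal ((1/2) ^ k) * ennreal V + ennreal (2 ^ k) * ennreal ((1/4) ^ k)"
      using fk[of k] by (intro add_mono mult_left_mono) (auto simp: V_def F.emeasure_eq_measure intro!: ennreal_leI)
    also have "\<dots> = ennreal ((V + 1) * (1/2) ^ k)"
    proof -
      have p: "(2::real) ^ k * (1/4) ^ k = (1/2) ^ k" by (simp add: power_mult_distrib[symmetric])
      have "ennreal ((1/2) ^ k) * ennreal V = ennreal ((1/2) ^ k * V)" "ennreal (2 ^ k) * ennreal ((1/4) ^ k) = ennreal ((1/2) ^ k)"
        by (simp_all add: ennreal_mult[symmetric] V_def p)
      then show ?thesis by (simp add: ennreal_plus[symmetric] V_def algebra_simps del: ennreal_plus)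
    qed
    finally show ?thesis .
  qed
  have mf: "(\<lambda>g. ennreal (norm (f k g))) \<in> borel_measurable MF" for k by (rule measurable_MF) measurable
  have "(\<integral>\<^sup>+g. (\<Sum>k. ennreal (norm (f k g))) \<partial>MF) = (\<Sum>k. \<integral>\<^sup>+g. ennreal (norm (f k g)) \<partial>MF)"
    by (rule nn_integral_suminf[OF mf])
  also have "\<dots> \<le> (\<Sum>k. ennreal ((V + 1) * (1/2) ^ k))" by (intro suminf_le bound) auto
  also have "\<dots> = ennreal (\<Sum>k. (V + 1) * (1/2) ^ k)"
    by (intro suminf_ennreal2 summable_mult) (auto simp: V_def summable_geometric)
  finally have "(\<integral>\<^sup>+g. (\<Sum>k. ennreal (norm (f k g))) \<partial>MF) \<noteq> \<infinity>" by (auto simp: top_unique)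
  then have "AE g in MF. (\<Sum>k. ennreal (norm (f k g))) \<noteq> \<infinity>"
    by (intro nn_integral_PInf_AE borel_measurable_suminf_order mf)
  then have conv: "AE g in MF. convergent (\<lambda>k. Y k g)"
  proof eventually_elim
    case (elim g)
    have "summable (\<lambda>k. norm (f k g))" by (rule summable_suminf_not_top) (use elim in auto)
    then have "summable (\<lambda>k. f k g)" by (rule summable_norm_cancel)
    then have "convergent (\<lambda>n. \<Sum>k<n. f k g)" by (simp add: summable_iff_convergent)
    moreover have "(\<Sum>k<n. f k g) = Y n g - Y 0 g" for n
      unfolding f_def by (rule sum_lessThan_telescope)
    ultimately have "convergent (\<lambda>n. Y n g - Y 0 g)" by simp
    then have "convergent (\<lambda>n. (Y n g - Y 0 g) + Y 0 g)" by (intro convergent_add convergent_const)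
    then show ?case by simp
  qed
  (* Where the sequence diverges, lim is an arbitrary value that need not change sign with the
     sequence. Antisymmetrising makes the pointwise limit equivariant at these points as well. *)
  define \<psi> where "\<psi> g = (1/2) *\<^sub>R (lim (\<lambda>k. Y k g) - lim (\<lambda>k. - Y k g))" for g
  have [measurable]: "\<psi> \<in> borel_measurable borel" unfolding \<psi>_def
    by (intro borel_measurable_scaleR borel_measurable_const borel_measurable_diff borel_measurable_lim_metric borel_measurable_uminus) measurable
  have sec: "\<psi> \<in> spinor_sections L \<epsilon>"
  proof (rule sectionI)
    fix l g assume l: "l \<in> L"
    have Yl: "Y k (osc_mult l g) = sg l *\<^sub>R Y k g" for k using YH l by (simp add: H_iff sectionD)
    have "sg l = 1 \<or> sg l = - 1" using abs_sg[of l] by linarith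
    then show "\<psi> (osc_mult l g) = sg l *\<^sub>R \<psi> g"
      unfolding \<psi>_def Yl by (elim disjE) (simp_all add: algebra_simps)
  qed
  have lim: "AE g in MF. (\<lambda>k. Y k g) \<longlonglongrightarrow> \<psi> g"
    using conv
  proof eventually_elim
    case (elim g)
    then have "(\<lambda>k. Y k g) \<longlonglongrightarrow> lim (\<lambda>k. Y k g)" by (simp add: convergent_LIMSEQ_iff)
    moreover from tendsto_minus[OF this] have "lim (\<lambda>k. - Y k g) = - lim (\<lambda>k. Y k g)" by (rule limI)
    then have "\<psi> g = lim (\<lambda>k. Y k g)" by (simp add: \<psi>_def scaleR_2[symmetric])
    ultimately show ?case by simp
  qed
  have fatou: "(\<integral>\<^sup>+g. ennreal ((norm (X n g - \<psi> g))\<^sup>2) \<partial>MF) \<le> ennreal ((1/4) ^ k)" if n: "n \<ge> M k" for n k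
  proof -
    have "(\<integral>\<^sup>+g. ennreal ((norm (X n g - \<psi> g))\<^sup>2) \<partial>MF) = (\<integral>\<^sup>+g. liminf (\<lambda>i. ennreal ((norm (X n g - Y i g))\<^sup>2)) \<partial>MF)"
    proof (rule nn_integral_cong_AE, use lim in eventually_elim)
      fix g assume "(\<lambda>k. Y k g) \<longlonglongrightarrow> \<psi> g"
      then have "(\<lambda>i. ennreal ((norm (X n g - Y i g))\<^sup>2)) \<longlonglongrightarrow> ennreal ((norm (X n g - \<psi> g))\<^sup>2)"
        by (intro tendsto_ennrealI tendsto_intros)
      then show "ennreal ((norm (X n g - \<psi> g))\<^sup>2) = liminf (\<lambda>i. ennreal ((norm (X n g - Y i g))\<^sup>2))"
        by (rule lim_imp_Liminf[OF sequentially_bot, symmetric])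
    qed
    also have "\<dots> \<le> liminf (\<lambda>i. \<integral>\<^sup>+g. ennreal ((norm (X n g - Y i g))\<^sup>2) \<partial>MF)"
      by (rule nn_integral_liminf) (rule measurable_MF, measurable)
    also have "\<dots> \<le> ennreal ((1/4) ^ k)"
    proof (rule Liminf_le)
      show "\<forall>\<^sub>F i in sequentially. (\<integral>\<^sup>+g. ennreal ((norm (X n g - Y i g))\<^sup>2) \<partial>MF) \<le> ennreal ((1/4) ^ k)"
        unfolding eventually_sequentially
      proof (intro exI[of _ k] allI impI)
        fix i assume "i \<ge> k"
        then have "ip (\<lambda>g. X n g - Y i g) (\<lambda>g. X n g - Y i g) < (1/4) ^ k"
          unfolding Y_def by (intro M n sge)
        then show "(\<integral>\<^sup>+g. ennreal ((norm (X n g - Y i g))\<^sup>2) \<partial>MF) \<le> ennreal ((1/4) ^ k)"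
          unfolding nn_sq_ip[OF diff[OF X YH]] by (intro ennreal_leI) simp
      qed
    qed simp
    finally show ?thesis .
  qed
  have dH: "(\<lambda>g. X n g - \<psi> g) \<in> H" if "n \<ge> M k" for n k
  proof -
    have "integrable MF (\<lambda>g. (norm (X n g - \<psi> g))\<^sup>2)"
      unfolding integrable_iff_bounded
    proof
      show "(\<lambda>g. (norm (X n g - \<psi> g))\<^sup>2) \<in> borel_measurable MF" by (rule measurable_MF) measurable
      show "(\<integral>\<^sup>+g. ennreal (norm ((norm (X n g - \<psi> g))\<^sup>2)) \<partial>MF) < \<infinity>"
        using fatou[OF that] by (simp add: order.strict_trans1)
    qed
    moreover have "(\<lambda>g. X n g - \<psi> g) \<in> spinor_sections L \<epsilon>"
      using X[of n] sec by (intro sectionI) (simp add: H_iff sectionD scaleR_diff_right)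
    ultimately show ?thesis by (simp add: H_iff)
  qed
  have \<psi>H: "\<psi> \<in> H"
    using diff[OF X dH[OF order_refl], of "M 0" 0] by simp
  have "(\<lambda>n. sqrt (ip (\<lambda>g. X n g - \<psi> g) (\<lambda>g. X n g - \<psi> g))) \<longlonglongrightarrow> 0"
    unfolding LIMSEQ_iff
  proof (intro allI impI)
    fix e :: real assume e: "e > 0"
    obtain k where k: "(1/2) ^ k < e" using real_arch_pow_inv[OF e, of "1/2"] by auto
    have "sqrt (ip (\<lambda>g. X n g - \<psi> g) (\<lambda>g. X n g - \<psi> g)) < e" if n: "n \<ge> M k" for n
    proof -
      have "ip (\<lambda>g. X n g - \<psi> g) (\<lambda>g. X n g - \<psi> g) \<le> (1/4) ^ k"
        using fatou[OF n] unfolding nn_sq_ip[OF dH[OF n]] by simp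
      also have "(1/4::real) ^ k = ((1/2) ^ k)\<^sup>2" by (simp add: power_mult[symmetric] power2_eq_square power_mult_distrib[symmetric])
      finally have "sqrt (ip (\<lambda>g. X n g - \<psi> g) (\<lambda>g. X n g - \<psi> g)) \<le> (1/2) ^ k" by (intro real_le_lsqrt) auto
      then show ?thesis using k by simp
    qed
    then show "\<exists>no. \<forall>n\<ge>no. norm (sqrt (ip (\<lambda>g. X n g - \<psi> g) (\<lambda>g. X n g - \<psi> g)) - 0) < e"
      by (intro exI[of _ "M k"]) (simp add: ip_self_nonneg)
  qed
  then show ?thesis using \<psi>H by blast
qed

lemma semi_hilbert_L2: "semi_hilbert H ip"
proof
  show "0 \<in> H" using D_H zero_D by (simp add: zero_fun_def subset_iff)
  show "\<psi> + \<phi> \<in> H" if "\<psi> \<in> H" "\<phi> \<in> H" for \<psi> \<phi> using L2_add[OF that] by (simp add: plus_fun_def)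
  show "smul c \<psi> \<in> H" if "\<psi> \<in> H" for c \<psi> using L2_smul[OF that] by (simp add: smul_def)
  show "ip \<psi> \<phi> = ip \<phi> \<psi>" for \<psi> \<phi> by (simp add: ip_def inner_commute)
  show "ip (\<psi> + \<phi>) \<omega> = ip \<psi> \<omega> + ip \<phi> \<omega>" if "\<psi> \<in> H" "\<phi> \<in> H" "\<omega> \<in> H" for \<psi> \<phi> \<omega>
    using H_inner_integrable[OF that(1,3)] H_inner_integrable[OF that(2,3)] by (simp add: ip_def inner_add_left)
  show "ip (smul c \<psi>) \<phi> = ip \<psi> (smul (cnj c) \<phi>)" for c \<psi> \<phi> by (simp add: ip_def smul_def inner_cscale)
  show "ip (smul (of_real a) \<psi>) \<phi> = a * ip \<psi> \<phi>" for a \<psi> \<phi>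
  proof -
    have "complex_of_real a *s x = a *\<^sub>R x" for x :: "complex ^ 4" by (simp add: vec_eq_iff scaleR_conv_of_real[where 'a=complex])
    then show ?thesis by (simp add: ip_def smul_def)
  qed
  show "ip \<psi> \<psi> \<ge> 0" for \<psi> by (rule ip_self_nonneg)
  fix X assume "\<And>n::nat. X n \<in> H" "\<And>e. e > 0 \<Longrightarrow> \<exists>M. \<forall>m\<ge>M. \<forall>n\<ge>M. sqrt (ip (X m - X n) (X m - X n)) < e"
  then show "\<exists>\<psi>\<in>H. (\<lambda>n. sqrt (ip (X n - \<psi>) (X n - \<psi>))) \<longlonglongrightarrow> 0"
    using L2_complete[of X] by (simp add: fun_diff_def)
qed

lemma lder_D: assumes "\<psi> \<in> D" "V \<in> {vX, vY, vZ, vT}" shows "lder V \<psi> \<in> D"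
proof -
  have sm: "smooth \<psi>" using assms by (simp add: D_iff)
  have "lder V \<psi> (osc_mult l g) = sg l *\<^sub>R lder V \<psi> g" if "l \<in> L" for l g
  proof -
    have "lder V \<psi> (osc_mult l g) = lder V (\<lambda>g. \<psi> (osc_mult l g)) g" by (rule lder_left_translate[symmetric])
    also have "(\<lambda>g. \<psi> (osc_mult l g)) = (\<lambda>g. sg l *\<^sub>R \<psi> g)" using assms(1) that by (simp add: D_iff sectionD)
    also have "lder V \<dots> g = sg l *\<^sub>R lder V \<psi> g" by (simp add: frame_bounded_linear(4)[OF bounded_linear_scaleR_right sm])
    finally show ?thesis .
  qed
  then show ?thesis using smooth_lder[OF sm assms(2)] by (simp add: D_iff sectionI)
qed

text \<open>Integration by parts: the inner product of two sections is lattice-invariant, because the signs cancel.\<close>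

lemma lder_antisymmetric:
  assumes \<psi>: "\<psi> \<in> D" and \<phi>: "\<phi> \<in> D" and V: "V \<in> {vX, vY, vZ, vT}"
  shows "ip (lder V \<psi>) \<phi> = - ip \<psi> (lder V \<phi>)"
proof -
  have sm: "smooth \<psi>" "smooth \<phi>" using assms by (auto simp: D_iff)
  let ?f = "\<lambda>g. \<psi> g \<bullet> \<phi> g"
  have f: "smooth ?f" by (rule smooth_inner[OF sm])
  have "L_inv ?f" unfolding L_inv_def
  proof (intro ballI allI)
    fix l g assume "l \<in> L"
    then have "?f (osc_mult l g) = (sg l * sg l) * ?f g" using \<psi> \<phi> by (simp add: D_iff sectionD)
    then show "?f (osc_mult l g) = ?f g" by (simp only: sg_sq mult_1)
  qed
  then have "(LINT g|MF. lder V ?f g) = 0" by (rule integral_lder_zero[OF f _ V])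
  moreover have "lder V ?f g = \<psi> g \<bullet> lder V \<phi> g + lder V \<psi> g \<bullet> \<phi> g" for g
    unfolding lder_eq[OF f] lder_eq[OF sm(1)] lder_eq[OF sm(2)]
    by (rule dird_bilinear[OF bounded_bilinear_inner smooth_differentiable[OF sm(1)] smooth_differentiable[OF sm(2)]])
  moreover have "integrable MF (\<lambda>g. \<psi> g \<bullet> lder V \<phi> g)" "integrable MF (\<lambda>g. lder V \<psi> g \<bullet> \<phi> g)"
    using lder_D[OF \<psi> V] lder_D[OF \<phi> V] \<psi> \<phi> D_H by (auto intro!: H_inner_integrable)
  ultimately show ?thesis by (simp add: ip_def)
qed

lemma casimir_D: "\<psi> \<in> D \<Longrightarrow> casimir \<psi> = lder vX (lder vX \<psi>) + lder vY (lder vY \<psi>) + smul 2 (lder vZ (lder vT \<psi>))"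
proof
  fix g
  have "2 *\<^sub>R x = 2 *s x" for x :: "complex ^ 4" by (simp add: vec_eq_iff scaleR_conv_of_real[where 'a=complex])
  then show "casimir \<psi> g = (lder vX (lder vX \<psi>) + lder vY (lder vY \<psi>) + smul 2 (lder vZ (lder vT \<psi>))) g"
    by (simp add: casimir_def basis_deriv_lder smul_def)
qed

lemma D_lin: "\<psi> \<in> D \<Longrightarrow> \<phi> \<in> D \<Longrightarrow> \<psi> + \<phi> \<in> D" "\<psi> \<in> D \<Longrightarrow> smul c \<psi> \<in> D"
  by (auto simp: D_iff plus_fun_def smul_def section_add section_smul smooth_add smooth_bounded_linear[OF bounded_linear_cscale])

lemma casimir_in_D: "\<psi> \<in> D \<Longrightarrow> casimir \<psi> \<in> D"
  unfolding casimir_D by (intro D_lin lder_D) auto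

lemma casimir_linear:
  "\<psi> \<in> D \<Longrightarrow> \<phi> \<in> D \<Longrightarrow> casimir (\<psi> + \<phi>) = casimir \<psi> + casimir \<phi>"
  "\<psi> \<in> D \<Longrightarrow> casimir (smul c \<psi>) = smul c (casimir \<psi>)"
proof -
  have a: "lder V (\<psi> + \<phi>) = lder V \<psi> + lder V \<phi>" if "\<psi> \<in> D" "\<phi> \<in> D" for V \<psi> \<phi>
    using that frame_add(4)[of \<psi> \<phi> V] by (simp add: D_iff plus_fun_def)
  have b: "lder V (smul c \<psi>) = smul c (lder V \<psi>)" if "\<psi> \<in> D" for V \<psi> c
    using that frame_bounded_linear(4)[OF bounded_linear_cscale, of \<psi> V c] by (simp add: D_iff smul_def)
  show "casimir (\<psi> + \<phi>) = casimir \<psi> + casimir \<phi>" if "\<psi> \<in> D" "\<phi> \<in> D"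
    using that by (simp only: casimir_D D_lin a lder_D insert_iff simp_thms smul_add) (simp add: add_ac)
  show "casimir (smul c \<psi>) = smul c (casimir \<psi>)" if "\<psi> \<in> D"
    using that by (simp only: casimir_D D_lin b lder_D insert_iff simp_thms smul_add smul_simps mult.commute)
qed

text \<open>Moving both derivatives reverses their order, which matters for \<open>Z\<close> and \<open>T\<close> only, and these commute.\<close>

lemma casimir_symmetric:
  assumes \<psi>: "\<psi> \<in> D" and \<phi>: "\<phi> \<in> D" shows "ip (casimir \<psi>) \<phi> = ip \<psi> (casimir \<phi>)"
proof -
  interpret semi_hilbert H ip by (rule semi_hilbert_L2)
  have inH: "lder V (lder W \<omega>) \<in> H" if "\<omega> \<in> D" "V \<in> {vX, vY, vZ, vT}" "W \<in> {vX, vY, vZ, vT}" for V W \<omega>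
    using that lder_D D_H by blast
  have \<psi>\<phi>: "\<psi> \<in> H" "\<phi> \<in> H" using \<psi> \<phi> D_H by auto
  have s: "ip (lder V (lder W \<psi>)) \<phi> = ip \<psi> (lder W (lder V \<phi>))" if "V \<in> {vX, vY, vZ, vT}" "W \<in> {vX, vY, vZ, vT}" for V W
    using lder_antisymmetric[OF lder_D[OF \<psi> that(2)] \<phi> that(1)] lder_antisymmetric[OF \<psi> lder_D[OF \<phi> that(1)] that(2)] by simp
  have two: "ip (smul 2 \<omega>) \<eta> = 2 * ip \<omega> \<eta>" "ip \<eta> (smul 2 \<omega>) = 2 * ip \<eta> \<omega>" for \<omega> \<eta>
    using ip_real[of 2] ip_real_right[of _ 2] by simp_all
  have "lder vT (lder vZ \<phi>) = lder vZ (lder vT \<phi>)"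
    by (rule ext) (rule lie_brackets(6), use \<phi> in \<open>simp add: D_iff\<close>)
  then show ?thesis
    unfolding casimir_D[OF \<psi>] casimir_D[OF \<phi>]
    using inH[OF \<psi>] inH[OF \<phi>] \<psi>\<phi> s by (simp add: ip_add ip_add_right H_add H_smul two)
qed

end

section \<open>Total families of functions\<close>

text \<open>Countability of the family is what makes totality pass to products: countably many exceptional null sets are
again a null set.\<close>

definition total_family :: "'a measure \<Rightarrow> ('a \<Rightarrow> complex) set \<Rightarrow> bool" where
  "total_family M E \<longleftrightarrow> countable E \<and> (\<forall>e\<in>E. e \<in> borel_measurable M \<and> (\<forall>x. cmod (e x) \<le> 1)) \<and>
    (\<forall>f. integrable M f \<longrightarrow> (\<forall>e\<in>E. (LINT x|M. e x * f x) = 0) \<longrightarrow> (AE x in M. f x = 0))"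

lemma total_familyD:
  assumes "total_family M E" "integrable M f" "\<And>e. e \<in> E \<Longrightarrow> (LINT x|M. e x * f x) = 0"
  shows "AE x in M. f x = 0"
  using assms(1)[unfolded total_family_def, THEN conjunct2, THEN conjunct2, THEN spec, of f] assms(2,3) by simp

lemma total_family_props:
  assumes "total_family M E" shows "countable E" "e \<in> E \<Longrightarrow> e \<in> borel_measurable M" "e \<in> E \<Longrightarrow> cmod (e x) \<le> 1"
  using assms unfolding total_family_def by simp_all

text \<open>Partial expansion: it is enough that the coefficients in the second variable vanish almost everywhere as functions of
the first.\<close>

lemma AE_zero_of_coefficients:
  fixes f :: "'a \<times> 'b \<Rightarrow> complex"
  assumes M: "sigma_finite_measure M" and N: "sigma_finite_measure N" and E: "total_family N E"
    and f: "integrable (M \<Otimes>\<^sub>M N) f"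
    and zero: "\<And>e. e \<in> E \<Longrightarrow> AE x in M. (LINT y|N. e y * f (x, y)) = 0"
  shows "AE z in M \<Otimes>\<^sub>M N. f z = 0"
proof -
  interpret M: sigma_finite_measure M by (rule M)
  interpret N: sigma_finite_measure N by (rule N)
  interpret pair_sigma_finite M N ..
  have [measurable]: "f \<in> borel_measurable (M \<Otimes>\<^sub>M N)" using f by simp
  have "AE x in M. \<forall>e\<in>E. (LINT y|N. e y * f (x, y)) = 0"
    unfolding AE_ball_countable[OF total_family_props(1)[OF E]] using zero by simp
  moreover have "AE x in M. integrable N (\<lambda>y. f (x, y))" by (rule AE_integrable_fst'[OF f])
  ultimately have "AE x in M. AE y in N. f (x, y) = 0"
  proof eventually_elim
    case (elim x)
    show ?case by (rule total_familyD[OF E]) (use elim in simp_all)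
  qed
  moreover have "{z \<in> space (M \<Otimes>\<^sub>M N). f z = 0} \<in> sets (M \<Otimes>\<^sub>M N)"
  proof -
    have "{z \<in> space (M \<Otimes>\<^sub>M N). f z = 0} = f -` {0} \<inter> space (M \<Otimes>\<^sub>M N)" by auto
    also have "\<dots> \<in> sets (M \<Otimes>\<^sub>M N)" by (rule measurable_sets[of f _ borel]) simp_all
    finally show ?thesis .
  qed
  ultimately show ?thesis by (intro AE_pair_measure)
qed

lemma total_family_pair:
  assumes M: "sigma_finite_measure M" and N: "sigma_finite_measure N"
    and E1: "total_family M E1" and E2: "total_family N E2"
  shows "total_family (M \<Otimes>\<^sub>M N) ((\<lambda>(a, b) (x, y). a x * b y) ` (E1 \<times> E2))"
  unfolding total_family_def
proof (intro conjI ballI allI impI)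
  interpret M: sigma_finite_measure M by (rule M)
  interpret N: sigma_finite_measure N by (rule N)
  interpret pair_sigma_finite M N ..
  have m: "a \<in> borel_measurable M" "b \<in> borel_measurable N" "cmod (a x) \<le> 1" "cmod (b y) \<le> 1"
    if "a \<in> E1" "b \<in> E2" for a b x y using that total_family_props[OF E1] total_family_props[OF E2] by simp_all
  show "countable ((\<lambda>(a, b) (x, y). a x * b y) ` (E1 \<times> E2))" using total_family_props(1)[OF E1] total_family_props(1)[OF E2] by simp
  fix e assume "e \<in> (\<lambda>(a, b) (x, y). a x * b y) ` (E1 \<times> E2)"
  then obtain a b where ab: "a \<in> E1" "b \<in> E2" and e: "e = (\<lambda>(x, y). a x * b y)" by auto
  note [measurable] = m(1,2)[OF ab]
  show "e \<in> borel_measurable (M \<Otimes>\<^sub>M N)" unfolding e by measurable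
  show "cmod (e z) \<le> 1" for z
    using mult_mono[OF m(3)[OF ab, of "fst z"] m(4)[OF ab, of "snd z"]] by (cases z) (simp add: e norm_mult)
next
  interpret M: sigma_finite_measure M by (rule M)
  interpret N: sigma_finite_measure N by (rule N)
  interpret pair_sigma_finite M N ..
  have m: "a \<in> borel_measurable M" "b \<in> borel_measurable N" "cmod (a x) \<le> 1" "cmod (b y) \<le> 1"
    if "a \<in> E1" "b \<in> E2" for a b x y using that total_family_props[OF E1] total_family_props[OF E2] by simp_all
  fix f assume f: "integrable (M \<Otimes>\<^sub>M N) f"
    and z: "\<forall>e\<in>(\<lambda>(a, b) (x, y). a x * b y) ` (E1 \<times> E2). (LINT z|(M \<Otimes>\<^sub>M N). e z * f z) = 0"
  show "AE z in M \<Otimes>\<^sub>M N. f z = 0"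
  proof (rule AE_zero_of_coefficients[OF M N E2 f])
    fix b assume b: "b \<in> E2"
    then have [measurable]: "b \<in> borel_measurable N" and b1: "\<And>y. cmod (b y) \<le> 1" using total_family_props[OF E2] by simp_all
    have int: "integrable (M \<Otimes>\<^sub>M N) (\<lambda>z. b (snd z) * f z)"
      by (rule integrable_bounded_mult[OF f]) (measurable, rule b1)
    have "integrable M (\<lambda>x. LINT y|N. b y * f (x, y))" using integrable_fst'[OF int] by simp
    moreover have "(LINT x|M. a x * (LINT y|N. b y * f (x, y))) = 0" if a: "a \<in> E1" for a
    proof -
      note [measurable] = m(1)[OF a b]
      have "integrable (M \<Otimes>\<^sub>M N) (\<lambda>z. a (fst z) * (b (snd z) * f z))"
        by (rule integrable_bounded_mult[OF int]) (measurable, rule m(3)[OF a b])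
      from integral_fst'[OF this] have "(LINT x|M. a x * (LINT y|N. b y * f (x, y))) = (LINT z|(M \<Otimes>\<^sub>M N). a (fst z) * (b (snd z) * f z))"
        by simp
      also have "\<dots> = (LINT z|(M \<Otimes>\<^sub>M N). (\<lambda>(x, y). a x * b y) z * f z)" by (simp add: case_prod_beta mult.assoc)
      also have "\<dots> = 0"
        using bspec[OF z image_eqI[of _ _ "(a, b)"], of "\<lambda>(x, y). a x * b y"] a b by simp
      finally show ?thesis .
    qed
    ultimately show "AE x in M. (LINT y|N. b y * f (x, y)) = 0" by (rule total_familyD[OF E1])
  qed
qed

definition Ivl :: "real \<Rightarrow> real measure" where "Ivl P = restrict_space lborel {0..<P}"

text \<open>The factor \<open>cis (a * x)\<close> twists periodic to quasi-periodic exponentials. With it, one statement covers the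
characters of both parities.\<close>

lemma total_family_interval:
  assumes P: "P > 0"
  shows "total_family (Ivl P) ((\<lambda>n x. cis (a * x) * cis (2 * pi / P * of_int n * x)) ` UNIV)"
  unfolding total_family_def
proof (intro conjI ballI allI impI)
  show "countable ((\<lambda>n x. cis (a * x) * cis (2 * pi / P * of_int n * x)) ` UNIV)" by simp
  fix e assume "e \<in> (\<lambda>n x. cis (a * x) * cis (2 * pi / P * real_of_int n * x)) ` UNIV"
  then obtain n where e: "e = (\<lambda>x. cis (a * x) * cis (2 * pi / P * real_of_int n * x))" by auto
  have "e \<in> borel_measurable borel" unfolding e by (intro borel_measurable_continuous_onI continuous_intros)
  then show "e \<in> borel_measurable (Ivl P)" by (simp add: Ivl_def measurable_restrict_space1)
  show "cmod (e x) \<le> 1" for x by (simp add: e norm_mult)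
next
  fix f assume f: "integrable (Ivl P) f" 
    and z: "\<forall>e\<in>(\<lambda>n x. cis (a * x) * cis (2 * pi / P * real_of_int n * x)) ` UNIV. (LINT x|Ivl P. e x * f x) = 0"
  define g where "g x = indicator {0..<P} x *\<^sub>R (cis (a * x) * f x)" for x
  have c: "(\<lambda>x. cis (a * x)) \<in> borel_measurable (Ivl P)"
  proof -
    have "(\<lambda>x. cis (a * x)) \<in> borel_measurable borel" by (intro borel_measurable_continuous_onI continuous_intros)
    then show ?thesis by (simp add: Ivl_def measurable_restrict_space1)
  qed
  have cf: "integrable (Ivl P) (\<lambda>x. cis (a * x) * f x)" by (rule integrable_bounded_mult[OF f c, of 1]) simp
  have "AE x in lborel. g x = 0"
  proof (rule fourier_coefficients_unique[OF P])
    show "integrable lborel g" using cf unfolding g_def Ivl_def by (simp add: integrable_restrict_space)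
    show "g x = 0" if "x \<notin> {0..<P}" for x using that by (simp add: g_def)
    fix n :: int
    have "(LINT x|lborel. g x * cis (2 * pi / P * of_int n * x)) = (LINT x|Ivl P. (cis (a * x) * cis (2 * pi / P * of_int n * x)) * f x)"
      unfolding Ivl_def by (subst integral_restrict_space) (auto simp: g_def mult_ac intro!: Bochner_Integration.integral_cong)
    also have "\<dots> = 0" by (rule bspec[OF z rangeI[where x=n]])
    finally show "(LINT x|lborel. g x * cis (2 * pi / P * of_int n * x)) = 0" .
  qed
  then show "AE x in Ivl P. f x = 0"
    unfolding Ivl_def by (subst AE_restrict_space_iff) (auto simp: g_def)
qed

lemma sigma_finite_Ivl: "sigma_finite_measure (Ivl P)"
  unfolding Ivl_def by (rule sigma_finite_measure_restrict_space) (simp_all add: sigma_finite_lborel)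

section \<open>Unfolding the fundamental domain to a strip\<close>

lemma measurable_Ivl_borel: "f \<in> M \<rightarrow>\<^sub>M Ivl P \<Longrightarrow> f \<in> borel_measurable M"
  unfolding Ivl_def by (simp add: measurable_restrict_space2_iff)

context osc_quotient begin

abbreviation "Txw \<equiv> Ivl pt \<Otimes>\<^sub>M (Ivl px \<Otimes>\<^sub>M Ivl pw)"
text \<open>The range of \<open>y\<close> in the box number \<open>n\<close>.\<close>

definition I :: "int \<Rightarrow> real set" where "I n = {of_int n * py..<(of_int n + 1) * py}"
abbreviation "YM n \<equiv> restrict_space lborel (I n)"
abbreviation "SM n \<equiv> YM n \<Otimes>\<^sub>M Txw"

text \<open>The coordinates of \<open>Phi\<close> with \<open>y\<close> in front, as the expansion is in \<open>(t, x, w)\<close> for fixed \<open>y\<close>.\<close>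

definition PhiY :: "real \<times> real \<times> real \<times> real \<Rightarrow> osc" where
  "PhiY z = Phi (fst (snd z)) (fst z) (fst (snd (snd z))) (snd (snd (snd z)))"

lemma sigma_finite_YM: "sigma_finite_measure (YM n)"
  unfolding I_def by (rule sigma_finite_measure_restrict_space) (simp_all add: sigma_finite_lborel)

lemma sigma_finite_Txw: "sigma_finite_measure Txw"
  by (intro sigma_finite_pair_measure sigma_finite_Ivl)

lemma I_0: "YM 0 = Ivl py" by (simp add: I_def Ivl_def)

lemma measurable_Txw [measurable]:
  "fst \<in> borel_measurable Txw" "(\<lambda>v. fst (snd v)) \<in> borel_measurable Txw" "(\<lambda>v. snd (snd v)) \<in> borel_measurable Txw"
proof -
  show "fst \<in> borel_measurable Txw" by (rule measurable_Ivl_borel[of _ _ pt]) measurable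
  show "(\<lambda>v. fst (snd v)) \<in> borel_measurable Txw" by (rule measurable_Ivl_borel[of _ _ px]) measurable
  show "(\<lambda>v. snd (snd v)) \<in> borel_measurable Txw" by (rule measurable_Ivl_borel[of _ _ pw]) measurable
qed

lemma measurable_SM_fst: "fst \<in> borel_measurable (SM n)"
proof -
  have "(\<lambda>x. x) \<in> YM n \<rightarrow>\<^sub>M borel" by (rule measurable_restrict_space1) simp
  from measurable_compose[OF measurable_fst this] show ?thesis .
qed

lemma measurable_PhiY: "PhiY \<in> SM n \<rightarrow>\<^sub>M borel"
  unfolding PhiY_def
  by (intro measurable_Phi measurable_SM_fst measurable_compose[OF measurable_snd measurable_Txw(1)]
      measurable_compose[OF measurable_snd measurable_Txw(2)] measurable_compose[OF measurable_snd measurable_Txw(3)])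

lemma nn_MB_SM:
  fixes f :: "osc \<Rightarrow> ennreal"
  assumes f: "f \<in> borel_measurable borel"
  shows "(\<integral>\<^sup>+v. f (Phi4 v) \<partial>MB n) = (\<integral>\<^sup>+z. f (PhiY z) \<partial>SM n)"
proof -
  interpret T: sigma_finite_measure "Ivl pt" by (rule sigma_finite_Ivl)
  interpret X: sigma_finite_measure "Ivl px" by (rule sigma_finite_Ivl)
  interpret W: sigma_finite_measure "Ivl pw" by (rule sigma_finite_Ivl)
  interpret XW: sigma_finite_measure "Ivl px \<Otimes>\<^sub>M Ivl pw" by (intro sigma_finite_pair_measure sigma_finite_Ivl)
  interpret TXW: sigma_finite_measure Txw by (rule sigma_finite_Txw)
  interpret Y: sigma_finite_measure "YM n" by (rule sigma_finite_YM)
  interpret TY: pair_sigma_finite "YM n" "Ivl pt" ..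
  let ?F = "\<lambda>y v. f (Phi (fst v) y (fst (snd v)) (snd (snd v)))"
  have m: "(\<lambda>z. f (PhiY z)) \<in> borel_measurable (SM n)" by (rule measurable_compose[OF measurable_PhiY f])
  have mt: "(\<lambda>v. f (Phi (fst v) y (fst (snd v)) (snd (snd v)))) \<in> borel_measurable Txw" for y
    by (rule measurable_compose[OF measurable_Phi f]) (rule measurable_Txw measurable_const; simp)+
  have mxw: "(\<lambda>v. f (Phi t y (fst v) (snd v))) \<in> borel_measurable (Ivl px \<Otimes>\<^sub>M Ivl pw)" for y t
    by (rule measurable_compose[OF measurable_Phi f]; (simp; fail)?) (auto intro: measurable_Ivl_borel[of _ _ px] measurable_Ivl_borel[of _ _ pw])
  have myt: "(\<lambda>q. f (Phi (snd (fst q)) (fst (fst q)) (fst (snd q)) (snd (snd q)))) \<in> borel_measurable ((YM n \<Otimes>\<^sub>M Ivl pt) \<Otimes>\<^sub>M (Ivl px \<Otimes>\<^sub>M Ivl pw))"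
  proof (rule measurable_compose[OF measurable_Phi f])
    show "(\<lambda>q. snd (fst q)) \<in> borel_measurable ((YM n \<Otimes>\<^sub>M Ivl pt) \<Otimes>\<^sub>M (Ivl px \<Otimes>\<^sub>M Ivl pw))"
      by (rule measurable_Ivl_borel[of _ _ pt]) measurable
    show "(\<lambda>q. fst (snd q)) \<in> borel_measurable ((YM n \<Otimes>\<^sub>M Ivl pt) \<Otimes>\<^sub>M (Ivl px \<Otimes>\<^sub>M Ivl pw))"
      by (rule measurable_Ivl_borel[of _ _ px]) measurable
    show "(\<lambda>q. snd (snd q)) \<in> borel_measurable ((YM n \<Otimes>\<^sub>M Ivl pt) \<Otimes>\<^sub>M (Ivl px \<Otimes>\<^sub>M Ivl pw))"
      by (rule measurable_Ivl_borel[of _ _ pw]) measurable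
    have "(\<lambda>x. x) \<in> YM n \<rightarrow>\<^sub>M borel" by (rule measurable_restrict_space1) simp
    then show "(\<lambda>q. fst (fst q)) \<in> borel_measurable ((YM n \<Otimes>\<^sub>M Ivl pt) \<Otimes>\<^sub>M (Ivl px \<Otimes>\<^sub>M Ivl pw))"
      by (rule measurable_compose[rotated]) measurable
  qed
  have XWf: "(\<integral>\<^sup>+v. f (Phi t y (fst v) (snd v)) \<partial>(Ivl px \<Otimes>\<^sub>M Ivl pw)) = (\<integral>\<^sup>+x. \<integral>\<^sup>+w. f (Phi t y x w) \<partial>Ivl pw \<partial>Ivl px)" for t y
    using W.nn_integral_fst[OF mxw[of t y]] by simp
  have "(\<integral>\<^sup>+z. f (PhiY z) \<partial>SM n) = (\<integral>\<^sup>+y. \<integral>\<^sup>+v. ?F y v \<partial>Txw \<partial>YM n)"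
    using TXW.nn_integral_fst[OF m] by (simp add: PhiY_def)
  also have "\<dots> = (\<integral>\<^sup>+y. \<integral>\<^sup>+t. \<integral>\<^sup>+v. f (Phi t y (fst v) (snd v)) \<partial>(Ivl px \<Otimes>\<^sub>M Ivl pw) \<partial>Ivl pt \<partial>YM n)"
    using XW.nn_integral_fst[OF mt] by (intro nn_integral_cong) simp
  also have "\<dots> = (\<integral>\<^sup>+t. \<integral>\<^sup>+y. \<integral>\<^sup>+v. f (Phi t y (fst v) (snd v)) \<partial>(Ivl px \<Otimes>\<^sub>M Ivl pw) \<partial>YM n \<partial>Ivl pt)"
  proof (rule TY.Fubini'[symmetric])
    show "(\<lambda>(y, t). \<integral>\<^sup>+v. f (Phi t y (fst v) (snd v)) \<partial>(Ivl px \<Otimes>\<^sub>M Ivl pw)) \<in> borel_measurable (YM n \<Otimes>\<^sub>M Ivl pt)"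
      using XW.borel_measurable_nn_integral_fst[OF myt] by (simp add: case_prod_beta)
  qed
  also have "\<dots> = (\<integral>\<^sup>+t. \<integral>\<^sup>+y. \<integral>\<^sup>+x. \<integral>\<^sup>+w. f (Phi t y x w) \<partial>Ivl pw \<partial>Ivl px \<partial>YM n \<partial>Ivl pt)" unfolding XWf ..
  also have "\<dots> = (\<integral>\<^sup>+v. f (Phi4 v) \<partial>MB n)"
    unfolding nn_MB_Phi[OF f] Ivl_def I_def by (simp add: nn_integral_restrict_space)
  finally show ?thesis by simp
qed

lemma box_SM:
  fixes f :: "osc \<Rightarrow> complex"
  assumes f: "f \<in> borel_measurable borel"
  shows "integrable (MB n) (\<lambda>v. f (Phi4 v)) \<longleftrightarrow> integrable (SM n) (\<lambda>z. f (PhiY z))"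
    and "integral\<^sup>L (MB n) (\<lambda>v. f (Phi4 v)) = integral\<^sup>L (SM n) (\<lambda>z. f (PhiY z))"
proof -
  have 1: "(\<lambda>v. f (Phi4 v)) \<in> borel_measurable (MB n)"
    by (rule measurable_MB) (rule measurable_compose[OF measurable_Phi4 f])
  have 2: "(\<lambda>z. f (PhiY z)) \<in> borel_measurable (SM n)" by (rule measurable_compose[OF measurable_PhiY f])
  have eq: "(\<integral>\<^sup>+x. \<eta> (f (Phi4 x)) \<partial>MB n) = (\<integral>\<^sup>+x. \<eta> (f (PhiY x)) \<partial>SM n)" if "\<eta> \<in> borel_measurable borel" for \<eta>
    by (rule nn_MB_SM) (rule measurable_compose[OF f that])
  show "integrable (MB n) (\<lambda>v. f (Phi4 v)) \<longleftrightarrow> integrable (SM n) (\<lambda>z. f (PhiY z))"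
    by (rule integral_transfer(1)[OF 1 2 eq])
  show "integral\<^sup>L (MB n) (\<lambda>v. f (Phi4 v)) = integral\<^sup>L (SM n) (\<lambda>z. f (PhiY z))"
    by (rule integral_transfer(2)[OF 1 2 eq])
qed

lemma Phi4_box_bounded: obtains R where "\<And>v. v \<in> box 0 \<Longrightarrow> norm (Phi4 v) \<le> R"
proof (rule that)
  fix v assume v: "v \<in> box 0"
  obtain t y x w where vv: "v = (t, y, x, w)" by (cases v)
  have b: "0 \<le> t" "t \<le> pt" "0 \<le> y" "y \<le> py" "0 \<le> x" "x \<le> px" "0 \<le> w" "w \<le> pw" using v by (auto simp: box_def vv)
  have "x * y \<le> px * py" using b \<nu> by (intro mult_mono) auto
  moreover have "0 \<le> x * y" using b by simp
  moreover have "norm (Phi t y x w) \<le> cmod (Complex x y) + norm (w + x * y / 2, t)" unfolding Phi_def by (rule norm_Pair_le)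
  moreover have "norm (w + x * y / 2, t) \<le> norm (w + x * y / 2) + norm t" by (rule norm_Pair_le)
  moreover have "cmod (Complex x y) \<le> \<bar>x\<bar> + \<bar>y\<bar>" using cmod_le[of "Complex x y"] by simp
  ultimately show "norm (Phi4 v) \<le> px + py + pw + px * py / 2 + pt" using b by (simp add: vv Phi4_def)
qed

definition strip_index :: "real \<Rightarrow> int" where "strip_index y = \<lfloor>y / py\<rfloor>"

lemma mem_I: "y \<in> I n \<longleftrightarrow> n = strip_index y"
proof -
  have "y \<in> I n \<longleftrightarrow> of_int n \<le> y / py \<and> y / py < of_int n + 1"
    using periods_pos(2) by (simp add: I_def pos_le_divide_eq pos_divide_less_eq)
  also have "\<dots> \<longleftrightarrow> n = strip_index y" unfolding strip_index_def by linarith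
  finally show ?thesis .
qed

lemma strip_single: 
  fixes f :: "real \<Rightarrow> complex"
  shows "(\<lambda>n. indicator (I (int_decode n)) y *\<^sub>R f y) sums f y" "summable (\<lambda>n. norm (indicator (I (int_decode n)) y *\<^sub>R f y))"
proof -
  define N where "N = int_encode (strip_index y)"
  have e: "y \<in> I (int_decode n) \<longleftrightarrow> n = N" for n
    unfolding mem_I N_def by (metis int_decode_inverse int_encode_inverse)
  have 1: "indicator (I (int_decode n)) y *\<^sub>R f y = (if n = N then f y else 0)" for n by (simp add: indicator_def e)
  show "(\<lambda>n. indicator (I (int_decode n)) y *\<^sub>R f y) sums f y" unfolding 1 by (rule sums_single)
  have 2: "norm (indicator (I (int_decode n)) y *\<^sub>R f y) = (if n = N then norm (f y) else 0)" for n by (simp add: indicator_def e)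
  show "summable (\<lambda>n. norm (indicator (I (int_decode n)) y *\<^sub>R f y))" unfolding 2 by (rule sums_summable[OF sums_single])
qed

lemma I_sets [measurable]: "I n \<in> sets borel" by (simp add: I_def)

text \<open>The line is the disjoint union of the intervals \<open>I n\<close>.\<close>

lemma strip_integrable:
  fixes f :: "real \<Rightarrow> complex"
  assumes f: "\<And>n. integrable (YM n) f" and B: "summable (\<lambda>n. LINT y|YM (int_decode n). norm (f y))"
  shows "integrable lborel f" and "(\<lambda>n. LINT y|YM (int_decode n). f y) sums (LINT y|lborel. f y)"
proof -
  let ?g = "\<lambda>n y. indicator (I (int_decode n)) y *\<^sub>R f y"
  have g: "integrable lborel (?g n)" for n using f[of "int_decode n"] by (simp add: integrable_restrict_space)
  have n: "(LINT y|lborel. norm (?g n y)) = (LINT y|YM (int_decode n). norm (f y))" for n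
    by (subst integral_restrict_space) (auto intro!: Bochner_Integration.integral_cong simp: indicator_def)
  have s: "summable (\<lambda>n. LINT y|lborel. norm (?g n y))" unfolding n by (rule B)
  have e: "(\<lambda>y. \<Sum>n. ?g n y) = f" by (rule ext) (rule sums_unique[OF strip_single(1), symmetric])
  have ae: "AE y in lborel. summable (\<lambda>n. norm (?g n y))" by (intro AE_I2 strip_single(2))
  show "integrable lborel f" using integrable_suminf[OF g ae s] unfolding e .
  have i: "integral\<^sup>L lborel (?g n) = (LINT y|YM (int_decode n). f y)" for n by (simp add: integral_restrict_space)
  show "(\<lambda>n. LINT y|YM (int_decode n). f y) sums (LINT y|lborel. f y)"
    using sums_integral[OF g ae s] unfolding e i .
qed

text \<open>For a function with bounded integrals over the intervals \<open>I n\<close>, an exponentially decreasing weight makes the sum over all intervals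
converge.\<close>

lemma strip_weighted_integrable:
  fixes a :: "real \<Rightarrow> complex"
  assumes a: "\<And>n. integrable (YM n) a" and N: "\<And>n. (LINT y|YM n. norm (a y)) \<le> N"
  shows "integrable lborel (\<lambda>y. of_real (exp (- \<bar>y\<bar>)) * a y)"
    and "\<And>h. h \<in> borel_measurable borel \<Longrightarrow> (\<And>y. cmod (h y) \<le> C * exp (- \<bar>y\<bar>)) \<Longrightarrow>
      (\<lambda>n. LINT y|YM (int_decode n). h y * a y) sums (LINT y|lborel. h y * a y)"
proof -
  have *: "(\<forall>n. integrable (YM n) (\<lambda>y. h y * a y)) \<and> summable (\<lambda>n. LINT y|YM (int_decode n). norm (h y * a y))"
    if h: "h \<in> borel_measurable borel" and C: "\<And>y. cmod (h y) \<le> C * exp (- \<bar>y\<bar>)" for h C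
  proof
    have C0: "0 \<le> C" using C[of 0] order_trans[OF norm_ge_zero] by fastforce
    have hm: "h \<in> borel_measurable (YM n)" for n using h by (simp add: measurable_restrict_space1)
    have hC: "cmod (h y) \<le> C" for y
    proof -
      have "C * exp (- \<bar>y\<bar>) \<le> C * 1" using C0 by (intro mult_left_mono) auto
      then show ?thesis using C[of y] by simp
    qed
    show int: "\<forall>n. integrable (YM n) (\<lambda>y. h y * a y)" by (intro allI integrable_bounded_mult[OF a hm hC])
    have b: "(LINT y|YM n. norm (h y * a y)) \<le> C * exp py * N * exp (- (py * \<bar>real_of_int n\<bar>))" for n
    proof -
      let ?K = "C * (exp py * exp (- (py * \<bar>real_of_int n\<bar>)))"
      have p: "norm (h y * a y) \<le> ?K * norm (a y)" if "y \<in> I n" for y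
      proof -
        have 1: "of_int n * py \<le> y" "y < of_int n * py + py" using that by (auto simp: I_def algebra_simps)
        have "py * \<bar>real_of_int n\<bar> = \<bar>of_int n * py\<bar>" using periods_pos(2) by (simp add: abs_mult)
        then have "- \<bar>y\<bar> \<le> py + - (py * \<bar>real_of_int n\<bar>)" using 1 periods_pos(2) by linarith
        then have "exp (- \<bar>y\<bar>) \<le> exp py * exp (- (py * \<bar>real_of_int n\<bar>))" unfolding exp_add[symmetric] by (rule exp_le_cancel_iff[THEN iffD2])
        then have "C * exp (- \<bar>y\<bar>) \<le> ?K" using C0 by (rule mult_left_mono)
        then have "cmod (h y) \<le> ?K" using C[of y] by linarith
        then show ?thesis unfolding norm_mult by (rule mult_right_mono) simp
      qed
      have "(LINT y|YM n. norm (h y * a y)) \<le> (LINT y|YM n. ?K * norm (a y))"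
        by (intro integral_mono integrable_norm spec[OF int] integrable_mult_right a) (use p in \<open>simp add: space_restrict_space\<close>)
      also have "\<dots> = ?K * (LINT y|YM n. norm (a y))" by simp
      also have "\<dots> \<le> ?K * N" using N C0 by (intro mult_left_mono) auto
      finally show ?thesis by (simp add: mult_ac)
    qed
    show "summable (\<lambda>n. LINT y|YM (int_decode n). norm (h y * a y))"
      by (rule summable_comparison_test'[OF summable_mult[OF summable_exp_int_decode_rate[OF periods_pos(2)], of "C * exp py * N"], of 0])
        (use b in \<open>simp add: integral_nonneg_AE\<close>)
  qed
  have e: "(\<lambda>y. complex_of_real (exp (- \<bar>y\<bar>))) \<in> borel_measurable borel" by (intro borel_measurable_continuous_onI continuous_intros)
  have 1: "(\<forall>n. integrable (YM n) (\<lambda>y. of_real (exp (- \<bar>y\<bar>)) * a y)) \<and> summable (\<lambda>n. LINT y|YM (int_decode n). norm (of_real (exp (- \<bar>y\<bar>)) * a y))"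
    by (rule *[OF e, of 1]) simp
  show "integrable lborel (\<lambda>y. of_real (exp (- \<bar>y\<bar>)) * a y)" by (rule strip_integrable(1)) (use 1 in blast)+
  show "(\<lambda>n. LINT y|YM (int_decode n). h y * a y) sums (LINT y|lborel. h y * a y)"
    if h: "h \<in> borel_measurable borel" "\<And>y. cmod (h y) \<le> C * exp (- \<bar>y\<bar>)" for h
    by (rule strip_integrable(2)) (use *[OF h] in blast)+
qed

lemma hf_bound: assumes "\<zeta> \<noteq> 0" shows "\<exists>C. \<forall>y. \<bar>hf j \<zeta> s y\<bar> \<le> C * exp (- \<bar>y\<bar>)"
proof -
  define \<sigma> where "\<sigma> = sqrt \<bar>\<zeta>\<bar>"
  have \<sigma>: "\<sigma> > 0" using assms by (simp add: \<sigma>_def)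
  obtain C1 where C1: "\<And>u. \<bar>herm j u\<bar> \<le> C1 * exp \<bar>u\<bar>" using herm_exp_bound[of 0 j] by auto
  have C10: "0 \<le> C1" using order_trans[OF abs_ge_zero C1[of 0]] by simp
  obtain C2 where C2: "\<And>y. exp (\<sigma> * \<bar>y\<bar>) * exp (- (\<sigma> * (y - s / \<zeta>))\<^sup>2 / 2) \<le> C2 * exp (- \<bar>y\<bar>)"
    using gaussian_exp_bound[OF \<sigma>, of \<sigma> "s / \<zeta>"] by blast
  have "\<bar>hf j \<zeta> s y\<bar> \<le> (C1 * exp (\<sigma> * \<bar>s / \<zeta>\<bar>) * C2) * exp (- \<bar>y\<bar>)" for y
  proof -
    let ?G = "exp (- (\<sigma> * (y - s / \<zeta>))\<^sup>2 / 2)"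
    have "\<bar>\<sigma> * (y - s / \<zeta>)\<bar> = \<sigma> * \<bar>y - s / \<zeta>\<bar>" using \<sigma> by (simp add: abs_mult)
    also have "\<dots> \<le> \<sigma> * (\<bar>s / \<zeta>\<bar> + \<bar>y\<bar>)" using \<sigma> by (intro mult_left_mono) linarith+
    finally have "exp \<bar>\<sigma> * (y - s / \<zeta>)\<bar> \<le> exp (\<sigma> * \<bar>s / \<zeta>\<bar>) * exp (\<sigma> * \<bar>y\<bar>)"
      unfolding exp_add[symmetric] distrib_left by (rule exp_le_cancel_iff[THEN iffD2])
    then have "C1 * exp \<bar>\<sigma> * (y - s / \<zeta>)\<bar> \<le> C1 * (exp (\<sigma> * \<bar>s / \<zeta>\<bar>) * exp (\<sigma> * \<bar>y\<bar>))" using C10 by (rule mult_left_mono)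
    then have "\<bar>herm j (\<sigma> * (y - s / \<zeta>))\<bar> \<le> C1 * (exp (\<sigma> * \<bar>s / \<zeta>\<bar>) * exp (\<sigma> * \<bar>y\<bar>))" using C1 order_trans by blast
    then have "\<bar>herm j (\<sigma> * (y - s / \<zeta>))\<bar> * ?G \<le> C1 * (exp (\<sigma> * \<bar>s / \<zeta>\<bar>) * exp (\<sigma> * \<bar>y\<bar>)) * ?G" by (rule mult_right_mono) simp
    also have "\<dots> = C1 * exp (\<sigma> * \<bar>s / \<zeta>\<bar>) * (exp (\<sigma> * \<bar>y\<bar>) * ?G)" by (simp add: mult_ac)
    also have "\<dots> \<le> C1 * exp (\<sigma> * \<bar>s / \<zeta>\<bar>) * (C2 * exp (- \<bar>y\<bar>))" using C10 C2 by (intro mult_left_mono) auto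
    finally show ?thesis unfolding hf_def \<sigma>_def[symmetric] abs_mult by (simp add: mult_ac)
  qed
  then show ?thesis by blast
qed

text \<open>The conjugate of the exponential factor of a wave.\<close>

definition Epk :: "int \<Rightarrow> int \<Rightarrow> int \<Rightarrow> real \<times> real \<times> real \<Rightarrow> complex" where
  "Epk p q k v = cis (- (zt p * snd (snd v) + tf q * fst v + sx k * fst (snd v)))"

lemma wave_PhiY: "cnj (wave (zt p) (tf q) (sx k) h (PhiY z)) = cnj (h (fst z)) * Epk p q k (snd z)"
  by (simp only: PhiY_def wave_Phi Epk_def cis_conv_exp[symmetric] complex_cnj_mult cis_cnj)

text \<open>The exponents with \<open>p\<close>, \<open>q\<close>, \<open>k\<close> in fixed parity classes are exactly one twisted Fourier basis in each variable, since the
periods are those of the lattice.\<close>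

lemma total_Epk: "\<exists>E. total_family Txw E \<and> (\<forall>e\<in>E. \<exists>p q k. even (p - a) \<and> even (q - b) \<and> even (k - c) \<and> e = Epk p q k)"
proof -
  let ?E = "\<lambda>P d. (\<lambda>n x. cis (d * x) * cis (2 * pi / P * real_of_int n * x)) ` UNIV"
  let ?F = "(\<lambda>(f, g) (x, y). f x * g y) ` (?E pt (- tf b) \<times> ((\<lambda>(f, g) (x, y). f x * g y) ` (?E px (- sx c) \<times> ?E pw (- zt a))))"
  have "total_family Txw ?F"
    by (intro total_family_pair total_family_interval sigma_finite_Ivl sigma_finite_pair_measure periods_pos)
  moreover have "\<exists>p q k. even (p - a) \<and> even (q - b) \<and> even (k - c) \<and> e = Epk p q k" if eF: "e \<in> ?F" for e
  proof -
    obtain l m n where e: "e = (\<lambda>(t, x, w). (cis (- tf b * t) * cis (2 * pi / pt * real_of_int l * t)) *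
      ((cis (- sx c * x) * cis (2 * pi / px * real_of_int m * x)) * (cis (- zt a * w) * cis (2 * pi / pw * real_of_int n * w))))"
      using eF by (auto simp: fun_eq_iff)
    have t: "- tf b * t + 2 * pi / pt * real_of_int l * t = - (tf (b - 2 * l) * t)" for t
      using \<kappa> by (simp add: field_simps)
    have x: "- sx c * x + 2 * pi / px * real_of_int m * x = - (sx (c - 2 * m) * x)" for x
      using \<nu> by (simp add: algebra_simps)
    have w: "- zt a * w + 2 * pi / pw * real_of_int n * w = - (zt (a - 2 * n) * w)" for w
      using r by (simp add: algebra_simps)
    have "e = Epk (a - 2 * n) (b - 2 * l) (c - 2 * m)"
      unfolding e Epk_def cis_mult t x w by (rule ext) (auto intro!: arg_cong[where f=cis] simp: algebra_simps)
    then show ?thesis by (intro exI[of _ "a - 2 * n"] exI[of _ "b - 2 * l"] exI[of _ "c - 2 * m"] conjI) simp_all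
  qed
  ultimately show ?thesis by (intro exI[of _ ?F] conjI ballI)
qed

end

section \<open>Totality of theta functions and torus waves\<close>

lemma exp_line_derivative:
  "((\<lambda>x. c * exp (\<i> * of_real (a * x))) has_vector_derivative (\<i> * of_real a * c) * exp (\<i> * of_real (a * y))) (at y within S)"
proof -
  have "((\<lambda>z. c * exp (\<i> * of_real a * z)) has_field_derivative (\<i> * of_real a * c) * exp (\<i> * of_real a * of_real y)) (at (of_real y))"
    by (auto intro!: derivative_eq_intros)
  from has_vector_derivative_real_field[OF this] show ?thesis by (simp add: mult.assoc)
qed

text \<open>Homomorphisms from the integers to the signs are determined by their value at \<open>1\<close>.\<close>

lemma hom_cis:
  fixes G :: "int \<Rightarrow> real"
  assumes add: "\<And>m. G (m + 1) = G m * G 1" and G0: "G 0 = 1" and G1: "complex_of_real (G 1) = cis (pi * of_int e)" and sq: "G 1 * G 1 = 1"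
  shows "complex_of_real (G n) = cis (pi * of_int (e * n))"
proof (induction n rule: int_induct[where k=0])
  case base
  then show ?case by (simp add: G0)
next
  case (step1 i)
  have "complex_of_real (G (i + 1)) = complex_of_real (G i) * complex_of_real (G 1)" unfolding add by simp
  also have "\<dots> = cis (pi * of_int (e * i) + pi * of_int e)" unfolding step1.IH G1 cis_mult ..
  finally show ?case by (simp add: algebra_simps)
next
  case (step2 i)
  have "G i = G (i - 1) * G 1" using add[of "i - 1"] by simp
  then have "G i * G 1 = G (i - 1) * (G 1 * G 1)" by (simp add: mult.assoc)
  then have "G (i - 1) = G i * G 1" by (simp add: sq)
  then have "complex_of_real (G (i - 1)) = complex_of_real (G i) * complex_of_real (G 1)" by simp
  also have "\<dots> = cis (pi * of_int (e * i) + pi * of_int e)" unfolding step2.IH G1 cis_mult ..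
  also have "\<dots> = cis (pi * of_int (e * i + e))" by (simp add: algebra_simps)
  also have "\<dots> = cis (pi * of_int (e * (i - 1)))" by (rule cis_pi_cong) (simp add: algebra_simps)
  finally show ?case .
qed

context osc_quotient begin

lemma torus_smooth_cas:
  fixes a :: real and h defines "h \<equiv> \<lambda>y. cis (a * y)"
  shows "smooth (wave (zt 0) \<tau> s h)" "cas (wave (zt 0) \<tau> s h) g = - of_real (s\<^sup>2 + a\<^sup>2) * wave (zt 0) \<tau> s h g"
proof -
  let ?Q = "\<lambda>(m::int) (g::osc). \<i> * (of_real a * of_real (Im (fst g)) + of_real \<tau> * of_real (snd (snd g)) + of_real s * of_real (Re (fst g)))"
  have Q: "?Q \<in> polyfam" by (intro polyfam.add polyfam.mult polyfam.const polyfam_coords)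
  have "wave (zt 0) \<tau> s h = (\<lambda>g. 1 * exp (?Q 0 g))"
    by (rule ext) (simp add: wave_def h_def cis_conv_exp exp_add[symmetric] algebra_simps)
  moreover have "smooth (\<lambda>g. (\<lambda>m g. 1) (0::int) g * exp (?Q 0 g))" by (rule smooth_polyexp[OF polyfam.const Q])
  ultimately show "smooth (wave (zt 0) \<tau> s h)" by simp
  have h: "h = (\<lambda>y. 1 * exp (\<i> * of_real (a * y)))" by (simp add: h_def cis_conv_exp)
  show "cas (wave (zt 0) \<tau> s h) g = - of_real (s\<^sup>2 + a\<^sup>2) * wave (zt 0) \<tau> s h g"
    unfolding cas_def h
    by (rule wave_eigen[OF exp_line_derivative exp_line_derivative]) (simp add: power2_eq_square algebra_simps)
qed

end

context osc_spin begin

abbreviation "e1 \<equiv> \<epsilon> (lat 1 0 0 0)"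
abbreviation "e2 \<equiv> \<epsilon> (lat 0 1 0 0)"
abbreviation "e3 \<equiv> \<epsilon> (lat 0 0 1 0)"
abbreviation "e4 \<equiv> \<epsilon> (lat 0 0 0 1)"

lemma sg_cis: assumes "l \<in> L" "even (k - \<epsilon> l)" shows "complex_of_real (sg l) = cis (pi * of_int k)"
proof -
  have "cis (pi * of_int k) = cis (pi * of_int (\<epsilon> l))" by (rule cis_pi_cong[OF assms(2)])
  then show ?thesis using \<epsilon>_range[OF assms(1)] unfolding cis_pi_int by (auto simp: sg_def)
qed

lemma sg_lat_n: "complex_of_real (sg (lat 0 n 0 0)) = cis (pi * of_int (e2 * n))"
  by (rule hom_cis[of "\<lambda>n. sg (lat 0 n 0 0)"])
    (simp_all add: sg_mult[OF lat_in_L lat_in_L, symmetric] lat_elt_mult[OF \<nu> r] one_lat sg_one sg_sq sg_cis[OF lat_in_L])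

lemma sg_lat_abc: "complex_of_real (sg (lat a 0 b c)) = cis (pi * of_int (e1 * a + e3 * b + e4 * c))"
proof -
  have "complex_of_real (sg (lat a 0 0 0)) = cis (pi * of_int (e1 * a))"
    by (rule hom_cis[of "\<lambda>n. sg (lat n 0 0 0)"])
      (simp_all add: sg_mult[OF lat_in_L lat_in_L, symmetric] lat_elt_mult[OF \<nu> r] one_lat sg_one sg_sq sg_cis[OF lat_in_L])
  moreover have "complex_of_real (sg (lat 0 0 b 0)) = cis (pi * of_int (e3 * b))"
    by (rule hom_cis[of "\<lambda>n. sg (lat 0 0 n 0)"])
      (simp_all add: sg_mult[OF lat_in_L lat_in_L, symmetric] lat_elt_mult[OF \<nu> r] one_lat sg_one sg_sq sg_cis[OF lat_in_L])
  moreover have "complex_of_real (sg (lat 0 0 0 c)) = cis (pi * of_int (e4 * c))"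
    by (rule hom_cis[of "\<lambda>n. sg (lat 0 0 0 n)"])
      (simp_all add: sg_mult[OF lat_in_L lat_in_L, symmetric] lat_elt_mult[OF \<nu> r] one_lat sg_one sg_sq sg_cis[OF lat_in_L])
  moreover have "sg (lat a 0 b c) = sg (lat a 0 0 0) * (sg (lat 0 0 b 0) * sg (lat 0 0 0 c))"
    by (simp add: sg_mult[OF lat_in_L lat_in_L, symmetric] lat_elt_mult[OF \<nu> r])
  ultimately show ?thesis by (simp add: cis_mult distrib_left add.assoc)
qed

text \<open>Scalar functions that transform like the components of a section.\<close>

definition eqv :: "(osc \<Rightarrow> complex) \<Rightarrow> bool" where
  "eqv u \<longleftrightarrow> (\<forall>l\<in>L. \<forall>g. u (osc_mult l g) = of_real (sg l) * u g)"

lemma eqvD: "eqv u \<Longrightarrow> l \<in> L \<Longrightarrow> u (osc_mult l g) = of_real (sg l) * u g"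
  unfolding eqv_def by (drule (1) bspec, erule spec)

lemma eqvI: "(\<And>l g. l \<in> L \<Longrightarrow> u (osc_mult l g) = of_real (sg l) * u g) \<Longrightarrow> eqv u"
  unfolding eqv_def by (rule ballI, rule allI)

lemma eqv_gensI:
  assumes "\<And>g. u (osc_mult (lat 1 0 0 0) g) = of_real (sg (lat 1 0 0 0)) * u g"
    "\<And>g. u (osc_mult (lat 0 1 0 0) g) = of_real (sg (lat 0 1 0 0)) * u g"
    "\<And>g. u (osc_mult (lat 0 0 1 0) g) = of_real (sg (lat 0 0 1 0)) * u g"
    "\<And>g. u (osc_mult (lat 0 0 0 1) g) = of_real (sg (lat 0 0 0 1)) * u g"
  shows "eqv u"
proof (rule eqvI)
  fix l g assume l: "l \<in> L"
  have "(\<lambda>g. \<chi> i. u g) \<in> spinor_sections L \<epsilon>"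
    by (rule section_gensI) (simp_all only: assms vec_eq_iff vector_scaleR_component vec_lambda_beta scaleR_conv_of_real[where 'a=complex] simp_thms)
  from arg_cong[OF sectionD[OF this l, of g], of "\<lambda>v. v $ 1"]
  show "u (osc_mult l g) = of_real (sg l) * u g"
    by (simp only: vector_scaleR_component vec_lambda_beta scaleR_conv_of_real[where 'a=complex])
qed

lemma L_inv_mult_cnj: assumes "eqv u" "eqv v" shows "L_inv (\<lambda>g. u g * cnj (v g))"
  unfolding L_inv_def
proof (intro ballI allI)
  fix l g assume l: "l \<in> L"
  have "u (osc_mult l g) * cnj (v (osc_mult l g)) = complex_of_real (sg l * sg l) * (u g * cnj (v g))"
    unfolding eqvD[OF assms(1) l] eqvD[OF assms(2) l] by simp
  then show "u (osc_mult l g) * cnj (v (osc_mult l g)) = u g * cnj (v g)" unfolding sg_sq by simp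
qed

text \<open>The sign of \<open>l3^r\<close> is trivial.\<close>

lemma even_rp: assumes "even (p - e3)" shows "even (int r * p)"
proof -
  have "int r * p = int r * (p - e3) + int r * e3" by (simp add: algebra_simps)
  then show ?thesis using assms even_r_\<epsilon>3 by simp
qed

lemma theta_eqv:
  assumes p: "p \<noteq> 0" and par: "even (p - e3)" "even (q - e4)" "even (k - e1)"
  shows "eqv (theta j p q k e2)"
proof -
  note rp = even_rp[OF par(1)]
  show ?thesis
  proof (rule eqv_gensI)
    show "theta j p q k e2 (osc_mult (lat 1 0 0 0) g) = of_real (sg (lat 1 0 0 0)) * theta j p q k e2 g" for g
      unfolding theta_lat[OF p rp] sg_cis[OF lat_in_L par(3)] by simp
    show "theta j p q k e2 (osc_mult (lat 0 1 0 0) g) = of_real (sg (lat 0 1 0 0)) * theta j p q k e2 g" for g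
      unfolding theta_gen2[OF p rp] by (simp add: sg_cis[OF lat_in_L, of e2])
    show "theta j p q k e2 (osc_mult (lat 0 0 1 0) g) = of_real (sg (lat 0 0 1 0)) * theta j p q k e2 g" for g
      unfolding theta_lat[OF p rp] sg_cis[OF lat_in_L par(1)] by simp
    show "theta j p q k e2 (osc_mult (lat 0 0 0 1) g) = of_real (sg (lat 0 0 0 1)) * theta j p q k e2 g" for g
      unfolding theta_lat[OF p rp] sg_cis[OF lat_in_L par(2)] by simp
  qed
qed

text \<open>The frequency in \<open>y\<close>. The summand \<open>\<mu> * of_int k\<close> compensates the translation of \<open>x\<close> by \<open>l2\<close>.\<close>

definition sy :: "int \<Rightarrow> int \<Rightarrow> real" where "sy k l = pi * (of_int l + \<mu> * of_int k) / py"
text \<open>Eigenfunctions that do not depend on the coordinate \<open>w\<close>. The parameter \<open>zt 0 = 0\<close> is kept for uniformity with the theta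
functions.\<close>

definition torus_wave :: "int \<Rightarrow> int \<Rightarrow> int \<Rightarrow> osc \<Rightarrow> complex" where
  "torus_wave q k l = wave (zt 0) (tf q) (sx k) (\<lambda>y. cis (sy k l * y))"

lemma torus_smooth: "smooth (torus_wave q k l)" unfolding torus_wave_def by (rule torus_smooth_cas)

lemma torus_wave_eqv:
  assumes e3: "e3 = 0" and par: "even (q - e4)" "even (k - e1)" "even (l - e2)"
  shows "eqv (torus_wave q k l)"
proof (rule eqv_gensI)
  show "torus_wave q k l (osc_mult (lat 1 0 0 0) g) = of_real (sg (lat 1 0 0 0)) * torus_wave q k l g" for g
    unfolding torus_wave_def wave_lat sg_cis[OF lat_in_L par(2)] by simp
  show "torus_wave q k l (osc_mult (lat 0 0 1 0) g) = of_real (sg (lat 0 0 1 0)) * torus_wave q k l g" for g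
    unfolding torus_wave_def wave_lat using sg_cis[OF lat_in_L, of 0 0 0 1 0] e3 by simp
  show "torus_wave q k l (osc_mult (lat 0 0 0 1) g) = of_real (sg (lat 0 0 0 1)) * torus_wave q k l g" for g
    unfolding torus_wave_def wave_lat sg_cis[OF lat_in_L par(1)] by simp
  fix g
  obtain t y x w where g: "g = Phi t y x w" using Phi_surj by blast
  have s: "sy k l * (y + py) = sy k l * y + (pi * of_int l + \<mu> * of_int k * pi)"
    using periods_pos(2) by (simp add: sy_def divide_simps) (simp add: algebra_simps)
  have x: "tf q * t + sx k * (x - \<mu> * px) = tf q * t + sx k * x - \<mu> * of_int k * pi"
    using periods_pos(2) by (simp add: divide_simps) (simp add: algebra_simps)
  have "torus_wave q k l (osc_mult (lat 0 1 0 0) g) = cis (sy k l * (y + py) + (tf q * t + sx k * (x - \<mu> * px)))"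
    unfolding g lat_Phi torus_wave_def wave_Phi cis_conv_exp[symmetric] cis_mult by (simp add: algebra_simps)
  also have "\<dots> = cis (pi * of_int l) * cis (sy k l * y + (tf q * t + sx k * x))"
    unfolding s x cis_mult by (simp add: algebra_simps)
  also have "cis (sy k l * y + (tf q * t + sx k * x)) = torus_wave q k l g"
    unfolding g torus_wave_def wave_Phi cis_conv_exp[symmetric] cis_mult by simp
  finally show "torus_wave q k l (osc_mult (lat 0 1 0 0) g) = of_real (sg (lat 0 1 0 0)) * torus_wave q k l g"
    unfolding sg_cis[OF lat_in_L par(3)] .
qed

text \<open>The Fourier coefficients of \<open>u\<close> in the variables \<open>t\<close>, \<open>x\<close>, \<open>w\<close>, as functions of \<open>y\<close>.\<close>

definition coefs :: "(osc \<Rightarrow> complex) \<Rightarrow> int \<Rightarrow> int \<Rightarrow> int \<Rightarrow> real \<Rightarrow> complex" where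
  "coefs u p q k y = (LINT v|Txw. Epk p q k v * u (PhiY (y, v)))"

lemma measurable_Epk: "Epk p q k \<in> borel_measurable Txw"
proof -
  have c: "cis \<in> borel_measurable borel" by (intro borel_measurable_continuous_onI continuous_intros)
  show ?thesis unfolding Epk_def
    by (rule measurable_compose[OF _ c]) (intro borel_measurable_uminus borel_measurable_add borel_measurable_times borel_measurable_const measurable_Txw)
qed

lemma norm_Epk: "cmod (Epk p q k v) = 1" by (simp add: Epk_def)

lemma pair_SM: "pair_sigma_finite (YM n) Txw"
  by (simp add: pair_sigma_finite_def sigma_finite_YM sigma_finite_Txw)

context
  fixes u :: "osc \<Rightarrow> complex"
  assumes um: "u \<in> borel_measurable borel" and ui: "integrable MF u" and ue: "eqv u"
begin

text \<open>The absolute value of \<open>u\<close> is lattice-invariant, so its integral over every box is the integral over the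
quotient.\<close>

lemma u_SM: "integrable (SM n) (\<lambda>z. u (PhiY z))" and u_SM_norm: "(LINT z|SM n. norm (u (PhiY z))) = (LINT g|MF. norm (u g))"
proof -
  define f where "f g = complex_of_real (cmod (u g))" for g
  have fm: "f \<in> borel_measurable borel" unfolding f_def using um by measurable
  have fl: "f (osc_mult l g) = f g" if "l \<in> L" for l g
    unfolding f_def eqvD[OF ue that] by (simp add: norm_mult abs_sg)
  have inv: "L_inv f" unfolding L_inv_def using fl by (intro ballI allI)
  have inv': "f (osc_mult (lat m 0 p q) g) = f g" for m p q g by (rule fl[OF lat_in_L])
  have s: "f (osc_mult (lat 0 n 0 0) g) = f g" for g by (rule fl[OF lat_in_L])
  have fi: "integrable MF f" unfolding f_def using ui by auto
  have i: "integrable (SM n) (\<lambda>z. f (PhiY z))"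
    using fi F_box(1)[OF fm inv] box_strip(1)[OF fm inv', of n] box_SM(1)[OF fm, of n] unfolding s by simp
  have e: "integral\<^sup>L MF f = (LINT z|SM n. f (PhiY z))"
    using F_box(2)[OF fm inv] box_strip(2)[OF fm inv', of n] box_SM(2)[OF fm, of n] unfolding s by simp
  have m: "(\<lambda>z. u (PhiY z)) \<in> borel_measurable (SM n)" by (rule measurable_compose[OF measurable_PhiY um])
  have "integrable (SM n) (\<lambda>z. norm (f (PhiY z)))" using i by (rule integrable_norm)
  then show "integrable (SM n) (\<lambda>z. u (PhiY z))" using m by (simp add: f_def integrable_norm_iff)
  show "(LINT z|SM n. norm (u (PhiY z))) = (LINT g|MF. norm (u g))" using e unfolding f_def by simp
qed

lemma wave_SM:
  assumes h: "h \<in> borel_measurable borel" "\<And>y. cmod (h y) \<le> B"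
  shows "(LINT z|SM n. u (PhiY z) * cnj (wave (zt p) (tf q) (sx k) h (PhiY z))) = (LINT y|YM n. cnj (h y) * coefs u p q k y)"
proof -
  interpret pair_sigma_finite "YM n" Txw by (rule pair_SM)
  have m: "(\<lambda>z. cnj (h (fst z)) * Epk p q k (snd z)) \<in> borel_measurable (SM n)"
  proof -
    have "(\<lambda>y. cnj (h y)) \<in> borel_measurable borel" by (rule measurable_compose[OF h(1)]) (intro borel_measurable_continuous_onI continuous_intros)
    from measurable_compose[OF measurable_SM_fst this] show ?thesis
      by (intro borel_measurable_times measurable_compose[OF measurable_snd measurable_Epk])
  qed
  have "integrable (SM n) (\<lambda>z. (cnj (h (fst z)) * Epk p q k (snd z)) * u (PhiY z))"
    by (rule integrable_bounded_mult[OF u_SM m]) (use h(2) in \<open>simp add: norm_mult norm_Epk\<close>)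
  from integral_fst'[OF this] show ?thesis
    unfolding wave_PhiY coefs_def by (simp add: mult_ac)
qed

lemma coefs_YM: "integrable (YM n) (coefs u p q k)" and coefs_YM_norm: "(LINT y|YM n. norm (coefs u p q k y)) \<le> (LINT g|MF. norm (u g))"
proof -
  interpret pair_sigma_finite "YM n" Txw by (rule pair_SM)
  let ?f = "\<lambda>z. Epk p q k (snd z) * u (PhiY z)"
  have i: "integrable (SM n) ?f"
    by (rule integrable_bounded_mult[OF u_SM measurable_compose[OF measurable_snd measurable_Epk], where B=1]) (simp add: norm_Epk)
  show c: "integrable (YM n) (coefs u p q k)" using integrable_fst'[OF i] by (simp add: coefs_def[abs_def])
  have n: "integrable (SM n) (\<lambda>z. norm (?f z))" using i by (rule integrable_norm)
  have "(LINT y|YM n. norm (coefs u p q k y)) \<le> (LINT y|YM n. LINT v|Txw. norm (?f (y, v)))"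
  proof (rule integral_mono)
    show "integrable (YM n) (\<lambda>y. norm (coefs u p q k y))" using c by (rule integrable_norm)
    show "integrable (YM n) (\<lambda>y. LINT v|Txw. norm (?f (y, v)))" by (rule integrable_fst'[OF n])
    show "norm (coefs u p q k y) \<le> (LINT v|Txw. norm (?f (y, v)))" for y
      unfolding coefs_def using integral_norm_bound[of Txw "\<lambda>v. Epk p q k v * u (PhiY (y, v))"] by simp
  qed
  also have "\<dots> = (LINT z|SM n. norm (?f z))" by (rule integral_fst'[OF n])
  also have "\<dots> = (LINT z|SM n. norm (u (PhiY z)))" by (simp add: norm_mult norm_Epk)
  finally show "(LINT y|YM n. norm (coefs u p q k y)) \<le> (LINT g|MF. norm (u g))" unfolding u_SM_norm .
qed

lemma hf_continuous: "continuous_on UNIV (hf j \<zeta> s)"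
proof -
  have "continuous_on UNIV (herm j)"
    by (intro continuous_at_imp_continuous_on ballI DERIV_isCont[OF herm_deriv])
  then have "continuous_on UNIV (\<lambda>y. herm j (sqrt \<bar>\<zeta>\<bar> * (y - s / \<zeta>)))"
    by (rule continuous_on_compose2) (auto intro!: continuous_intros)
  then show ?thesis unfolding hf_def[abs_def] by (intro continuous_intros) auto
qed

text \<open>Unfolding. The theta function is a sum of translates of a single wave by the powers \<open>l2^m\<close>. Since \<open>u\<close> is equivariant, the
integral over the box number \<open>0\<close> of \<open>u\<close> against the term of index \<open>m\<close> is the integral over the box number \<open>m\<close> of
\<open>u\<close> against the wave itself. Summation and integration commute by the exponential decay of the
terms.\<close>

lemma theta_pairing:
  assumes p: "p \<noteq> 0" and par: "even (p - e3)" "even (q - e4)" "even (k - e1)"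
  shows "(\<lambda>n. LINT y|YM (int_decode n). cnj (of_real (hf j (zt p) (sx k) y)) * coefs u p q k y) sums (LINT g|MF. u g * cnj (theta j p q k e2 g))"
proof -
  note rp = even_rp[OF par(1)]
  have zp: "zt p \<noteq> 0" using p r by simp
  let ?th = "theta j p q k e2" and ?tt = "theta_term j p q k e2"
  let ?h = "\<lambda>y. complex_of_real (hf j (zt p) (sx k) y)"
  let ?W = "wave (zt p) (tf q) (sx k) ?h"
  have thmeas: "?th \<in> borel_measurable borel"
    by (rule borel_measurable_continuous_onI[OF smooth_continuous[OF theta_smooth[OF p rp]]])
  have c: "cnj \<in> borel_measurable borel" by (intro borel_measurable_continuous_onI continuous_intros)
  have hm: "?h \<in> borel_measurable borel"
    by (rule borel_measurable_continuous_onI) (intro continuous_on_of_real hf_continuous)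
  have "?W = (\<lambda>g. ?h (Im (fst g)) * exp (\<i> * of_real (zt p * ww g + tf q * snd (snd g) + sx k * Re (fst g))))"
    by (rule ext) (rule wave_def)
  moreover have "continuous_on UNIV \<dots>"
    unfolding ww_def by (intro continuous_intros continuous_on_compose2[OF hf_continuous]) auto
  ultimately have Wc: "continuous_on UNIV ?W" by simp
  have Wm: "?W \<in> borel_measurable borel" by (rule borel_measurable_continuous_onI[OF Wc])
  have ttm: "?tt m \<in> borel_measurable borel" for m
    unfolding theta_term_def[abs_def] by (intro borel_measurable_times borel_measurable_const measurable_compose[OF measurable_osc_mult(1) Wm])
  obtain R where R: "\<And>v. v \<in> box 0 \<Longrightarrow> norm (Phi4 v) \<le> R" using Phi4_box_bounded by blast
  obtain C where C: "\<And>m g. norm g \<le> R \<Longrightarrow> cmod (?tt m g) \<le> C * exp (- \<bar>real_of_int m\<bar>)"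
    using tt_dominated[OF p rp, of R j q k e2] by blast
  have inv: "L_inv (\<lambda>g. u g * cnj (?th g))" by (rule L_inv_mult_cnj[OF ue theta_eqv[OF p par]])
  have um': "(\<lambda>g. u g * cnj (?th g)) \<in> borel_measurable borel"
    by (intro borel_measurable_times um measurable_compose[OF thmeas c])
  have eq1: "(LINT g|MF. u g * cnj (?th g)) = (LINT v|MB 0. u (Phi4 v) * cnj (?th (Phi4 v)))"
    by (rule F_box(2)[OF um' inv])
  define f where "f g = u g * cnj (?W g)" for g
  have fm: "f \<in> borel_measurable borel" unfolding f_def by (intro borel_measurable_times um measurable_compose[OF Wm c])
  have f_inv: "f (osc_mult (lat a 0 b d) g) = f g" for a b d g
  proof -
    have "cis (pi * of_int (e1 * a + e3 * b + e4 * d)) = cis (pi * of_int (k * a + p * b + q * d))"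
    proof (rule cis_pi_cong)
      have "e1 * a + e3 * b + e4 * d - (k * a + p * b + q * d) = - ((k - e1) * a + (p - e3) * b + (q - e4) * d)" by (simp add: algebra_simps)
      then show "even (e1 * a + e3 * b + e4 * d - (k * a + p * b + q * d))" using par by simp
    qed
    then have "complex_of_real (sg (lat a 0 b d)) * cnj (cis (pi * of_int (k * a + p * b + q * d))) = 1"
      unfolding sg_lat_abc by (simp add: cis_cnj cis_mult)
    moreover have "f (osc_mult (lat a 0 b d) g) =
      (complex_of_real (sg (lat a 0 b d)) * cnj (cis (pi * of_int (k * a + p * b + q * d)))) * f g"
      unfolding f_def eqvD[OF ue lat_in_L] wave_lat by (simp only: complex_cnj_mult mult_ac)
    ultimately show ?thesis by (simp only: mult_1)
  qed
  have ftt: "u (Phi4 v) * cnj (?tt m (Phi4 v)) = f (osc_mult (lat 0 m 0 0) (Phi4 v))" for m v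
  proof -
    have "complex_of_real (sg (lat 0 m 0 0)) = cnj (complex_of_real (sg (lat 0 m 0 0)))" by simp
    then have "complex_of_real (sg (lat 0 m 0 0)) = cnj (cis (pi * of_int (e2 * m)))" unfolding sg_lat_n .
    then show ?thesis unfolding f_def eqvD[OF ue lat_in_L] theta_term_def by (simp only: complex_cnj_mult mult_ac)
  qed
  have N: "integrable (MB 0) (\<lambda>v. u (Phi4 v))" using u_SM[of 0] box_SM(1)[OF um, of 0] by simp
  have Ni: "integrable (MB 0) (\<lambda>v. norm (u (Phi4 v)))" using N by (rule integrable_norm)
  have dom: "norm (u (Phi4 v) * cnj (?tt m (Phi4 v))) \<le> (C * exp (- \<bar>real_of_int m\<bar>)) * norm (u (Phi4 v))" if "v \<in> box 0" for v m
    using mult_right_mono[OF C[OF R[OF that], of m], of "cmod (u (Phi4 v))"] by (simp add: norm_mult mult_ac)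
  have sp: "space (MB 0) = box 0" by (simp add: space_restrict_space)
  have int: "integrable (MB 0) (\<lambda>v. u (Phi4 v) * cnj (?tt m (Phi4 v)))" for m
  proof (rule Bochner_Integration.integrable_bound)
    show "integrable (MB 0) (\<lambda>v. (C * exp (- \<bar>real_of_int m\<bar>)) * norm (u (Phi4 v)))" using Ni by (rule integrable_mult_right)
    show "(\<lambda>v. u (Phi4 v) * cnj (?tt m (Phi4 v))) \<in> borel_measurable (MB 0)"
      by (rule measurable_MB) (intro borel_measurable_times measurable_compose[OF measurable_Phi4 um] measurable_compose[OF measurable_compose[OF measurable_Phi4 ttm] c])
    show "AE v in MB 0. norm (u (Phi4 v) * cnj (?tt m (Phi4 v))) \<le> norm ((C * exp (- \<bar>real_of_int m\<bar>)) * norm (u (Phi4 v)))"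
    proof (rule AE_I2)
      fix v assume "v \<in> space (MB 0)"
      then show "norm (u (Phi4 v) * cnj (?tt m (Phi4 v))) \<le> norm ((C * exp (- \<bar>real_of_int m\<bar>)) * norm (u (Phi4 v)))"
        unfolding sp real_norm_def by (rule order_trans[OF dom abs_ge_self])
    qed
  qed
  have hs: "(\<lambda>n. u (Phi4 v) * cnj (?tt (int_decode n) (Phi4 v))) sums (u (Phi4 v) * cnj (?th (Phi4 v)))" for v
    using tt_has_sum[OF p rp, of j q k e2 "Phi4 v", folded has_sum_int_decode, THEN has_sum_imp_sums]
    by (intro sums_mult bounded_linear.sums[OF bounded_linear_cnj])
  have sm: "summable (\<lambda>n. norm (u (Phi4 v) * cnj (?tt (int_decode n) (Phi4 v))))" if "v \<in> box 0" for v
    by (rule summable_comparison_test'[OF summable_mult[OF summable_exp_int_decode, of "C * norm (u (Phi4 v))"], of 0])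
      (use dom[OF that] in \<open>simp add: mult_ac\<close>)
  have ism: "summable (\<lambda>n. LINT v|MB 0. norm (u (Phi4 v) * cnj (?tt (int_decode n) (Phi4 v))))"
  proof (rule summable_comparison_test'[OF summable_mult[OF summable_exp_int_decode, of "C * (LINT v|MB 0. norm (u (Phi4 v)))"], of 0])
    fix n :: nat
    have "(LINT v|MB 0. norm (u (Phi4 v) * cnj (?tt (int_decode n) (Phi4 v)))) \<le> (LINT v|MB 0. (C * exp (- \<bar>real_of_int (int_decode n)\<bar>)) * norm (u (Phi4 v)))"
      by (rule integral_mono[OF integrable_norm[OF int] integrable_mult_right[OF Ni]]) (use dom sp in simp)
    also have "\<dots> = C * exp (- \<bar>real_of_int (int_decode n)\<bar>) * (LINT v|MB 0. norm (u (Phi4 v)))" by (rule integral_mult_right_zero)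
    finally show "norm (LINT v|MB 0. norm (u (Phi4 v) * cnj (?tt (int_decode n) (Phi4 v)))) \<le> C * (LINT v|MB 0. norm (u (Phi4 v))) * exp (- \<bar>real_of_int (int_decode n)\<bar>)"
      by (simp add: mult_ac integral_nonneg_AE)
  qed
  have "(\<lambda>n. LINT v|MB 0. u (Phi4 v) * cnj (?tt (int_decode n) (Phi4 v))) sums (LINT v|MB 0. (\<Sum>n. u (Phi4 v) * cnj (?tt (int_decode n) (Phi4 v))))"
    by (rule sums_integral[OF int _ ism]) (rule AE_I2, rule sm, simp add: sp)
  moreover have "(LINT v|MB 0. (\<Sum>n. u (Phi4 v) * cnj (?tt (int_decode n) (Phi4 v)))) = (LINT v|MB 0. u (Phi4 v) * cnj (?th (Phi4 v)))"
    unfolding sums_unique[OF hs, symmetric] ..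
  moreover have "(LINT v|MB 0. u (Phi4 v) * cnj (?tt m (Phi4 v))) = (LINT y|YM m. cnj (?h y) * coefs u p q k y)" for m
  proof -
    obtain B where B: "\<And>y. \<bar>hf j (zt p) (sx k) y\<bar> \<le> B * exp (- \<bar>y\<bar>)" using hf_bound[OF zp, of j "sx k"] by blast
    have "0 \<le> B" using order_trans[OF abs_ge_zero B[of 0]] by simp
    then have "B * exp (- \<bar>y\<bar>) \<le> B" for y using mult_left_mono[of "exp (- \<bar>y\<bar>)" 1 B] by simp
    then have hB: "cmod (?h y) \<le> B" for y using order_trans[OF B] by simp
    have "(LINT v|MB 0. u (Phi4 v) * cnj (?tt m (Phi4 v))) = (LINT v|MB m. f (Phi4 v))"
      unfolding ftt by (rule box_strip(2)[OF fm f_inv])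
    also have "\<dots> = (LINT z|SM m. f (PhiY z))" by (rule box_SM(2)[OF fm])
    also have "\<dots> = (LINT y|YM m. cnj (?h y) * coefs u p q k y)" unfolding f_def by (rule wave_SM[OF hm hB])
    finally show ?thesis .
  qed
  ultimately show ?thesis unfolding eq1 by simp
qed

text \<open>The sum in \<open>theta_pairing\<close> is the integral of the coefficient against a Hermite function over the whole line.\<close>

lemma coefs_zero_theta:
  assumes p: "p \<noteq> 0" and par: "even (p - e3)" "even (q - e4)" "even (k - e1)"
    and 0: "\<And>j. (LINT g|MF. u g * cnj (theta j p q k e2 g)) = 0"
  shows "AE y in YM n. coefs u p q k y = 0"
proof -
  have zp: "zt p \<noteq> 0" using p r by simp
  have "AE y in lborel. coefs u p q k y = 0"
  proof (rule hermite_functions_total[of "sqrt \<bar>zt p\<bar>" _ "sx k / zt p"])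
    show "sqrt \<bar>zt p\<bar> > 0" using zp by simp
    show "integrable lborel (\<lambda>y. complex_of_real (exp (- \<bar>y\<bar>)) * coefs u p q k y)"
      by (rule strip_weighted_integrable(1)[OF coefs_YM coefs_YM_norm])
    fix j
    obtain B where B: "\<And>y. \<bar>hf j (zt p) (sx k) y\<bar> \<le> B * exp (- \<bar>y\<bar>)" using hf_bound[OF zp, of j "sx k"] by blast
    have "(\<lambda>y. complex_of_real (hf j (zt p) (sx k) y)) \<in> borel_measurable borel"
      by (rule borel_measurable_continuous_onI) (intro continuous_on_of_real hf_continuous)
    then have "(\<lambda>n. LINT y|YM (int_decode n). of_real (hf j (zt p) (sx k) y) * coefs u p q k y) sums (LINT y|lborel. of_real (hf j (zt p) (sx k) y) * coefs u p q k y)"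
      by (rule strip_weighted_integrable(2)[OF coefs_YM coefs_YM_norm, of _ B]) (use B in simp)
    moreover have "(\<lambda>n. LINT y|YM (int_decode n). of_real (hf j (zt p) (sx k) y) * coefs u p q k y) sums 0"
      using theta_pairing[OF p par, of j] unfolding 0 complex_cnj_complex_of_real .
    ultimately have "(LINT y|lborel. of_real (hf j (zt p) (sx k) y) * coefs u p q k y) = 0" by (rule sums_unique2)
    then show "(LINT y|lborel. coefs u p q k y * complex_of_real (herm j (sqrt \<bar>zt p\<bar> * (y - sx k / zt p)) * exp (- (sqrt \<bar>zt p\<bar> * (y - sx k / zt p))\<^sup>2 / 2))) = 0"
      unfolding hf_def by (simp only: mult.commute)
  qed
  then show ?thesis by (subst AE_restrict_space_iff) (auto simp: I_def)
qed

text \<open>Torus waves restrict to a Fourier basis in \<open>y\<close> over one period.\<close>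

lemma coefs_zero_torus:
  assumes e3: "e3 = 0" and par: "even (q - e4)" "even (k - e1)"
    and 0: "\<And>l. even (l - e2) \<Longrightarrow> (LINT g|MF. u g * cnj (torus_wave q k l g)) = 0"
  shows "AE y in YM 0. coefs u 0 q k y = 0"
  unfolding I_0
proof (rule total_familyD[OF total_family_interval[OF periods_pos(2), of "- sy k e2"]])
  show "integrable (Ivl py) (coefs u 0 q k)" using coefs_YM[of 0] unfolding I_0 .
  fix e assume "e \<in> range (\<lambda>n x. cis (- sy k e2 * x) * cis (2 * pi / py * real_of_int n * x))"
  then obtain n where e: "e = (\<lambda>x. cis (- sy k e2 * x) * cis (2 * pi / py * real_of_int n * x))" by auto
  define l where "l = e2 - 2 * n"
  have l: "even (l - e2)" by (simp add: l_def)
  have "- sy k e2 * x + 2 * pi / py * real_of_int n * x = - (sy k l * x)" for x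
    using periods_pos(2) by (simp add: sy_def l_def divide_simps) (simp add: algebra_simps)
  then have e': "e y = cnj (cis (sy k l * y))" for y unfolding e cis_mult by (simp add: cis_cnj)
  have hm: "(\<lambda>y. cis (sy k l * y)) \<in> borel_measurable borel" by (intro borel_measurable_continuous_onI continuous_intros)
  have tm: "torus_wave q k l \<in> borel_measurable borel"
    by (rule borel_measurable_continuous_onI[OF smooth_continuous[OF torus_smooth]])
  have c: "cnj \<in> borel_measurable borel" by (intro borel_measurable_continuous_onI continuous_intros)
  have m: "(\<lambda>g. u g * cnj (torus_wave q k l g)) \<in> borel_measurable borel" by (intro borel_measurable_times um measurable_compose[OF tm c])
  have "(LINT x|Ivl py. e x * coefs u 0 q k x) = (LINT y|YM 0. cnj (cis (sy k l * y)) * coefs u 0 q k y)" unfolding I_0 e' ..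
  also have "\<dots> = (LINT z|SM 0. u (PhiY z) * cnj (torus_wave q k l (PhiY z)))"
    unfolding torus_wave_def by (rule wave_SM[OF hm, of 1, symmetric]) simp
  also have "\<dots> = (LINT v|MB 0. u (Phi4 v) * cnj (torus_wave q k l (Phi4 v)))" by (rule box_SM(2)[OF m, symmetric])
  also have "\<dots> = (LINT g|MF. u g * cnj (torus_wave q k l g))"
    by (rule F_box(2)[OF m L_inv_mult_cnj[OF ue torus_wave_eqv[OF e3 par l]], symmetric])
  also have "\<dots> = 0" by (rule 0[OF l])
  finally show "(LINT x|Ivl py. e x * coefs u 0 q k x) = 0" .
qed

lemma scalar_totality:
  assumes th: "\<And>j p q k. p \<noteq> 0 \<Longrightarrow> even (p - e3) \<Longrightarrow> even (q - e4) \<Longrightarrow> even (k - e1) \<Longrightarrow> (LINT g|MF. u g * cnj (theta j p q k e2 g)) = 0"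
    and tw: "\<And>q k l. e3 = 0 \<Longrightarrow> even (q - e4) \<Longrightarrow> even (k - e1) \<Longrightarrow> even (l - e2) \<Longrightarrow> (LINT g|MF. u g * cnj (torus_wave q k l g)) = 0"
  shows "AE g in MF. u g = 0"
proof -
  obtain E where E: "total_family Txw E" and el: "\<And>e. e \<in> E \<Longrightarrow> \<exists>p q k. even (p - e3) \<and> even (q - e4) \<and> even (k - e1) \<and> e = Epk p q k"
    using total_Epk[of e3 e4 e1] by blast
  have "AE z in SM 0. u (PhiY z) = 0"
  proof (rule AE_zero_of_coefficients[OF sigma_finite_YM sigma_finite_Txw E u_SM])
    fix e assume "e \<in> E"
    then obtain p q k where par: "even (p - e3)" "even (q - e4)" "even (k - e1)" and e: "e = Epk p q k" using el by blast
    have "AE y in YM 0. coefs u p q k y = 0"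
    proof (cases "p = 0")
      case True
      then have "e3 = 0" using par(1) \<epsilon>_range[OF lat_in_L, of 0 0 1 0] by auto
      then show ?thesis unfolding True by (rule coefs_zero_torus[OF _ par(2,3) tw]) (use par \<open>e3 = 0\<close> in auto)
    next
      case False
      show ?thesis by (rule coefs_zero_theta[OF False par th[OF False par]])
    qed
    then show "AE x in YM 0. (LINT y|Txw. e y * u (PhiY (x, y))) = 0" unfolding e coefs_def .
  qed
  then have ae: "AE z in SM 0. norm (u (PhiY z)) = 0" by (rule eventually_mono) simp
  have "(\<lambda>z. norm (u (PhiY z))) \<in> borel_measurable (SM 0)" using integrable_norm[OF u_SM[of 0]] by (rule borel_measurable_integrable)
  from integral_cong_AE[OF this _ ae] have "(LINT z|SM 0. norm (u (PhiY z))) = 0" by simp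
  then have "(LINT g|MF. norm (u g)) = 0" unfolding u_SM_norm .
  then show ?thesis using integral_nonneg_eq_0_iff_AE[of MF "\<lambda>g. norm (u g)"] ui by simp
qed

end

end

section \<open>The spectrum as a set of eigenvalues\<close>

text \<open>A convergent sequence stays in a bounded part, which is finite and therefore closed.\<close>

lemma closed_if_finite_bounded_parts:
  fixes S :: "real set"
  assumes "\<And>R. finite {x \<in> S. \<bar>x\<bar> \<le> R}" shows "closed S"
  unfolding closed_sequential_limits
proof (intro allI impI, elim conjE)
  fix x l assume x: "\<forall>n. x n \<in> S" and l: "x \<longlonglongrightarrow> l"
  define T where "T = {x \<in> S. \<bar>x\<bar> \<le> \<bar>l\<bar> + 1}"
  have "closed T" unfolding T_def by (rule finite_imp_closed[OF assms])
  moreover have "eventually (\<lambda>n. \<bar>x n\<bar> < \<bar>l\<bar> + 1) sequentially"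
    by (rule order_tendstoD(2)[OF tendsto_rabs[OF l]]) simp
  then have "eventually (\<lambda>n. x n \<in> T) sequentially"
    by (rule eventually_mono) (use x in \<open>simp add: T_def\<close>)
  ultimately have "l \<in> T" using l by (intro Lim_in_closed_set[OF _ _ _ l]) simp_all
  then show "l \<in> S" by (simp add: T_def)
qed

lemma finite_multiples:
  fixes \<beta> :: real assumes "\<beta> > 0" shows "finite {x \<in> range (\<lambda>n. \<beta> * real_of_int n). \<bar>x\<bar> \<le> R}"
proof (rule finite_subset)
  show "{x \<in> range (\<lambda>n. \<beta> * real_of_int n). \<bar>x\<bar> \<le> R} \<subseteq> (\<lambda>n. \<beta> * real_of_int n) ` {- \<lceil>R / \<beta>\<rceil>..\<lceil>R / \<beta>\<rceil>}"
  proof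
    fix x assume "x \<in> {x \<in> range (\<lambda>n. \<beta> * real_of_int n). \<bar>x\<bar> \<le> R}"
    then obtain n where n: "x = \<beta> * real_of_int n" "\<bar>x\<bar> \<le> R" by auto
    have "\<bar>x\<bar> = \<beta> * \<bar>real_of_int n\<bar>" using assms by (simp add: n(1) abs_mult)
    then have "\<bar>real_of_int n\<bar> \<le> R / \<beta>" using n(2) assms by (simp add: pos_le_divide_eq mult.commute)
    then have "\<bar>real_of_int n\<bar> \<le> of_int \<lceil>R / \<beta>\<rceil>" by linarith
    then have "\<bar>n\<bar> \<le> \<lceil>R / \<beta>\<rceil>" by linarith
    then show "x \<in> (\<lambda>n. \<beta> * real_of_int n) ` {- \<lceil>R / \<beta>\<rceil>..\<lceil>R / \<beta>\<rceil>}"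
      unfolding n(1) by (intro image_eqI[of _ _ n]) auto
  qed
qed simp

text \<open>The square of the norm \<open>kl_norm\<close>, with the sign of \<open>k\<close> reversed; this is the sign that comes out of
the torus waves.\<close>

definition kl_form :: "real \<Rightarrow> real \<Rightarrow> int \<Rightarrow> int \<Rightarrow> real" where
  "kl_form \<mu> \<nu> k l = \<nu> * (of_int k)\<^sup>2 + (of_int l + \<mu> * of_int k)\<^sup>2 / \<nu>"

lemma finite_kl_form:
  assumes \<nu>: "\<nu> > 0" shows "finite {(k, l). kl_form \<mu> \<nu> k l \<le> R}"
proof (rule finite_subset)
  define A B where "A = R / \<nu>" and "B = 1 + R * \<nu> + \<bar>\<mu>\<bar> * (R / \<nu>)"
  show "{(k, l). kl_form \<mu> \<nu> k l \<le> R} \<subseteq> {- \<lceil>A\<rceil>..\<lceil>A\<rceil>} \<times> {- \<lceil>B\<rceil>..\<lceil>B\<rceil>}"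
  proof clarify
    fix k l assume le: "kl_form \<mu> \<nu> k l \<le> R"
    let ?x = "of_int l + \<mu> * of_int k"
    have nn: "0 \<le> \<nu> * (real_of_int k)\<^sup>2" "0 \<le> ?x\<^sup>2 / \<nu>" using \<nu> by auto
    have "\<nu> * (real_of_int k)\<^sup>2 \<le> R" using le nn unfolding kl_form_def by linarith
    then have k2: "(real_of_int k)\<^sup>2 \<le> A" using \<nu> by (simp add: A_def pos_le_divide_eq mult.commute)
    have "?x\<^sup>2 / \<nu> \<le> R" using le nn unfolding kl_form_def by linarith
    then have x2: "?x\<^sup>2 \<le> R * \<nu>" using \<nu> by (simp add: pos_divide_le_eq)
    have "\<bar>k\<bar> \<le> k\<^sup>2"
    proof (cases "k = 0")
      case False
      then have "\<bar>k\<bar> * 1 \<le> \<bar>k\<bar> * \<bar>k\<bar>" by (intro mult_left_mono) auto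
      then show ?thesis by (simp add: power2_eq_square abs_mult[symmetric])
    qed simp
    then have "real_of_int \<bar>k\<bar> \<le> real_of_int (k\<^sup>2)" by (rule of_int_le_iff[THEN iffD2])
    then have kA: "\<bar>real_of_int k\<bar> \<le> A" using k2 by simp
    have "0 \<le> (\<bar>?x\<bar> - 1)\<^sup>2" by simp
    then have "2 * \<bar>?x\<bar> \<le> 1 + ?x\<^sup>2" by (simp add: power2_diff)
    moreover have "2 * a \<le> 1 + b \<Longrightarrow> b \<le> c \<Longrightarrow> 0 \<le> a \<Longrightarrow> a \<le> 1 + c" for a b c :: real by linarith
    ultimately have "\<bar>?x\<bar> \<le> 1 + R * \<nu>" using x2 abs_ge_zero[of ?x] by blast
    moreover have "\<bar>\<mu> * of_int k\<bar> \<le> \<bar>\<mu>\<bar> * A" unfolding abs_mult by (intro mult_left_mono kA) simp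
    ultimately have lB: "\<bar>real_of_int l\<bar> \<le> B" unfolding B_def A_def by linarith
    have "\<bar>k\<bar> \<le> \<lceil>A\<rceil>" "\<bar>l\<bar> \<le> \<lceil>B\<rceil>" using kA lB by linarith+
    then show "k \<in> {- \<lceil>A\<rceil>..\<lceil>A\<rceil>} \<and> l \<in> {- \<lceil>B\<rceil>..\<lceil>B\<rceil>}" by auto
  qed
qed simp

text \<open>A scalar function as a spinor in one component. The factor \<open>c\<close> is needed since orthogonality is expressed by a real inner product.\<close>

definition emb :: "complex \<Rightarrow> 4 \<Rightarrow> complex \<Rightarrow> complex ^ 4" where "emb c i z = (c * z) *s axis i 1"

lemma bounded_linear_emb: "bounded_linear (emb c i)"
proof -
  have "linear (emb c i)" by (rule linearI) (auto simp: emb_def vec_eq_iff algebra_simps)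
  then show ?thesis by (simp add: linear_conv_bounded_linear)
qed

lemma inner_emb: "v \<bullet> emb c i z = Re (cnj c * (v $ i * cnj z))"
proof -
  have "v \<bullet> emb c i z = (\<Sum>j\<in>UNIV. if j = i then v $ i \<bullet> (c * z) else 0)"
    unfolding inner_vec_def by (rule sum.cong) (auto simp: emb_def axis_def)
  also have "\<dots> = v $ i \<bullet> (c * z)" by simp
  also have "\<dots> = Re (cnj c * (v $ i * cnj z))" by (simp add: inner_complex_def algebra_simps)
  finally show ?thesis .
qed

lemma emb_nth: "emb c i z $ j = (if j = i then c * z else 0)" by (simp add: emb_def axis_def)

lemma integral_cis_period:
  assumes P: "P > 0" and n: "n \<noteq> 0"
  shows "(LINT x|restrict_space lborel {0..P}. cis (2 * pi / P * of_int n * x)) = 0"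
proof -
  define a where "a = 2 * pi / P * of_int n"
  have a: "a \<noteq> 0" using P n by (simp add: a_def)
  have "((\<lambda>x. cis (a * x) / (\<i> * of_real a)) has_vector_derivative cis (a * x)) (at x within {0..P})" for x
  proof -
    have "(\<i> * of_real a * (1 / (\<i> * of_real a))) * exp (\<i> * of_real (a * x)) = cis (a * x)" using a by (simp add: cis_conv_exp)
    moreover have "(\<lambda>x. 1 / (\<i> * of_real a) * exp (\<i> * of_real (a * x))) = (\<lambda>x. cis (a * x) / (\<i> * of_real a))" by (simp add: cis_conv_exp)
    ultimately show ?thesis using exp_line_derivative[of "1 / (\<i> * of_real a)" a x "{0..P}"] by simp
  qed
  moreover have "continuous_on {0..P} (\<lambda>x. cis (a * x))" by (intro continuous_intros)
  ultimately have "(LINT x|lborel. indicator {0..P} x *\<^sub>R cis (a * x)) = cis (a * P) / (\<i> * of_real a) - cis (a * 0) / (\<i> * of_real a)"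
    using P by (intro integral_FTC_Icc) auto
  moreover have "cis (a * P) = 1"
  proof -
    have "a * P = 2 * pi * of_int n" using P by (simp add: a_def)
    then show ?thesis using cis_multiple_2pi[of "of_int n"] by simp
  qed
  ultimately show ?thesis unfolding a_def[symmetric] by (simp add: integral_restrict_space)
qed

context osc_quotient begin

text \<open>On the line \<open>x \<mapsto> Phi 0 y x 0\<close> the terms of the theta function are exponentials with distinct frequencies
that differ from \<open>sx k\<close> by multiples of \<open>2 * pi / px\<close>. So the Fourier coefficient at frequency \<open>sx k\<close> sees only the term with \<open>m = 0\<close>. At the
centre \<open>y\<close> of the ground state this term is not zero.\<close>

lemma theta_nonzero:
  assumes p: "p \<noteq> 0" and rp: "even (int r * p)" shows "\<exists>g. theta 0 p q k e g \<noteq> 0"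
proof (rule ccontr)
  assume "\<not> ?thesis"
  then have th0: "theta 0 p q k e g = 0" for g by blast
  have zp: "zt p \<noteq> 0" using p r by simp
  define y where "y = sx k / zt p"
  define s where "s m = sx k - zt p * of_int m * py" for m :: int
  define A where "A m = exp (\<i> * of_real (zt p * \<mu> * (of_int m)\<^sup>2 / 2 - sx k * of_int m * \<mu> * px + pi * of_int (e * m))) * of_real (hf 0 (zt p) (s m) y)" for m :: int
  let ?M = "restrict_space lborel {0..px}"
  let ?F = "\<lambda>m x. A m * cis (2 * pi / px * of_int (- ((int r * p) div 2 * m)) * x)"
  have tt: "theta_term 0 p q k e m (Phi 0 y x 0) = cis (sx k * x) * ?F m x" for m x
  proof -
    have rp2: "real_of_int (int r * p) = 2 * real_of_int ((int r * p) div 2)" using rp by (metis dvd_mult_div_cancel of_int_mult of_int_numeral)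
    have "s m * x = sx k * x + - (pi * real_of_int (int r * p) * of_int m * py * x)" by (simp add: s_def algebra_simps)
    also have "\<dots> = sx k * x + 2 * pi / px * of_int (- ((int r * p) div 2 * m)) * x" unfolding rp2 by (simp add: algebra_simps)
    finally have "cis (s m * x) = cis (sx k * x) * cis (2 * pi / px * of_int (- ((int r * p) div 2 * m)) * x)" unfolding cis_mult by simp
    moreover have "theta_term 0 p q k e m (Phi 0 y x 0) = A m * cis (s m * x)"
      unfolding tt_wave[OF p rp] wave_Phi s_def[symmetric] A_def cis_conv_exp[symmetric] by (simp add: mult_ac)
    ultimately show ?thesis by (simp add: mult_ac)
  qed
  (* A bound for the norm of the points on the line with x in {0..px}. *)
  define R where "R = px + \<bar>y\<bar> + px * \<bar>y\<bar> / 2"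
  have R: "norm (Phi 0 y x 0) \<le> R" if "x \<in> {0..px}" for x
  proof -
    have "norm (Phi 0 y x 0) \<le> cmod (Complex x y) + norm (0 + x * y / 2, 0::real)" unfolding Phi_def by (rule norm_Pair_le)
    moreover have "norm (0 + x * y / 2, 0::real) = \<bar>x\<bar> * \<bar>y\<bar> / 2" by (simp add: norm_Pair abs_mult)
    moreover have "cmod (Complex x y) \<le> \<bar>x\<bar> + \<bar>y\<bar>" using cmod_le[of "Complex x y"] by simp
    moreover have "\<bar>x\<bar> * \<bar>y\<bar> \<le> px * \<bar>y\<bar>" using that by (intro mult_right_mono) auto
    moreover have "\<bar>x\<bar> \<le> px" using that by auto
    moreover have "a \<le> b + c \<Longrightarrow> c = d / 2 \<Longrightarrow> b \<le> X + Y \<Longrightarrow> d \<le> e \<Longrightarrow> X \<le> P \<Longrightarrow> a \<le> P + Y + e / 2"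
      for a b c d e X Y P :: real by linarith
    ultimately show ?thesis unfolding R_def by blast
  qed
  obtain C where C: "\<And>m g. norm g \<le> R \<Longrightarrow> cmod (theta_term 0 p q k e m g) \<le> C * exp (- \<bar>real_of_int m\<bar>)"
    using tt_dominated[OF p rp, of R 0 q k e] by blast
  have "0 \<in> {0..px}" using periods_pos(3) by simp
  from C[OF R[OF this]] have AC: "cmod (A m) \<le> C * exp (- \<bar>real_of_int m\<bar>)" for m
    unfolding tt by (simp add: norm_mult)
  have sumA: "summable (\<lambda>n. cmod (A (int_decode n)))"
    by (rule summable_comparison_test'[OF summable_mult[OF summable_exp_int_decode, of C], of 0]) (use AC in simp)
  have int: "integrable ?M (?F m)" for m
  proof -
    have "set_integrable lborel {0..px} (?F m)" by (rule borel_integrable_atLeastAtMost') (intro continuous_intros)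
    then show ?thesis by (simp add: set_integrable_def integrable_restrict_space)
  qed
  have nF: "norm (?F m x) = cmod (A m)" for m x by (simp add: norm_mult)
  have vol: "(LINT x|?M. c) = px *\<^sub>R c" for c :: "'z::{banach, second_countable_topology}"
    using periods_pos(3) by (simp add: measure_restrict_space)
  have "(\<lambda>n. LINT x|?M. ?F (int_decode n) x) sums (LINT x|?M. (\<Sum>n. ?F (int_decode n) x))"
    by (rule sums_integral[OF int]) (unfold nF vol, intro AE_I2 sumA, intro summable_scaleR_right sumA)
  moreover have "(\<Sum>n. ?F (int_decode n) x) = 0" for x
  proof -
    have "(\<lambda>n. cis (sx k * x) * ?F (int_decode n) x) sums 0"
      using tt_has_sum[OF p rp, of 0 q k e "Phi 0 y x 0", folded has_sum_int_decode, THEN has_sum_imp_sums] unfolding tt th0 .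
    from sums_mult[OF this, of "cis (- (sx k * x))"] have "(\<lambda>n. ?F (int_decode n) x) sums 0"
      by (simp add: mult.assoc[symmetric] cis_mult)
    then show ?thesis by (rule sums_unique[symmetric])
  qed
  moreover have "(LINT x|?M. ?F (int_decode n) x) = (if n = int_encode 0 then px *\<^sub>R A 0 else 0)" for n
  proof (cases "int_decode n = 0")
    case True
    then have "n = int_encode 0" by (metis int_decode_inverse)
    then show ?thesis by (simp add: vol[of "A 0"] del: lebesgue_integral_const)
  next
    case False
    have "(int r * p) div 2 \<noteq> 0" using p r rp by (auto elim: evenE)
    then have "- ((int r * p) div 2 * int_decode n) \<noteq> 0" using False by simp
    from integral_cis_period[OF periods_pos(3) this] have "(LINT x|?M. ?F (int_decode n) x) = 0"
      by (subst integral_mult_right_zero) (simp only: mult_zero_right)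
    moreover have "n \<noteq> int_encode 0" using False by auto
    ultimately show ?thesis by simp
  qed
  ultimately have "(\<lambda>n. if n = int_encode 0 then px *\<^sub>R A 0 else 0) sums 0" by simp
  from sums_unique2[OF this sums_single] have "px *\<^sub>R A 0 = 0" by simp
  moreover have "hf 0 (zt p) (s 0) y = 1" by (simp add: hf_def s_def y_def)
  then have "A 0 \<noteq> 0" unfolding A_def by simp
  ultimately show False using periods_pos(3) by simp
qed

lemma emeasure_MF_nonzero: "(\<integral>\<^sup>+g. 1 \<partial>MF) \<noteq> 0"
proof -
  have "L_inv (\<lambda>g. 1 :: ennreal)" unfolding L_inv_def by simp
  from nn_F_box[OF _ this] have "(\<integral>\<^sup>+g. 1 \<partial>MF) = (\<integral>\<^sup>+v. 1 \<partial>MB 0)" by simp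
  also have "\<dots> = ennreal pw * ennreal px * ennreal py * ennreal pt"
    unfolding nn_MB[of "\<lambda>_. 1" 0, OF borel_measurable_const] using periods_pos by (simp add: nn_integral_cmult_indicator)
  also have "\<dots> \<noteq> 0" using periods_pos r \<kappa> \<nu> by (simp add: ennreal_zero_less_mult_iff)
  finally show ?thesis .
qed

lemma AE_MF_ex: assumes "AE g in MF. P g" shows "\<exists>g. P g"
proof (rule ccontr)
  assume "\<not> ?thesis"
  then have "AE g in MF. (1::ennreal) = 0" using assms by (auto elim!: eventually_mono)
  then have "(\<integral>\<^sup>+g. 1 \<partial>MF) = (\<integral>\<^sup>+g. 0 \<partial>MF)" by (rule nn_integral_cong_AE)
  then show False using emeasure_MF_nonzero by simp
qed

end

lemma osc_transitive: "\<exists>h. osc_mult g h = g'"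
proof -
  interpret group Osc by (rule group_Osc)
  have "osc_mult g (inv\<^bsub>Osc\<^esub> g) = (0, 0, 0)" using r_inv[of g] by (simp add: Osc_def)
  then have "osc_mult g (osc_mult (inv\<^bsub>Osc\<^esub> g) g') = osc_mult (0, 0, 0) g'" unfolding osc_mult_assoc[symmetric] by simp
  also have "\<dots> = g'" by (cases g') (simp add: osc_omega_def)
  finally show ?thesis by (rule exI)
qed

context osc_spin begin

text \<open>Every right translate of \<open>u\<close> vanishes almost everywhere on \<open>F\<close>. For a countable dense set of translations this happens
simultaneously at some point \<open>g\<close>, and then \<open>h \<mapsto> u (g h)\<close> is a continuous function vanishing on a dense set.\<close>

lemma continuous_eqv_zero:
  assumes c: "continuous_on UNIV u" and e: "eqv u" and 0: "(LINT g|MF. norm (u g)) = 0" shows "u g0 = 0"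
proof (rule ccontr)
  assume nz: "u g0 \<noteq> 0"
  have cn: "continuous_on UNIV (\<lambda>g. norm (u g))" by (intro continuous_on_norm c)
  have m: "(\<lambda>g. norm (u g)) \<in> borel_measurable borel" by (rule borel_measurable_continuous_onI[OF cn])
  have inv: "L_inv (\<lambda>g. norm (u g))" unfolding L_inv_def
    by (intro ballI allI) (simp only: eqvD[OF e] norm_mult norm_of_real abs_sg mult_1)
  obtain C where C: "\<And>g. norm (u g) \<le> C" using L_inv_continuous_bounded[OF c inv] by blast
  have i: "integrable MF (\<lambda>g. norm (u g))" by (rule integrable_MF_bounded[OF m, of C]) (use C in simp)
  have z: "AE g in MF. u (osc_mult g h) = 0" for h
  proof -
    have "integrable MF (\<lambda>g. norm (u (osc_mult g h)))" using F_right(1)[OF m inv, of h] i by simp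
    moreover have "(LINT g|MF. norm (u (osc_mult g h))) = 0" using F_right(2)[OF m inv, of h] 0 by simp
    ultimately show ?thesis using integral_nonneg_eq_0_iff_AE[of MF "\<lambda>g. norm (u (osc_mult g h))"] by simp
  qed
  obtain Q :: "osc set" where Q: "countable Q" "\<And>X. open X \<Longrightarrow> X \<noteq> {} \<Longrightarrow> \<exists>d\<in>Q. d \<in> X"
    by (rule countable_dense_setE) blast
  have "AE g in MF. \<forall>h\<in>Q. u (osc_mult g h) = 0" unfolding AE_ball_countable[OF Q(1)] using z by (intro ballI)
  then obtain g where g: "\<forall>h\<in>Q. u (osc_mult g h) = 0" by (rule exE[OF AE_MF_ex])
  obtain h0 where h0: "osc_mult g h0 = g0" by (rule exE[OF osc_transitive])
  have "open {h. u (osc_mult g h) \<noteq> 0}"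
    by (intro open_Collect_neq continuous_on_compose2[OF c] continuous_intros) simp_all
  moreover have "h0 \<in> {h. u (osc_mult g h) \<noteq> 0}" using h0 nz by simp
  ultimately have "\<exists>d\<in>Q. d \<in> {h. u (osc_mult g h) \<noteq> 0}" by (intro Q(2)) blast+
  then show False using g by blast
qed

lemma emb_D: assumes "eqv u" "smooth u" shows "(\<lambda>g. emb c i (u g)) \<in> D"
  unfolding D_iff
proof
  show "(\<lambda>g. emb c i (u g)) \<in> spinor_sections L \<epsilon>"
    by (rule sectionI) (simp only: eqvD[OF assms(1)] vec_eq_iff emb_nth vector_scaleR_component scaleR_conv_of_real[where 'a=complex], simp)
  show "smooth (\<lambda>g. emb c i (u g))" by (rule smooth_bounded_linear[OF bounded_linear_emb assms(2)])
qed

lemma emb_eigen: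
  assumes "smooth u" and cas: "\<And>g. cas u g = - of_real l * u g"
  shows "(\<lambda>g. - casimir (\<lambda>g. emb c i (u g)) g) = smul (of_real l) (\<lambda>g. emb c i (u g))"
proof
  fix g
  show "- casimir (\<lambda>g. emb c i (u g)) g = smul (of_real l) (\<lambda>g. emb c i (u g)) g"
    unfolding casimir_linear_image[OF bounded_linear_emb assms(1)] cas by (simp add: smul_def vec_eq_iff emb_nth)
qed

lemma eigen_nonzero:
  assumes e: "eqv u" and s: "smooth u" and nz: "u g0 \<noteq> 0" and cas: "\<And>g. cas u g = - of_real l * u g"
  shows "\<exists>\<psi>\<in>D. (\<lambda>g. - casimir \<psi> g) = smul (of_real l) \<psi> \<and> ip \<psi> \<psi> \<noteq> 0"
proof (intro bexI conjI)
  let ?\<psi> = "\<lambda>g. emb 1 1 (u g)"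
  show D: "?\<psi> \<in> D" by (rule emb_D[OF e s])
  show "(\<lambda>g. - casimir ?\<psi> g) = smul (of_real l) ?\<psi>" by (rule emb_eigen[OF s cas])
  show "ip ?\<psi> ?\<psi> \<noteq> 0"
  proof
    assume 0: "ip ?\<psi> ?\<psi> = 0"
    have n: "emb 1 1 z \<bullet> emb 1 1 z = (norm z)\<^sup>2" for z
      unfolding inner_emb emb_nth by (simp add: complex_norm_square[symmetric] flip: of_real_power)
    have "?\<psi> \<in> H" using D D_H by blast
    then have "integrable MF (\<lambda>g. (norm (u g))\<^sup>2)" using H_inner_integrable[of ?\<psi> ?\<psi>] unfolding n by simp
    moreover have "(LINT g|MF. (norm (u g))\<^sup>2) = 0" using 0 unfolding ip_def n .
    ultimately have "AE g in MF. (norm (u g))\<^sup>2 = 0" using integral_nonneg_eq_0_iff_AE[of MF "\<lambda>g. (norm (u g))\<^sup>2"] by simp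
    then have ae: "AE g in MF. norm (u g) = 0" by simp
    have m: "(\<lambda>g. norm (u g)) \<in> borel_measurable MF"
      by (rule measurable_MF) (intro borel_measurable_continuous_onI continuous_on_norm smooth_continuous[OF s])
    have "(LINT g|MF. norm (u g)) = (LINT g|MF. 0)" by (rule integral_cong_AE[OF m _ ae]) simp
    then have "u g0 = 0" by (intro continuous_eqv_zero[OF smooth_continuous[OF s] e]) simp
    then show False using nz by simp
  qed
qed

text \<open>The eigenvalue of the ground state \<open>j = 0\<close>.\<close>

definition theta_val :: "int \<Rightarrow> int \<Rightarrow> real" where "theta_val p q = pi * real r / real \<kappa> * of_int (\<bar>p\<bar> * int \<kappa> + p * q)"

text \<open>The index \<open>j\<close> of the Hermite function does not appear, since raising it only changes \<open>q\<close> by an even number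
(\<open>theta_val_j\<close>).\<close>

definition eigenvalue_set :: "real set" where
  "eigenvalue_set = {theta_val p q | p q. p \<noteq> 0 \<and> even (p - e3) \<and> even (q - e4)} \<union>
     {pi\<^sup>2 * kl_form \<mu> \<nu> k l | k l. e3 = 0 \<and> even (k - e1) \<and> even (l - e2)}"

text \<open>The values of the theta functions are multiples of a fixed number, and the torus waves contribute the values
of a positive definite quadratic form at integral points.\<close>

lemma closed_eigenvalue_set: "closed eigenvalue_set"
proof (rule closed_if_finite_bounded_parts)
  fix R
  have "pi * real r / real \<kappa> > 0" using r \<kappa> by simp
  note f1 = finite_multiples[OF this, of R]
  have f2: "finite ((\<lambda>(k, l). pi\<^sup>2 * kl_form \<mu> \<nu> k l) ` {(k, l). kl_form \<mu> \<nu> k l \<le> R / pi\<^sup>2})"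
    by (intro finite_imageI finite_kl_form \<nu>)
  have "{x \<in> eigenvalue_set. \<bar>x\<bar> \<le> R} \<subseteq> {x \<in> range (\<lambda>n. pi * real r / real \<kappa> * real_of_int n). \<bar>x\<bar> \<le> R} \<union>
    (\<lambda>(k, l). pi\<^sup>2 * kl_form \<mu> \<nu> k l) ` {(k, l). kl_form \<mu> \<nu> k l \<le> R / pi\<^sup>2}"
  proof
    fix x assume "x \<in> {x \<in> eigenvalue_set. \<bar>x\<bar> \<le> R}"
    then have R: "\<bar>x\<bar> \<le> R" and "(\<exists>p q. x = theta_val p q) \<or> (\<exists>k l. x = pi\<^sup>2 * kl_form \<mu> \<nu> k l)"
      by (auto simp: eigenvalue_set_def)
    then show "x \<in> {x \<in> range (\<lambda>n. pi * real r / real \<kappa> * real_of_int n). \<bar>x\<bar> \<le> R} \<union>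
      (\<lambda>(k, l). pi\<^sup>2 * kl_form \<mu> \<nu> k l) ` {(k, l). kl_form \<mu> \<nu> k l \<le> R / pi\<^sup>2}"
    proof (elim disjE exE)
      fix p q assume "x = theta_val p q"
      then have "x \<in> range (\<lambda>n. pi * real r / real \<kappa> * real_of_int n)" unfolding theta_val_def by blast
      then show ?thesis using R by blast
    next
      fix k l assume x: "x = pi\<^sup>2 * kl_form \<mu> \<nu> k l"
      then have "kl_form \<mu> \<nu> k l * pi\<^sup>2 \<le> R" using R by (simp add: mult.commute)
      then have "kl_form \<mu> \<nu> k l \<le> R / pi\<^sup>2" by (simp add: pos_le_divide_eq)
      then show ?thesis unfolding x by (intro UnI2 image_eqI[of _ _ "(k, l)"]) simp_all
    qed
  qed
  then show "finite {x \<in> eigenvalue_set. \<bar>x\<bar> \<le> R}" by (rule finite_subset) (intro finite_UnI f1 f2)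
qed

lemma theta_val_j: "\<bar>zt p\<bar> * (2 * real j + 1) + 2 * zt p * tf q = theta_val p (q + sgn p * (2 * int j * int \<kappa>))"
proof -
  have sp: "p * (sgn p * (2 * int j * int \<kappa>)) = \<bar>p\<bar> * (2 * int j * int \<kappa>)" by (simp add: abs_sgn mult_ac)
  have "\<bar>p\<bar> * int \<kappa> + p * (q + sgn p * (2 * int j * int \<kappa>)) = \<bar>p\<bar> * int \<kappa> * (2 * int j + 1) + p * q"
    unfolding distrib_left sp by (simp add: algebra_simps)
  moreover have "\<bar>zt p\<bar> = pi * real r * \<bar>real_of_int p\<bar>" by (simp add: abs_mult)
  then have "\<bar>zt p\<bar> * (2 * real j + 1) + 2 * zt p * tf q = pi * real r / real \<kappa> * of_int (\<bar>p\<bar> * int \<kappa> * (2 * int j + 1) + p * q)"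
    using \<kappa> by (simp add: field_simps)
  ultimately show ?thesis unfolding theta_val_def by (simp only:)
qed

lemma theta_in_eigenvalue_set:
  assumes "p \<noteq> 0" "even (p - e3)" "even (q - e4)"
  shows "\<bar>zt p\<bar> * (2 * real j + 1) + 2 * zt p * tf q \<in> eigenvalue_set"
proof -
  have "even (q + sgn p * (2 * int j * int \<kappa>) - e4)" using assms(3) by simp
  then show ?thesis unfolding theta_val_j eigenvalue_set_def using assms(1,2) by blast
qed

lemma torus_cas: "cas (torus_wave q k l) g = - of_real (pi\<^sup>2 * kl_form \<mu> \<nu> k l) * torus_wave q k l g"
proof -
  have "py\<^sup>2 = \<nu>" using \<nu> by simp
  then have "(sx k)\<^sup>2 = pi\<^sup>2 * (\<nu> * (of_int k)\<^sup>2)" "(sy k l)\<^sup>2 = pi\<^sup>2 * ((of_int l + \<mu> * of_int k)\<^sup>2 / \<nu>)"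
    by (simp_all only: sy_def power_mult_distrib power_divide mult_ac times_divide_eq_right)
  then have "(sx k)\<^sup>2 + (sy k l)\<^sup>2 = pi\<^sup>2 * kl_form \<mu> \<nu> k l"
    unfolding kl_form_def by (simp only: distrib_left)
  then show ?thesis unfolding torus_wave_def torus_smooth_cas(2) by simp
qed

lemma eigenvalue_set_attained:
  assumes "l \<in> eigenvalue_set"
  shows "\<exists>\<psi>\<in>D. (\<lambda>g. - casimir \<psi> g) = smul (of_real l) \<psi> \<and> ip \<psi> \<psi> \<noteq> 0"
proof -
  consider (theta) p q where "l = theta_val p q" "p \<noteq> 0" "even (p - e3)" "even (q - e4)"
    | (torus) k m where "l = pi\<^sup>2 * kl_form \<mu> \<nu> k m" "e3 = 0" "even (k - e1)" "even (m - e2)"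
    using assms unfolding eigenvalue_set_def by blast
  then show ?thesis
  proof cases
    case theta
    note rp = even_rp[OF theta(3)]
    obtain g0 where g0: "theta 0 p q e1 e2 g0 \<noteq> 0" using theta_nonzero[OF theta(2) rp] by blast
    have l: "\<bar>zt p\<bar> * (2 * real 0 + 1) + 2 * zt p * tf q = l" unfolding theta_val_j theta(1) by simp
    show ?thesis
      by (rule eigen_nonzero[OF theta_eqv[OF theta(2-4)] theta_smooth[OF theta(2) rp] g0]) (simp_all only: theta_cas[OF theta(2) rp] l, simp)
  next
    case torus
    have nz: "torus_wave e4 k m (0, 0, 0) \<noteq> 0" by (simp add: torus_wave_def wave_def)
    show ?thesis unfolding torus(1)
      by (rule eigen_nonzero[OF torus_wave_eqv[OF torus(2) _ torus(3,4)] torus_smooth nz torus_cas]) simp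
  qed
qed

text \<open>The quotient has finite volume, so square-integrable functions are integrable.\<close>

lemma component_L1:
  assumes "\<psi> \<in> H"
  shows "(\<lambda>g. \<psi> g $ i) \<in> borel_measurable borel" "integrable MF (\<lambda>g. \<psi> g $ i)" "eqv (\<lambda>g. \<psi> g $ i)"
proof -
  have m: "\<psi> \<in> borel_measurable borel" and s: "\<psi> \<in> spinor_sections L \<epsilon>" and n: "integrable MF (\<lambda>g. (norm (\<psi> g))\<^sup>2)"
    using assms by (auto simp: H_iff)
  show mi: "(\<lambda>g. \<psi> g $ i) \<in> borel_measurable borel"
    by (rule measurable_compose[OF m]) (intro borel_measurable_continuous_onI continuous_intros)
  show "eqv (\<lambda>g. \<psi> g $ i)" by (rule eqvI) (simp only: sectionD[OF s] vector_scaleR_component scaleR_conv_of_real[where 'a=complex])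
  have one: "integrable MF (\<lambda>g. 1::real)" by (rule integrable_MF_bounded[of _ 1]) simp_all
  show "integrable MF (\<lambda>g. \<psi> g $ i)"
  proof (rule Bochner_Integration.integrable_bound)
    show "integrable MF (\<lambda>g. 1 + (norm (\<psi> g))\<^sup>2)" by (intro Bochner_Integration.integrable_add one n)
    show "(\<lambda>g. \<psi> g $ i) \<in> borel_measurable MF" by (rule measurable_MF[OF mi])
    have "norm (x $ i) \<le> norm (1 + (norm x)\<^sup>2)" for x :: "complex ^ 4"
    proof -
      have "norm (x $ i) \<le> norm x" by (rule Finite_Cartesian_Product.norm_nth_le)
      moreover have "0 \<le> (norm x - 1)\<^sup>2" by simp
      then have "2 * norm x \<le> 1 + (norm x)\<^sup>2" by (simp add: power2_diff)
      moreover have "0 \<le> norm x" "0 \<le> (norm x)\<^sup>2" by simp_all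
      moreover have "norm (1 + (norm x)\<^sup>2) = 1 + (norm x)\<^sup>2" by simp
      ultimately show ?thesis by linarith
    qed
    then show "AE g in MF. norm (\<psi> g $ i) \<le> norm (1 + (norm (\<psi> g))\<^sup>2)" by (intro AE_I2)
  qed
qed

text \<open>Orthogonality to \<open>u\<close> and \<open>\<i> u\<close> in the component \<open>i\<close>, with respect to the real inner product, gives the vanishing of
the complex integral to which \<open>scalar_totality\<close> applies.\<close>

lemma eigenfunctions_total:
  assumes \<psi>: "\<psi> \<in> H" and 0: "\<And>l \<phi>. l \<in> eigenvalue_set \<Longrightarrow> \<phi> \<in> D \<Longrightarrow> (\<lambda>g. - casimir \<phi> g) = smul (of_real l) \<phi> \<Longrightarrow> ip \<psi> \<phi> = 0"
  shows "ip \<psi> \<psi> = 0"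
proof -
  have orth: "(LINT g|MF. \<psi> g $ i * cnj (u g)) = 0"
    if u: "eqv u" "smooth u" and l: "l \<in> eigenvalue_set" and cas: "\<And>g. cas u g = - of_real l * u g" for u l i
  proof -
    have inv: "L_inv (\<lambda>g. norm (u g))" unfolding L_inv_def
      by (intro ballI allI) (simp only: eqvD[OF u(1)] norm_mult norm_of_real abs_sg mult_1)
    obtain C where C: "\<And>g. norm (u g) \<le> C" using L_inv_continuous_bounded[OF smooth_continuous[OF u(2)] inv] by blast
    have "continuous_on UNIV (\<lambda>g. cnj (u g))" by (intro continuous_on_cnj smooth_continuous[OF u(2)])
    then have "(\<lambda>g. cnj (u g)) \<in> borel_measurable MF" by (intro measurable_MF borel_measurable_continuous_onI)
    then have "integrable MF (\<lambda>g. cnj (u g) * \<psi> g $ i)"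
      by (rule integrable_bounded_mult[OF component_L1(2)[OF \<psi>]]) (use C in simp)
    then have int: "integrable MF (\<lambda>g. \<psi> g $ i * cnj (u g))" by (simp only: mult.commute)
    have "Re (cnj c * (LINT g|MF. \<psi> g $ i * cnj (u g))) = 0" for c
    proof -
      have "ip \<psi> (\<lambda>g. emb c i (u g)) = 0" by (rule 0[OF l emb_D[OF u] emb_eigen[OF u(2) cas]])
      then have "(LINT g|MF. Re (cnj c * (\<psi> g $ i * cnj (u g)))) = 0" unfolding ip_def inner_emb .
      moreover have "integrable MF (\<lambda>g. cnj c * (\<psi> g $ i * cnj (u g)))" by (intro integrable_mult_right int)
      ultimately have "Re (LINT g|MF. cnj c * (\<psi> g $ i * cnj (u g))) = 0" by (simp only: integral_Re)
      then show ?thesis by (simp only: integral_mult_right_zero)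
    qed
    from this[of 1] this[of \<i>] show ?thesis by (simp add: complex_eq_iff)
  qed
  have "AE g in MF. \<psi> g $ i = 0" for i
  proof (rule scalar_totality[OF component_L1[OF \<psi>]])
    fix j p q k assume p: "p \<noteq> 0" and par: "even (p - e3)" "even (q - e4)" "even (k - e1)"
    note rp = even_rp[OF par(1)]
    show "(LINT g|MF. \<psi> g $ i * cnj (theta j p q k e2 g)) = 0"
      by (rule orth[OF theta_eqv[OF p par] theta_smooth[OF p rp] theta_in_eigenvalue_set[OF p par(1,2)] theta_cas[OF p rp]])
  next
    fix q k l assume par: "e3 = 0" "even (q - e4)" "even (k - e1)" "even (l - e2)"
    have "pi\<^sup>2 * kl_form \<mu> \<nu> k l \<in> eigenvalue_set" unfolding eigenvalue_set_def using par by blast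
    then show "(LINT g|MF. \<psi> g $ i * cnj (torus_wave q k l g)) = 0"
      by (rule orth[OF torus_wave_eqv[OF par] torus_smooth _ torus_cas])
  qed
  then have "AE g in MF. \<forall>i\<in>UNIV. \<psi> g $ i = 0" by (subst AE_ball_countable) simp_all
  then have "AE g in MF. \<psi> g \<bullet> \<psi> g = 0" by (rule eventually_mono) (simp add: vec_eq_iff)
  moreover have "(\<lambda>g. \<psi> g \<bullet> \<psi> g) \<in> borel_measurable MF" using H_inner_integrable[OF \<psi> \<psi>] by simp
  ultimately have "(LINT g|MF. \<psi> g \<bullet> \<psi> g) = (LINT g|MF. 0)" by (intro integral_cong_AE) simp_all
  then show ?thesis by (simp add: ip_def)
qed

lemma A_eq: "(\<lambda>g. - casimir \<psi> g) = smul (- 1) (casimir \<psi>)"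
  by (simp add: smul_def vec_eq_iff fun_eq_iff del: split_paired_All)

theorem spec_casimir_eq: "spec_casimir r \<kappa> \<mu> \<nu> \<epsilon> = of_real ` eigenvalue_set"
proof -
  interpret semi_hilbert H ip by (rule semi_hilbert_L2)
  have cD: "casimir \<psi> \<in> H" if "\<psi> \<in> D" for \<psi> using casimir_in_D[OF that] D_H by blast
  have neg: "ip (smul (- 1) \<psi>) \<phi> = - ip \<psi> \<phi>" "ip \<phi> (smul (- 1) \<psi>) = - ip \<phi> \<psi>" for \<psi> \<phi>
    using ip_real[of "- 1" \<psi> \<phi>] ip_real_right[of \<phi> "- 1" \<psi>] by simp_all
  interpret total_eigenvectors H ip D "\<lambda>\<psi> g. - casimir \<psi> g" eigenvalue_set
  proof
    show "D \<subseteq> H" by (rule D_H)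
    show "0 \<in> D" using zero_D by (simp add: zero_fun_def)
    show "\<psi> + \<phi> \<in> D" if "\<psi> \<in> D" "\<phi> \<in> D" for \<psi> \<phi> by (rule D_lin(1)[OF that])
    show "smul c \<psi> \<in> D" if "\<psi> \<in> D" for c \<psi> by (rule D_lin(2)[OF that])
    show "(\<lambda>g. - casimir \<psi> g) \<in> H" if "\<psi> \<in> D" for \<psi> unfolding A_eq by (rule H_smul[OF cD[OF that]])
    show "(\<lambda>g. - casimir (\<psi> + \<phi>) g) = (\<lambda>g. - casimir \<psi> g) + (\<lambda>g. - casimir \<phi> g)" if "\<psi> \<in> D" "\<phi> \<in> D" for \<psi> \<phi>
      unfolding A_eq unfolding casimir_linear(1)[OF that] smul_add ..
    show "(\<lambda>g. - casimir (smul c \<psi>) g) = smul c (\<lambda>g. - casimir \<psi> g)" if "\<psi> \<in> D" for c \<psi>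
      unfolding A_eq unfolding casimir_linear(2)[OF that] smul_simps by (simp only: mult.commute)
    show "ip (\<lambda>g. - casimir \<psi> g) \<phi> = ip \<psi> (\<lambda>g. - casimir \<phi> g)" if "\<psi> \<in> D" "\<phi> \<in> D" for \<psi> \<phi>
      unfolding A_eq unfolding neg casimir_symmetric[OF that] ..
    show "\<exists>\<psi>\<in>D. (\<lambda>g. - casimir \<psi> g) = smul (of_real l) \<psi> \<and> ip \<psi> \<psi> \<noteq> 0" if "l \<in> eigenvalue_set" for l
      by (rule eigenvalue_set_attained[OF that])
    show "ip \<psi> \<psi> = 0" if "\<psi> \<in> H" "\<And>l \<phi>. l \<in> eigenvalue_set \<Longrightarrow> \<phi> \<in> D \<Longrightarrow> (\<lambda>g. - casimir \<phi> g) = smul (of_real l) \<phi> \<Longrightarrow> ip \<psi> \<phi> = 0" for \<psi>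
      by (rule eigenfunctions_total[OF that])
    show "closed eigenvalue_set" by (rule closed_eigenvalue_set)
  qed
  have N: "L2_norm F = N" by (rule ext) (simp only: L2_norm_ip N_def)
  show ?thesis unfolding spec_casimir_def Let_def N by (rule closure_spectrum_eq)
qed

end

section \<open>Arithmetic of the eigenvalues\<close>

lemma kl_norm_form: "kl_norm \<mu> \<nu> k l = sqrt (kl_form \<mu> \<nu> (- k) l)"
  by (simp add: kl_norm_def kl_form_def algebra_simps)

lemma kl_form_nonneg: "\<nu> > 0 \<Longrightarrow> kl_form \<mu> \<nu> k l \<ge> 0"
  by (simp add: kl_form_def)

lemma kl_form_pos: assumes "\<nu> > 0" "(k, l) \<noteq> (0, 0)" shows "kl_form \<mu> \<nu> k l > 0"
proof (cases "k = 0")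
  case True
  then show ?thesis using assms by (simp add: kl_form_def)
next
  case False
  then have "0 < \<nu> * (real_of_int k)\<^sup>2" using assms by simp
  moreover have "0 \<le> (real_of_int l + \<mu> * of_int k)\<^sup>2 / \<nu>" using assms by simp
  ultimately show ?thesis unfolding kl_form_def by linarith
qed

text \<open>A level of the quadratic form contains only finitely many points, so that a nonzero cardinality means that the level
is attained. The restriction to positive \<open>a\<close> removes exactly the origin.\<close>

lemma calA_iff:
  assumes \<nu>: "\<nu> > 0" and P: "\<And>k. P (- k) = P (k::int)"
  shows "{pi\<^sup>2 * a\<^sup>2 | a. a > 0 \<and> card {(k, l). kl_norm \<mu> \<nu> k l = a \<and> P k \<and> Q l} \<noteq> 0} =
    {pi\<^sup>2 * kl_form \<mu> \<nu> k l | k l. P k \<and> Q l \<and> (k, l) \<noteq> (0, 0)}" (is "?L = ?R")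
proof (intro equalityI subsetI)
  fix x assume "x \<in> ?L"
  then obtain a where x: "x = pi\<^sup>2 * a\<^sup>2" and a: "a > 0" and c: "card {(k, l). kl_norm \<mu> \<nu> k l = a \<and> P k \<and> Q l} \<noteq> 0" by blast
  have "{(k, l). kl_norm \<mu> \<nu> k l = a \<and> P k \<and> Q l} \<noteq> {}" using c by (metis card.empty)
  then obtain k l where kl: "kl_norm \<mu> \<nu> k l = a" "P k" "Q l" by auto
  have "a\<^sup>2 = kl_form \<mu> \<nu> (- k) l" using kl_form_nonneg[OF \<nu>, of \<mu> "- k" l] by (simp add: kl(1)[symmetric] kl_norm_form)
  moreover have "(- k, l) \<noteq> (0, 0)"
  proof
    assume "(- k, l) = (0, 0)"
    then have "a = 0" using kl(1) by (simp add: kl_norm_def)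
    then show False using a by simp
  qed
  ultimately show "x \<in> ?R" unfolding x using kl P[of k] by (intro CollectI exI[of _ "- k"] exI[of _ l]) simp
next
  fix x assume "x \<in> ?R"
  then obtain k l where x: "x = pi\<^sup>2 * kl_form \<mu> \<nu> k l" and kl: "P k" "Q l" "(k, l) \<noteq> (0, 0)" by blast
  define a where "a = sqrt (kl_form \<mu> \<nu> k l)"
  have a: "a > 0" using kl_form_pos[OF \<nu> kl(3)] by (simp add: a_def)
  have n: "{(k, l). kl_norm \<mu> \<nu> k l = a \<and> P k \<and> Q l} \<subseteq> (\<lambda>(k, l). (- k, l)) ` {(k, l). kl_form \<mu> \<nu> k l \<le> a\<^sup>2}"
  proof (rule subsetI)
    fix z assume "z \<in> {(k, l). kl_norm \<mu> \<nu> k l = a \<and> P k \<and> Q l}"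
    then obtain k' l' where z: "z = (k', l')" and "kl_norm \<mu> \<nu> k' l' = a" by blast
    then have "kl_form \<mu> \<nu> (- k') l' = a\<^sup>2" using kl_form_nonneg[OF \<nu>, of \<mu> "- k'" l'] by (metis kl_norm_form real_sqrt_pow2)
    then show "z \<in> (\<lambda>(k, l). (- k, l)) ` {(k, l). kl_form \<mu> \<nu> k l \<le> a\<^sup>2}"
      unfolding z by (intro image_eqI[of _ _ "(- k', l')"]) simp_all
  qed
  have "finite {(k, l). kl_norm \<mu> \<nu> k l = a \<and> P k \<and> Q l}"
    by (rule finite_subset[OF n]) (intro finite_imageI finite_kl_form \<nu>)
  moreover have "(- k, l) \<in> {(k, l). kl_norm \<mu> \<nu> k l = a \<and> P k \<and> Q l}" using kl P[of k] by (simp add: kl_norm_form a_def)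
  ultimately have "card {(k, l). kl_norm \<mu> \<nu> k l = a \<and> P k \<and> Q l} \<noteq> 0" by (auto simp: card_eq_0_iff)
  moreover have "x = pi\<^sup>2 * a\<^sup>2" using kl_form_nonneg[OF \<nu>, of \<mu> k l] by (simp add: x a_def)
  ultimately show "x \<in> ?L" using a by blast
qed

lemma calA_eq:
  assumes "\<nu> > 0"
  shows "calA0 \<mu> \<nu> = {pi\<^sup>2 * kl_form \<mu> \<nu> k l | k l. even k \<and> even l \<and> (k, l) \<noteq> (0, 0)}"
    "calA1 \<mu> \<nu> = {pi\<^sup>2 * kl_form \<mu> \<nu> k l | k l. even k \<and> odd l \<and> (k, l) \<noteq> (0, 0)}"
    "calA2 \<mu> \<nu> = {pi\<^sup>2 * kl_form \<mu> \<nu> k l | k l. odd k \<and> odd l \<and> (k, l) \<noteq> (0, 0)}"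
  unfolding calA0_def calA1_def calA2_def alpha0_def alpha1_def alpha2_def
  by (rule calA_iff[OF assms]; simp)+

text \<open>By \<open>\<bar>p\<bar> \<kappa> + p q = p (sgn p \<kappa> + q)\<close> one gets products of \<open>p\<close> with an integer of the parity of \<open>b + \<kappa>\<close>. All
products are obtained already with \<open>p = 2\<close> or \<open>p = 1\<close> and, if the second factor is odd and \<open>p\<close> even, with the second
factor \<open>1\<close>; in that case the product cannot be zero.\<close>

lemma theta_integers:
  fixes c b \<kappa> :: int
  shows "{\<bar>p\<bar> * \<kappa> + p * q | p q. p \<noteq> 0 \<and> even p \<and> even (q - b)} =
      (if even (b + \<kappa>) then {4 * n | n. True} else {2 * n | n. n \<noteq> 0})" (is "?E = ?E'")
    and "{\<bar>p\<bar> * \<kappa> + p * q | p q. p \<noteq> 0 \<and> even (p - 1) \<and> even (q - b)} =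
      (if even (b + \<kappa>) then {2 * n | n. True} else {2 * n + 1 | n. True})" (is "?O = ?O'")
proof -
  have form: "\<bar>p\<bar> * \<kappa> + p * q = p * (sgn p * \<kappa> + q)" for p q :: int
    by (simp add: abs_sgn distrib_left mult_ac)
  have par: "even (sgn p * \<kappa> + q - (b + \<kappa>))" if "p \<noteq> 0" "even (q - b)" for p q :: int
    using that by (cases "p > 0") auto
  show "?E = ?E'"
  proof (cases "even (b + \<kappa>)")
    case True
    have "?E = {4 * n | n. True}"
    proof (intro equalityI subsetI)
      fix x :: int assume "x \<in> ?E"
      then obtain p q where x: "x = p * (sgn p * \<kappa> + q)" and p: "p \<noteq> 0" "even p" "even (q - b)" unfolding form by blast
      have "even (sgn p * \<kappa> + q)" using par[OF p(1,3)] True by simp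
      with p(2) have "2 * 2 dvd x" unfolding x by (rule mult_dvd_mono)
      then show "x \<in> {4 * n | n. True}" by (auto elim: dvdE)
    next
      fix x :: int assume "x \<in> {4 * n | n. True}"
      then obtain n where x: "x = 4 * n" by blast
      have "x = \<bar>2\<bar> * \<kappa> + 2 * (2 * n - \<kappa>)" "even (2 * n - \<kappa> - b)" using True by (auto simp: x)
      then show "x \<in> ?E" by (intro CollectI exI[of _ 2] exI[of _ "2 * n - \<kappa>"]) auto
    qed
    then show ?thesis using True by simp
  next
    case False
    have "?E = {2 * n | n. n \<noteq> 0}"
    proof (intro equalityI subsetI)
      fix x :: int assume "x \<in> ?E"
      then obtain p q where x: "x = p * (sgn p * \<kappa> + q)" and p: "p \<noteq> 0" "even p" "even (q - b)" unfolding form by blast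
      have "odd (sgn p * \<kappa> + q)" using par[OF p(1,3)] False by simp
      moreover have "odd z \<Longrightarrow> z \<noteq> 0" for z :: int by auto
      ultimately have "sgn p * \<kappa> + q \<noteq> 0" by blast
      then have "x \<noteq> 0" using p(1) by (simp add: x)
      moreover have "even x" using p(2) by (simp add: x)
      ultimately show "x \<in> {2 * n | n. n \<noteq> 0}" by (auto elim!: evenE)
    next
      fix x :: int assume "x \<in> {2 * n | n. n \<noteq> (0::int)}"
      then obtain n where x: "x = 2 * n" "n \<noteq> 0" by blast
      have "x = \<bar>2 * n\<bar> * \<kappa> + (2 * n) * (1 - sgn (2 * n) * \<kappa>)" unfolding form by (simp add: x)
      moreover have "even (1 - sgn (2 * n) * \<kappa> - b)" using False x(2) by (cases "n > 0") auto
      ultimately show "x \<in> ?E" using x(2) by (intro CollectI exI[of _ "2 * n"] exI[of _ "1 - sgn (2 * n) * \<kappa>"]) auto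
    qed
    then show ?thesis using False by simp
  qed
  have odd_witness: "n \<in> ?O" if "even (n - (b + \<kappa>))" for n
  proof -
    have "n = \<bar>1\<bar> * \<kappa> + 1 * (n - \<kappa>)" "even (n - \<kappa> - b)" using that by (auto simp: algebra_simps)
    then show ?thesis by (intro CollectI exI[of _ 1] exI[of _ "n - \<kappa>"]) auto
  qed
  have odd_only: "even (x - (b + \<kappa>))" if xO: "x \<in> ?O" for x
  proof -
    obtain p q where x: "x = p * (sgn p * \<kappa> + q)" and p: "p \<noteq> 0" "even (p - 1)" "even (q - b)" using xO unfolding form by blast
    then show ?thesis using par[OF p(1,3)] by (simp add: x)
  qed
  show "?O = ?O'"
  proof (cases "even (b + \<kappa>)")
    case True
    have "?O = {2 * n | n. True}"
    proof (intro equalityI subsetI)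
      fix x :: int assume "x \<in> ?O"
      from odd_only[OF this] have "even x" using True by simp
      then show "x \<in> {2 * n | n. True}" by (auto elim: evenE)
    next
      fix x :: int assume "x \<in> {2 * n | n. True}"
      then show "x \<in> ?O" using True by (intro odd_witness) auto
    qed
    then show ?thesis using True by simp
  next
    case False
    have "?O = {2 * n + 1 | n. True}"
    proof (intro equalityI subsetI)
      fix x :: int assume "x \<in> ?O"
      from odd_only[OF this] have "odd x" using False by simp
      then show "x \<in> {2 * n + 1 | n. True}" by (auto elim: oddE)
    next
      fix x :: int assume "x \<in> {2 * n + 1 | n. True}"
      then show "x \<in> ?O" using False by (intro odd_witness) auto
    qed
    then show ?thesis using False by simp
  qed
qed

lemma Ints_image:
  "{c * n | n. n \<in> \<int>} = (\<lambda>n. c * real_of_int n) ` UNIV"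
  "{c * n | n. n \<in> \<int> - {0}} = (\<lambda>n. c * real_of_int n) ` {n. n \<noteq> 0}"
  "{c * (2 * n + 1) | n. n \<in> \<int>} = (\<lambda>n. c * (2 * real_of_int n + 1)) ` UNIV"
proof -
  have coll: "{f n | n. n \<in> h ` S} = (\<lambda>m. f (h m)) ` S" for f :: "real \<Rightarrow> real" and h :: "int \<Rightarrow> real" and S by blast
  have nz: "\<int> - {0 :: real} = of_int ` {n. n \<noteq> 0}"
  proof (intro equalityI subsetI)
    fix x :: real assume "x \<in> \<int> - {0}"
    then obtain n where "x = of_int n" "x \<noteq> 0" by (elim DiffE Ints_cases) simp
    then show "x \<in> of_int ` {n. n \<noteq> 0}" by (intro image_eqI[of _ _ n]) simp_all
  next
    fix x :: real assume "x \<in> of_int ` {n. n \<noteq> 0}"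
    then show "x \<in> \<int> - {0}" by (elim imageE) simp
  qed
  show "{c * n | n. n \<in> \<int>} = (\<lambda>n. c * real_of_int n) ` UNIV"
    unfolding Ints_def by (rule coll[of "\<lambda>n. c * n"])
  show "{c * n | n. n \<in> \<int> - {0}} = (\<lambda>n. c * real_of_int n) ` {n. n \<noteq> 0}"
    unfolding nz by (rule coll[of "\<lambda>n. c * n"])
  show "{c * (2 * n + 1) | n. n \<in> \<int>} = (\<lambda>n. c * (2 * real_of_int n + 1)) ` UNIV"
    unfolding Ints_def by (rule coll[of "\<lambda>n. c * (2 * n + 1)"])
qed

context osc_spin begin

lemma theta_part:
  defines "\<beta> \<equiv> pi * real r / real \<kappa>"
  shows "{theta_val p q | p q. p \<noteq> 0 \<and> even (p - e3) \<and> even (q - e4)} =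
    (if e3 = 0 then if even (e4 + int \<kappa>) then {4 * \<beta> * n | n. n \<in> \<int>} else {2 * \<beta> * n | n. n \<in> \<int> - {0}}
     else if even (e4 + int \<kappa>) then {2 * \<beta> * n | n. n \<in> \<int>} else {\<beta> * (2 * n + 1) | n. n \<in> \<int>})"
proof -
  let ?S = "{\<bar>p\<bar> * int \<kappa> + p * q | p q. p \<noteq> 0 \<and> even (p - e3) \<and> even (q - e4)}"
  have L: "{theta_val p q | p q. p \<noteq> 0 \<and> even (p - e3) \<and> even (q - e4)} = (\<lambda>n. \<beta> * real_of_int n) ` ?S"
  proof -
    have "{f (g p q) | p q. P p q} = f ` {g p q | p q. P p q}" for f :: "int \<Rightarrow> real" and g :: "int \<Rightarrow> int \<Rightarrow> int" and P by blast
    from this[of "\<lambda>n. \<beta> * real_of_int n" "\<lambda>p q. \<bar>p\<bar> * int \<kappa> + p * q" "\<lambda>p q. p \<noteq> 0 \<and> even (p - e3) \<and> even (q - e4)"]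
    show ?thesis unfolding theta_val_def \<beta>_def .
  qed
  have images: "{4 * n | n::int. True} = (\<lambda>n. 4 * n) ` UNIV" "{2 * n | n::int. n \<noteq> 0} = (\<lambda>n. 2 * n) ` {n. n \<noteq> 0}"
    "{2 * n | n::int. True} = (\<lambda>n. 2 * n) ` UNIV" "{2 * n + 1 | n::int. True} = (\<lambda>n. 2 * n + 1) ` UNIV"
    by blast+
  have im: "(\<lambda>n. \<beta> * real_of_int n) ` {4 * n | n. True} = (\<lambda>n. 4 * \<beta> * real_of_int n) ` UNIV"
    "(\<lambda>n. \<beta> * real_of_int n) ` {2 * n | n. n \<noteq> 0} = (\<lambda>n. 2 * \<beta> * real_of_int n) ` {n. n \<noteq> 0}"
    "(\<lambda>n. \<beta> * real_of_int n) ` {2 * n | n. True} = (\<lambda>n. 2 * \<beta> * real_of_int n) ` UNIV"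
    "(\<lambda>n. \<beta> * real_of_int n) ` {2 * n + 1 | n. True} = (\<lambda>n. \<beta> * (2 * real_of_int n + 1)) ` UNIV"
    unfolding images image_image by (intro image_cong refl; simp)+
  have "e3 = 0 \<or> e3 = 1" by (rule \<epsilon>_range[OF lat_in_L])
  then show ?thesis
  proof
    assume e: "e3 = 0"
    have "?S = (if even (e4 + int \<kappa>) then {4 * n | n. True} else {2 * n | n. n \<noteq> 0})"
      unfolding e diff_zero by (rule theta_integers(1))
    then show ?thesis unfolding L Ints_image if_P[OF e] by (simp only: if_distrib[of "image _"] im)
  next
    assume e: "e3 = 1"
    have "?S = (if even (e4 + int \<kappa>) then {2 * n | n. True} else {2 * n + 1 | n. True})"
      unfolding e by (rule theta_integers(2))
    moreover have "e3 \<noteq> 0" using e by simp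
    ultimately show ?thesis unfolding L Ints_image by (simp only: if_distrib[of "image _"] im if_not_P if_False)
  qed
qed

text \<open>The origin contributes the value \<open>0\<close> when both parities are even, and is excluded by parity otherwise.\<close>

lemma torus_part:
  defines "T \<equiv> {pi\<^sup>2 * kl_form \<mu> \<nu> k l | k l. even (k - e1) \<and> even (l - e2)}"
  shows "e1 = 0 \<Longrightarrow> e2 = 0 \<Longrightarrow> T = insert 0 (calA0 \<mu> \<nu>)"
    and "e1 = 0 \<Longrightarrow> e2 = 1 \<Longrightarrow> T = calA1 \<mu> \<nu>"
    and "e1 = 1 \<Longrightarrow> e2 = 1 \<Longrightarrow> T = calA2 \<mu> \<nu>"
proof -
  have z: "kl_form \<mu> \<nu> 0 0 = 0" by (simp add: kl_form_def)
  have "{pi\<^sup>2 * kl_form \<mu> \<nu> k l | k l. even k \<and> even l} = insert 0 {pi\<^sup>2 * kl_form \<mu> \<nu> k l | k l. even k \<and> even l \<and> (k, l) \<noteq> (0, 0)}"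
    (is "?A = ?B")
  proof (intro equalityI subsetI)
    fix x assume "x \<in> ?A"
    then obtain k l where x: "x = pi\<^sup>2 * kl_form \<mu> \<nu> k l" "even k" "even l" by blast
    show "x \<in> ?B"
    proof (cases "(k, l) = (0, 0)")
      case True
      then show ?thesis using x(1) z by simp
    next
      case False
      then show ?thesis using x by blast
    qed
  next
    fix x assume "x \<in> ?B"
    moreover have "0 = pi\<^sup>2 * kl_form \<mu> \<nu> 0 0" by (simp add: z)
    then have "0 \<in> ?A" by (intro CollectI exI[of _ 0]) simp
    ultimately show "x \<in> ?A" by blast
  qed
  then show "e1 = 0 \<Longrightarrow> e2 = 0 \<Longrightarrow> T = insert 0 (calA0 \<mu> \<nu>)" by (simp add: T_def calA_eq[OF \<nu>])
  have parity: "even (l - 1) \<longleftrightarrow> odd l" "(even k \<and> odd l \<and> (k, l) \<noteq> (0, 0)) = (even k \<and> odd l)"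
    "(odd k \<and> odd l \<and> (k, l) \<noteq> (0, 0)) = (odd k \<and> odd l)" for k l :: int by auto
  show "e1 = 0 \<Longrightarrow> e2 = 1 \<Longrightarrow> T = calA1 \<mu> \<nu>" "e1 = 1 \<Longrightarrow> e2 = 1 \<Longrightarrow> T = calA2 \<mu> \<nu>"
    unfolding T_def calA_eq[OF \<nu>] parity by (simp_all only: parity diff_zero)
qed

end

text \<open>The union of the eigenvalues of theta functions and torus waves, case by case. The torus waves are present only for
\<open>\<epsilon>3 = 0\<close>. For \<open>\<epsilon>1 = \<epsilon>2 = 0\<close> they contribute \<open>0\<close>, which is already among the multiples of \<open>4 \<beta>\<close>
if \<open>\<epsilon>4 + \<kappa>\<close> is even and completes the nonzero multiples of \<open>2 \<beta>\<close> otherwise.\<close>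

theorem theorem6p1:
  fixes r \<kappa> :: nat and \<mu> \<nu> \<beta> :: real
    and \<epsilon> :: "osc \<Rightarrow> int" and \<epsilon>1 \<epsilon>2 \<epsilon>3 \<epsilon>4 :: int
    and cl :: "osc \<Rightarrow> complex ^ 4 ^ 4"
  assumes "r > 0" and "\<kappa> > 0" and "\<nu> > 0"
    and "\<epsilon> \<in> spin_structures (osc_lattice r \<kappa> \<mu> \<nu>)"
    and "\<epsilon>1 = \<epsilon> (gen1 \<nu>)" and "\<epsilon>2 = \<epsilon> (gen2 \<mu> \<nu>)"
    and "\<epsilon>3 = \<epsilon> (gen3 r)" and "\<epsilon>4 = \<epsilon> (gen4 \<kappa>)"
    and "\<epsilon>1 \<noteq> \<epsilon>2 \<Longrightarrow> (\<epsilon>1, \<epsilon>2) = (0, 1)"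
    and "clifford_module cl"
    and "\<beta> = pi * real r / real \<kappa>"
  shows "(\<forall>\<psi>\<in>smooth_sections (osc_lattice r \<kappa> \<mu> \<nu>) \<epsilon>. \<forall>g.
            cubic_dirac cl (cubic_dirac cl \<psi>) g = - casimir \<psi> g) \<and>
    ((\<epsilon>3, (\<epsilon>4 + int \<kappa>) mod 2) = (0, 0) \<longrightarrow>
       ((\<epsilon>1, \<epsilon>2) = (0, 0) \<longrightarrow> spec_casimir r \<kappa> \<mu> \<nu> \<epsilon> =
          of_real ` (calA0 \<mu> \<nu> \<union> {4 * \<beta> * n | n. n \<in> \<int>})) \<and>
       ((\<epsilon>1, \<epsilon>2) = (0, 1) \<longrightarrow> spec_casimir r \<kappa> \<mu> \<nu> \<epsilon> =
          of_real ` (calA1 \<mu> \<nu> \<union> {4 * \<beta> * n | n. n \<in> \<int>})) \<and>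
       ((\<epsilon>1, \<epsilon>2) = (1, 1) \<longrightarrow> spec_casimir r \<kappa> \<mu> \<nu> \<epsilon> =
          of_real ` (calA2 \<mu> \<nu> \<union> {4 * \<beta> * n | n. n \<in> \<int>}))) \<and>
    ((\<epsilon>3, (\<epsilon>4 + int \<kappa>) mod 2) = (0, 1) \<longrightarrow>
       ((\<epsilon>1, \<epsilon>2) = (0, 0) \<longrightarrow> spec_casimir r \<kappa> \<mu> \<nu> \<epsilon> =
          of_real ` (calA0 \<mu> \<nu> \<union> {2 * \<beta> * n | n. n \<in> \<int>})) \<and>
       ((\<epsilon>1, \<epsilon>2) = (0, 1) \<longrightarrow> spec_casimir r \<kappa> \<mu> \<nu> \<epsilon> =
          of_real ` (calA1 \<mu> \<nu> \<union> {2 * \<beta> * n | n. n \<in> \<int> - {0}})) \<and>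
       ((\<epsilon>1, \<epsilon>2) = (1, 1) \<longrightarrow> spec_casimir r \<kappa> \<mu> \<nu> \<epsilon> =
          of_real ` (calA2 \<mu> \<nu> \<union> {2 * \<beta> * n | n. n \<in> \<int> - {0}}))) \<and>
    ((\<epsilon>3, (\<epsilon>4 + int \<kappa>) mod 2) = (1, 0) \<longrightarrow>
       spec_casimir r \<kappa> \<mu> \<nu> \<epsilon> = of_real ` {2 * \<beta> * n | n. n \<in> \<int>}) \<and>
    ((\<epsilon>3, (\<epsilon>4 + int \<kappa>) mod 2) = (1, 1) \<longrightarrow>
       spec_casimir r \<kappa> \<mu> \<nu> \<epsilon> = of_real ` {\<beta> * (2 * n + 1) | n. n \<in> \<int>})"
proof -
  interpret osc_spin r \<kappa> \<mu> \<nu> \<epsilon> by unfold_locales (fact assms)+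
  note e = assms(5-8)[unfolded gens_lat]
  have "cubic_dirac cl (cubic_dirac cl \<psi>) g = - casimir \<psi> g" if "\<psi> \<in> D" for \<psi> g
    using that by (intro cubic_dirac_square[OF assms(10)]) (simp add: D_iff)
  then have dirac: "\<forall>\<psi>\<in>D. \<forall>g. cubic_dirac cl (cubic_dirac cl \<psi>) g = - casimir \<psi> g" by (intro ballI allI)
  let ?T = "{pi\<^sup>2 * kl_form \<mu> \<nu> k l | k l. even (k - e1) \<and> even (l - e2)}"
  have "eigenvalue_set = {theta_val p q | p q. p \<noteq> 0 \<and> even (p - e3) \<and> even (q - e4)} \<union> (if e3 = 0 then ?T else {})"
    unfolding eigenvalue_set_def by auto
  then have spec: "spec_casimir r \<kappa> \<mu> \<nu> \<epsilon> = of_real `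
    ((if e3 = 0 then if even (e4 + int \<kappa>) then {4 * \<beta> * n | n. n \<in> \<int>} else {2 * \<beta> * n | n. n \<in> \<int> - {0}}
     else if even (e4 + int \<kappa>) then {2 * \<beta> * n | n. n \<in> \<int>} else {\<beta> * (2 * n + 1) | n. n \<in> \<int>}) \<union> (if e3 = 0 then ?T else {}))"
    unfolding spec_casimir_eq theta_part assms(11) by (rule arg_cong)
  have zero: "insert 0 A \<union> {4 * \<beta> * n | n. n \<in> \<int>} = A \<union> {4 * \<beta> * n | n. n \<in> \<int>}"
    "insert 0 A \<union> {2 * \<beta> * n | n. n \<in> \<int> - {0}} = A \<union> {2 * \<beta> * n | n. n \<in> \<int>}" for A
    by auto
  have m2: "even x \<longleftrightarrow> x mod 2 = 0" for x :: int by (rule even_iff_mod_2_eq_zero)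
  show ?thesis
  proof (intro conjI impI dirac)
    assume h: "(\<epsilon>3, (\<epsilon>4 + int \<kappa>) mod 2) = (0, 0)"
    then have s: "spec_casimir r \<kappa> \<mu> \<nu> \<epsilon> = of_real ` (?T \<union> {4 * \<beta> * n | n. n \<in> \<int>})"
      unfolding spec e m2 by (simp add: Un_commute)
    show "spec_casimir r \<kappa> \<mu> \<nu> \<epsilon> = of_real ` (calA0 \<mu> \<nu> \<union> {4 * \<beta> * n | n. n \<in> \<int>})" if "(\<epsilon>1, \<epsilon>2) = (0, 0)"
    proof -
      have "?T = insert 0 (calA0 \<mu> \<nu>)" by (rule torus_part(1)) (use that in \<open>simp_all add: e\<close>)
      then show ?thesis unfolding s by (simp only: zero)
    qed
    show "spec_casimir r \<kappa> \<mu> \<nu> \<epsilon> = of_real ` (calA1 \<mu> \<nu> \<union> {4 * \<beta> * n | n. n \<in> \<int>})" if "(\<epsilon>1, \<epsilon>2) = (0, 1)"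
    proof -
      have "?T = calA1 \<mu> \<nu>" by (rule torus_part(2)) (use that in \<open>simp_all add: e\<close>)
      then show ?thesis unfolding s by simp
    qed
    show "spec_casimir r \<kappa> \<mu> \<nu> \<epsilon> = of_real ` (calA2 \<mu> \<nu> \<union> {4 * \<beta> * n | n. n \<in> \<int>})" if "(\<epsilon>1, \<epsilon>2) = (1, 1)"
    proof -
      have "?T = calA2 \<mu> \<nu>" by (rule torus_part(3)) (use that in \<open>simp_all add: e\<close>)
      then show ?thesis unfolding s by simp
    qed
  next
    assume h: "(\<epsilon>3, (\<epsilon>4 + int \<kappa>) mod 2) = (0, 1)"
    then have s: "spec_casimir r \<kappa> \<mu> \<nu> \<epsilon> = of_real ` (?T \<union> {2 * \<beta> * n | n. n \<in> \<int> - {0}})"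
      unfolding spec e m2 by (simp add: Un_commute)
    show "spec_casimir r \<kappa> \<mu> \<nu> \<epsilon> = of_real ` (calA0 \<mu> \<nu> \<union> {2 * \<beta> * n | n. n \<in> \<int>})" if "(\<epsilon>1, \<epsilon>2) = (0, 0)"
    proof -
      have "?T = insert 0 (calA0 \<mu> \<nu>)" by (rule torus_part(1)) (use that in \<open>simp_all add: e\<close>)
      then show ?thesis unfolding s by (simp only: zero)
    qed
    show "spec_casimir r \<kappa> \<mu> \<nu> \<epsilon> = of_real ` (calA1 \<mu> \<nu> \<union> {2 * \<beta> * n | n. n \<in> \<int> - {0}})" if "(\<epsilon>1, \<epsilon>2) = (0, 1)"
    proof -
      have "?T = calA1 \<mu> \<nu>" by (rule torus_part(2)) (use that in \<open>simp_all add: e\<close>)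
      then show ?thesis unfolding s by simp
    qed
    show "spec_casimir r \<kappa> \<mu> \<nu> \<epsilon> = of_real ` (calA2 \<mu> \<nu> \<union> {2 * \<beta> * n | n. n \<in> \<int> - {0}})" if "(\<epsilon>1, \<epsilon>2) = (1, 1)"
    proof -
      have "?T = calA2 \<mu> \<nu>" by (rule torus_part(3)) (use that in \<open>simp_all add: e\<close>)
      then show ?thesis unfolding s by simp
    qed
  next
    assume "(\<epsilon>3, (\<epsilon>4 + int \<kappa>) mod 2) = (1, 0)"
    then show "spec_casimir r \<kappa> \<mu> \<nu> \<epsilon> = of_real ` {2 * \<beta> * n | n. n \<in> \<int>}" unfolding spec e m2 by simp
  next
    assume "(\<epsilon>3, (\<epsilon>4 + int \<kappa>) mod 2) = (1, 1)"
    then show "spec_casimir r \<kappa> \<mu> \<nu> \<epsilon> = of_real ` {\<beta> * (2 * n + 1) | n. n \<in> \<int>}" unfolding spec e m2 by simp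
  qed
qed

end
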